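(* Let $k$ be a perfect field, $G=\mathrm{GL}_6\times\mathrm{GL}_2$ and $V=\wedge^2\mathbb{A}^6\otimes\mathbb{A}^2$ with the natural action of $G$. Let $\{S_\beta\}_{\beta\in\mathfrak{B}}$ be the strata of the GIT stratification of $V$ (see context). Then there are exactly $13$ elements $\beta\in\mathfrak{B}$ such that $S_\beta\neq\emptyset$. Moreover, there is one $\beta_0\in\mathfrak B$ with $S_{\beta_0}\ne\emptyset$ such that for every $\beta\in\mathfrak{B}$ with $\beta\neq\beta_0$ and $S_\beta\neq\emptyset$ the set $G_k\backslash S_{\beta\,k}$ consists of a single point, whereas $G_k\backslash S_{\beta_0\,k}$ is in bijective correspondence with $\mathrm{Ex}_2(k)$.
   Context: $k$ is a perfect field with algebraic closure $\bar k$. $\mathrm{Ex}_2(k)$ is the set of isomorphism classes of separable field extensions of $k$ of degree up to two ($k$ itself included). Setting. $G=\mathrm{GL}_6\times\mathrm{GL}_2$, $V=\wedge^2\mathbb{A}^6\otimes\mathbb{A}^2$, $G_{\mathrm{st}}=\mathrm{SL}_6\times\mathrm{SL}_2$. $V$ has basis $e_{ijl}=(\mathbb{e}_i\wedge\mathbb{e}_j)\otimes\mathbb{f}_l$ ($1\le i<j\le 6$, $l=1,2$) formed from the standard bases. Let $\mathfrak{t}^*=\{(a_{11},\dots,a_{16},a_{21},a_{22})\in\mathbb{R}^8\mid \sum_i a_{1i}=\sum_i a_{2i}=0\}$ with the standard inner product $(\ ,\ )_*$ of $\mathbb{R}^8$, and let $\mathfrak{t}^*_+$ be the set of those elements with $a_{11}\le\cdots\le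 a_{16}$, $a_{21}\le a_{22}$. The weight $\gamma_{ijl}\in\mathfrak{t}^*$ of $e_{ijl}$ is the orthogonal projection to $\mathfrak{t}^*$ of the vector with entry $1$ at the positions $1i$, $1j$, $2l$ and $0$ elsewhere. GIT stratification. $\mathfrak{B}$ is the (finite) set of all non-zero $\beta\in\mathfrak{t}^*_+$ such that $\beta$ is the point closest to the origin of the convex hull of some non-empty set of weights $\gamma_{ijl}$. For $\beta=(b_{11},\dots,b_{16},b_{21},b_{22})\in\mathfrak{B}$: - $Z_\beta$ (resp. $W_\beta$) is the span of the $e_{ijl}$ with $(\gamma_{ijl},\beta)_*=(\beta,\beta)_*$ (resp. $>(\beta,\beta)_*$), and $Y_\beta=Z_\beta\oplus W_\beta$. - $P_\beta\subset G$ (resp. $M_\beta\subset G$) consists of the $(g_1,g_2)$ such that, for each $m=1,2$, the $(i,j)$-entry of $g_m$ is $0$ unless $b_{mi}\ge b_{mj}$ (resp. unless $b_{mi}=b_{mj}$). Thus $P_\beta$ is a lower block triangular parabolic subgroup with Levi subgroup $M_\beta$. - $\chi_\beta$ is the indivisible character of $M_\beta$ proportional (with positive factor) to $\beta$, i.e. a product of the determinants of the diagonal blocks raised to powers proportional to the corresponding entries of $\beta$. $G_{\mathrm{st},\beta}$ is the identity component of $\{g\in M_\beta\cap G_{\mathrm{st}}\mid\chi_\beta(g)=1\}$. - $Z_\beta^{\mathrm{ss}}$ is the set of points of $Z_\beta$ (over $\bar k$) at which some non-constant homogeneous $G_{\mathrm{st},\beta}$-invariant polynomial on $Z_\beta$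 does not vanish. $Y_\beta^{\mathrm{ss}}=\{z+w\mid z\in Z_\beta^{\mathrm{ss}},\ w\in W_\beta\}$. - The stratum is $S_\beta=G\cdot Y_\beta^{\mathrm{ss}}\subset V$. $S_{\beta\,k}$ is its set of $k$-rational points. It is known that, as $k$ is perfect, $S_{\beta\,k}=G_k\cdot Y^{\mathrm{ss}}_{\beta\,k}\cong G_k\times_{P_{\beta\,k}}Y^{\mathrm{ss}}_{\beta\,k}$. A subscript $k$ denotes the set of $k$-rational points. *)

theory Defs
  imports
    "HOL-Analysis.Analysis"
    "HOL-Library.Poly_Mapping"
    "HOL-Algebra.Algebraic_Closure_Type"
begin

no_notation fps_nth (infixl "$" 75)

section \<open>Polynomials and the Zariski topology\<close>

text \<open>A multivariate polynomial is a finitely supported family of coefficients indexed by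
  monomials, a monomial being a finitely supported family of exponents.\<close>

type_synonym ('v, 'a) mpol = "('v \<Rightarrow>\<^sub>0 nat) \<Rightarrow>\<^sub>0 'a"

definition mpol_eval :: "('v, 'a::comm_semiring_1) mpol \<Rightarrow> ('v \<Rightarrow> 'a) \<Rightarrow> 'a" where
  "mpol_eval p x =
     (\<Sum>m\<in>Poly_Mapping.keys p. Poly_Mapping.lookup p m *
        (\<Prod>v\<in>Poly_Mapping.keys m. x v ^ Poly_Mapping.lookup m v))"

definition mpol_vars :: "('v, 'a::zero) mpol \<Rightarrow> 'v set" where
  "mpol_vars p = (\<Union>m\<in>Poly_Mapping.keys p. Poly_Mapping.keys m)"

definition mpol_homogeneous :: "nat \<Rightarrow> ('v, 'a::zero) mpol \<Rightarrow> bool" where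
  "mpol_homogeneous d p \<longleftrightarrow>
     (\<forall>m\<in>Poly_Mapping.keys p. (\<Sum>v\<in>Poly_Mapping.keys m. Poly_Mapping.lookup m v) = d)"


section \<open>The group and the representation\<close>

text \<open>The indices \<open>1, \<dots>, 6\<close> and \<open>1, 2\<close> are the elements of the numeral types \<open>6\<close> and \<open>2\<close>.
  As these types consist of residue classes ordered by their least non-negative representatives,
  the last index is written \<open>0\<close> and comes first, so that the ordered list \<open>1, \<dots>, 6\<close> of the
  text corresponds to \<open>0 < 1 < \<dots> < 5\<close>.\<close>

type_synonym 'a grp = "('a^6^6) \<times> ('a^2^2)"

text \<open>\<open>\<wedge>\<^sup>2 A\<^sup>6 \<otimes> A\<^sup>2\<close> is realised by pairs of alternating matrices: \<open>u \<wedge> v\<close> is the alternating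
  tensor \<open>u \<otimes> v - v \<otimes> u\<close> (this realisation of the second exterior power is valid in every
  characteristic), and \<open>x $ l $ i $ j\<close> with \<open>i < j\<close> is the coordinate of \<open>x\<close> at
  \<open>(e\<^sub>i \<wedge> e\<^sub>j) \<otimes> f\<^sub>l\<close>; see \<open>mem_spanV_iff\<close> and \<open>act_decomposable\<close> below.\<close>

type_synonym 'a rep = "'a^6^6^2"

definition wedge :: "'a::comm_ring_1^6 \<Rightarrow> 'a^6 \<Rightarrow> 'a^6^6" where
  "wedge u v = (\<chi> i j. u $ i * v $ j - u $ j * v $ i)"

definition tensor :: "'a::comm_ring_1^6^6 \<Rightarrow> 'a^2 \<Rightarrow> 'a rep" where
  "tensor w f = (\<chi> l i j. w $ i $ j * f $ l)"

definition idx :: "(6 \<times> 6 \<times> 2) set" where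
  "idx = {(i, j, l). i < j}"

definition basis_e :: "6 \<times> 6 \<times> 2 \<Rightarrow> 'a::comm_ring_1 rep" where
  "basis_e = (\<lambda>(i, j, l). tensor (wedge (axis i 1) (axis j 1)) (axis l 1))"

definition scaleV :: "'a::comm_ring_1 \<Rightarrow> 'a rep \<Rightarrow> 'a rep" where
  "scaleV c x = (\<chi> l i j. c * x $ l $ i $ j)"

definition spanV :: "(6 \<times> 6 \<times> 2) set \<Rightarrow> 'a::comm_ring_1 rep set" where
  "spanV I = {\<Sum>t\<in>I. scaleV (c t) (basis_e t) | c. True}"

definition V :: "'a::comm_ring_1 rep set" where
  "V = spanV idx"

definition coordV :: "'a rep \<Rightarrow> 6 \<times> 6 \<times> 2 \<Rightarrow> 'a" where
  "coordV x = (\<lambda>(i, j, l). x $ l $ i $ j)"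

definition G :: "'a::comm_ring_1 grp set" where
  "G = {g. invertible (fst g) \<and> invertible (snd g)}"

definition G_st :: "'a::comm_ring_1 grp set" where
  "G_st = {g. det (fst g) = 1 \<and> det (snd g) = 1}"

definition act :: "'a::comm_ring_1 grp \<Rightarrow> 'a rep \<Rightarrow> 'a rep" where
  "act g x = (\<chi> l i j. \<Sum>m\<in>UNIV.
      snd g $ l $ m * (fst g ** x $ m ** transpose (fst g)) $ i $ j)"

lemma act_decomposable:
  "act g (tensor (wedge u v) f) = tensor (wedge (fst g *v u) (fst g *v v)) (snd g *v f)"
proof -
  have 1: "(fst g ** wedge u v ** transpose (fst g)) = wedge (fst g *v u) (fst g *v v)"
  proof -
    have "(\<Sum>k\<in>UNIV. (\<Sum>ka\<in>UNIV. fst g $ i $ ka * (u $ ka * v $ k - u $ k * v $ ka)) * fst g $ j $ k)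
      = (\<Sum>k\<in>UNIV. fst g $ i $ k * u $ k) * (\<Sum>k\<in>UNIV. fst g $ j $ k * v $ k)
       - (\<Sum>k\<in>UNIV. fst g $ j $ k * u $ k) * (\<Sum>k\<in>UNIV. fst g $ i $ k * v $ k)" for i j
    proof -
      have "(\<Sum>k\<in>UNIV. (\<Sum>ka\<in>UNIV. fst g $ i $ ka * (u $ ka * v $ k - u $ k * v $ ka)) * fst g $ j $ k)
        = (\<Sum>k\<in>UNIV. \<Sum>ka\<in>UNIV. (fst g $ i $ ka * u $ ka) * (fst g $ j $ k * v $ k))
        - (\<Sum>k\<in>UNIV. \<Sum>ka\<in>UNIV. (fst g $ j $ k * u $ k) * (fst g $ i $ ka * v $ ka))"
        by (simp only: sum_distrib_right sum_subtractf[symmetric]) (simp add: algebra_simps)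
      moreover have "(\<Sum>k\<in>UNIV. \<Sum>ka\<in>UNIV. (fst g $ i $ ka * u $ ka) * (fst g $ j $ k * v $ k))
        = (\<Sum>k\<in>UNIV. fst g $ i $ k * u $ k) * (\<Sum>k\<in>UNIV. fst g $ j $ k * v $ k)"
        by (subst sum.swap) (simp add: sum_product)
      ultimately show ?thesis
        by (simp add: sum_product)
    qed
    then show ?thesis
      by (simp add: vec_eq_iff matrix_matrix_mult_def matrix_vector_mult_def wedge_def transpose_def)
  qed
  have 2: "tensor (wedge u v) f $ m = (\<chi> i j. f $ m * wedge u v $ i $ j)" for m
    by (simp add: tensor_def vec_eq_iff mult.commute)
  have 3: "(A ** (\<chi> i j. c * B $ i $ j) ** C) $ i $ j = c * (A ** B ** C) $ i $ j"
    for A B C :: "'a^6^6" and c i j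
    by (simp add: matrix_matrix_mult_def sum_distrib_left sum_distrib_right mult_ac)
  show ?thesis
    unfolding act_def 2 3 1
    by (simp add: vec_eq_iff tensor_def matrix_vector_mult_def sum_distrib_left sum_distrib_right mult_ac)
qed

lemma mem_spanV_iff:
  assumes "I \<subseteq> idx"
  shows "x \<in> spanV I \<longleftrightarrow>
    (\<forall>l i. x $ l $ i $ i = 0) \<and> (\<forall>l i j. x $ l $ i $ j = - x $ l $ j $ i) \<and>
    (\<forall>t\<in>idx - I. coordV x t = 0)"
proof -
  have fin: "finite I" by simp
  have basis: "scaleV c (basis_e t) $ l $ i $ j =
      (if t = (i, j, l) then c else 0) - (if t = (j, i, l) then c else 0)" for c :: 'a and t l i j
  proof -
    obtain p q m where t: "t = (p, q, m)" by (cases t)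
    show ?thesis
      unfolding t scaleV_def basis_e_def tensor_def wedge_def axis_def vec_lambda_beta prod.case prod.inject
      by (cases "m = l"; cases "p = i"; cases "q = j"; cases "p = j"; cases "q = i") simp_all
  qed
  have comp: "(\<Sum>t\<in>I. scaleV (c t) (basis_e t)) $ l $ i $ j =
      (if (i, j, l) \<in> I then c (i, j, l) else 0) - (if (j, i, l) \<in> I then c (j, i, l) else 0)"
    for c :: "6 \<times> 6 \<times> 2 \<Rightarrow> 'a" and l i j
  proof -
    have "(\<Sum>t\<in>I. scaleV (c t) (basis_e t)) $ l $ i $ j
      = (\<Sum>t\<in>I. (if t = (i, j, l) then c t else 0) - (if t = (j, i, l) then c t else 0))"
      unfolding sum_component by (rule sum.cong) (simp_all add: basis)
    then show ?thesis
      using fin by (simp add: sum_subtractf sum.delta)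
  qed
  show ?thesis
  proof
    assume "x \<in> spanV I"
    then obtain c where c: "x = (\<Sum>t\<in>I. scaleV (c t) (basis_e t))"
      by (auto simp: spanV_def)
    have xc: "x $ l $ i $ j =
      (if (i, j, l) \<in> I then c (i, j, l) else 0) - (if (j, i, l) \<in> I then c (j, i, l) else 0)"
      for l i j
      unfolding c by (rule comp)
    have "(i, j, l) \<in> idx \<Longrightarrow> (j, i, l) \<notin> I" for i j l
      using assms by (auto simp: idx_def)
    then show "(\<forall>l i. x $ l $ i $ i = 0) \<and> (\<forall>l i j. x $ l $ i $ j = - x $ l $ j $ i) \<and>
      (\<forall>t\<in>idx - I. coordV x t = 0)"
      by (auto simp: xc coordV_def)
  next
    assume *: "(\<forall>l i. x $ l $ i $ i = 0) \<and> (\<forall>l i j. x $ l $ i $ j = - x $ l $ j $ i) \<and>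
      (\<forall>t\<in>idx - I. coordV x t = 0)"
    have off: "x $ l $ i $ j = 0" if "(i, j, l) \<in> idx" "(i, j, l) \<notin> I" for l i j
    proof -
      have "coordV x (i, j, l) = 0" using * that by blast
      then show ?thesis by (simp add: coordV_def)
    qed
    have diag: "x $ l $ i $ i = 0" for l i
      using * by blast
    have skew: "x $ l $ i $ j = - x $ l $ j $ i" for l i j
      using * by blast
    have "x $ l $ i $ j = (\<Sum>t\<in>I. scaleV (coordV x t) (basis_e t)) $ l $ i $ j" for l i j
    proof (cases i j rule: linorder_cases)
      case less
      then have "(i, j, l) \<in> idx" "(j, i, l) \<notin> I"
        using assms by (auto simp: idx_def)
      then show ?thesis unfolding comp by (simp add: coordV_def off)
    next
      case equal
      then show ?thesis unfolding comp by (simp add: diag)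
    next
      case greater
      then have "(j, i, l) \<in> idx" "(i, j, l) \<notin> I"
        using assms by (auto simp: idx_def)
      then show ?thesis
        unfolding comp by (subst skew) (simp add: coordV_def off)
    qed
    then have "x = (\<Sum>t\<in>I. scaleV (coordV x t) (basis_e t))"
      by (simp add: vec_eq_iff)
    then show "x \<in> spanV I"
      by (auto simp: spanV_def)
  qed
qed

definition coordG :: "'a grp \<Rightarrow> (6 \<times> 6) + (2 \<times> 2) \<Rightarrow> 'a" where
  "coordG g = case_sum (\<lambda>(i, j). fst g $ i $ j) (\<lambda>(i, j). snd g $ i $ j)"

text \<open>The Zariski topology on the affine space of pairs of matrices, with the principal open
  sets as a basis.\<close>

definition zariski :: "'a::comm_ring_1 grp topology" where
  "zariski = topology_generated_by {{g. mpol_eval p (coordG g) \<noteq> 0} | p. True}"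

definition identity_component :: "'a::comm_ring_1 grp set \<Rightarrow> 'a grp set" where
  "identity_component H = connected_component_of_set (subtopology zariski H) (mat 1, mat 1)"


section \<open>Weights and the index set of the stratification\<close>

text \<open>The inner product of the product type \<open>(real^6) \<times> (real^2)\<close> is the standard one of
  \<open>\<real>\<^sup>8\<close>.\<close>

type_synonym wt = "(real^6) \<times> (real^2)"

definition t_star :: "wt set" where
  "t_star = {a. (\<Sum>i\<in>UNIV. fst a $ i) = 0 \<and> (\<Sum>i\<in>UNIV. snd a $ i) = 0}"

definition t_star_plus :: "wt set" where
  "t_star_plus = {a \<in> t_star. (\<forall>i j. i \<le> j \<longrightarrow> fst a $ i \<le> fst a $ j) \<and>
                              (\<forall>i j. i \<le> j \<longrightarrow> snd a $ i \<le> snd a $ j)}"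

definition orth_proj :: "'a::real_inner set \<Rightarrow> 'a \<Rightarrow> 'a" where
  "orth_proj S x = (THE y. y \<in> S \<and> (\<forall>z\<in>S. orthogonal (x - y) z))"

definition gam :: "6 \<times> 6 \<times> 2 \<Rightarrow> wt" where
  "gam = (\<lambda>(i, j, l). orth_proj t_star (axis i 1 + axis j 1, axis l 1))"

definition BB :: "wt set" where
  "BB = {\<beta> \<in> t_star_plus. \<beta> \<noteq> 0 \<and>
          (\<exists>I. I \<subseteq> idx \<and> I \<noteq> {} \<and> \<beta> = closest_point (convex hull (gam ` I)) 0)}"


section \<open>Strata\<close>

definition Z_idx :: "wt \<Rightarrow> (6 \<times> 6 \<times> 2) set" where
  "Z_idx \<beta> = {t \<in> idx. gam t \<bullet> \<beta> = \<beta> \<bullet> \<beta>}"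

definition W_idx :: "wt \<Rightarrow> (6 \<times> 6 \<times> 2) set" where
  "W_idx \<beta> = {t \<in> idx. gam t \<bullet> \<beta> > \<beta> \<bullet> \<beta>}"

definition Z :: "wt \<Rightarrow> 'a::comm_ring_1 rep set" where
  "Z \<beta> = spanV (Z_idx \<beta>)"

definition W :: "wt \<Rightarrow> 'a::comm_ring_1 rep set" where
  "W \<beta> = spanV (W_idx \<beta>)"

definition M :: "wt \<Rightarrow> 'a::comm_ring_1 grp set" where
  "M \<beta> = {g \<in> G. (\<forall>i j. fst \<beta> $ i \<noteq> fst \<beta> $ j \<longrightarrow> fst g $ i $ j = 0) \<and>
                   (\<forall>i j. snd \<beta> $ i \<noteq> snd \<beta> $ j \<longrightarrow> snd g $ i $ j = 0)}"

definition entry :: "wt \<Rightarrow> 6 + 2 \<Rightarrow> real" where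
  "entry \<beta> = case_sum (\<lambda>i. fst \<beta> $ i) (\<lambda>i. snd \<beta> $ i)"

text \<open>The positive factor which makes \<open>\<beta>\<close> a primitive integral vector. Since the exponents of
  the block determinants are the entries of this vector, the resulting character is the
  indivisible one.\<close>

definition chi_scale :: "wt \<Rightarrow> real" where
  "chi_scale \<beta> = (THE c. c > 0 \<and>
     (\<exists>n :: 6 + 2 \<Rightarrow> int. (\<forall>p. of_int (n p) = c * entry \<beta> p) \<and> Gcd (range n) = 1))"

definition block_det :: "'a::comm_ring_1^'n^'n \<Rightarrow> 'n set \<Rightarrow> 'a" where
  "block_det A B = det (\<chi> i j. if i \<in> B \<and> j \<in> B then A $ i $ j else if i = j then 1 else 0)"

definition chi :: "wt \<Rightarrow> 'a::field grp \<Rightarrow> 'a" where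
  "chi \<beta> g =
     (\<Prod>b\<in>range (\<lambda>i. fst \<beta> $ i). block_det (fst g) {i. fst \<beta> $ i = b} powi \<lfloor>chi_scale \<beta> * b\<rfloor>) *
     (\<Prod>b\<in>range (\<lambda>i. snd \<beta> $ i). block_det (snd g) {i. snd \<beta> $ i = b} powi \<lfloor>chi_scale \<beta> * b\<rfloor>)"

text \<open>From here up to the strata the type \<open>'a\<close> stands for the algebraically closed field, and
  the varieties are identified with their sets of rational points over it.\<close>

definition G_st_beta :: "wt \<Rightarrow> 'a::alg_closed_field grp set" where
  "G_st_beta \<beta> = identity_component {g \<in> M \<beta> \<inter> G_st. chi \<beta> g = 1}"

definition Z_ss :: "wt \<Rightarrow> 'a::alg_closed_field rep set" where
  "Z_ss \<beta> = {z \<in> Z \<beta>. \<exists>d p. d > 0 \<and> mpol_homogeneous d p \<and> mpol_vars p \<subseteq> Z_idx \<beta> \<and>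
      (\<forall>g\<in>G_st_beta \<beta>. \<forall>y\<in>Z \<beta>. mpol_eval p (coordV (act g y)) = mpol_eval p (coordV y)) \<and>
      mpol_eval p (coordV z) \<noteq> 0}"

definition Y_ss :: "wt \<Rightarrow> 'a::alg_closed_field rep set" where
  "Y_ss \<beta> = {z + w | z w. z \<in> Z_ss \<beta> \<and> w \<in> W \<beta>}"

definition stratum :: "wt \<Rightarrow> 'a::alg_closed_field rep set" where
  "stratum \<beta> = {act g y | g y. g \<in> G \<and> y \<in> Y_ss \<beta>}"

definition base_change :: "'k::field rep \<Rightarrow> 'k alg_closure rep" where
  "base_change x = (\<chi> l i j. to_ac (x $ l $ i $ j))"

definition stratum_rat :: "wt \<Rightarrow> 'k::field rep set" where
  "stratum_rat \<beta> = {x \<in> V. base_change x \<in> stratum \<beta>}"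

definition orbits :: "'k::field rep set \<Rightarrow> 'k rep set set" where
  "orbits S = (\<lambda>x. (\<lambda>g. act g x) ` G) ` S"


section \<open>Perfect fields and extensions of degree at most two\<close>

definition separable_poly :: "'k::field poly \<Rightarrow> bool" where
  "separable_poly p \<longleftrightarrow> coprime p (pderiv p)"

definition perfect_field :: "'k::field itself \<Rightarrow> bool" where
  "perfect_field _ \<longleftrightarrow> (\<forall>p :: 'k poly. Factorial_Ring.irreducible p \<longrightarrow> separable_poly p)"

definition intermediate_field :: "'k::field alg_closure set \<Rightarrow> bool" where
  "intermediate_field L \<longleftrightarrow> range to_ac \<subseteq> L \<and>
     (\<forall>x\<in>L. \<forall>y\<in>L. x - y \<in> L \<and> x * y \<in> L) \<and> (\<forall>x\<in>L. inverse x \<in> L)"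

definition separable_ext :: "'k::field alg_closure set \<Rightarrow> bool" where
  "separable_ext L \<longleftrightarrow>
     (\<forall>x\<in>L. \<exists>p :: 'k poly. Factorial_Ring.irreducible p \<and> separable_poly p \<and> poly (map_poly to_ac p) x = 0)"

abbreviation k_scale :: "'k::field \<Rightarrow> 'k alg_closure \<Rightarrow> 'k alg_closure" where
  "k_scale c x \<equiv> to_ac c * x"

definition degree_at_most_2 :: "'k::field alg_closure set \<Rightarrow> bool" where
  "degree_at_most_2 L \<longleftrightarrow>
     (\<exists>B. finite B \<and> card B \<le> 2 \<and> \<not> Modules.module.dependent k_scale B \<and> Modules.module.span k_scale B = L)"

definition k_isomorphic :: "'k::field alg_closure set \<Rightarrow> 'k alg_closure set \<Rightarrow> bool" where
  "k_isomorphic L L' \<longleftrightarrow> (\<exists>\<sigma>. bij_betw \<sigma> L L' \<and>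
     (\<forall>x\<in>L. \<forall>y\<in>L. \<sigma> (x + y) = \<sigma> x + \<sigma> y \<and> \<sigma> (x * y) = \<sigma> x * \<sigma> y) \<and>
     (\<forall>c. \<sigma> (to_ac c) = to_ac c))"

text \<open>Every finite extension of \<open>k\<close> embeds over \<open>k\<close> into the algebraic closure, so all
  isomorphism classes are represented by intermediate fields.\<close>

definition Ex2_fields :: "'k::field alg_closure set set" where
  "Ex2_fields = {L. intermediate_field L \<and> separable_ext L \<and> degree_at_most_2 L}"

definition Ex2 :: "'k::field alg_closure set set set" where
  "Ex2 = Ex2_fields // {(L, L'). L \<in> Ex2_fields \<and> L' \<in> Ex2_fields \<and> k_isomorphic L L'}"

end

theory Submission
  imports Defs
begin

text \<open>A pencil of alternating forms is brought to one of thirteen normal forms, or to a form whose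
  associated binary quadratic form is nondegenerate, by splitting off bivectors.  The weights in the
  support of a normal form determine \<open>\<beta>\<close>, and a product of minors, Pfaffians and discriminants
  which is a relative invariant of the Levi subgroup shows that the normal form is semistable.  That
  no other pencils occur follows from the determinant of the pencil: in a stratum this
  binary sextic has a root of multiplicity at least four or vanishes.  Over a perfect field such a root
  is rational, so every rational point of a stratum is degenerate and the classification applies.
  Pencils with nondegenerate binary quadratic form are classified by the field generated by its roots.\<close>

text \<open>The set \<open>BB\<close> is never enumerated, and no semistable set is computed in
  full. It suffices to place one representative of each normal form in a stratum; no other index is
  possible because strata of different indices are disjoint. Disjointness rests on the Bruhat
  decomposition, which reduces an equivalence between points of two strata to a permutation of
  weights, and on the fact that the weights of a semistable point have \<beta> in their convex hull.
  The latter uses integral one-parameter subgroups orthogonal to \<beta>, hence the rationality of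
  \<beta>. The group of invariance is an identity component in the Zariski topology; elements are
  placed in it by joining them to the identity along rational curves. All formulas must survive in
  characteristic two. For this reason quadratic pencils are parametrised by
  \<open>x^2 + g x - b\<close> rather than by a square root, alternating matrices have zero diagonal
  by definition, and perfectness enters the classification only through the double root of a
  quadratic of discriminant zero.\<close>

lemma exhaust_6: fixes x :: 6 shows "x = 0 \<or> x = 1 \<or> x = 2 \<or> x = 3 \<or> x = 4 \<or> x = 5"
proof (induct x)
  case (of_int z)
  then have "z = 0 \<or> z = 1 \<or> z = 2 \<or> z = 3 \<or> z = 4 \<or> z = 5" by fastforce
  then show ?case by auto
qed

lemma exhaust_2': fixes x :: 2 shows "x = 0 \<or> x = 1"
proof (induct x)
  case (of_int z)
  then have "z = 0 \<or> z = 1" by fastforce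
  then show ?case by auto
qed

lemma UNIV_6: "UNIV = {0, 1, 2, 3, 4, 5 :: 6}" using exhaust_6 by auto
lemma UNIV_2': "UNIV = {0, 1 :: 2}" using exhaust_2' by auto

lemma forall_6: "(\<forall>i::6. P i) \<longleftrightarrow> P 0 \<and> P 1 \<and> P 2 \<and> P 3 \<and> P 4 \<and> P 5"
  by (metis exhaust_6)
lemma forall_2': "(\<forall>i::2. P i) \<longleftrightarrow> P 0 \<and> P 1"
  by (metis exhaust_2')

lemma sum_6: "sum f (UNIV :: 6 set) = f 0 + f 1 + f 2 + f 3 + f 4 + f 5"
  unfolding UNIV_6 by (simp add: ac_simps)
lemma sum_2': "sum f (UNIV :: 2 set) = f 0 + f 1"
  unfolding UNIV_2' by simp

lemma Rep_6: "Rep_bit0 (0::6) = 0" "Rep_bit0 (1::6) = 1" "Rep_bit0 (2::6) = 2"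
  "Rep_bit0 (3::6) = 3" "Rep_bit0 (4::6) = 4" "Rep_bit0 (5::6) = 5"
  by (simp_all add: bit0.Rep_0 bit0.Rep_1 bit0.Rep_numeral)
lemma Rep_2: "Rep_bit0 (0::2) = 0" "Rep_bit0 (1::2) = 1"
  by (simp_all add: bit0.Rep_0 bit0.Rep_1)

lemma less_6 [simp]:
  "(0::6) < 1" "(0::6) < 2" "(0::6) < 3" "(0::6) < 4" "(0::6) < 5"
  "(1::6) < 2" "(1::6) < 3" "(1::6) < 4" "(1::6) < 5"
  "(2::6) < 3" "(2::6) < 4" "(2::6) < 5" "(3::6) < 4" "(3::6) < 5" "(4::6) < 5"
  by (simp_all add: less_bit0_def Rep_6)

lemma not_less_6 [simp]:
  "\<not> (i::6) < 0" "\<not> (2::6) < 1" "\<not> (3::6) < 1" "\<not> (4::6) < 1" "\<not> (5::6) < 1"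
  "\<not> (3::6) < 2" "\<not> (4::6) < 2" "\<not> (5::6) < 2"
  "\<not> (4::6) < 3" "\<not> (5::6) < 3" "\<not> (5::6) < 4"
  using exhaust_6[of i] by (auto simp add: less_bit0_def Rep_6)

lemma le_6 [simp]:
  "(0::6) \<le> i" "(1::6) \<le> 2" "(1::6) \<le> 3" "(1::6) \<le> 4" "(1::6) \<le> 5"
  "(2::6) \<le> 3" "(2::6) \<le> 4" "(2::6) \<le> 5" "(3::6) \<le> 4" "(3::6) \<le> 5" "(4::6) \<le> 5"
  by (simp_all add: not_less[symmetric])

lemma not_le_6 [simp]:
  "\<not> (1::6) \<le> 0" "\<not> (2::6) \<le> 0" "\<not> (3::6) \<le> 0" "\<not> (4::6) \<le> 0" "\<not> (5::6) \<le> 0"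
  "\<not> (2::6) \<le> 1" "\<not> (3::6) \<le> 1" "\<not> (4::6) \<le> 1" "\<not> (5::6) \<le> 1"
  "\<not> (3::6) \<le> 2" "\<not> (4::6) \<le> 2" "\<not> (5::6) \<le> 2"
  "\<not> (4::6) \<le> 3" "\<not> (5::6) \<le> 3" "\<not> (5::6) \<le> 4"
  by (simp_all add: not_le)

lemma less_2 [simp]: "(0::2) < 1" "\<not> (i::2) < 0" "(0::2) \<le> i" "\<not> (1::2) \<le> 0"
  using exhaust_2'[of i] by (auto simp add: less_bit0_def less_eq_bit0_def Rep_2)

lemma idx_iff [simp]: "(i, j, l) \<in> idx \<longleftrightarrow> i < j"
  by (simp add: idx_def)

subsection \<open>Weights\<close>

lemma orthogonal_foot_unique:
  assumes "orthogonal (x - y) (y' - y)" "orthogonal (x - y') (y' - y)"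
  shows "y' = y"
proof -
  have "(y' - y) \<bullet> (y' - y) = (x - y) \<bullet> (y' - y) - (x - y') \<bullet> (y' - y)"
    by (simp add: algebra_simps)
  then show ?thesis using assms by (simp add: orthogonal_def)
qed

text \<open>Projection to \<open>t_star\<close> subtracts the mean of each block: two ones among six
  entries give 1/3, one among two gives 1/2.\<close>

lemma gam_eq: "gam (i, j, l) = (axis i 1 + axis j 1 - (\<chi> _. 1/3), axis l 1 - (\<chi> _. 1/2))"
proof -
  let ?x = "(axis i 1 + axis j 1, axis l 1) :: wt"
  let ?y = "(axis i 1 + axis j 1 - (\<chi> _. 1/3), axis l 1 - (\<chi> _. 1/2)) :: wt"
  have s6: "(\<Sum>m\<in>UNIV. axis p (1::real) $ m) = 1" for p :: 6
    by (simp add: axis_def)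
  have s2: "(\<Sum>m\<in>UNIV. axis p (1::real) $ m) = 1" for p :: 2
    by (simp add: axis_def)
  have y: "?y \<in> t_star"
    by (simp add: t_star_def sum.distrib sum_subtractf s6 s2)
  have o: "orthogonal (?x - ?y) z" if "z \<in> t_star" for z
    using that by (cases z) (simp add: orthogonal_def t_star_def inner_vec_def sum_divide_distrib[symmetric])
  show ?thesis
    unfolding gam_def orth_proj_def prod.case
  proof (rule the_equality)
    show "?y \<in> t_star \<and> (\<forall>z\<in>t_star. orthogonal (?x - ?y) z)" using y o by blast
    fix y' assume y': "y' \<in> t_star \<and> (\<forall>z\<in>t_star. orthogonal (?x - y') z)"
    have d: "y' - ?y \<in> t_star"
      using y y' by (simp add: t_star_def sum_subtractf)
    show "y' = ?y"
      using o[OF d] y' d by (blast intro: orthogonal_foot_unique)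
  qed
qed

lemma gam_in_t_star: "gam t \<in> t_star"
proof -
  obtain i j l where "t = (i, j, l)" by (cases t)
  moreover have "(\<Sum>m\<in>UNIV. axis p (1::real) $ m) = 1" for p :: 6
    by (simp add: axis_def)
  moreover have "(\<Sum>m\<in>UNIV. axis p (1::real) $ m) = 1" for p :: 2
    by (simp add: axis_def)
  ultimately show ?thesis
    by (simp add: gam_eq t_star_def sum.distrib sum_subtractf)
qed

definition wgt :: "wt \<Rightarrow> 6 \<times> 6 \<times> 2 \<Rightarrow> real" where
  "wgt \<beta> = (\<lambda>(i, j, l). fst \<beta> $ i + fst \<beta> $ j + snd \<beta> $ l)"

text \<open>The constants subtracted in \<open>gam_eq\<close> pair to zero with a vector of
  vanishing block sums, so only the entries of \<beta> at the indices of \<open>t\<close>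
  remain.\<close>

lemma inner_gam:
  assumes "\<beta> \<in> t_star"
  shows "gam t \<bullet> \<beta> = wgt \<beta> t"
proof -
  obtain i j l where t: "t = (i, j, l)" by (cases t)
  have *: "(\<chi> _. c) \<bullet> x = c * (\<Sum>i\<in>UNIV. x $ i)" for c and x :: "real^'n"
    by (simp add: inner_vec_def sum_distrib_left)
  show ?thesis
    using assms
    by (cases \<beta>) (simp add: t gam_eq wgt_def t_star_def inner_diff_left inner_add_left
        cart_eq_inner_axis[symmetric] inner_axis' * )
qed

lemma Z_idx_iff: "\<beta> \<in> t_star \<Longrightarrow> t \<in> Z_idx \<beta> \<longleftrightarrow> t \<in> idx \<and> wgt \<beta> t = \<beta> \<bullet> \<beta>"
  and W_idx_iff: "\<beta> \<in> t_star \<Longrightarrow> t \<in> W_idx \<beta> \<longleftrightarrow> t \<in> idx \<and> wgt \<beta> t > \<beta> \<bullet> \<beta>"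
  by (auto simp: Z_idx_def W_idx_def inner_gam)

lemma t_star_plus_t_star: "\<beta> \<in> t_star_plus \<Longrightarrow> \<beta> \<in> t_star"
  by (simp add: t_star_plus_def)

lemma BB_t_star: "\<beta> \<in> BB \<Longrightarrow> \<beta> \<in> t_star"
  by (simp add: BB_def t_star_plus_def)

subsection \<open>The action\<close>

text \<open>The zero diagonal is a separate condition because skew symmetry does not imply it in
  characteristic two.\<close>

definition alt :: "'a::comm_ring_1^'n^'n \<Rightarrow> bool" where
  "alt A \<longleftrightarrow> (\<forall>i. A $ i $ i = 0) \<and> (\<forall>i j. A $ i $ j = - A $ j $ i)"

lemma V_iff: "x \<in> V \<longleftrightarrow> (\<forall>l. alt (x $ l))"
  unfolding V_def mem_spanV_iff[OF order_refl] alt_def Diff_cancel by blast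

lemma spanV_iff: "I \<subseteq> idx \<Longrightarrow> x \<in> spanV I \<longleftrightarrow> x \<in> V \<and> (\<forall>t\<in>idx - I. coordV x t = 0)"
  unfolding mem_spanV_iff V_iff alt_def by metis

lemma act_component: "act g x $ l $ i $ j =
   (\<Sum>m\<in>UNIV. \<Sum>q\<in>UNIV. \<Sum>p\<in>UNIV. snd g $ l $ m * fst g $ i $ p * fst g $ j $ q * x $ m $ p $ q)"
  by (simp add: act_def matrix_matrix_mult_def transpose_def sum_distrib_left sum_distrib_right mult_ac)

definition gmul :: "'a::comm_ring_1 grp \<Rightarrow> 'a grp \<Rightarrow> 'a grp" where
  "gmul g h = (fst g ** fst h, snd g ** snd h)"

lemma act_gmul: "act (gmul g h) x = act g (act h x)"
proof -
  have 1: "(fst g ** A ** transpose (fst g)) $ i $ j = (\<Sum>q\<in>UNIV. \<Sum>p\<in>UNIV. fst g $ i $ p * A $ p $ q * fst g $ j $ q)"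
    for A :: "'a^6^6" and i j
    by (simp add: matrix_matrix_mult_def transpose_def sum_distrib_right)
  have 2: "fst (gmul g h) ** A ** transpose (fst (gmul g h)) =
    fst g ** (fst h ** A ** transpose (fst h)) ** transpose (fst g)" for A
    by (simp add: gmul_def matrix_transpose_mul matrix_mul_assoc)
  have 3: "(fst g ** (act h x $ m) ** transpose (fst g)) $ i $ j =
    (\<Sum>n\<in>UNIV. snd h $ m $ n * (fst g ** (fst h ** x $ n ** transpose (fst h)) ** transpose (fst g)) $ i $ j)"
    for m i j
  proof -
    have "(fst g ** (act h x $ m) ** transpose (fst g)) $ i $ j =
     (\<Sum>q\<in>UNIV. \<Sum>p\<in>UNIV. \<Sum>n\<in>UNIV. snd h $ m $ n * (fst g $ i $ p * (fst h ** x $ n ** transpose (fst h)) $ p $ q * fst g $ j $ q))"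
      unfolding 1 by (simp add: act_def sum_distrib_left sum_distrib_right mult_ac)
    also have "\<dots> = (\<Sum>q\<in>UNIV. \<Sum>n\<in>UNIV. \<Sum>p\<in>UNIV. snd h $ m $ n * (fst g $ i $ p * (fst h ** x $ n ** transpose (fst h)) $ p $ q * fst g $ j $ q))"
      by (intro sum.cong refl sum.swap)
    also have "\<dots> = (\<Sum>n\<in>UNIV. \<Sum>q\<in>UNIV. \<Sum>p\<in>UNIV. snd h $ m $ n * (fst g $ i $ p * (fst h ** x $ n ** transpose (fst h)) $ p $ q * fst g $ j $ q))"
      by (rule sum.swap)
    finally show ?thesis
      unfolding 1 by (simp add: sum_distrib_left)
  qed
  have "act (gmul g h) x $ l $ i $ j = act g (act h x) $ l $ i $ j" for l i j
  proof -
    have "act g (act h x) $ l $ i $ j = (\<Sum>m\<in>UNIV. \<Sum>n\<in>UNIV. snd g $ l $ m * snd h $ m $ n *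
       (fst g ** (fst h ** x $ n ** transpose (fst h)) ** transpose (fst g)) $ i $ j)"
      by (subst act_def) (simp add: 3 sum_distrib_left mult_ac)
    also have "\<dots> = (\<Sum>n\<in>UNIV. \<Sum>m\<in>UNIV. snd g $ l $ m * snd h $ m $ n *
       (fst g ** (fst h ** x $ n ** transpose (fst h)) ** transpose (fst g)) $ i $ j)"
      by (rule sum.swap)
    also have "\<dots> = act (gmul g h) x $ l $ i $ j"
      by (simp add: act_def 2) (simp add: gmul_def matrix_matrix_mult_def sum_distrib_right)
    finally show ?thesis by simp
  qed
  then show ?thesis by (simp add: vec_eq_iff)
qed

lemma act_one: "act (mat 1, mat 1) x = x"
  by (simp add: vec_eq_iff act_def transpose_mat) (simp add: mat_def if_distrib if_distribR cong: if_cong)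

lemma act_add: "act g (x + y) = act g x + act g y"
  by (simp add: vec_eq_iff act_component distrib_left sum.distrib)

definition ginv :: "'a::field grp \<Rightarrow> 'a grp" where
  "ginv g = (matrix_inv (fst g), matrix_inv (snd g))"

lemma matrix_inv_both:
  assumes "invertible (A::'a::field^'n^'n)"
  shows "matrix_inv A ** A = mat 1" "A ** matrix_inv A = mat 1"
  using someI_ex[OF assms[unfolded invertible_def]] unfolding matrix_inv_def by auto

lemma ginv_gmul: "g \<in> G \<Longrightarrow> gmul (ginv g) g = (mat 1, mat 1)"
  and gmul_ginv: "g \<in> G \<Longrightarrow> gmul g (ginv g) = (mat 1, mat 1)"
  by (simp_all add: G_def gmul_def ginv_def matrix_inv_both)

lemma gmul_G: "g \<in> G \<Longrightarrow> h \<in> G \<Longrightarrow> gmul g h \<in> (G :: 'a::comm_ring_1 grp set)"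
  by (simp add: G_def gmul_def invertible_mult)

lemma one_G: "(mat 1, mat 1) \<in> G"
  by (simp add: G_def invertible_def)

lemma ginv_G: "g \<in> G \<Longrightarrow> ginv g \<in> G"
  by (simp add: G_def ginv_def) (meson invertible_def matrix_inv_both)

definition equivG :: "'a::field rep \<Rightarrow> 'a rep \<Rightarrow> bool" (infix "\<sim>\<^sub>G" 50) where
  "x \<sim>\<^sub>G y \<longleftrightarrow> (\<exists>g\<in>G. y = act g x)"

lemma equivG_refl [simp]: "x \<sim>\<^sub>G x"
  unfolding equivG_def using one_G act_one by metis

lemma equivG_sym: "x \<sim>\<^sub>G y \<Longrightarrow> y \<sim>\<^sub>G x"
  unfolding equivG_def by (metis act_gmul ginv_gmul ginv_G act_one)

lemma equivG_trans [trans]: "x \<sim>\<^sub>G y \<Longrightarrow> y \<sim>\<^sub>G z \<Longrightarrow> x \<sim>\<^sub>G z"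
  unfolding equivG_def by (metis act_gmul gmul_G)

text \<open>Skew symmetry alone would show only that twice the diagonal vanishes. Expanding
  \<open>x\<close> in decomposable tensors avoids this: they are sent to decomposable tensors, which
  are visibly alternating.\<close>

lemma alt_act: "(\<And>l. alt (x $ l)) \<Longrightarrow> alt (act g x $ l)"
proof -
  assume a: "\<And>l. alt (x $ l)"
  have "x \<in> V" using a by (simp add: V_iff)
  then obtain c where x: "x = (\<Sum>t\<in>idx. scaleV (c t) (basis_e t))"
    unfolding V_def spanV_def by blast
  have act0: "act g (0::'a rep) = 0" by (simp add: vec_eq_iff act_component)
  have acts: "act g (sum f A) = (\<Sum>t\<in>A. act g (f t))" if "finite A" for f :: "6 \<times> 6 \<times> 2 \<Rightarrow> 'a rep" and A
    using that by induction (simp_all add: act0 act_add)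
  have scal: "act g (scaleV c' y) = scaleV c' (act g y)" for c' and y :: "'a rep"
    by (simp add: vec_eq_iff act_component scaleV_def sum_distrib_left mult_ac)
  have altw: "alt (scaleV c' (act g (basis_e t)) $ l)" for c' t
  proof -
    obtain i j m where t: "t = (i, j, m)" by (cases t)
    show ?thesis
      unfolding t basis_e_def prod.case act_decomposable
      by (simp add: alt_def scaleV_def tensor_def wedge_def algebra_simps)
  qed
  have "alt ((\<Sum>t\<in>idx. scaleV (c t) (act g (basis_e t))) $ l)"
    unfolding alt_def sum_component sum_negf[symmetric]
    by (intro conjI allI sum.neutral sum.cong ballI refl altw[unfolded alt_def, THEN conjunct1, rule_format]
        altw[unfolded alt_def, THEN conjunct2, rule_format])
  then show ?thesis by (simp add: x acts scal)
qed

lemma act_V: "x \<in> V \<Longrightarrow> act g x \<in> V"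
  by (simp add: V_iff alt_act)

subsection \<open>Bruhat decomposition\<close>

definition lower_uni :: "'a::comm_ring_1^'n::{finite,wellorder}^'n::{finite,wellorder} \<Rightarrow> bool" where
  "lower_uni A \<longleftrightarrow> (\<forall>i. A $ i $ i = 1) \<and> (\<forall>i j. i < j \<longrightarrow> A $ i $ j = 0)"

lemma det_lower_uni: "lower_uni A \<Longrightarrow> det A = 1"
  by (subst det_lowerdiagonal) (auto simp: lower_uni_def)

lemma lower_uni_mat_1: "lower_uni (mat 1)"
  by (auto simp: lower_uni_def mat_def)

lemma lower_uni_mult:
  fixes A B :: "'a::comm_ring_1^'n::{finite,wellorder}^'n::{finite,wellorder}"
  assumes "lower_uni A" "lower_uni B"
  shows "lower_uni (A ** B)"
proof -
  have "(A ** B) $ i $ j = 0" if "i < j" for i j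
    unfolding matrix_matrix_mult_def using that assms
    by (auto simp: lower_uni_def intro!: sum.neutral) (metis mult_zero_left mult_zero_right not_less order.strict_trans1)
  moreover have "(A ** B) $ i $ i = 1" for i
  proof -
    have "(A ** B) $ i $ i = (\<Sum>k\<in>UNIV. A $ i $ k * B $ k $ i)"
      by (simp add: matrix_matrix_mult_def)
    also have "\<dots> = (\<Sum>k\<in>UNIV. if k = i then 1 else 0)"
      using assms by (intro sum.cong refl) (auto simp: lower_uni_def neq_iff)
    finally show ?thesis by simp
  qed
  ultimately show ?thesis by (auto simp: lower_uni_def)
qed

text \<open>Rows are treated from the smallest on. Columns to the left of the pivot and rows below
  it are cleared by lower unitriangular factors. The pivot columns of earlier rows already vanish in
  the new row, so the new pivot lies in another column and the earlier rows stay as they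
  are.\<close>

lemma bruhat_step:
  fixes A :: "'a::field^'n::{finite,wellorder}^'n::{finite,wellorder}"
  assumes "invertible A"
  shows "\<exists>u1 u2 N \<pi>. lower_uni u1 \<and> lower_uni u2 \<and> u1 ** A = N ** u2 \<and>
    (\<forall>a\<in>S. N $ a $ \<pi> a \<noteq> 0 \<and> (\<forall>j. j \<noteq> \<pi> a \<longrightarrow> N $ a $ j = 0) \<and> (\<forall>b>a. N $ b $ \<pi> a = 0))"
  using finite[of S]
proof (induction S rule: finite_linorder_max_induct)
  case empty
  have "u1 ** A = N ** u2" if "u1 = mat 1" "N = A" "u2 = mat 1" for u1 N u2
    using that by simp
  then show ?case using lower_uni_mat_1 by blast
next
  case (insert b S)
  then obtain u1 u2 N \<pi> where u: "lower_uni u1" "lower_uni u2" "u1 ** A = N ** u2"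
    and S: "\<And>a. a \<in> S \<Longrightarrow> N $ a $ \<pi> a \<noteq> 0" "\<And>a j. a \<in> S \<Longrightarrow> j \<noteq> \<pi> a \<Longrightarrow> N $ a $ j = 0"
      "\<And>a b. a \<in> S \<Longrightarrow> b > a \<Longrightarrow> N $ b $ \<pi> a = 0"
    by blast
  have "det N * det u2 = det u1 * det A"
    by (simp add: det_mul[symmetric] u(3))
  then have "det N \<noteq> 0"
    using assms u(1,2) by (simp add: det_lower_uni invertible_det_nz)
  then have "row b N \<noteq> 0" using det_zero_row(2) by blast
  then have ne: "{j. N $ b $ j \<noteq> 0} \<noteq> {}" by (auto simp: row_def vec_eq_iff)
  \<comment> \<open>The last nonzero entry of the row is the pivot: what has to be cleared lies to
    its left, where column operations by a lower unitriangular matrix reach.\<close>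
  define p where "p = Max {j. N $ b $ j \<noteq> 0}"
  have p: "N $ b $ p \<noteq> 0"
    using Max_in[OF _ ne] by (simp add: p_def)
  have p': "N $ b $ j = 0" if "p < j" for j
  proof (rule ccontr)
    assume "N $ b $ j \<noteq> 0"
    then have "j \<le> p" using Max_ge[of "{j. N $ b $ j \<noteq> 0}" j] by (simp add: p_def)
    then show False using that by simp
  qed
  have pS: "p \<noteq> \<pi> a" if "a \<in> S" for a
    using S(3)[OF that, of b] insert(2) p that by auto
  define c where "c j = (if j < p then N $ b $ j / N $ b $ p else 0)" for j
  define C :: "'a^'n::{finite,wellorder}^'n::{finite,wellorder}" where "C = (\<chi> i j. (if i = j then 1 else 0) - (if i = p then c j else 0))"
  define C' :: "'a^'n::{finite,wellorder}^'n::{finite,wellorder}" where "C' = (\<chi> i j. (if i = j then 1 else 0) + (if i = p then c j else 0))"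
  have cp: "c p = 0" by (simp add: c_def)
  have CC': "C ** C' = mat 1"
  proof -
    have "(C ** C') $ i $ j = mat 1 $ i $ j" for i j
    proof -
      have "(C ** C') $ i $ j = C' $ i $ j - (if i = p then (\<Sum>k\<in>UNIV. c k * C' $ k $ j) else 0)"
        by (simp add: C_def matrix_matrix_mult_def left_diff_distrib sum_subtractf mult_delta_left)
      also have "(\<Sum>k\<in>UNIV. c k * C' $ k $ j) = c j"
        by (simp add: C'_def distrib_left sum.distrib mult_delta_right cp)
      finally show ?thesis by (simp add: C'_def mat_def)
    qed
    then show ?thesis by (simp add: vec_eq_iff)
  qed
  define N' where "N' = N ** C"
  have N': "N' $ i $ j = N $ i $ j - N $ i $ p * c j" for i j
    by (simp add: N'_def C_def matrix_matrix_mult_def right_diff_distrib sum_subtractf mult_delta_right)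
  define r where "r i = (if b < i then N' $ i $ p / N' $ b $ p else 0)" for i
  define R :: "'a^'n::{finite,wellorder}^'n::{finite,wellorder}" where "R = (\<chi> i j. (if i = j then 1 else 0) - (if j = b then r i else 0))"
  define N'' where "N'' = R ** N'"
  have N'': "N'' $ i $ j = N' $ i $ j - r i * N' $ b $ j" for i j
    by (simp add: N''_def R_def matrix_matrix_mult_def left_diff_distrib sum_subtractf mult_delta_left)
  have lo: "lower_uni C'" "lower_uni R"
    by (auto simp: lower_uni_def C'_def R_def c_def r_def)
  have "N'' ** (C' ** u2) = R ** (N ** (C ** C') ** u2)"
    by (simp add: N''_def N'_def matrix_mul_assoc)
  then have eq: "(R ** u1) ** A = N'' ** (C' ** u2)"
    by (simp add: CC' u(3)[symmetric] matrix_mul_assoc)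
  have N'bp: "N' $ b $ p = N $ b $ p" by (simp add: N' cp)
  define \<pi>' where "\<pi>' = \<pi>(b := p)"
  have main: "N'' $ a $ \<pi>' a \<noteq> 0 \<and> (\<forall>j. j \<noteq> \<pi>' a \<longrightarrow> N'' $ a $ j = 0) \<and> (\<forall>b>a. N'' $ b $ \<pi>' a = 0)"
    if a: "a \<in> insert b S" for a
  proof (cases "a = b")
    case True
    have rb: "r b = 0" by (simp add: r_def)
    have "N'' $ b $ j = 0" if "j \<noteq> p" for j
    proof (cases "j < p")
      case True then show ?thesis using p by (simp add: N'' rb N' c_def)
    next
      case False then show ?thesis using p' that by (simp add: N'' rb N' c_def)
    qed
    moreover have "N'' $ b' $ p = 0" if "b' > b" for b'
      using that p N'bp by (simp add: N'' r_def)
    moreover have "N'' $ b $ p \<noteq> 0" by (simp add: N'' rb N'bp p)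
    ultimately show ?thesis using True by (simp add: \<pi>'_def)
  next
    case False
    then have aS: "a \<in> S" and ab: "a < b" using a insert(2) by auto
    have row: "N'' $ a $ j = N $ a $ j" for j
      using ab S(2)[OF aS pS[OF aS]] by (simp add: N'' r_def N')
    have c0: "c (\<pi> a) = 0" using S(3)[OF aS ab] by (simp add: c_def)
    have "N'' $ b' $ \<pi> a = 0" if "b' > a" for b'
      using S(3)[OF aS that] S(3)[OF aS ab] by (simp add: N'' N' c0)
    then show ?thesis using S(1,2)[OF aS] False by (simp add: \<pi>'_def row)
  qed
  show ?case using main eq lower_uni_mult[OF lo(1) u(2)] lower_uni_mult[OF lo(2) u(1)] by blast
qed

text \<open>Lower unitriangular factors are chosen because they preserve every \<open>Y_ss\<close>.
  A group element between two such sets can thus be replaced by a monomial matrix.\<close>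

proposition bruhat_decomposition:
  fixes A :: "'a::field^'n::{finite,wellorder}^'n::{finite,wellorder}"
  assumes "invertible A"
  obtains u1 u2 N \<pi> where "lower_uni u1" "lower_uni u2" "u1 ** A = N ** u2" "bij \<pi>"
    "\<And>i j. N $ i $ j \<noteq> 0 \<longleftrightarrow> j = \<pi> i"
proof -
  obtain u1 u2 N \<pi> where u: "lower_uni u1" "lower_uni u2" "u1 ** A = N ** u2"
    and N: "\<And>a. N $ a $ \<pi> a \<noteq> 0" "\<And>a j. j \<noteq> \<pi> a \<Longrightarrow> N $ a $ j = 0"
      "\<And>a b. b > a \<Longrightarrow> N $ b $ \<pi> a = 0"
    using bruhat_step[OF assms, of UNIV] by (metis UNIV_I)
  have "inj \<pi>"
    by (rule injI) (metis N(1,3) neq_iff)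
  then have "bij \<pi>" by (simp add: bij_def finite_UNIV_inj_surj)
  then show ?thesis using that[OF u] N by blast
qed

subsection \<open>Polynomial functions\<close>

definition mon_eval :: "('v \<Rightarrow>\<^sub>0 nat) \<Rightarrow> ('v \<Rightarrow> 'a::comm_semiring_1) \<Rightarrow> 'a" where
  "mon_eval m x = (\<Prod>v\<in>Poly_Mapping.keys m. x v ^ Poly_Mapping.lookup m v)"

definition mon_deg :: "('v \<Rightarrow>\<^sub>0 nat) \<Rightarrow> nat" where
  "mon_deg m = (\<Sum>v\<in>Poly_Mapping.keys m. Poly_Mapping.lookup m v)"

lemma mon_eval_superset:
  assumes "finite A" "Poly_Mapping.keys m \<subseteq> A"
  shows "mon_eval m x = (\<Prod>v\<in>A. x v ^ Poly_Mapping.lookup m v)"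
  unfolding mon_eval_def
  by (rule prod.mono_neutral_left) (use assms in \<open>auto simp: not_in_keys_iff_lookup_eq_zero\<close>)

lemma mon_deg_superset:
  assumes "finite A" "Poly_Mapping.keys m \<subseteq> A"
  shows "mon_deg m = (\<Sum>v\<in>A. Poly_Mapping.lookup m v)"
  unfolding mon_deg_def
  by (rule sum.mono_neutral_left) (use assms in \<open>auto simp: not_in_keys_iff_lookup_eq_zero\<close>)

lemma mon_eval_add: "mon_eval (m + m') x = mon_eval m x * mon_eval m' x"
proof -
  let ?A = "Poly_Mapping.keys m \<union> Poly_Mapping.keys m'"
  have "mon_eval (m + m') x = (\<Prod>v\<in>?A. x v ^ Poly_Mapping.lookup (m + m') v)"
    using Poly_Mapping.keys_add[of m m'] by (intro mon_eval_superset) auto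
  then show ?thesis
    by (simp add: mon_eval_superset[of ?A m] mon_eval_superset[of ?A m'] lookup_add power_add prod.distrib)
qed

lemma mon_deg_add: "mon_deg (m + m') = mon_deg m + mon_deg m'"
proof -
  let ?A = "Poly_Mapping.keys m \<union> Poly_Mapping.keys m'"
  have "mon_deg (m + m') = (\<Sum>v\<in>?A. Poly_Mapping.lookup (m + m') v)"
    using Poly_Mapping.keys_add[of m m'] by (intro mon_deg_superset) auto
  then show ?thesis
    by (simp add: mon_deg_superset[of ?A m] mon_deg_superset[of ?A m'] lookup_add sum.distrib)
qed

text \<open>Stated for functions, so that invariants can be written as ordinary expressions and
  certified by closure rules. Coefficients may vanish, which makes the zero function homogeneous of
  every degree.\<close>

definition hompoly :: "'v set \<Rightarrow> nat \<Rightarrow> (('v \<Rightarrow> 'a::comm_ring_1) \<Rightarrow> 'a) \<Rightarrow> bool" where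
  "hompoly S d f \<longleftrightarrow> (\<exists>K c. finite K \<and> (\<forall>m\<in>K. Poly_Mapping.keys m \<subseteq> S \<and> mon_deg m = d) \<and>
     (\<forall>x. f x = (\<Sum>m\<in>K. c m * mon_eval m x)))"

lemma hompoly_mpol:
  assumes "hompoly S d f"
  obtains p where "mpol_homogeneous d p" "mpol_vars p \<subseteq> S" "\<And>x. mpol_eval p x = f x"
proof -
  obtain K c where K: "finite K" "\<And>m. m \<in> K \<Longrightarrow> Poly_Mapping.keys m \<subseteq> S \<and> mon_deg m = d"
    and f: "\<And>x. f x = (\<Sum>m\<in>K. c m * mon_eval m x)"
    using assms unfolding hompoly_def by blast
  define p where "p = Abs_poly_mapping (\<lambda>m. if m \<in> K then c m else 0)"
  have lp: "Poly_Mapping.lookup p = (\<lambda>m. if m \<in> K then c m else 0)"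
    unfolding p_def by (rule Abs_poly_mapping_inverse) (use K(1) in \<open>auto intro: finite_subset[of _ K]\<close>)
  have kp: "Poly_Mapping.keys p \<subseteq> K"
    by (auto simp: in_keys_iff lp split: if_splits)
  have "mpol_eval p x = (\<Sum>m\<in>K. Poly_Mapping.lookup p m * mon_eval m x)" for x
    unfolding mpol_eval_def mon_eval_def[symmetric]
    by (rule sum.mono_neutral_left) (use K(1) kp in \<open>auto simp: not_in_keys_iff_lookup_eq_zero\<close>)
  then have "mpol_eval p x = f x" for x by (simp add: f lp)
  moreover have "mpol_homogeneous d p"
    using kp K(2) by (auto simp: mpol_homogeneous_def mon_deg_def)
  moreover have "mpol_vars p \<subseteq> S"
    using kp K(2) by (auto simp: mpol_vars_def)
  ultimately show ?thesis using that by blast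
qed

lemma hompoly_cong: "hompoly S d f \<Longrightarrow> (\<And>x. f x = g x) \<Longrightarrow> hompoly S d g"
  by (simp add: hompoly_def)

lemma hompoly_zero: "hompoly S d (\<lambda>x. 0)"
  unfolding hompoly_def by (rule exI[of _ "{}"]) simp

lemma hompoly_const: "hompoly S 0 (\<lambda>x. c)"
  unfolding hompoly_def
  by (rule exI[of _ "{0}"], rule exI[of _ "\<lambda>_. c"]) (simp add: mon_deg_def mon_eval_def)

lemma hompoly_var: "v \<in> S \<Longrightarrow> hompoly S 1 (\<lambda>x. x v)"
  unfolding hompoly_def
  by (rule exI[of _ "{Poly_Mapping.single v 1}"], rule exI[of _ "\<lambda>_. 1"])
     (simp add: mon_deg_def mon_eval_def)

lemma hompoly_add:
  assumes "hompoly S d f" "hompoly S d g"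
  shows "hompoly S d (\<lambda>x. f x + g x)"
proof -
  obtain K c where K: "finite K" "\<And>m. m \<in> K \<Longrightarrow> Poly_Mapping.keys m \<subseteq> S \<and> mon_deg m = d"
    and f: "\<And>x. f x = (\<Sum>m\<in>K. c m * mon_eval m x)"
    using assms(1) unfolding hompoly_def by blast
  obtain L e where L: "finite L" "\<And>m. m \<in> L \<Longrightarrow> Poly_Mapping.keys m \<subseteq> S \<and> mon_deg m = d"
    and g: "\<And>x. g x = (\<Sum>m\<in>L. e m * mon_eval m x)"
    using assms(2) unfolding hompoly_def by blast
  have 1: "f x = (\<Sum>m\<in>K\<union>L. (if m \<in> K then c m else 0) * mon_eval m x)" for x
    unfolding f using K(1) L(1) by (intro sum.mono_neutral_cong_left) auto
  have 2: "g x = (\<Sum>m\<in>K\<union>L. (if m \<in> L then e m else 0) * mon_eval m x)" for x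
    unfolding g using K(1) L(1) by (intro sum.mono_neutral_cong_left) auto
  have "\<forall>m\<in>K \<union> L. Poly_Mapping.keys m \<subseteq> S \<and> mon_deg m = d" using K(2) L(2) by blast
  moreover have "f x + g x = (\<Sum>m\<in>K \<union> L. ((if m \<in> K then c m else 0) + (if m \<in> L then e m else 0)) * mon_eval m x)" for x
    by (simp only: 1 2 sum.distrib distrib_right)
  ultimately show ?thesis
    unfolding hompoly_def
    by (intro exI[of _ "K \<union> L"] exI[of _ "\<lambda>m. (if m \<in> K then c m else 0) + (if m \<in> L then e m else 0)"])
       (use K(1) L(1) in simp)
qed

lemma hompoly_sum:
  assumes "\<And>i. i \<in> I \<Longrightarrow> hompoly S d (f i)"
  shows "hompoly S d (\<lambda>x. \<Sum>i\<in>I. f i x)"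
proof (cases "finite I")
  case True
  then show ?thesis using assms
    by induction (simp_all add: hompoly_zero hompoly_add)
qed (simp add: hompoly_zero)

lemma hompoly_mult:
  assumes "hompoly S d f" "hompoly S d' g"
  shows "hompoly S (d + d') (\<lambda>x. f x * g x)"
proof -
  obtain K c where K: "finite K" "\<And>m. m \<in> K \<Longrightarrow> Poly_Mapping.keys m \<subseteq> S \<and> mon_deg m = d"
    and f: "\<And>x. f x = (\<Sum>m\<in>K. c m * mon_eval m x)"
    using assms(1) unfolding hompoly_def by blast
  obtain L e where L: "finite L" "\<And>m. m \<in> L \<Longrightarrow> Poly_Mapping.keys m \<subseteq> S \<and> mon_deg m = d'"
    and g: "\<And>x. g x = (\<Sum>m\<in>L. e m * mon_eval m x)"
    using assms(2) unfolding hompoly_def by blast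
  have "hompoly S (d + d') (\<lambda>x. (c m * e n) * mon_eval (m + n) x)" if "m \<in> K" "n \<in> L" for m n
    unfolding hompoly_def
    by (rule exI[of _ "{m + n}"], rule exI[of _ "\<lambda>_. c m * e n"])
       (use K(2)[OF that(1)] L(2)[OF that(2)] Poly_Mapping.keys_add[of m n] in \<open>auto simp: mon_deg_add\<close>)
  then have "hompoly S (d + d') (\<lambda>x. \<Sum>m\<in>K. \<Sum>n\<in>L. (c m * e n) * mon_eval (m + n) x)"
    by (intro hompoly_sum) auto
  then show ?thesis
    by (rule hompoly_cong) (simp add: f g sum_product mon_eval_add mult_ac)
qed

lemma hompoly_cmult: "hompoly S d f \<Longrightarrow> hompoly S d (\<lambda>x. c * f x)"
  using hompoly_mult[OF hompoly_const[of S c]] by simp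

lemma hompoly_uminus: "hompoly S d f \<Longrightarrow> hompoly S d (\<lambda>x. - f x)"
  using hompoly_cmult[of S d f "-1"] by simp

lemma hompoly_diff: "hompoly S d f \<Longrightarrow> hompoly S d g \<Longrightarrow> hompoly S d (\<lambda>x. f x - g x)"
  using hompoly_add[OF _ hompoly_uminus, of S d f g] by simp

lemma hompoly_power: "hompoly S d f \<Longrightarrow> hompoly S (n * d) (\<lambda>x. f x ^ n)"
  by (induction n) (auto simp: hompoly_const intro: hompoly_mult)

lemma hompoly_prod:
  assumes "finite I" "\<And>i. i \<in> I \<Longrightarrow> hompoly S 1 (f i)"
  shows "hompoly S (card I) (\<lambda>x. \<Prod>i\<in>I. f i x)"
  using assms
proof induction
  case (insert a I)
  then have "hompoly S (1 + card I) (\<lambda>x. f a x * (\<Prod>i\<in>I. f i x))"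
    by (intro hompoly_mult) auto
  then show ?case using insert by simp
qed (simp add: hompoly_const)

subsection \<open>Connectedness of rational curves in the Zariski topology\<close>

text \<open>Only the values on \<open>S\<close> count, and the denominator has no zero there. The
  parameter set will be the affine line or the punctured line.\<close>

definition ratfun :: "'a::field set \<Rightarrow> ('a \<Rightarrow> 'a) \<Rightarrow> bool" where
  "ratfun S f \<longleftrightarrow> (\<exists>D Q. \<forall>s\<in>S. poly D s \<noteq> 0 \<and> poly D s * f s = poly Q s)"

lemma ratfun_const: "ratfun S (\<lambda>_. c)"
  unfolding ratfun_def by (rule exI[of _ 1], rule exI[of _ "[:c:]"]) simp

lemma ratfun_id: "ratfun S (\<lambda>s. s)"
  unfolding ratfun_def by (rule exI[of _ 1], rule exI[of _ "[:0, 1:]"]) simp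

lemma ratfun_add:
  assumes "ratfun S f" "ratfun S g" shows "ratfun S (\<lambda>s. f s + g s)"
proof -
  obtain D Q D' Q' where "\<forall>s\<in>S. poly D s \<noteq> 0 \<and> poly D s * f s = poly Q s"
    "\<forall>s\<in>S. poly D' s \<noteq> 0 \<and> poly D' s * g s = poly Q' s"
    using assms unfolding ratfun_def by blast
  then have "\<forall>s\<in>S. poly (D * D') s \<noteq> 0 \<and> poly (D * D') s * (f s + g s) = poly (D' * Q + D * Q') s"
    by (auto simp: algebra_simps) 
  then show ?thesis unfolding ratfun_def by blast
qed

lemma ratfun_mult:
  assumes "ratfun S f" "ratfun S g" shows "ratfun S (\<lambda>s. f s * g s)"
proof -
  obtain D Q D' Q' where *: "\<forall>s\<in>S. poly D s \<noteq> 0 \<and> poly D s * f s = poly Q s"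
    "\<forall>s\<in>S. poly D' s \<noteq> 0 \<and> poly D' s * g s = poly Q' s"
    using assms unfolding ratfun_def by blast
  have "poly (D * D') s \<noteq> 0 \<and> poly (D * D') s * (f s * g s) = poly (Q * Q') s" if "s \<in> S" for s
  proof -
    have "poly (D * D') s * (f s * g s) = (poly D s * f s) * (poly D' s * g s)" by (simp add: mult_ac)
    then show ?thesis using * that by simp
  qed
  then show ?thesis unfolding ratfun_def by blast
qed

lemma ratfun_inverse: assumes "0 \<notin> S" shows "ratfun S inverse"
  unfolding ratfun_def
  by (rule exI[of _ "[:0, 1:]"], rule exI[of _ 1]) (use assms in \<open>auto intro!: right_inverse\<close>)

lemma ratfun_power: "ratfun S f \<Longrightarrow> ratfun S (\<lambda>s. f s ^ n)"
  by (induction n) (auto intro: ratfun_const ratfun_mult)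

lemma ratfun_sum: "(\<And>i. i \<in> I \<Longrightarrow> ratfun S (f i)) \<Longrightarrow> ratfun S (\<lambda>s. \<Sum>i\<in>I. f i s)"
  by (induction I rule: infinite_finite_induct) (auto intro: ratfun_const ratfun_add)

lemma ratfun_prod: "(\<And>i. i \<in> I \<Longrightarrow> ratfun S (f i)) \<Longrightarrow> ratfun S (\<lambda>s. \<Prod>i\<in>I. f i s)"
  by (induction I rule: infinite_finite_induct) (auto intro: ratfun_const ratfun_mult)

lemma ratfun_mpol_eval:
  assumes "\<And>v. ratfun S (\<lambda>s. x s v)"
  shows "ratfun S (\<lambda>s. mpol_eval p (x s))"
  unfolding mpol_eval_def
  by (intro ratfun_sum ratfun_mult ratfun_const ratfun_prod ratfun_power assms)

lemma ratfun_finite_zeros: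
  assumes "ratfun S f" "s0 \<in> S" "f s0 \<noteq> 0"
  shows "finite {s \<in> S. f s = 0}"
proof -
  obtain D Q where DQ: "\<forall>s\<in>S. poly D s \<noteq> 0 \<and> poly D s * f s = poly Q s"
    using assms(1) unfolding ratfun_def by blast
  then have "Q \<noteq> 0" using assms(2,3) by fastforce
  then have "finite {s. poly Q s = 0}" by (rule poly_roots_finite)
  then show ?thesis
    by (rule finite_subset[rotated]) (use DQ in fastforce)
qed

text \<open>For a principal open set this is the finiteness of the zeros of a nonzero rational
  function. The property passes to finite intersections and to unions, hence to every open set that
  the curve meets.\<close>

lemma zariski_open_curve:
  assumes "\<And>v. ratfun S (\<lambda>s. coordG (\<phi> s) v)" "openin zariski U" "s0 \<in> S" "\<phi> s0 \<in> U"
  shows "finite {s \<in> S. \<phi> s \<notin> U}"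
  using assms(2,4) unfolding zariski_def openin_topology_generated_by_iff
proof induction
  case (Int A B)
  have "{s \<in> S. \<phi> s \<notin> A \<inter> B} = {s \<in> S. \<phi> s \<notin> A} \<union> {s \<in> S. \<phi> s \<notin> B}" by blast
  then show ?case using Int by simp
next
  case (UN K)
  then obtain k where "k \<in> K" "\<phi> s0 \<in> k" by blast
  then have "finite {s \<in> S. \<phi> s \<notin> k}" using UN by blast
  then show ?case by (rule finite_subset[rotated]) (use \<open>k \<in> K\<close> in blast)
next
  case (Basis B)
  then obtain p where B: "B = {g. mpol_eval p (coordG g) \<noteq> 0}" by blast
  have "finite {s \<in> S. mpol_eval p (coordG (\<phi> s)) = 0}"
    using Basis assms(3) by (intro ratfun_finite_zeros[of S _ s0] ratfun_mpol_eval assms(1)) (auto simp: B)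
  then show ?case by (simp add: B)
qed simp

text \<open>A separation of the image by two open sets would write the infinite parameter set as a
  union of two finite ones. So the image is connected, and it contains the identity.\<close>

lemma zariski_curve_identity_component:
  assumes rat: "\<And>v. ratfun S (\<lambda>s. coordG (\<phi> s) v)" and inf: "infinite S"
    and H: "\<And>s. s \<in> S \<Longrightarrow> \<phi> s \<in> H" and s0: "s0 \<in> S" "\<phi> s0 = (mat 1, mat 1)" and s1: "s1 \<in> S"
  shows "\<phi> s1 \<in> identity_component H"
proof -
  have sp: "topspace zariski = (UNIV :: 'a grp set)"
  proof -
    have "mpol_eval (Poly_Mapping.single 0 1) (coordG g) \<noteq> 0" for g :: "'a grp"
      by (simp add: mpol_eval_def)
    then show ?thesis
      unfolding zariski_def topology_generated_by_topspace by blast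
  qed
  have con: "connectedin zariski (\<phi> ` S)"
    unfolding connectedin
  proof (intro conjI notI)
    show "\<phi> ` S \<subseteq> topspace zariski" by (simp add: sp)
    assume "\<exists>E1 E2. openin zariski E1 \<and> openin zariski E2 \<and> \<phi> ` S \<subseteq> E1 \<union> E2 \<and>
      E1 \<inter> E2 \<inter> \<phi> ` S = {} \<and> E1 \<inter> \<phi> ` S \<noteq> {} \<and> E2 \<inter> \<phi> ` S \<noteq> {}"
    then obtain E1 E2 a b where E: "openin zariski E1" "openin zariski E2" "E1 \<inter> E2 \<inter> \<phi> ` S = {}"
      "a \<in> S" "\<phi> a \<in> E1" "b \<in> S" "\<phi> b \<in> E2" by blast
    have "finite ({s \<in> S. \<phi> s \<notin> E1} \<union> {s \<in> S. \<phi> s \<notin> E2})"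
      using zariski_open_curve[OF rat E(1,4,5)] zariski_open_curve[OF rat E(2,6,7)] by simp
    moreover have "S \<subseteq> {s \<in> S. \<phi> s \<notin> E1} \<union> {s \<in> S. \<phi> s \<notin> E2}" using E(3) by auto
    ultimately show False using inf by (meson finite_subset)
  qed
  have "connectedin (subtopology zariski H) (\<phi> ` S)"
    unfolding connectedin_subtopology using H con by (intro conjI image_subsetI) simp_all
  moreover have "(mat 1, mat 1) \<in> \<phi> ` S" using imageI[OF s0(1), of \<phi>] s0(2) by simp
  moreover have "\<phi> s1 \<in> \<phi> ` S" using s1 by (rule imageI)
  ultimately have "connected_component_of (subtopology zariski H) (mat 1, mat 1) (\<phi> s1)"
    unfolding connected_component_of_def by blast
  then show ?thesis by (simp add: identity_component_def)
qed

subsection \<open>Rationality of the elements of the index set\<close>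

text \<open>A linear projection of the reals onto the rationals, obtained by extending the value at
  1 from an independent set to the whole vector space over the rationals.\<close>

lemma rational_functional:
  obtains \<phi> :: "real \<Rightarrow> rat" where "\<And>a b. \<phi> (a + b) = \<phi> a + \<phi> b"
    "\<And>q r. \<phi> (of_rat q * r) = q * \<phi> r" "\<phi> 1 = 1"
proof -
  interpret vector_space_pair "\<lambda>q r. of_rat q * r :: real" "(*) :: rat \<Rightarrow> rat \<Rightarrow> rat"
    by unfold_locales (auto simp: algebra_simps of_rat_add of_rat_mult)
  have "vs1.independent {1}" by (simp add: vs1.dependent_single)
  from linear_independent_extend[OF this, of "\<lambda>_. 1"]
  obtain g where g: "Vector_Spaces.linear (\<lambda>q r. of_rat q * r :: real) ((*) :: rat \<Rightarrow> rat \<Rightarrow> rat) g" "g 1 = 1" by auto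
  show ?thesis
    by (rule that[of g]) (use g in \<open>auto simp: Vector_Spaces.linear_def module_hom_def module_hom_axioms_def\<close>)
qed

lemma in_hull_inner_ge:
  fixes \<beta> :: "'a::real_inner"
  assumes "\<And>y. y \<in> S \<Longrightarrow> y \<bullet> \<beta> \<ge> r" "x \<in> convex hull S"
  shows "x \<bullet> \<beta> \<ge> r"
proof -
  have "convex {x. \<beta> \<bullet> x \<ge> r}" by (rule convex_halfspace_ge)
  then have "convex hull S \<subseteq> {x. \<beta> \<bullet> x \<ge> r}"
    by (intro hull_minimal) (use assms(1) in \<open>auto simp: inner_commute\<close>)
  then show ?thesis using assms(2) by (auto simp: inner_commute)
qed

text \<open>The supporting half-space at the closest point only has to be tested on the generators.
  Conversely, the Cauchy-Schwarz inequality turns the half-space condition into minimality of the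
  norm.\<close>

lemma closest_point_hull_iff:
  fixes \<beta> :: "'a::euclidean_space"
  assumes "finite S" "S \<noteq> {}"
  shows "\<beta> = closest_point (convex hull S) 0 \<longleftrightarrow> \<beta> \<in> convex hull S \<and> (\<forall>x\<in>S. x \<bullet> \<beta> \<ge> \<beta> \<bullet> \<beta>)"
proof
  have cl: "closed (convex hull S)" "convex (convex hull S)"
    using assms by (auto simp: finite_imp_compact compact_convex_hull compact_imp_closed)
  {
    assume b: "\<beta> = closest_point (convex hull S) 0"
    have "\<beta> \<in> convex hull S" unfolding b using cl assms(2) by (intro closest_point_in_set) auto
    moreover have "x \<bullet> \<beta> \<ge> \<beta> \<bullet> \<beta>" if "x \<in> S" for x
      using closest_point_dot[OF cl(2,1) hull_inc[OF that], of 0] unfolding b[symmetric]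
      by (simp add: algebra_simps inner_commute)
    ultimately show "\<beta> \<in> convex hull S \<and> (\<forall>x\<in>S. x \<bullet> \<beta> \<ge> \<beta> \<bullet> \<beta>)" by blast
  }
  assume b: "\<beta> \<in> convex hull S \<and> (\<forall>x\<in>S. x \<bullet> \<beta> \<ge> \<beta> \<bullet> \<beta>)"
  show "\<beta> = closest_point (convex hull S) 0"
  proof (rule closest_point_unique[OF cl(2,1)])
    show "\<beta> \<in> convex hull S" using b by blast
    show "\<forall>z\<in>convex hull S. dist 0 \<beta> \<le> dist 0 z"
    proof
      fix z assume "z \<in> convex hull S"
      then have "\<beta> \<bullet> \<beta> \<le> z \<bullet> \<beta>" using b in_hull_inner_ge by blast
      also have "\<dots> \<le> norm z * norm \<beta>" by (rule norm_cauchy_schwarz)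
      finally have "norm \<beta> * norm \<beta> \<le> norm z * norm \<beta>"
        by (simp add: power2_norm_eq_inner[symmetric] power2_eq_square)
      then show "dist 0 \<beta> \<le> dist 0 z"
        by (cases "\<beta> = 0") auto
    qed
  qed
qed

text \<open>A rational-linear functional fixing 1 is applied to the convex coefficients. The
  resulting vector \<open>\<beta>'\<close> has the transformed entries of \<beta>. The coefficients
  vanish off the supporting hyperplane, so all inner products among \<beta> and
  \<open>\<beta>'\<close> can be evaluated, and the difference of the two has norm zero. Hence each
  entry of \<beta> equals its rational image.\<close>

lemma closest_point_hull_rational:
  fixes \<beta> :: wt
  assumes fin: "finite S" "S \<noteq> {}" and b: "\<beta> = closest_point (convex hull S) 0"
    and rat: "\<And>x p. x \<in> S \<Longrightarrow> entry x p \<in> \<rat>"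
  shows "entry \<beta> p \<in> \<rat>"
proof -
  obtain \<phi> where \<phi>: "\<And>a b. \<phi> (a + b) = \<phi> a + \<phi> b" "\<And>q r. \<phi> (real_of_rat q * r) = q * \<phi> r" "\<phi> 1 = 1"
    by (rule rational_functional) (rule that)
  define \<psi> :: "real \<Rightarrow> real" where "\<psi> r = of_rat (\<phi> r)" for r
  have \<psi>_add: "\<psi> (a + b) = \<psi> a + \<psi> b" for a b by (simp add: \<psi>_def \<phi>(1) of_rat_add)
  have \<psi>_mult: "\<psi> (q * r) = q * \<psi> r" if "q \<in> \<rat>" for q r
    using that by (auto simp: \<psi>_def \<phi>(2) of_rat_mult elim!: Rats_cases)
  have \<psi>_1: "\<psi> 1 = 1" by (simp add: \<psi>_def \<phi>(3))
  have \<psi>_0: "\<psi> 0 = 0" using \<psi>_mult[of 0 0] by simp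
  have \<psi>_sum: "\<psi> (\<Sum>x\<in>S. f x) = (\<Sum>x\<in>S. \<psi> (f x))" for f
    using fin(1) by induction (simp_all add: \<psi>_0 \<psi>_add)
  have bb: "\<beta> \<in> convex hull S" "\<And>x. x \<in> S \<Longrightarrow> x \<bullet> \<beta> \<ge> \<beta> \<bullet> \<beta>"
    using b closest_point_hull_iff[OF fin] by auto
  then obtain u where u: "\<And>x. x \<in> S \<Longrightarrow> 0 \<le> u x" "sum u S = 1" "(\<Sum>x\<in>S. u x *\<^sub>R x) = \<beta>"
    unfolding convex_hull_finite[OF fin(1)] by blast
  define q where "q = \<beta> \<bullet> \<beta>"
  have "(\<Sum>x\<in>S. u x * (x \<bullet> \<beta> - q)) = (\<Sum>x\<in>S. u x *\<^sub>R x) \<bullet> \<beta> - sum u S * q"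
    by (simp add: inner_sum_left right_diff_distrib sum_subtractf sum_distrib_right)
  then have "(\<Sum>x\<in>S. u x * (x \<bullet> \<beta> - q)) = 0" by (simp add: u q_def)
  moreover have "u x * (x \<bullet> \<beta> - q) \<ge> 0" if "x \<in> S" for x
    using u(1)[OF that] bb(2)[OF that] by (simp add: q_def)
  ultimately have tight: "u x * (x \<bullet> \<beta> - q) = 0" if "x \<in> S" for x
    using that fin(1) by (simp add: sum_nonneg_eq_0_iff)
  then have tight': "u x = 0 \<or> x \<bullet> \<beta> = q" if "x \<in> S" for x using that by simp
  have t1: "\<psi> (u x) * (x \<bullet> \<beta>) = \<psi> (u x) * q" if "x \<in> S" for x
    using tight'[OF that] \<psi>_0 by (elim disjE) simp_all
  define \<beta>' where "\<beta>' = (\<Sum>x\<in>S. \<psi> (u x) *\<^sub>R x)"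
  have ent_sum: "entry (\<Sum>x\<in>S. c x *\<^sub>R x) p = (\<Sum>x\<in>S. c x * entry x p)" for c p
    by (cases p) (simp_all add: entry_def fst_sum snd_sum)
  have ent: "entry \<beta>' p = \<psi> (entry \<beta> p)" for p
  proof -
    have "\<psi> (entry \<beta> p) = (\<Sum>x\<in>S. \<psi> (entry x p * u x))"
      by (simp add: u(3)[symmetric] ent_sum \<psi>_sum mult.commute)
    also have "\<dots> = (\<Sum>x\<in>S. entry x p * \<psi> (u x))"
      using rat by (intro sum.cong refl \<psi>_mult) auto
    finally show ?thesis by (simp add: \<beta>'_def ent_sum mult.commute)
  qed
  have inner_ent: "x \<bullet> y = (\<Sum>p\<in>UNIV. entry x p * entry y p)" for x y :: wt
  proof -
    have "(\<Sum>p\<in>UNIV. entry x p * entry y p) = (\<Sum>p\<in>UNIV <+> UNIV. entry x p * entry y p)" by simp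
    also have "\<dots> = x \<bullet> y"
      by (subst sum.Plus) (simp_all add: entry_def inner_vec_def inner_prod_def)
    finally show ?thesis by simp
  qed
  have x\<beta>': "x \<bullet> \<beta>' = \<psi> (x \<bullet> \<beta>)" if "x \<in> S" for x
  proof -
    have *: "\<psi> (sum f A) = (\<Sum>p\<in>A. \<psi> (f p))" if "finite A" for f and A :: "(6 + 2) set"
      using that by induction (simp_all add: \<psi>_0 \<psi>_add)
    show ?thesis
      using rat[OF that] by (simp add: inner_ent ent * \<psi>_mult)
  qed
  have e1: "\<beta>' \<bullet> y = (\<Sum>x\<in>S. \<psi> (u x) * (x \<bullet> y))" for y
    by (simp add: \<beta>'_def inner_sum_left)
  have s1: "(\<Sum>x\<in>S. \<psi> (u x)) = 1" by (simp add: \<psi>_sum[symmetric] u(2) \<psi>_1)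
  have "\<beta>' \<bullet> \<beta> = (\<Sum>x\<in>S. \<psi> (u x) * q)"
    unfolding e1 by (intro sum.cong refl t1)
  then have a: "\<beta>' \<bullet> \<beta> = q" using s1 by (simp add: sum_distrib_right[symmetric])
  have t2: "\<psi> (u x) * (x \<bullet> \<beta>') = \<psi> (u x) * \<psi> q" "u x * (x \<bullet> \<beta>') = u x * \<psi> q" if "x \<in> S" for x
    using tight'[OF that] x\<beta>'[OF that] \<psi>_0 by (elim disjE; simp)+
  have "\<beta>' \<bullet> \<beta>' = (\<Sum>x\<in>S. \<psi> (u x) * \<psi> q)"
    unfolding e1 by (intro sum.cong refl t2)
  then have b': "\<beta>' \<bullet> \<beta>' = \<psi> q" using s1 by (simp add: sum_distrib_right[symmetric])
  have "\<beta> \<bullet> \<beta>' = (\<Sum>x\<in>S. u x *\<^sub>R x) \<bullet> \<beta>'" by (simp only: u(3))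
  also have "\<dots> = (\<Sum>x\<in>S. u x * (x \<bullet> \<beta>'))"
    by (simp add: inner_sum_left)
  also have "\<dots> = (\<Sum>x\<in>S. u x * \<psi> q)"
    by (intro sum.cong refl t2)
  finally have "\<beta> \<bullet> \<beta>' = \<psi> q" using u(2) by (simp add: sum_distrib_right[symmetric])
  then have "(\<beta> - \<beta>') \<bullet> (\<beta> - \<beta>') = 0"
    using a b' by (simp add: inner_diff_left inner_diff_right q_def)
  then have "\<beta> = \<beta>'" by simp
  then have "entry \<beta> p = \<psi> (entry \<beta> p)" using ent by simp
  then show ?thesis unfolding \<psi>_def by (metis Rats_of_rat)
qed

lemma entry_gam_rat: "entry (gam t) p \<in> \<rat>"
proof -
  obtain i j l where "t = (i, j, l)" by (cases t)
  then show ?thesis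
    by (cases p) (auto simp: entry_def gam_eq axis_def intro!: Rats_diff Rats_add)
qed

definition prim_dir :: "wt \<Rightarrow> real \<Rightarrow> (6 + 2 \<Rightarrow> int) \<Rightarrow> bool" where
  "prim_dir \<beta> c n \<longleftrightarrow> c > 0 \<and> (\<forall>p. of_int (n p) = c * entry \<beta> p) \<and> Gcd (range n) = 1"

text \<open>Two primitive integral vectors on one ray have proportional entries. Taking the gcd of
  the cross-multiplied families shows that corresponding entries agree in absolute value, so the
  positive factors coincide.\<close>

lemma prim_dir_chi_scale:
  assumes "prim_dir \<beta> c n"
  shows "chi_scale \<beta> = c"
  unfolding chi_scale_def
proof (rule the_equality)
  show "0 < c \<and> (\<exists>n. (\<forall>p. of_int (n p) = c * entry \<beta> p) \<and> Gcd (range n) = 1)"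
    using assms by (auto simp: prim_dir_def)
  fix c' assume "0 < c' \<and> (\<exists>n. (\<forall>p. of_int (n p) = c' * entry \<beta> p) \<and> Gcd (range n) = 1)"
  then obtain n' where n': "0 < c'" "\<And>p. of_int (n' p) = c' * entry \<beta> p" "Gcd (range n') = 1" by blast
  have n: "0 < c" "\<And>p. of_int (n p) = c * entry \<beta> p" "Gcd (range n) = 1"
    using assms by (auto simp: prim_dir_def)
  have "\<not> range n \<subseteq> {0}" using n(3) by (metis Gcd_0_iff zero_neq_one)
  then obtain p0 where p0: "n p0 \<noteq> 0" by auto
  have "n' p * n p0 = n p * n' p0" for p
  proof -
    have "real_of_int (n' p * n p0) = of_int (n p * n' p0)" by (simp add: n(2) n'(2))
    then show ?thesis by (simp only: of_int_eq_iff)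
  qed
  then have "(\<lambda>x. n p0 * x) ` range n' = (\<lambda>x. n' p0 * x) ` range n"
    by (auto simp: image_image mult.commute)
  then have "normalize (n p0 * Gcd (range n')) = normalize (n' p0 * Gcd (range n))"
    by (simp only: Gcd_mult[symmetric])
  then have "\<bar>n p0\<bar> = \<bar>n' p0\<bar>" by (simp add: n(3) n'(3))
  then have "\<bar>real_of_int (n p0)\<bar> = \<bar>real_of_int (n' p0)\<bar>" by (simp only: of_int_abs[symmetric])
  then have "c * \<bar>entry \<beta> p0\<bar> = c' * \<bar>entry \<beta> p0\<bar>"
    using n(1) n'(1) by (simp add: n(2) n'(2) abs_mult)
  moreover have "entry \<beta> p0 \<noteq> 0" using p0 n(2)[of p0] by auto
  ultimately show "c' = c" by simp
qed

lemma common_denominator: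
  assumes "finite A" "\<And>p. p \<in> A \<Longrightarrow> f p \<in> \<rat>"
  shows "\<exists>D>0. \<forall>p\<in>A. real_of_int D * f p \<in> \<int>"
  using assms
proof induction
  case (insert a A)
  then obtain D where D: "D > 0" "\<forall>p\<in>A. real_of_int D * f p \<in> \<int>" by auto
  obtain r s :: int where rs: "s > 0" "f a = of_int r / of_int s"
    using insert.prems[of a] by (auto elim!: Rats_cases')
  have "real_of_int (s * D) * f a \<in> \<int>" using rs by simp
  moreover have "real_of_int (s * D) * f p \<in> \<int>" if "p \<in> A" for p
    using D(2) that by (auto simp: mult.assoc)
  ultimately show ?case using D(1) rs(1) by (intro exI[of _ "s * D"]) auto
qed (auto intro: exI[of _ 1])

text \<open>Rational entries have a common denominator; the integral vector is then divided by its
  gcd, which is positive because \<beta> is nonzero.\<close>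

lemma BB_prim_dir:
  assumes "\<beta> \<in> BB"
  obtains c n where "prim_dir \<beta> c n"
proof -
  obtain I where I: "I \<subseteq> idx" "I \<noteq> {}" "\<beta> = closest_point (convex hull (gam ` I)) 0" and b0: "\<beta> \<noteq> 0"
    using assms by (auto simp: BB_def)
  have "entry \<beta> p \<in> \<rat>" for p
    by (rule closest_point_hull_rational[OF _ _ I(3)]) (use I(2) entry_gam_rat in auto)
  then obtain D where D: "D > 0" "\<And>p. real_of_int D * entry \<beta> p \<in> \<int>"
    using common_denominator[of UNIV "entry \<beta>"] by auto
  define m where "m p = \<lfloor>real_of_int D * entry \<beta> p\<rfloor>" for p
  have m: "real_of_int (m p) = D * entry \<beta> p" for p using D(2)[of p] by (simp add: m_def)
  define g where "g = Gcd (range m)"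
  have "g \<noteq> 0"
  proof
    assume "g = 0"
    then have "m p = 0" for p unfolding g_def Gcd_0_iff by auto
    then have "entry \<beta> p = 0" for p using m[of p] D(1) by simp
    from this[of "Inl _"] this[of "Inr _"] have "\<beta> = 0"
      by (simp add: entry_def prod_eq_iff vec_eq_iff)
    then show False using b0 by simp
  qed
  moreover have "g \<ge> 0" by (simp add: g_def)
  ultimately have g: "g > 0" by simp
  have dv: "g * (m p div g) = m p" for p by (simp add: g_def)
  have "prim_dir \<beta> (of_int D / of_int g) (\<lambda>p. m p div g)"
    unfolding prim_dir_def
  proof (intro conjI allI)
    show "0 < real_of_int D / real_of_int g" using D(1) g by simp
    show "real_of_int (m p div g) = of_int D / of_int g * entry \<beta> p" for p
    proof -
      have "real_of_int g * real_of_int (m p div g) = D * entry \<beta> p"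
        unfolding of_int_mult[symmetric] dv m ..
      then show ?thesis using g by (simp add: field_simps)
    qed
    have "range m = (*) g ` range (\<lambda>p. m p div g)" by (simp add: image_image dv)
    then have "g = normalize (g * Gcd (range (\<lambda>p. m p div g)))"
      unfolding Gcd_mult[symmetric] g_def by simp
    then show "Gcd (range (\<lambda>p. m p div g)) = 1" using g by (simp add: abs_mult)
  qed
  then show ?thesis using that by blast
qed

subsection \<open>Elements of the stabilising groups\<close>

lemma block_det_lower:
  fixes A :: "'a::comm_ring_1^'n::{finite,wellorder}^'n::{finite,wellorder}"
  assumes "\<And>i j. i < j \<Longrightarrow> A $ i $ j = 0"
  shows "block_det A B = (\<Prod>i\<in>B. A $ i $ i)"
proof -
  have "block_det A B = (\<Prod>i\<in>UNIV. if i \<in> B then A $ i $ i else 1)"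
    unfolding block_det_def by (subst det_lowerdiagonal) (auto simp: assms intro: prod.cong)
  also have "\<dots> = (\<Prod>i\<in>B. A $ i $ i)"
    by (simp add: prod.If_cases)
  finally show ?thesis .
qed

lemma power_int_prod: "(\<Prod>i\<in>A. f i) powi n = (\<Prod>i\<in>A. f i powi n)" for f :: "'b \<Rightarrow> 'a::field"
  by (induction A rule: infinite_finite_induct) (auto simp: power_int_mult_distrib)

lemma prod_power_int: "(\<Prod>i\<in>A. x powi f i) = x powi (\<Sum>i\<in>A. f i)" if "x \<noteq> (0::'a::field)"
  using that by (induction A rule: infinite_finite_induct) (auto simp: power_int_add)

text \<open>For lower triangular matrices each block determinant is a product of diagonal entries,
  so the character can be evaluated without knowing which entries of \<beta> coincide.\<close>

lemma chi_lower:
  fixes g :: "'a::field grp"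
  assumes "\<And>i j. i < j \<Longrightarrow> fst g $ i $ j = 0" "\<And>i j. i < j \<Longrightarrow> snd g $ i $ j = 0"
  shows "chi \<beta> g = (\<Prod>i\<in>UNIV. (fst g $ i $ i) powi \<lfloor>chi_scale \<beta> * fst \<beta> $ i\<rfloor>) *
    (\<Prod>i\<in>UNIV. (snd g $ i $ i) powi \<lfloor>chi_scale \<beta> * snd \<beta> $ i\<rfloor>)"
proof -
  have *: "(\<Prod>b\<in>range f. block_det A {i. f i = b} powi \<lfloor>c * b\<rfloor>) = (\<Prod>i\<in>UNIV. (A $ i $ i) powi \<lfloor>c * f i\<rfloor>)"
    if "\<And>i j. i < j \<Longrightarrow> A $ i $ j = 0"
    for A :: "'a^'n::{finite,wellorder}^'n::{finite,wellorder}" and f :: "'n::{finite,wellorder} \<Rightarrow> real" and c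
  proof -
    have "(\<Prod>i\<in>UNIV. (A $ i $ i) powi \<lfloor>c * f i\<rfloor>)
      = (\<Prod>b\<in>range f. \<Prod>i\<in>{i. i \<in> UNIV \<and> f i = b}. (A $ i $ i) powi \<lfloor>c * f i\<rfloor>)"
      by (rule prod.image_gen) simp
    also have "\<dots> = (\<Prod>b\<in>range f. block_det A {i. f i = b} powi \<lfloor>c * b\<rfloor>)"
      by (intro prod.cong refl) (simp add: block_det_lower[OF that] power_int_prod)
    finally show ?thesis by simp
  qed
  show ?thesis
    unfolding chi_def by (simp only: *[OF assms(1)] *[OF assms(2)])
qed

lemma coordG_Inl [simp]: "coordG g (Inl (i, j)) = fst g $ i $ j"
  and coordG_Inr [simp]: "coordG g (Inr (a, b)) = snd g $ a $ b"
  by (simp_all add: coordG_def)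

lemma ratfun_coordG:
  assumes "\<And>i j. ratfun S (\<lambda>s. fst (\<phi> s) $ i $ j)" "\<And>i j. ratfun S (\<lambda>s. snd (\<phi> s) $ i $ j)"
  shows "ratfun S (\<lambda>s. coordG (\<phi> s) v)"
  using assms by (cases v) auto

lemma infinite_UNIV_alg_closed: "infinite (UNIV :: 'a::alg_closed_field set)"
proof
  assume fin: "finite (UNIV :: 'a set)"
  define p :: "'a poly" where "p = (\<Prod>a\<in>UNIV. [:- a, 1:]) + 1"
  have val: "poly p x = 1" for x
  proof -
    have "(\<Prod>a\<in>UNIV. poly [:- a, 1:] x) = 0"
      using fin by (subst prod_zero_iff) auto
    then show ?thesis by (simp add: p_def poly_prod)
  qed
  have "Polynomial.degree (\<Prod>a\<in>(UNIV::'a set). [:- a, 1:]) = card (UNIV :: 'a set)"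
    by (subst degree_prod_eq_sum_degree) auto
  then have "Polynomial.degree (\<Prod>a\<in>(UNIV::'a set). [:- a, 1:]) > 0"
    using fin by (simp add: card_gt_0_iff)
  then have "Polynomial.degree p > 0" unfolding p_def
    by (subst degree_add_eq_left) auto
  then obtain x where "poly p x = 0" using alg_closed_imp_poly_has_root by blast
  then show False using val by simp
qed

lemma infinite_alg_closed_nonzero: "infinite (UNIV - {0 :: 'a::alg_closed_field})"
  using infinite_UNIV_alg_closed by simp

text \<open>Scaling the entries off the diagonal by \<open>s\<close> gives a line from the identity
  at 0 to \<open>u\<close> at 1. All its points are lower unitriangular, so determinants and
  character stay equal to one.\<close>

lemma lower_uni_G_st_beta:
  fixes u :: "'a::alg_closed_field grp"
  assumes u: "lower_uni (fst u)" "lower_uni (snd u)"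
    and b: "\<And>i j. fst \<beta> $ i \<noteq> fst \<beta> $ j \<Longrightarrow> fst u $ i $ j = 0"
      "\<And>i j. snd \<beta> $ i \<noteq> snd \<beta> $ j \<Longrightarrow> snd u $ i $ j = 0"
  shows "u \<in> G_st_beta \<beta>"
proof -
  define \<phi> :: "'a \<Rightarrow> 'a grp" where
    "\<phi> s = (\<chi> i j. if i = j then 1 else s * fst u $ i $ j, \<chi> i j. if i = j then 1 else s * snd u $ i $ j)" for s
  have lu: "lower_uni (fst (\<phi> s))" "lower_uni (snd (\<phi> s))" for s
    using u by (auto simp: lower_uni_def \<phi>_def)
  have "\<phi> 1 \<in> G_st_beta \<beta>"
    unfolding G_st_beta_def
  proof (rule zariski_curve_identity_component[of UNIV \<phi> _ 0])
    show "ratfun UNIV (\<lambda>s. coordG (\<phi> s) v)" for v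
    proof (rule ratfun_coordG)
      show "ratfun UNIV (\<lambda>s. fst (\<phi> s) $ i $ j)" for i j
        by (cases "i = j") (simp_all add: \<phi>_def ratfun_const ratfun_mult ratfun_id)
      show "ratfun UNIV (\<lambda>s. snd (\<phi> s) $ i $ j)" for i j
        by (cases "i = j") (simp_all add: \<phi>_def ratfun_const ratfun_mult ratfun_id)
    qed
    fix s
    have "\<phi> s \<in> G_st" "\<phi> s \<in> G"
      by (simp_all add: G_st_def G_def invertible_det_nz det_lower_uni lu)
    moreover have "\<phi> s \<in> M \<beta>"
      using \<open>\<phi> s \<in> G\<close> b by (auto simp: M_def \<phi>_def)
    moreover have "chi \<beta> (\<phi> s) = 1"
      using lu[of s] by (subst chi_lower) (auto simp: lower_uni_def)
    ultimately show "\<phi> s \<in> {g \<in> M \<beta> \<inter> G_st. chi \<beta> g = 1}" by simp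
  next
    show "\<phi> 0 = (mat 1, mat 1)" by (simp add: \<phi>_def mat_def vec_eq_iff)
  qed (simp_all add: infinite_UNIV_alg_closed)
  moreover have "\<phi> 1 = u"
    using u by (cases u) (auto simp: \<phi>_def lower_uni_def vec_eq_iff)
  ultimately show ?thesis by simp
qed

definition torus :: "(6 \<Rightarrow> int) \<Rightarrow> (2 \<Rightarrow> int) \<Rightarrow> 'a::field \<Rightarrow> 'a grp" where
  "torus a b t = (\<chi> i j. if i = j then t powi a i else 0, \<chi> i j. if i = j then t powi b i else 0)"

lemma act_torus:
  assumes "t \<noteq> 0"
  shows "act (torus a b t) x $ l $ i $ j = t powi (a i + a j + b l) * x $ l $ i $ j"
proof -
  have "act (torus a b t) x $ l $ i $ j = (\<Sum>m\<in>UNIV. \<Sum>q\<in>UNIV. \<Sum>p\<in>UNIV.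
      if p = i then if q = j then if m = l then t powi b l * t powi a i * t powi a j * x $ l $ i $ j else 0 else 0 else 0)"
    unfolding act_component by (intro sum.cong refl) (auto simp: torus_def)
  also have "\<dots> = t powi b l * t powi a i * t powi a j * x $ l $ i $ j" by simp
  finally show ?thesis using assms by (simp add: power_int_add mult_ac)
qed

lemma ratfun_power_int: "0 \<notin> S \<Longrightarrow> ratfun S (\<lambda>s. s powi n)"
  by (cases "n \<ge> 0")
     (auto simp: power_int_def power_inverse[symmetric] intro!: ratfun_power ratfun_id ratfun_inverse)

text \<open>The first two sums make the determinants one, and the third, orthogonality to \<beta>,
  makes the character one. The connecting curve is the subgroup itself over the punctured line, with
  the identity at parameter 1.\<close>

lemma torus_G_st_beta:
  fixes t :: "'a::alg_closed_field"
  assumes "prim_dir \<beta> c n" "t \<noteq> 0" and s: "(\<Sum>i\<in>UNIV. a i) = 0" "(\<Sum>i\<in>UNIV. b i) = 0"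
    "(\<Sum>i\<in>UNIV. a i * n (Inl i)) + (\<Sum>i\<in>UNIV. b i * n (Inr i)) = 0"
  shows "torus a b t \<in> G_st_beta \<beta>"
  unfolding G_st_beta_def
proof (rule zariski_curve_identity_component[of "UNIV - {0}" "torus a b" _ 1])
  show "ratfun (UNIV - {0}) (\<lambda>s. coordG (torus a b s) v)" for v
  proof (rule ratfun_coordG)
    show "ratfun (UNIV - {0}) (\<lambda>s. fst (torus a b s) $ i $ j)" for i j
      by (cases "i = j") (simp_all add: torus_def ratfun_const ratfun_power_int)
    show "ratfun (UNIV - {0}) (\<lambda>s. snd (torus a b s) $ i $ j)" for i j
      by (cases "i = j") (simp_all add: torus_def ratfun_const ratfun_power_int)
  qed
  have fl: "\<lfloor>chi_scale \<beta> * fst \<beta> $ i\<rfloor> = n (Inl i)" "\<lfloor>chi_scale \<beta> * snd \<beta> $ l\<rfloor> = n (Inr l)" for i l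
  proof -
    have "chi_scale \<beta> = c" by (rule prim_dir_chi_scale[OF assms(1)])
    then have "chi_scale \<beta> * fst \<beta> $ i = n (Inl i)" "chi_scale \<beta> * snd \<beta> $ l = n (Inr l)"
      using assms(1) unfolding prim_dir_def by (auto simp: entry_def)
    then show "\<lfloor>chi_scale \<beta> * fst \<beta> $ i\<rfloor> = n (Inl i)" "\<lfloor>chi_scale \<beta> * snd \<beta> $ l\<rfloor> = n (Inr l)" by simp_all
  qed
  fix s :: 'a assume "s \<in> UNIV - {0}"
  then have s0: "s \<noteq> 0" by simp
  have d: "det (fst (torus a b s)) = 1" "det (snd (torus a b s)) = 1"
    by (subst det_diagonal; simp add: torus_def prod_power_int s0 s)+
  then have G: "torus a b s \<in> G_st" "torus a b s \<in> G"
    by (simp_all add: G_st_def G_def invertible_det_nz)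
  moreover have "torus a b s \<in> M \<beta>"
    using G by (auto simp: M_def torus_def)
  moreover have "chi \<beta> (torus a b s) = 1"
  proof (subst chi_lower)
    show "(\<Prod>i\<in>UNIV. (fst (torus a b s) $ i $ i) powi \<lfloor>chi_scale \<beta> * fst \<beta> $ i\<rfloor>) *
      (\<Prod>i\<in>UNIV. (snd (torus a b s) $ i $ i) powi \<lfloor>chi_scale \<beta> * snd \<beta> $ i\<rfloor>) = 1"
      by (simp add: fl torus_def power_int_mult[symmetric] prod_power_int s0 power_int_add[symmetric] s(3))
  qed (auto simp: torus_def)
  ultimately show "torus a b s \<in> {g \<in> M \<beta> \<inter> G_st. chi \<beta> g = 1}" by simp
next
  show "torus a b 1 = (mat 1, mat 1)" by (simp add: torus_def mat_def vec_eq_iff)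
qed (use assms infinite_alg_closed_nonzero in auto)

subsection \<open>Stability of the semistable sets\<close>

lemma V_sym_nonzero: "x \<in> V \<Longrightarrow> x $ l $ j $ i \<noteq> 0 \<Longrightarrow> x $ l $ i $ j \<noteq> 0"
  unfolding V_iff alt_def by (metis neg_equal_0_iff_equal)

lemma V_diag: "x \<in> V \<Longrightarrow> x $ l $ i $ i = 0"
  by (simp add: V_iff alt_def)

lemma V_skew: "x \<in> V \<Longrightarrow> x $ l $ i $ j = - x $ l $ j $ i"
  unfolding V_iff alt_def by blast

lemma V_diff:
  assumes "x \<in> V" "y \<in> V" shows "x - y \<in> V"
proof -
  have "(x - y) $ l $ i $ j = - (x - y) $ l $ j $ i" for l i j
    using V_skew[OF assms(1), of l i j] V_skew[OF assms(2), of l i j] by simp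
  moreover have "(x - y) $ l $ i $ i = 0" for l i
    using V_diag[OF assms(1)] V_diag[OF assms(2)] by simp
  ultimately show ?thesis unfolding V_iff alt_def by blast
qed

lemma V_add:
  assumes "x \<in> V" "y \<in> V" shows "x + y \<in> V"
proof -
  have "(x + y) $ l $ i $ j = - (x + y) $ l $ j $ i" for l i j
    using V_skew[OF assms(1), of l i j] V_skew[OF assms(2), of l i j] by simp
  moreover have "(x + y) $ l $ i $ i = 0" for l i
    using V_diag[OF assms(1)] V_diag[OF assms(2)] by simp
  ultimately show ?thesis unfolding V_iff alt_def by blast
qed

lemma wgt_sym: "wgt \<beta> (i, j, l) = wgt \<beta> (j, i, l)"
  by (simp add: wgt_def)

text \<open>Weights are symmetric in \<open>i\<close> and \<open>j\<close>, so membership can be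
  expressed through all entries of the matrices. Later computations then need no ordering of the two
  indices.\<close>

lemma spanV_wgt_iff:
  assumes I: "I = {t \<in> idx. P (wgt \<beta> t)}"
  shows "x \<in> spanV I \<longleftrightarrow> x \<in> V \<and> (\<forall>l i j. x $ l $ i $ j \<noteq> 0 \<longrightarrow> P (wgt \<beta> (i, j, l)))"
proof -
  have "I \<subseteq> idx" using I by auto
  then have "x \<in> spanV I \<longleftrightarrow> x \<in> V \<and> (\<forall>t\<in>idx - I. coordV x t = 0)" by (rule spanV_iff)
  also have "\<dots> \<longleftrightarrow> x \<in> V \<and> (\<forall>l i j. x $ l $ i $ j \<noteq> 0 \<longrightarrow> P (wgt \<beta> (i, j, l)))"
  proof (intro conj_cong refl iffI allI impI ballI)
    fix l i j assume x: "x \<in> V" and *: "\<forall>t\<in>idx - I. coordV x t = 0" and n: "x $ l $ i $ j \<noteq> 0"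
    have key: "P (wgt \<beta> (i, j, l))" if "i < j" "x $ l $ i $ j \<noteq> 0" for i j
    proof (rule ccontr)
      assume "\<not> P (wgt \<beta> (i, j, l))"
      then have "(i, j, l) \<in> idx - I" using that I by simp
      then show False using * that by (force simp: coordV_def)
    qed
    show "P (wgt \<beta> (i, j, l))"
    proof (cases i j rule: linorder_cases)
      case less then show ?thesis using key n by blast
    next
      case equal then show ?thesis using V_diag[OF x] n by simp
    next
      case greater
      then show ?thesis using key[OF greater V_sym_nonzero[OF x n]] wgt_sym[of \<beta> i j l] by simp
    qed
  next
    fix t assume "\<forall>l i j. x $ l $ i $ j \<noteq> 0 \<longrightarrow> P (wgt \<beta> (i, j, l))" "t \<in> idx - I"
    then show "coordV x t = 0" using I by (cases t) (auto simp: coordV_def)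
  qed
  finally show ?thesis .
qed

lemma Z_iff:
  assumes "\<beta> \<in> t_star"
  shows "x \<in> Z \<beta> \<longleftrightarrow> x \<in> V \<and> (\<forall>l i j. x $ l $ i $ j \<noteq> 0 \<longrightarrow> wgt \<beta> (i, j, l) = \<beta> \<bullet> \<beta>)"
  unfolding Z_def by (rule spanV_wgt_iff) (use assms in \<open>auto simp: Z_idx_iff\<close>)

lemma W_iff:
  assumes "\<beta> \<in> t_star"
  shows "x \<in> W \<beta> \<longleftrightarrow> x \<in> V \<and> (\<forall>l i j. x $ l $ i $ j \<noteq> 0 \<longrightarrow> wgt \<beta> (i, j, l) > \<beta> \<bullet> \<beta>)"
  unfolding W_def by (rule spanV_wgt_iff) (use assms in \<open>auto simp: W_idx_iff\<close>)

lemma sum3_nonzero: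
  fixes f :: "2 \<Rightarrow> 6 \<Rightarrow> 6 \<Rightarrow> 'a::comm_ring_1"
  assumes "(\<Sum>m\<in>UNIV. \<Sum>q\<in>UNIV. \<Sum>p\<in>UNIV. f m q p) \<noteq> 0"
  obtains m q p where "f m q p \<noteq> 0"
  using assms by (meson sum.neutral)

lemma act_component_nonzero:
  assumes "act g x $ l $ i $ j \<noteq> 0"
  obtains m p q where "snd g $ l $ m \<noteq> 0" "fst g $ i $ p \<noteq> 0" "fst g $ j $ q \<noteq> 0" "x $ m $ p $ q \<noteq> 0"
  using sum3_nonzero[OF assms[unfolded act_component]] by (metis mult_zero_left mult_zero_right)

lemma act_M_Z:
  assumes "\<beta> \<in> t_star" "g \<in> M \<beta>" "z \<in> Z \<beta>"
  shows "act g z \<in> Z \<beta>"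
  unfolding Z_iff[OF assms(1)]
proof (intro conjI allI impI)
  have z: "z \<in> V" "\<And>l i j. z $ l $ i $ j \<noteq> 0 \<Longrightarrow> wgt \<beta> (i, j, l) = \<beta> \<bullet> \<beta>"
    using assms(3) by (auto simp: Z_iff[OF assms(1)])
  show "act g z \<in> V" using z by (simp add: act_V)
  fix l i j assume "act g z $ l $ i $ j \<noteq> 0"
  then obtain m p q where n: "snd g $ l $ m \<noteq> 0" "fst g $ i $ p \<noteq> 0" "fst g $ j $ q \<noteq> 0" "z $ m $ p $ q \<noteq> 0"
    by (rule act_component_nonzero)
  then have "snd \<beta> $ l = snd \<beta> $ m" "fst \<beta> $ i = fst \<beta> $ p" "fst \<beta> $ j = fst \<beta> $ q"
    using assms(2) unfolding M_def by blast+
  then show "wgt \<beta> (i, j, l) = \<beta> \<bullet> \<beta>" using z(2)[OF n(4)] by (simp add: wgt_def)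
qed

lemma G_st_beta_sub: "G_st_beta \<beta> \<subseteq> {g \<in> M \<beta> \<inter> G_st. chi \<beta> g = 1}"
  unfolding G_st_beta_def identity_component_def
  using connected_component_of_subset_topspace[of "subtopology zariski {g \<in> M \<beta> \<inter> G_st. chi \<beta> g = 1}" "(mat 1, mat 1)"]
  by auto

lemma act_Z_ss:
  assumes "\<beta> \<in> t_star" "g \<in> G_st_beta \<beta>" "z \<in> Z_ss \<beta>"
  shows "act g z \<in> Z_ss \<beta>"
proof -
  obtain d p where z: "z \<in> Z \<beta>" and p: "d > 0" "mpol_homogeneous d p" "mpol_vars p \<subseteq> Z_idx \<beta>"
    "\<forall>g\<in>G_st_beta \<beta>. \<forall>y\<in>Z \<beta>. mpol_eval p (coordV (act g y)) = mpol_eval p (coordV y)"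
    "mpol_eval p (coordV z) \<noteq> 0"
    using assms(3) unfolding Z_ss_def by blast
  have "act g z \<in> Z \<beta>"
    using act_M_Z[OF assms(1) _ z] assms(2) G_st_beta_sub by blast
  moreover have "mpol_eval p (coordV (act g z)) \<noteq> 0" using p(4,5) assms(2) z by auto
  ultimately show ?thesis unfolding Z_ss_def using p by blast
qed

text \<open>Invariance is asked for on the whole kernel of the character. This contains its identity
  component, which therefore need not be determined.\<close>

lemma Z_ssI:
  assumes "z \<in> Z \<beta>" "hompoly (Z_idx \<beta>) d f" "d > 0" "f (coordV z) \<noteq> 0"
    "\<And>g y. g \<in> M \<beta> \<Longrightarrow> g \<in> G_st \<Longrightarrow> chi \<beta> g = 1 \<Longrightarrow> y \<in> Z \<beta> \<Longrightarrow> f (coordV (act g y)) = f (coordV y)"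
  shows "z \<in> Z_ss \<beta>"
proof -
  obtain p where p: "mpol_homogeneous d p" "mpol_vars p \<subseteq> Z_idx \<beta>" "\<And>x. mpol_eval p x = f x"
    using hompoly_mpol[OF assms(2)] by blast
  have "\<forall>g\<in>G_st_beta \<beta>. \<forall>y\<in>Z \<beta>. mpol_eval p (coordV (act g y)) = mpol_eval p (coordV y)"
    using G_st_beta_sub assms(5) by (fastforce simp: p(3))
  then show ?thesis
    unfolding Z_ss_def by (intro CollectI conjI exI[of _ d] exI[of _ p]) (use assms(1,3,4) p in simp_all)
qed

text \<open>Let \<open>v\<close> be the block diagonal part of \<open>u\<close>. It lies in
  \<open>G_st_beta\<close> and preserves \<open>Z_ss\<close>. The remaining entries of
  \<open>u\<close> strictly raise the weight, because \<beta> has increasing entries, so their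
  contribution falls into \<open>W\<close>.\<close>

lemma act_lower_Y_ss:
  fixes u :: "'a::alg_closed_field grp"
  assumes b: "\<beta> \<in> t_star_plus" and u: "lower_uni (fst u)" "lower_uni (snd u)" and y: "y \<in> Y_ss \<beta>"
  shows "act u y \<in> Y_ss \<beta>"
proof -
  have bt: "\<beta> \<in> t_star" using b by (rule t_star_plus_t_star)
  obtain z w where y: "y = z + w" and z: "z \<in> Z_ss \<beta>" and w: "w \<in> W \<beta>"
    using y unfolding Y_ss_def by blast
  have z': "z \<in> Z \<beta>" using z by (simp add: Z_ss_def)
  define v :: "'a grp" where "v = (\<chi> i j. if fst \<beta> $ i = fst \<beta> $ j then fst u $ i $ j else 0,
     \<chi> i j. if snd \<beta> $ i = snd \<beta> $ j then snd u $ i $ j else 0)"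
  have v: "v \<in> G_st_beta \<beta>"
    by (rule lower_uni_G_st_beta) (use u in \<open>auto simp: v_def lower_uni_def\<close>)
  have m1: "fst \<beta> $ p \<le> fst \<beta> $ i" if "fst u $ i $ p \<noteq> 0" for i p
  proof -
    have "p \<le> i" using that u(1) unfolding lower_uni_def by (metis not_le)
    then show ?thesis using b by (simp add: t_star_plus_def)
  qed
  have m2: "snd \<beta> $ p \<le> snd \<beta> $ i" if "snd u $ i $ p \<noteq> 0" for i p
  proof -
    have "p \<le> i" using that u(2) unfolding lower_uni_def by (metis not_le)
    then show ?thesis using b by (simp add: t_star_plus_def)
  qed
  have 1: "act u w \<in> W \<beta>"
    unfolding W_iff[OF bt]
  proof (intro conjI allI impI)
    show "act u w \<in> V" using w by (simp add: W_iff[OF bt] act_V)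
    fix l i j assume "act u w $ l $ i $ j \<noteq> 0"
    then obtain m p q where n: "snd u $ l $ m \<noteq> 0" "fst u $ i $ p \<noteq> 0" "fst u $ j $ q \<noteq> 0" "w $ m $ p $ q \<noteq> 0"
      by (rule act_component_nonzero)
    have "\<beta> \<bullet> \<beta> < wgt \<beta> (p, q, m)" using w n(4) by (simp add: W_iff[OF bt])
    also have "\<dots> \<le> wgt \<beta> (i, j, l)" unfolding wgt_def using m2[OF n(1)] m1[OF n(2)] m1[OF n(3)] by simp
    finally show "wgt \<beta> (i, j, l) > \<beta> \<bullet> \<beta>" .
  qed
  have 2: "act u z - act v z \<in> W \<beta>"
    unfolding W_iff[OF bt]
  proof (intro conjI allI impI)
    have "act u z \<in> V" "act v z \<in> V" using z' by (simp_all add: Z_iff[OF bt] act_V)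
    then show "act u z - act v z \<in> V" by (rule V_diff)
    fix l i j assume "(act u z - act v z) $ l $ i $ j \<noteq> 0"
    then have "(\<Sum>m\<in>UNIV. \<Sum>q\<in>UNIV. \<Sum>p\<in>UNIV. (snd u $ l $ m * fst u $ i $ p * fst u $ j $ q
       - snd v $ l $ m * fst v $ i $ p * fst v $ j $ q) * z $ m $ p $ q) \<noteq> 0"
      by (simp add: act_component left_diff_distrib sum_subtractf)
    then obtain m q p where n: "(snd u $ l $ m * fst u $ i $ p * fst u $ j $ q
       - snd v $ l $ m * fst v $ i $ p * fst v $ j $ q) * z $ m $ p $ q \<noteq> 0"
      by (rule sum3_nonzero)
    then have zn: "z $ m $ p $ q \<noteq> 0" by auto
    have un: "snd u $ l $ m \<noteq> 0" "fst u $ i $ p \<noteq> 0" "fst u $ j $ q \<noteq> 0"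
      using n by (auto simp: v_def split: if_splits)
    have "\<not> (snd \<beta> $ l = snd \<beta> $ m \<and> fst \<beta> $ i = fst \<beta> $ p \<and> fst \<beta> $ j = fst \<beta> $ q)"
      using n by (auto simp: v_def)
    then have "wgt \<beta> (p, q, m) < wgt \<beta> (i, j, l)"
      unfolding wgt_def using m2[OF un(1)] m1[OF un(2)] m1[OF un(3)] by auto
    then show "wgt \<beta> (i, j, l) > \<beta> \<bullet> \<beta>" using zn z' by (simp add: Z_iff[OF bt])
  qed
  have W_add: "a + c \<in> W \<beta>" if "a \<in> W \<beta>" "c \<in> W \<beta>" for a c :: "'a rep"
    unfolding W_iff[OF bt]
  proof (intro conjI allI impI)
    show "a + c \<in> V" using that unfolding W_iff[OF bt] by (intro V_add) simp_all
    fix l i j assume "(a + c) $ l $ i $ j \<noteq> 0"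
    then have "a $ l $ i $ j \<noteq> 0 \<or> c $ l $ i $ j \<noteq> 0" by auto
    then show "wgt \<beta> (i, j, l) > \<beta> \<bullet> \<beta>" using that unfolding W_iff[OF bt] by blast
  qed
  have "act u y = act v z + ((act u z - act v z) + act u w)"
    by (simp add: y act_add)
  moreover have "act v z \<in> Z_ss \<beta>" by (rule act_Z_ss[OF bt v z])
  ultimately show ?thesis unfolding Y_ss_def using W_add[OF 2 1] by blast
qed

subsection \<open>The weights of a semistable point\<close>

definition supp :: "'a::zero rep \<Rightarrow> (6 \<times> 6 \<times> 2) set" where
  "supp x = {t \<in> idx. coordV x t \<noteq> 0}"

lemma wt_abs_inner_le:
  assumes "\<And>i. \<bar>fst x $ i\<bar> \<le> 1" "\<And>i. \<bar>snd x $ i\<bar> \<le> 1"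
  shows "\<bar>x \<bullet> y\<bar> \<le> (\<Sum>i\<in>UNIV. \<bar>fst y $ i\<bar>) + (\<Sum>i\<in>UNIV. \<bar>snd (y::wt) $ i\<bar>)"
proof -
  have "\<bar>a \<bullet> b\<bar> \<le> (\<Sum>i\<in>UNIV. \<bar>b $ i\<bar>)" if "\<And>i. \<bar>a $ i\<bar> \<le> 1" for a b :: "real^'n"
  proof -
    have "\<bar>a \<bullet> b\<bar> \<le> (\<Sum>i\<in>UNIV. \<bar>a $ i * b $ i\<bar>)" unfolding inner_vec_def by simp
    also have "\<dots> \<le> (\<Sum>i\<in>UNIV. \<bar>b $ i\<bar>)"
      by (rule sum_mono) (use that in \<open>simp add: abs_mult mult_left_le_one_le\<close>)
    finally show ?thesis .
  qed
  then have "\<bar>fst x \<bullet> fst y\<bar> \<le> (\<Sum>i\<in>UNIV. \<bar>fst y $ i\<bar>)" "\<bar>snd x \<bullet> snd y\<bar> \<le> (\<Sum>i\<in>UNIV. \<bar>snd y $ i\<bar>)"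
    using assms by auto
  then show ?thesis by (simp add: inner_prod_def)
qed

text \<open>A real separating functional is multiplied by a large constant and rounded down. The
  rounding error is bounded by the sum of absolute values of \<open>x - \<beta>\<close>, which the
  scaled margin exceeds on the finite set.\<close>

lemma integral_separation:
  assumes "finite F" "(\<beta>::wt) \<notin> convex hull F"
  obtains a :: "6 \<Rightarrow> int" and b :: "2 \<Rightarrow> int" where
    "\<And>x. x \<in> F \<Longrightarrow> (\<chi> i. of_int (a i), \<chi> i. of_int (b i)) \<bullet> (x - \<beta>) > 0"
proof -
  have "closed (convex hull F)"
    using assms(1) by (simp add: finite_imp_compact compact_convex_hull compact_imp_closed)
  then obtain v r where v: "v \<bullet> \<beta> < r" "\<forall>x\<in>convex hull F. v \<bullet> x > r"
    using separating_hyperplane_closed_point[of "convex hull F" \<beta>] assms(2) by auto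
  define B where "B y = (\<Sum>i\<in>UNIV. \<bar>fst y $ i\<bar>) + (\<Sum>i\<in>UNIV. \<bar>snd y $ i\<bar>)" for y :: wt
  have pos: "v \<bullet> (x - \<beta>) > 0" if "x \<in> F" for x
    using v(1) v(2)[rule_format, OF hull_inc[OF that]] by (simp add: inner_diff_right)
  have "\<exists>K. \<forall>x\<in>F. K * (v \<bullet> (x - \<beta>)) > B (x - \<beta>)"
  proof (intro exI ballI)
    let ?K = "1 + (\<Sum>x\<in>F. B (x - \<beta>) / (v \<bullet> (x - \<beta>)))"
    fix x assume x: "x \<in> F"
    have B0: "B y \<ge> 0" for y by (simp add: B_def sum_nonneg)
    have "B (x - \<beta>) / (v \<bullet> (x - \<beta>)) \<le> (\<Sum>x\<in>F. B (x - \<beta>) / (v \<bullet> (x - \<beta>)))"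
    proof (rule member_le_sum[OF x])
      fix t assume "t \<in> F - {x}"
      then show "0 \<le> B (t - \<beta>) / (v \<bullet> (t - \<beta>))" using B0 pos[of t] by (simp add: less_imp_le)
    qed (rule assms(1))
    then have "B (x - \<beta>) / (v \<bullet> (x - \<beta>)) < ?K" by simp
    then show "B (x - \<beta>) < ?K * (v \<bullet> (x - \<beta>))"
      using pos[OF x] by (simp add: pos_divide_less_eq)
  qed
  then obtain K where K: "\<And>x. x \<in> F \<Longrightarrow> K * (v \<bullet> (x - \<beta>)) > B (x - \<beta>)" by blast
  define a where "a i = \<lfloor>K * fst v $ i\<rfloor>" for i
  define b where "b i = \<lfloor>K * snd v $ i\<rfloor>" for i
  have "(\<chi> i. of_int (a i), \<chi> i. of_int (b i)) \<bullet> (x - \<beta>) > 0" if x: "x \<in> F" for x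
  proof -
    let ?d = "K *\<^sub>R v - (\<chi> i. of_int (a i), \<chi> i. of_int (b i))"
    have "\<bar>?d \<bullet> (x - \<beta>)\<bar> \<le> B (x - \<beta>)"
      unfolding B_def
    proof (rule wt_abs_inner_le)
      show "\<bar>fst ?d $ i\<bar> \<le> 1" for i unfolding a_def by simp linarith
      show "\<bar>snd ?d $ i\<bar> \<le> 1" for i unfolding b_def by simp linarith
    qed
    then have "(K *\<^sub>R v) \<bullet> (x - \<beta>) - (\<chi> i. of_int (a i), \<chi> i. of_int (b i)) \<bullet> (x - \<beta>) \<le> B (x - \<beta>)"
      by (simp add: inner_diff_left)
    then show ?thesis using K[OF x] by simp
  qed
  then show ?thesis using that by blast
qed

lemma mpol_eval_cong:
  assumes "\<And>v. v \<in> mpol_vars p \<Longrightarrow> x v = y v"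
  shows "mpol_eval p x = mpol_eval p y"
  unfolding mpol_eval_def
proof (rule sum.cong[OF refl])
  fix m assume "m \<in> Poly_Mapping.keys p"
  then have "x v = y v" if "v \<in> Poly_Mapping.keys m" for v
    using that by (intro assms) (auto simp: mpol_vars_def)
  then have "(\<Prod>v\<in>Poly_Mapping.keys m. x v ^ Poly_Mapping.lookup m v)
     = (\<Prod>v\<in>Poly_Mapping.keys m. y v ^ Poly_Mapping.lookup m v)"
    by (intro prod.cong refl) simp
  then show "Poly_Mapping.lookup p m * (\<Prod>v\<in>Poly_Mapping.keys m. x v ^ Poly_Mapping.lookup m v) =
     Poly_Mapping.lookup p m * (\<Prod>v\<in>Poly_Mapping.keys m. y v ^ Poly_Mapping.lookup m v)" by simp
qed

lemma mpol_eval_homogeneous_zero: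
  assumes "mpol_homogeneous d p" "d > 0"
  shows "mpol_eval p (\<lambda>_. 0) = 0"
  unfolding mpol_eval_def
proof (rule sum.neutral, rule ballI)
  fix m assume "m \<in> Poly_Mapping.keys p"
  then have "(\<Sum>v\<in>Poly_Mapping.keys m. Poly_Mapping.lookup m v) = d"
    using assms(1) by (simp add: mpol_homogeneous_def)
  then obtain v where v: "v \<in> Poly_Mapping.keys m" "Poly_Mapping.lookup m v \<noteq> 0"
    using assms(2) by (metis less_irrefl sum.neutral)
  then have "(\<Prod>v\<in>Poly_Mapping.keys m. (0::'b) ^ Poly_Mapping.lookup m v) = 0"
    by (intro prod_zero bexI[of _ v]) (simp_all add: power_0_left)
  then show "Poly_Mapping.lookup p m * (\<Prod>v\<in>Poly_Mapping.keys m. 0 ^ Poly_Mapping.lookup m v) = 0" by simp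
qed

lemma supp_Z_subset: "\<beta> \<in> t_star \<Longrightarrow> z \<in> Z \<beta> \<Longrightarrow> supp z \<subseteq> Z_idx \<beta>"
  by (auto simp: supp_def coordV_def Z_iff Z_idx_iff)

text \<open>A destabilising one-parameter subgroup orthogonal to \<open>\<beta>\<close> would move the point to the origin
  without changing the value of any invariant.\<close>

proposition Z_ss_hull:
  fixes z :: "'a::alg_closed_field rep"
  assumes b: "\<beta> \<in> t_star" "prim_dir \<beta> c n" and z: "z \<in> Z_ss \<beta>"
  shows "\<beta> \<in> convex hull (gam ` supp z)"
proof (rule ccontr)
  assume nb: "\<beta> \<notin> convex hull (gam ` supp z)"
  obtain d p where zZ: "z \<in> Z \<beta>" and p: "d > 0" "mpol_homogeneous d p" "mpol_vars p \<subseteq> Z_idx \<beta>"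
    "\<forall>g\<in>G_st_beta \<beta>. \<forall>y\<in>Z \<beta>. mpol_eval p (coordV (act g y)) = mpol_eval p (coordV y)"
    "mpol_eval p (coordV z) \<noteq> 0"
    using z unfolding Z_ss_def by blast
  have fin: "finite (gam ` supp z)" by simp
  obtain a b' where ab: "\<And>x. x \<in> gam ` supp z \<Longrightarrow> (\<chi> i. of_int (a i), \<chi> i. of_int (b' i)) \<bullet> (x - \<beta>) > 0"
    by (rule integral_separation[OF fin nb]) (rule that)
  let ?A0 = "(\<chi> i. of_int (a i), \<chi> i. of_int (b' i)) :: wt"
  have n: "c > 0" "\<And>i. of_int (n (Inl i)) = c * fst \<beta> $ i" "\<And>i. of_int (n (Inr i)) = c * snd \<beta> $ i"
  proof -
    have *: "c > 0" "of_int (n p) = c * entry \<beta> p" for p using b(2) by (auto simp: prim_dir_def)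
    show "c > 0" by (rule *(1))
    show "of_int (n (Inl i)) = c * fst \<beta> $ i" "of_int (n (Inr l)) = c * snd \<beta> $ l" for i l
      using *(2)[of "Inl i"] *(2)[of "Inr l"] by (simp_all add: entry_def)
  qed
  define Sa where "Sa = (\<Sum>j\<in>UNIV. a j)"
  define Sb where "Sb = (\<Sum>j\<in>UNIV. b' j)"
  \<comment> \<open>Removing the block means makes both sums zero; the common factor 6 clears the
    denominators 6 and 2 and keeps the two blocks on the same scale.\<close>
  define a1 where "a1 i = 6 * a i - Sa" for i
  define b1 where "b1 i = 6 * b' i - 3 * Sb" for i
  define N where "N = (\<Sum>i\<in>UNIV. n (Inl i) * n (Inl i)) + (\<Sum>i\<in>UNIV. n (Inr i) * n (Inr i))"
  define s where "s = (\<Sum>i\<in>UNIV. a1 i * n (Inl i)) + (\<Sum>i\<in>UNIV. b1 i * n (Inr i))"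
  \<comment> \<open>Orthogonal projection away from \<beta>, multiplied by \<open>N\<close> to
    remain integral: \<open>N\<close> is the squared length of \<open>n\<close> and \<open>s\<close>
    its inner product with the previous vector.\<close>
  define a2 where "a2 i = N * a1 i - s * n (Inl i)" for i
  define b2 where "b2 i = N * b1 i - s * n (Inr i)" for i
  have sn: "(\<Sum>i\<in>UNIV. n (Inl i)) = 0" "(\<Sum>i\<in>UNIV. n (Inr i)) = 0"
  proof -
    have "real_of_int (\<Sum>i\<in>UNIV. n (Inl i)) = 0" "real_of_int (\<Sum>i\<in>UNIV. n (Inr i)) = 0"
      using b(1) by (simp_all add: n sum_distrib_left[symmetric] t_star_def)
    then show "(\<Sum>i\<in>UNIV. n (Inl i)) = 0" "(\<Sum>i\<in>UNIV. n (Inr i)) = 0" by (simp_all only: of_int_eq_0_iff)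
  qed
  have s1: "(\<Sum>i\<in>UNIV. a1 i) = 0" "(\<Sum>i\<in>UNIV. b1 i) = 0"
    by (simp_all add: a1_def b1_def Sa_def Sb_def sum_subtractf sum_distrib_left[symmetric])
  have s2: "(\<Sum>i\<in>UNIV. a2 i) = 0" "(\<Sum>i\<in>UNIV. b2 i) = 0"
    by (simp_all add: a2_def b2_def sum_subtractf sum_distrib_left[symmetric] s1 sn)
  have "(\<Sum>i\<in>UNIV. a2 i * n (Inl i)) + (\<Sum>i\<in>UNIV. b2 i * n (Inr i)) =
     N * s - s * N"
    by (simp add: a2_def b2_def left_diff_distrib sum_subtractf mult.assoc sum_distrib_left[symmetric])
       (simp add: s_def N_def algebra_simps)
  then have s3: "(\<Sum>i\<in>UNIV. a2 i * n (Inl i)) + (\<Sum>i\<in>UNIV. b2 i * n (Inr i)) = 0" by simp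
  have tor: "torus a2 b2 t \<in> G_st_beta \<beta>" if "t \<noteq> 0" for t :: 'a
    by (rule torus_G_st_beta[OF b(2) that s2 s3])
  define e where "e = (\<lambda>(i, j, l). a2 i + a2 j + b2 l)"
  \<comment> \<open>On the hyperplane through \<beta> the projection changes the separating
    functional by a positive factor only, so the exponents on the support stay positive.\<close>
  have epos: "e t > 0" if t: "t \<in> supp z" for t
  proof -
    let ?A1 = "(\<chi> i. of_int (a1 i), \<chi> i. of_int (b1 i)) :: wt"
    let ?A2 = "(\<chi> i. of_int (a2 i), \<chi> i. of_int (b2 i)) :: wt"
    have A1: "?A1 \<bullet> x = 6 * (?A0 \<bullet> x)" if "x \<in> t_star" for x
    proof -
      have "?A1 \<bullet> x = 6 * (?A0 \<bullet> x) - of_int Sa * (\<Sum>i\<in>UNIV. fst x $ i)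
           - 3 * of_int Sb * (\<Sum>i\<in>UNIV. snd x $ i)"
        by (simp add: inner_prod_def inner_vec_def a1_def b1_def left_diff_distrib sum_subtractf
            sum_distrib_left mult.assoc distrib_left)
      then show ?thesis using that by (simp add: t_star_def)
    qed
    have Nr: "of_int N = c * c * (\<beta> \<bullet> \<beta>)"
      by (simp add: N_def inner_prod_def inner_vec_def n sum_distrib_left distrib_left mult_ac)
    have sr: "of_int s = c * (?A1 \<bullet> \<beta>)"
      by (simp add: s_def inner_prod_def inner_vec_def n sum_distrib_left distrib_left mult_ac)
    have A2: "?A2 = of_int N *\<^sub>R ?A1 - (of_int s * c) *\<^sub>R \<beta>"
      by (simp add: prod_eq_iff vec_eq_iff a2_def b2_def n)
    have t2: "?A2 \<in> t_star"
      using s2 by (simp add: t_star_def of_int_sum[symmetric] del: of_int_sum)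
    have bg: "gam t \<bullet> \<beta> = \<beta> \<bullet> \<beta>"
      using t supp_Z_subset[OF b(1) zZ] by (auto simp: Z_idx_def)
    have "real_of_int (e t) = wgt ?A2 t" by (cases t) (simp add: e_def wgt_def)
    also have "\<dots> = gam t \<bullet> ?A2" by (rule inner_gam[OF t2, symmetric])
    also have "\<dots> = of_int N * (?A1 \<bullet> gam t) - of_int s * c * (\<beta> \<bullet> \<beta>)"
      unfolding A2 by (simp only: inner_diff_right inner_scaleR_right bg inner_commute[of "gam t" ?A1])
    also have "\<dots> = 6 * (c * c * (\<beta> \<bullet> \<beta>)) * (?A0 \<bullet> (gam t - \<beta>))"
      unfolding Nr sr A1[OF gam_in_t_star] A1[OF b(1)] inner_diff_right by (simp add: algebra_simps)
    finally have "real_of_int (e t) = 6 * (c * c * (\<beta> \<bullet> \<beta>)) * (?A0 \<bullet> (gam t - \<beta>))" .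
    moreover have "\<beta> \<bullet> \<beta> > 0"
    proof -
      have "\<beta> \<noteq> 0"
      proof
        assume "\<beta> = 0"
        then have "n p = 0" for p using b(2) by (cases p) (auto simp: prim_dir_def entry_def)
        then have "Gcd (range n) = 0" by (simp only: Gcd_0_iff) auto
        moreover have "Gcd (range n) = 1" using b(2) by (simp only: prim_dir_def)
        ultimately show False by simp
      qed
      then show ?thesis by simp
    qed
    ultimately have "real_of_int (e t) > 0" using n(1) ab[of "gam t"] t by simp
    then show ?thesis by simp
  qed
  \<comment> \<open>The orbit under the subgroup, extended to parameter 0. All exponents on the
    support are positive, so every relevant coordinate vanishes there.\<close>
  define x where "x r t = r ^ nat (e t) * coordV z t" for r t
  have x0: "mpol_eval p (x 0) = 0"
  proof -
    have "x 0 v = 0" if "v \<in> mpol_vars p" for v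
    proof (cases "v \<in> supp z")
      case True
      then have "nat (e v) \<noteq> 0" using epos[OF True] by simp
      then show ?thesis by (simp add: x_def)
    next
      case False
      moreover have "v \<in> idx" using p(3) that by (auto simp: Z_idx_def)
      ultimately show ?thesis by (simp add: x_def supp_def)
    qed
    then have "mpol_eval p (x 0) = mpol_eval p (\<lambda>_. 0)" by (intro mpol_eval_cong)
    then show ?thesis using mpol_eval_homogeneous_zero[OF p(2,1)] by simp
  qed
  have xr: "mpol_eval p (x r) = mpol_eval p (coordV z)" if r: "r \<noteq> 0" for r
  proof -
    have "mpol_eval p (x r) = mpol_eval p (coordV (act (torus a2 b2 r) z))"
    proof (rule mpol_eval_cong)
      fix v assume v: "v \<in> mpol_vars p"
      obtain i j l where vv: "v = (i, j, l)" by (cases v)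
      show "x r v = coordV (act (torus a2 b2 r) z) v"
      proof (cases "v \<in> supp z")
        case True
        then have "int (nat (e v)) = e v" using epos[OF True] by simp
        then have "r ^ nat (e v) = r powi e v" by (metis power_int_of_nat)
        then show ?thesis using r by (simp add: x_def vv coordV_def act_torus e_def)
      next
        case False
        moreover have "v \<in> idx" using p(3) v by (auto simp: Z_idx_def)
        ultimately have "coordV z v = 0" by (simp add: supp_def)
        then show ?thesis using r by (simp add: x_def vv coordV_def act_torus)
      qed
    qed
    then show ?thesis using p(4) tor[OF r] zZ by simp
  qed
  \<comment> \<open>This difference is zero for all nonzero parameters but nonzero at 0, which is
    impossible for a rational function on an infinite line.\<close>
  have "ratfun UNIV (\<lambda>r. mpol_eval p (x r) + (- mpol_eval p (coordV z)))"
    by (intro ratfun_add ratfun_const ratfun_mpol_eval) (simp add: x_def ratfun_mult ratfun_power ratfun_id ratfun_const)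
  then have "finite {r \<in> UNIV. mpol_eval p (x r) + (- mpol_eval p (coordV z)) = 0}"
    by (rule ratfun_finite_zeros[of _ _ 0]) (use x0 p(5) in auto)
  moreover have "UNIV - {0} \<subseteq> {r \<in> UNIV. mpol_eval p (x r) + (- mpol_eval p (coordV z)) = 0}"
    using xr by auto
  ultimately show False using infinite_alg_closed_nonzero by (meson finite_subset)
qed

subsection \<open>Disjointness of the strata\<close>

lemma Y_ss_V: "\<beta> \<in> t_star \<Longrightarrow> y \<in> Y_ss \<beta> \<Longrightarrow> y \<in> V"
  unfolding Y_ss_def Z_ss_def by (auto simp: Z_iff W_iff intro: V_add)

lemma Y_ss_wgt: 
  assumes "\<beta> \<in> t_star" "y \<in> Y_ss \<beta>" "y $ l $ i $ j \<noteq> 0"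
  shows "wgt \<beta> (i, j, l) \<ge> \<beta> \<bullet> \<beta>"
proof -
  obtain z w where y: "y = z + w" "z \<in> Z \<beta>" "w \<in> W \<beta>"
    using assms(2) unfolding Y_ss_def Z_ss_def by blast
  have "z $ l $ i $ j \<noteq> 0 \<or> w $ l $ i $ j \<noteq> 0" using assms(3) y(1) by auto
  then show ?thesis
    using y(2,3) unfolding Z_iff[OF assms(1)] W_iff[OF assms(1)] by (metis less_imp_le order_refl)
qed

text \<open>By \<open>closest_point_hull_iff\<close> the two conclusions recover \<beta> from the
  support of \<open>y\<close>. The component in \<open>W\<close> involves only weights beyond the
  hyperplane and cannot cancel coordinates of the semistable part.\<close>

lemma Y_ss_closest_point:
  fixes y :: "'a::alg_closed_field rep"
  assumes "\<beta> \<in> BB" "y \<in> Y_ss \<beta>"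
  shows "\<beta> \<in> convex hull (gam ` supp y)" "\<And>x. x \<in> gam ` supp y \<Longrightarrow> x \<bullet> \<beta> \<ge> \<beta> \<bullet> \<beta>"
proof -
  have bt: "\<beta> \<in> t_star" using assms(1) by (rule BB_t_star)
  obtain c n where pd: "prim_dir \<beta> c n" using BB_prim_dir[OF assms(1)] by blast
  obtain z w where y: "y = z + w" "z \<in> Z_ss \<beta>" "w \<in> W \<beta>"
    using assms(2) unfolding Y_ss_def by blast
  have zZ: "z \<in> Z \<beta>" using y(2) by (simp add: Z_ss_def)
  have "supp z \<subseteq> supp y"
  proof
    fix t assume t: "t \<in> supp z"
    obtain i j l where tt: "t = (i, j, l)" by (cases t)
    have "z $ l $ i $ j \<noteq> 0" using t by (simp add: supp_def tt coordV_def)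
    then have "wgt \<beta> (i, j, l) = \<beta> \<bullet> \<beta>" using zZ by (simp add: Z_iff[OF bt])
    then have "w $ l $ i $ j = 0" using y(3) by (force simp: W_iff[OF bt])
    then show "t \<in> supp y" using t by (simp add: supp_def tt coordV_def y(1))
  qed
  then show "\<beta> \<in> convex hull (gam ` supp y)"
    using Z_ss_hull[OF bt pd y(2)] hull_mono[of "gam ` supp z" "gam ` supp y"] by blast
  fix x assume "x \<in> gam ` supp y"
  then obtain i j l where t: "(i, j, l) \<in> supp y" "x = gam (i, j, l)" by auto
  then have "wgt \<beta> (i, j, l) \<ge> \<beta> \<bullet> \<beta>"
    by (intro Y_ss_wgt[OF bt assms(2)]) (simp add: supp_def coordV_def)
  then show "x \<bullet> \<beta> \<ge> \<beta> \<bullet> \<beta>" by (simp add: t(2) inner_gam[OF bt])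
qed

text \<open>Otherwise \<open>\<pi>\<close> would map \<open>{..i}\<close> injectively into the
  smaller set \<open>{..<i}\<close>.\<close>

lemma mono_permutation_aux:
  fixes f :: "'n::{finite,linorder} \<Rightarrow> real"
  assumes "\<And>i j. i \<le> j \<Longrightarrow> f i \<le> f j" "\<And>i j. i \<le> j \<Longrightarrow> f (\<pi> i) \<le> f (\<pi> j)" "inj \<pi>"
  shows "f i \<le> f (\<pi> i)"
proof (rule ccontr)
  assume a: "\<not> f i \<le> f (\<pi> i)"
  have "\<pi> ` {..i} \<subseteq> {..<i}"
  proof
    fix x assume "x \<in> \<pi> ` {..i}"
    then obtain j where "j \<le> i" "x = \<pi> j" by auto
    then have "f x < f i" using assms(2)[of j i] a by simp
    then have "\<not> i \<le> x" using assms(1)[of i x] by auto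
    then show "x \<in> {..<i}" by simp
  qed
  then have "card (\<pi> ` {..i}) \<le> card {..<i}" by (intro card_mono) auto
  moreover have "card (\<pi> ` {..i}) = card {..i}" by (rule card_image) (use assms(3) in \<open>auto intro: inj_on_subset\<close>)
  moreover have "card {..<i} < card {..i}" by (intro psubset_card_mono) auto
  ultimately show False by simp
qed

text \<open>The reverse inequality is the auxiliary one for the inverse permutation, applied to the
  rearranged sequence.\<close>

lemma mono_permutation:
  fixes f :: "'n::{finite,linorder} \<Rightarrow> real"
  assumes "\<And>i j. i \<le> j \<Longrightarrow> f i \<le> f j" "\<And>i j. i \<le> j \<Longrightarrow> f (\<pi> i) \<le> f (\<pi> j)" "bij \<pi>"
  shows "f (\<pi> i) = f i"
proof (rule antisym)
  show "f i \<le> f (\<pi> i)" by (rule mono_permutation_aux) (use assms in \<open>auto simp: bij_is_inj\<close>)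
  have s: "\<pi> (inv_into UNIV \<pi> x) = x" for x using assms(3) by (simp add: bij_is_surj surj_f_inv_f)
  have "f (\<pi> i) \<le> f (\<pi> (inv_into UNIV \<pi> i))"
    by (rule mono_permutation_aux[of "\<lambda>i. f (\<pi> i)" "inv_into UNIV \<pi>"])
       (use assms in \<open>auto simp: s bij_imp_bij_inv bij_is_inj\<close>)
  then show "f (\<pi> i) \<le> f i" by (simp add: s)
qed

text \<open>Lower unitriangular factors are moved into the two points, after which a monomial matrix
  relates them. It permutes the coordinates up to nonzero factors, so the isometry \<open>w\<close>
  maps one set of weights onto the other and one closest point onto the other. A permutation between
  two increasing sequences leaves the values in place, hence the two indices agree.\<close>

proposition strata_disjoint:
  fixes y y' :: "'a::alg_closed_field rep"
  assumes b: "\<beta> \<in> BB" "\<beta>' \<in> BB" and y: "y \<in> Y_ss \<beta>" "y' \<in> Y_ss \<beta>'" and g: "g \<in> G" "y' = act g y"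
  shows "\<beta> = \<beta>'"
proof -
  have bp: "\<beta> \<in> t_star_plus" "\<beta>' \<in> t_star_plus" using b by (auto simp: BB_def)
  have inv: "invertible (fst g)" "invertible (snd g)" using g(1) by (auto simp: G_def)
  obtain u1 u2 N \<pi> where u: "lower_uni u1" "lower_uni u2" "u1 ** fst g = N ** u2" "bij \<pi>"
    "\<And>i j. N $ i $ j \<noteq> 0 \<longleftrightarrow> j = \<pi> i"
    using bruhat_decomposition[OF inv(1)] by blast
  obtain v1 v2 Q \<rho> where v: "lower_uni v1" "lower_uni v2" "v1 ** snd g = Q ** v2" "bij \<rho>"
    "\<And>i j. Q $ i $ j \<noteq> 0 \<longleftrightarrow> j = \<rho> i"
    using bruhat_decomposition[OF inv(2)] by blast
  define x where "x = act (u2, v2) y"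
  define x' where "x' = act (u1, v1) y'"
  have x: "x \<in> Y_ss \<beta>" unfolding x_def by (rule act_lower_Y_ss[OF bp(1)]) (use u v y in auto)
  have x': "x' \<in> Y_ss \<beta>'" unfolding x'_def by (rule act_lower_Y_ss[OF bp(2)]) (use u v y in auto)
  have xx': "x' = act (N, Q) x"
    by (simp add: x_def x'_def g(2) act_gmul[symmetric] gmul_def u(3) v(3))
  have N0: "N $ i $ p = (if p = \<pi> i then N $ i $ \<pi> i else 0)" for i p using u(5)[of i p] by auto
  have O0: "Q $ i $ p = (if p = \<rho> i then Q $ i $ \<rho> i else 0)" for i p using v(5)[of i p] by auto
  have comp: "x' $ l $ i $ j = Q $ l $ \<rho> l * N $ i $ \<pi> i * N $ j $ \<pi> j * x $ \<rho> l $ \<pi> i $ \<pi> j" for l i j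
  proof -
    have "x' $ l $ i $ j = (\<Sum>m\<in>UNIV. \<Sum>q\<in>UNIV. \<Sum>p\<in>UNIV. Q $ l $ m * N $ i $ p * N $ j $ q * x $ m $ p $ q)"
      by (simp add: xx' act_component)
    also have "\<dots> = (\<Sum>m\<in>UNIV. \<Sum>q\<in>UNIV. \<Sum>p\<in>UNIV.
       if p = \<pi> i then if q = \<pi> j then if m = \<rho> l then Q $ l $ \<rho> l * N $ i $ \<pi> i * N $ j $ \<pi> j * x $ \<rho> l $ \<pi> i $ \<pi> j else 0 else 0 else 0)"
    proof (intro sum.cong refl)
      fix m q p
      show "Q $ l $ m * N $ i $ p * N $ j $ q * x $ m $ p $ q = (if p = \<pi> i then if q = \<pi> j then if m = \<rho> l then Q $ l $ \<rho> l * N $ i $ \<pi> i * N $ j $ \<pi> j * x $ \<rho> l $ \<pi> i $ \<pi> j else 0 else 0 else 0)"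
        using N0[of i p] N0[of j q] O0[of l m] by auto
    qed
    finally show ?thesis by simp
  qed
  have nz: "x' $ l $ i $ j \<noteq> 0 \<longleftrightarrow> x $ \<rho> l $ \<pi> i $ \<pi> j \<noteq> 0" for l i j
    using u(5)[of i "\<pi> i"] u(5)[of j "\<pi> j"] v(5)[of l "\<rho> l"] by (simp add: comp)
  define w :: "wt \<Rightarrow> wt" where "w a = (\<chi> i. fst a $ \<pi> i, \<chi> l. snd a $ \<rho> l)" for a
  have inner_w: "w a \<bullet> w c = a \<bullet> c" for a c
  proof -
    have "(\<Sum>i\<in>UNIV. fst a $ \<pi> i * fst c $ \<pi> i) = (\<Sum>i\<in>UNIV. fst a $ i * fst c $ i)"
      using sum.reindex_bij_betw[of \<pi> UNIV UNIV "\<lambda>i. fst a $ i * fst c $ i"] u(4) by simp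
    moreover have "(\<Sum>i\<in>UNIV. snd a $ \<rho> i * snd c $ \<rho> i) = (\<Sum>i\<in>UNIV. snd a $ i * snd c $ i)"
      using sum.reindex_bij_betw[of \<rho> UNIV UNIV "\<lambda>i. snd a $ i * snd c $ i"] v(4) by simp
    ultimately show ?thesis by (simp add: w_def inner_prod_def inner_vec_def)
  qed
  have lin: "linear w" by (rule linearI) (simp_all add: w_def vec_eq_iff)
  have gam_w: "w (gam (\<pi> i, \<pi> j, \<rho> l)) = gam (i, j, l)" for i j l
    using u(4) v(4) by (auto simp: w_def gam_eq vec_eq_iff axis_def bij_def inj_eq)
  have gam_sym: "gam (i, j, l) = gam (j, i, l)" for i j l
    by (simp add: gam_eq add.commute)
  have yV: "x \<in> V" "x' \<in> V" using x x' bp Y_ss_V t_star_plus_t_star by blast+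
  have gsupp: "gam ` supp q = {gam (i, j, l) | i j l. q $ l $ i $ j \<noteq> 0}" if q: "q \<in> V" for q :: "'a rep"
  proof (intro subset_antisym subsetI)
    fix t assume "t \<in> gam ` supp q"
    then show "t \<in> {gam (i, j, l) | i j l. q $ l $ i $ j \<noteq> 0}" by (auto simp: supp_def coordV_def)
  next
    fix t assume "t \<in> {gam (i, j, l) | i j l. q $ l $ i $ j \<noteq> 0}"
    then obtain i j l where t: "t = gam (i, j, l)" "q $ l $ i $ j \<noteq> 0" by blast
    show "t \<in> gam ` supp q"
    proof (cases i j rule: linorder_cases)
      case less
      then have "(i, j, l) \<in> supp q" using t by (simp add: supp_def coordV_def)
      then show ?thesis using t by blast
    next
      case equal then show ?thesis using V_diag[OF q] t by simp
    next
      case greater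
      then have "(j, i, l) \<in> supp q" using t V_sym_nonzero[OF q] by (simp add: supp_def coordV_def)
      then show ?thesis using t gam_sym by blast
    qed
  qed
  have img: "gam ` supp x' = w ` (gam ` supp x)"
    unfolding gsupp[OF yV(1)] gsupp[OF yV(2)]
  proof (intro subset_antisym subsetI)
    fix t assume "t \<in> {gam (i, j, l) | i j l. x' $ l $ i $ j \<noteq> 0}"
    then obtain i j l where "t = gam (i, j, l)" "x' $ l $ i $ j \<noteq> 0" by blast
    then have "t = w (gam (\<pi> i, \<pi> j, \<rho> l))" "x $ \<rho> l $ \<pi> i $ \<pi> j \<noteq> 0" by (simp_all add: gam_w nz[symmetric])
    then show "t \<in> w ` {gam (i, j, l) | i j l. x $ l $ i $ j \<noteq> 0}" by blast
  next
    fix t assume "t \<in> w ` {gam (i, j, l) | i j l. x $ l $ i $ j \<noteq> 0}"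
    then obtain i j l where t: "t = w (gam (i, j, l))" "x $ l $ i $ j \<noteq> 0" by blast
    obtain i' j' l' where "i = \<pi> i'" "j = \<pi> j'" "l = \<rho> l'"
      using bij_is_surj[OF u(4)] bij_is_surj[OF v(4)] by (meson surjE)
    then have "t = gam (i', j', l')" "x' $ l' $ i' $ j' \<noteq> 0" using t by (simp_all add: gam_w nz)
    then show "t \<in> {gam (i, j, l) | i j l. x' $ l $ i $ j \<noteq> 0}" by blast
  qed
  have c: "\<beta> \<in> convex hull (gam ` supp x)" "\<And>t. t \<in> gam ` supp x \<Longrightarrow> t \<bullet> \<beta> \<ge> \<beta> \<bullet> \<beta>"
    using Y_ss_closest_point[OF b(1) x] by auto
  have c': "\<beta>' \<in> convex hull (gam ` supp x')" "\<And>t. t \<in> gam ` supp x' \<Longrightarrow> t \<bullet> \<beta>' \<ge> \<beta>' \<bullet> \<beta>'"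
    using Y_ss_closest_point[OF b(2) x'] by auto
  have ne: "gam ` supp x' \<noteq> {}" using c'(1) by auto
  have fin: "finite (gam ` supp x')" by simp
  have "w \<beta> \<in> convex hull (gam ` supp x')"
    unfolding img convex_hull_linear_image[OF lin, symmetric] using c(1) by blast
  moreover have "t \<bullet> w \<beta> \<ge> w \<beta> \<bullet> w \<beta>" if "t \<in> gam ` supp x'" for t
  proof -
    have "t \<in> w ` (gam ` supp x)" using that by (simp only: img)
    then obtain r where "t = w r" "r \<in> gam ` supp x" by (erule_tac imageE) blast
    then show ?thesis using c(2)[of r] by (simp only: inner_w)
  qed
  ultimately have "w \<beta> = closest_point (convex hull (gam ` supp x')) 0"
    by (intro closest_point_hull_iff[OF fin ne, THEN iffD2] conjI ballI)
  also have "\<beta>' = closest_point (convex hull (gam ` supp x')) 0"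
    by (intro closest_point_hull_iff[OF fin ne, THEN iffD2] conjI ballI c')
  then have "closest_point (convex hull (gam ` supp x')) 0 = \<beta>'" by (rule sym)
  finally have w: "w \<beta> = \<beta>'" .
  have "fst \<beta>' $ i = fst \<beta> $ i" for i
  proof -
    have "fst \<beta> $ \<pi> i = fst \<beta> $ i"
    proof (rule mono_permutation[OF _ _ u(4)])
      show "fst \<beta> $ i \<le> fst \<beta> $ j" if "i \<le> j" for i j using bp(1) that by (simp add: t_star_plus_def)
      show "fst \<beta> $ \<pi> i \<le> fst \<beta> $ \<pi> j" if "i \<le> j" for i j
        using bp(2) that unfolding w[symmetric] by (simp add: t_star_plus_def w_def)
    qed
    then show ?thesis by (simp add: w[symmetric] w_def)
  qed
  moreover have "snd \<beta>' $ i = snd \<beta> $ i" for i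
  proof -
    have "snd \<beta> $ \<rho> i = snd \<beta> $ i"
    proof (rule mono_permutation[OF _ _ v(4)])
      show "snd \<beta> $ i \<le> snd \<beta> $ j" if "i \<le> j" for i j using bp(1) that by (simp add: t_star_plus_def)
      show "snd \<beta> $ \<rho> i \<le> snd \<beta> $ \<rho> j" if "i \<le> j" for i j
        using bp(2) that unfolding w[symmetric] by (simp add: t_star_plus_def w_def)
    qed
    then show ?thesis by (simp add: w[symmetric] w_def)
  qed
  ultimately show ?thesis by (simp add: prod_eq_iff vec_eq_iff)
qed

corollary strata_disjoint':
  fixes x :: "'a::alg_closed_field rep"
  assumes "\<beta> \<in> BB" "\<beta>' \<in> BB" "x \<in> stratum \<beta>" "x \<in> stratum \<beta>'"
  shows "\<beta> = \<beta>'"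
proof -
  obtain g y g' y' where *: "x = act g y" "g \<in> G" "y \<in> Y_ss \<beta>" "x = act g' y'" "g' \<in> G" "y' \<in> Y_ss \<beta>'"
    using assms(3,4) unfolding stratum_def by blast
  have "y' = act (ginv g') x" using *(4,5) by (simp add: act_gmul[symmetric] ginv_gmul act_one)
  then have "y' = act (gmul (ginv g') g) y" by (simp add: act_gmul *(1))
  moreover have "gmul (ginv g') g \<in> G" using *(2,5) by (simp add: gmul_G ginv_G)
  ultimately show ?thesis using strata_disjoint[OF assms(1,2) *(3,6)] by blast
qed

lemma stratum_act:
  assumes "x \<in> stratum \<beta>" "g \<in> G"
  shows "act g x \<in> stratum \<beta>"
proof -
  obtain h y where "x = act h y" "h \<in> G" "y \<in> Y_ss \<beta>" using assms(1) unfolding stratum_def by blast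
  moreover from this have "act g x = act (gmul g h) y" "gmul g h \<in> G"
    using assms(2) by (simp_all add: act_gmul gmul_G)
  ultimately show ?thesis unfolding stratum_def by blast
qed

lemma stratum_equivG: "x \<sim>\<^sub>G y \<Longrightarrow> x \<in> stratum \<beta> \<longleftrightarrow> y \<in> stratum \<beta>"
  unfolding equivG_def
  by (metis (no_types, lifting) act_gmul act_one ginv_G ginv_gmul stratum_act)

lemma stratum_V: "\<beta> \<in> t_star \<Longrightarrow> stratum \<beta> \<subseteq> V"
  unfolding stratum_def using Y_ss_V act_V by blast

subsection \<open>Frames and bivectors\<close>

definition smat :: "'a::comm_ring_1 \<Rightarrow> 'a^6^6 \<Rightarrow> 'a^6^6" where
  "smat c A = (\<chi> i j. c * A $ i $ j)"

definition mk :: "'a^6^6 \<Rightarrow> 'a^6^6 \<Rightarrow> 'a rep" where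
  "mk A B = (\<chi> l. if l = 0 then A else B)"

text \<open>Six spanning vectors form a basis, so no independence has to be carried along.\<close>

definition fr :: "'a::field^6 \<Rightarrow> 'a^6 \<Rightarrow> 'a^6 \<Rightarrow> 'a^6 \<Rightarrow> 'a^6 \<Rightarrow> 'a^6 \<Rightarrow> bool" where
  "fr a b c d e f \<longleftrightarrow> vec.span {a, b, c, d, e, f} = UNIV"

lemma mk_nth [simp]: "mk A B $ 0 = A" "mk A B $ 1 = B"
  by (simp_all add: mk_def)

lemma mk_eta: "mk (x $ 0) (x $ 1) = x"
  by (simp add: vec_eq_iff forall_2' mk_def)

lemma wedge_self [simp]: "wedge u u = 0"
  by (simp add: wedge_def vec_eq_iff)

lemma wedge_zero [simp]: "wedge 0 u = 0" "wedge u 0 = 0"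
  by (simp_all add: wedge_def vec_eq_iff)

lemmas wedge_unfold = vec_eq_iff wedge_def smat_def

lemma congr_wedge: "F ** wedge u v ** transpose F = wedge (F *v u) (F *v v)"
proof -
  have "act (F, mat 1) (tensor (wedge u v) (axis 0 1)) $ 0 = tensor (wedge (F *v u) (F *v v)) (axis 0 1) $ 0"
    by (simp add: act_decomposable)
  moreover have "tensor w (axis 0 1) $ 0 = w" for w :: "'a^6^6"
    by (simp add: tensor_def vec_eq_iff axis_def)
  moreover have "tensor w (axis 0 1) $ 1 = 0" for w :: "'a^6^6"
    by (simp add: tensor_def vec_eq_iff axis_def)
  moreover have "act (F, mat 1) y $ 0 = F ** y $ 0 ** transpose F" for y :: "'a rep"
    by (simp add: act_def vec_eq_iff sum_2' mat_def)
  ultimately show ?thesis by simp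
qed

lemma congr_add: "F ** (A + B) ** transpose F = F ** A ** transpose F + F ** B ** transpose F"
  for F :: "'a::comm_ring_1^6^6"
  by (simp add: matrix_add_ldistrib matrix_matrix_mult_def vec_eq_iff sum.distrib distrib_left distrib_right sum_distrib_right)

lemma congr_smat: "F ** smat c A ** transpose F = smat c (F ** A ** transpose F)"
  by (simp add: matrix_matrix_mult_def vec_eq_iff smat_def sum_distrib_left sum_distrib_right mult_ac)

lemma act_mk: "act (F, mat 1) (mk A B) = mk (F ** A ** transpose F) (F ** B ** transpose F)"
  by (simp add: act_def mk_def vec_eq_iff forall_2' sum_2' mat_def)

lemma act_mk2: "act (mat 1, H) (mk A B) =
   mk (smat (H $ 0 $ 0) A + smat (H $ 0 $ 1) B) (smat (H $ 1 $ 0) A + smat (H $ 1 $ 1) B)"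
  by (simp add: act_def mk_def vec_eq_iff forall_2' sum_2' smat_def transpose_mat)

lemma invertible_mat_1: "invertible (mat 1 :: 'a::comm_ring_1^'n^'n)"
  unfolding invertible_def by (rule exI[of _ "mat 1"]) simp

definition E :: "6 \<Rightarrow> 'a::field^6" where "E i = axis i 1"

lemma fr_matrix:
  assumes "fr v0 v1 v2 v3 v4 v5"
  obtains F where "invertible F" "F *v E 0 = v0" "F *v E 1 = v1" "F *v E 2 = v2"
    "F *v E 3 = v3" "F *v E 4 = v4" "F *v E 5 = v5"
proof -
  define f where "f i = (if i = 0 then v0 else if i = 1 then v1 else if i = 2 then v2
     else if i = 3 then v3 else if i = 4 then v4 else v5)" for i :: 6
  define F where "F = (\<chi> i j. f j $ i)"
  have col: "F *v E j = f j" for j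
    by (simp add: F_def E_def matrix_vector_mult_def vec_eq_iff axis_def if_distrib cong: if_cong)
  have "vec.span (columns F) = UNIV"
  proof -
    have "column j F = f j" for j by (simp add: column_def F_def vec_eq_iff)
    then have "columns F = f ` UNIV" by (auto simp: columns_def)
    also have "\<dots> = {v0, v1, v2, v3, v4, v5}" unfolding UNIV_6 by (auto simp: f_def)
    finally show ?thesis using assms by (simp add: fr_def)
  qed
  then have "invertible F"
    by (simp add: matrix_right_invertible_span_columns[symmetric] invertible_right_inverse)
  then show ?thesis using that[of F] col by (simp add: f_def)
qed

lemma equivG_gl2:
  assumes "p * s - q * r \<noteq> 0"
  shows "mk A B \<sim>\<^sub>G mk (smat p A + smat q B) (smat r A + smat s B)"
proof -
  define H :: "'a^2^2" where "H = (\<chi> i j. if i = 0 then if j = 0 then p else q else if j = 0 then r else s)"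
  define H' :: "'a^2^2" where "H' = (\<chi> i j. (if i = 0 then if j = 0 then s else -q else if j = 0 then -r else p) / (p * s - q * r))"
  have "H ** H' = mat 1"
    using assms by (simp add: vec_eq_iff forall_2' matrix_matrix_mult_def sum_2' mat_def H_def H'_def)
      (simp add: diff_divide_distrib[symmetric] mult.commute)
  then have "invertible H" unfolding invertible_right_inverse by blast
  then have "(mat 1, H) \<in> G" by (simp add: G_def invertible_mat_1)
  then show ?thesis unfolding equivG_def
    by (intro bexI[of _ "(mat 1, H)"]) (auto simp: act_mk2 H_def)
qed

text \<open>An expression in wedges of frame vectors is the congruence image of the same expression
  in standard vectors. This is how the normal forms are read off below.\<close>

lemma equivG_frame:
  assumes "fr v0 v1 v2 v3 v4 v5"
  shows "\<exists>F. F *v E 0 = v0 \<and> F *v E 1 = v1 \<and> F *v E 2 = v2 \<and> F *v E 3 = v3 \<and> F *v E 4 = v4 \<and>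
    F *v E 5 = v5 \<and> mk (F ** A ** transpose F) (F ** B ** transpose F) \<sim>\<^sub>G mk A B"
proof -
  obtain F where F: "invertible F" "F *v E 0 = v0" "F *v E 1 = v1" "F *v E 2 = v2"
    "F *v E 3 = v3" "F *v E 4 = v4" "F *v E 5 = v5" using fr_matrix[OF assms] by blast
  have "(F, mat 1) \<in> G" using F(1) by (simp add: G_def invertible_mat_1)
  then have "mk A B \<sim>\<^sub>G mk (F ** A ** transpose F) (F ** B ** transpose F)"
    unfolding equivG_def act_mk[symmetric] by blast
  then have "mk (F ** A ** transpose F) (F ** B ** transpose F) \<sim>\<^sub>G mk A B"
    by (rule equivG_sym)
  then show ?thesis using F by blast
qed

text \<open>Sums of wedges without scalars: over a subspace a scalar can be absorbed into a factor.
  The inductive form allows one vector at a time to be split off.\<close>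

inductive_set wspan :: "('a::comm_ring_1^6) set \<Rightarrow> ('a^6^6) set" for U where
  zero: "0 \<in> wspan U"
| add: "u \<in> U \<Longrightarrow> v \<in> U \<Longrightarrow> B \<in> wspan U \<Longrightarrow> wedge u v + B \<in> wspan U"

lemma wspan_mono: "B \<in> wspan U \<Longrightarrow> U \<subseteq> U' \<Longrightarrow> B \<in> wspan U'"
  by (induction rule: wspan.induct) (auto intro: wspan.intros)

lemma wspan_wedge: "u \<in> U \<Longrightarrow> v \<in> U \<Longrightarrow> wedge u v \<in> wspan U"
  using wspan.add[OF _ _ wspan.zero] by fastforce

lemma wspan_plus: "A \<in> wspan U \<Longrightarrow> B \<in> wspan U \<Longrightarrow> A + B \<in> wspan U"
  by (induction rule: wspan.induct) (auto intro: wspan.intros simp: add.assoc)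

lemma wspan_smat:
  assumes "A \<in> wspan (vec.span S)" shows "smat c A \<in> wspan (vec.span S)"
  using assms
proof induction
  case zero
  have "smat c 0 = 0" by (simp add: wedge_unfold)
  then show ?case by (simp add: wspan.zero)
next
  case (add u v B)
  have "smat c (wedge u v + B) = wedge (c *s u) v + smat c B"
    by (simp add: wedge_unfold algebra_simps)
  then show ?case using add by (auto intro: wspan.intros vec.span_scale)
qed

lemma wspan_sum: "(\<And>i. i \<in> I \<Longrightarrow> f i \<in> wspan U) \<Longrightarrow> sum f I \<in> wspan U"
  by (induction I rule: infinite_finite_induct) (auto intro: wspan.zero wspan_plus)

lemma alt_wspan:
  fixes x :: "'a::field rep"
  assumes "x \<in> V" shows "x $ l \<in> wspan UNIV"
proof -
  obtain c where x: "x = (\<Sum>t\<in>idx. scaleV (c t) (basis_e t))"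
    using assms unfolding V_def spanV_def by blast
  have "scaleV (c t) (basis_e t) $ l \<in> wspan UNIV" for t
  proof -
    obtain i j m where t: "t = (i, j, m)" by (cases t)
    have "scaleV (c t) (basis_e t) $ l = wedge ((c t * axis m 1 $ l) *s axis i 1) (axis j 1)"
      by (simp add: t basis_e_def scaleV_def tensor_def wedge_unfold algebra_simps)
    then show ?thesis by (auto intro: wspan_wedge)
  qed
  then show ?thesis unfolding x sum_component by (intro wspan_sum)
qed

text \<open>Writing both factors of each wedge as a multiple of \<open>s\<close> plus a vector of
  the smaller span collects all terms containing \<open>s\<close> into one wedge.\<close>

lemma wspan_insert:
  fixes s :: "'a::field^6"
  assumes "B \<in> wspan (vec.span (insert s T))"
  obtains y B' where "y \<in> vec.span T" "B' \<in> wspan (vec.span T)" "B = wedge s y + B'"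
  using assms
proof (induction arbitrary: thesis rule: wspan.induct)
  case zero
  show ?case by (rule zero[of 0 0]) (auto intro: wspan.zero vec.span_zero)
next
  case (add u v B)
  obtain y B' where yB: "y \<in> vec.span T" "B' \<in> wspan (vec.span T)" "B = wedge s y + B'"
    using add.IH by blast
  obtain a b where a: "u - a *s s \<in> vec.span T" and b: "v - b *s s \<in> vec.span T"
    using add.hyps(1,2) by (auto simp: vec.span_insert)
  define u' v' where "u' = u - a *s s" and "v' = v - b *s s"
  have uv: "u = a *s s + u'" "v = b *s s + v'" by (simp_all add: u'_def v'_def)
  have T: "u' \<in> vec.span T" "v' \<in> vec.span T" using a b by (simp_all only: u'_def v'_def)
  show ?case
  proof (rule add.prems)
    show "(a *s v' - b *s u') + y \<in> vec.span T"
      by (intro vec.span_add vec.span_diff vec.span_scale T yB(1))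
    show "wedge u' v' + B' \<in> wspan (vec.span T)"
      by (intro wspan.add T yB(2))
    show "wedge u v + B = wedge s ((a *s v' - b *s u') + y) + (wedge u' v' + B')"
      unfolding yB uv by (simp add: wedge_unfold algebra_simps)
  qed
qed

lemma wspan_empty: "B \<in> wspan (vec.span {}) \<Longrightarrow> B = 0"
  by (induction rule: wspan.induct) auto

lemma wspan_2:
  assumes "B \<in> wspan (vec.span {a, b})"
  obtains c where "B = smat c (wedge a b)"
proof -
  obtain y B' where 1: "y \<in> vec.span {b}" "B' \<in> wspan (vec.span {b})" "B = wedge a y + B'"
    using wspan_insert[OF assms] by blast
  obtain z B'' where 2: "z \<in> vec.span {}" "B'' \<in> wspan (vec.span {})" "B' = wedge b z + B''"
    using wspan_insert[OF 1(2)] by blast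
  obtain c where c: "y = c *s b" using 1(1) by (auto simp: vec.span_singleton)
  have "z = 0" using 2(1) by simp
  then have "B = smat c (wedge a b)"
    using wspan_empty[OF 2(2)] by (simp add: 1(3) 2(3) c wedge_unfold algebra_simps)
  then show ?thesis using that by blast
qed

lemma fr_repl:
  assumes "fr a b c d e f" "a' = k *s a + r" "k \<noteq> 0" "r \<in> vec.span {b, c, d, e, f}"
  shows "fr a' b c d e f"
proof -
  let ?S = "{b, c, d, e, f}"
  have r: "r \<in> vec.span (insert a' ?S)" using assms(4) vec.span_mono[of ?S "insert a' ?S"] by blast
  have "a = inverse k *s (a' - r)" using assms(2,3) by (simp add: vec.scale_scale)
  then have "a \<in> vec.span (insert a' ?S)"
    using r by (auto intro!: vec.span_scale vec.span_diff intro: vec.span_base)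
  then have "{a, b, c, d, e, f} \<subseteq> vec.span (insert a' ?S)" by (auto intro: vec.span_base)
  then have "vec.span {a, b, c, d, e, f} \<subseteq> vec.span (insert a' ?S)"
    by (rule vec.span_minimal) (rule vec.subspace_span)
  then show ?thesis using assms(1) by (simp add: fr_def top.extremum_unique)
qed

subsection \<open>Normal forms\<close>

abbreviation ew :: "6 \<Rightarrow> 6 \<Rightarrow> 'a::field^6^6" where "ew i j \<equiv> wedge (E i) (E j)"

text \<open>The suffixes encode the Kronecker type of the alternating pencil. Digits are sizes of
  regular blocks, written together when they belong to the same degenerate member; \<open>L1\<close>
  and \<open>L2\<close> are the singular blocks on three and five vectors; underscores separate the
  rest. The indices of the thirteen forms are arranged so that each lies in \<open>Z\<close> of an
  index with increasing entries.\<close>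

definition "z_1 = mk 0 (ew 4 5)"
definition "z_11 = mk 0 (ew 2 3 + ew 4 5)"
definition "z_111 = mk 0 (ew 0 1 + ew 2 3 + ew 4 5)"
definition "z_L1 = mk (ew 3 5) (ew 4 5)"
definition "z_1_1 = mk (ew 2 3) (ew 4 5)"
definition "z_2 = mk (ew 4 5) (ew 2 4 + ew 3 5)"
definition "z_L1_1 = mk (ew 2 5) (ew 1 5 + ew 3 4)"
definition "z_21 = mk (ew 4 5) (ew 0 4 + ew 1 5 + ew 2 3)"
definition "z_11_1 = mk (ew 4 5) (ew 0 1 + ew 2 3)"
definition "z_L2 = mk (ew 1 4 + ew 2 5) (ew 1 5 + ew 3 4)"
definition "z_L1_L1 = mk (ew 0 4 + ew 1 5) (ew 2 4 + ew 3 5)"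
definition "z_2_1 = mk (ew 2 3 + ew 4 5) (ew 0 2 + ew 1 3)"
definition "z_3 = mk (ew 2 4 + ew 3 5) (ew 0 4 + ew 1 5 + ew 2 3)"
text \<open>With \<open>A\<close>, \<open>B\<close> the two components, the Pfaffian of
  \<open>s A + t B\<close> on the last four vectors is \<open>s^2 + g s t - b t^2\<close>. Its
  discriminant \<open>g^2 + 4 b\<close> makes sense in every characteristic; in characteristic two
  it is nonzero exactly when \<open>g\<close> is.\<close>

definition "z_N g b = mk (ew 2 3 + ew 4 5) (ew 2 4 + smat b (ew 3 5) + smat g (ew 4 5))"
text \<open>The additional plane multiplies the Pfaffian by \<open>t\<close>, so the first component
  is a third degenerate member.\<close>

definition "z_S g b = mk (ew 2 3 + ew 4 5) (ew 0 1 + ew 2 4 + smat b (ew 3 5) + smat g (ew 4 5))"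

lemma congr_zero: "F ** (0 :: 'a::comm_ring_1^6^6) ** transpose F = 0"
  by (simp add: matrix_matrix_mult_def vec_eq_iff)

lemmas congr_simps = congr_add congr_wedge congr_smat congr_zero

lemma nf_1: "fr v0 v1 v2 v3 v4 v5 \<Longrightarrow> A = 0 \<Longrightarrow>
    B = wedge v4 v5 \<Longrightarrow> mk A B \<sim>\<^sub>G z_1"
  using equivG_frame[of v0 v1 v2 v3 v4 v5 "0"
      "ew 4 5"]
  by (auto simp: congr_simps z_1_def)

lemma nf_11: "fr v0 v1 v2 v3 v4 v5 \<Longrightarrow> A = 0 \<Longrightarrow>
    B = wedge v2 v3 + wedge v4 v5 \<Longrightarrow> mk A B \<sim>\<^sub>G z_11"
  using equivG_frame[of v0 v1 v2 v3 v4 v5 "0"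
      "ew 2 3 + ew 4 5"]
  by (auto simp: congr_simps z_11_def)

lemma nf_111: "fr v0 v1 v2 v3 v4 v5 \<Longrightarrow> A = 0 \<Longrightarrow>
    B = wedge v0 v1 + wedge v2 v3 + wedge v4 v5 \<Longrightarrow> mk A B \<sim>\<^sub>G z_111"
  using equivG_frame[of v0 v1 v2 v3 v4 v5 "0"
      "ew 0 1 + ew 2 3 + ew 4 5"]
  by (auto simp: congr_simps z_111_def)

lemma nf_L1: "fr v0 v1 v2 v3 v4 v5 \<Longrightarrow> A = wedge v3 v5 \<Longrightarrow>
    B = wedge v4 v5 \<Longrightarrow> mk A B \<sim>\<^sub>G z_L1"
  using equivG_frame[of v0 v1 v2 v3 v4 v5 "ew 3 5"
      "ew 4 5"]
  by (auto simp: congr_simps z_L1_def)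

lemma nf_1_1: "fr v0 v1 v2 v3 v4 v5 \<Longrightarrow> A = wedge v2 v3 \<Longrightarrow>
    B = wedge v4 v5 \<Longrightarrow> mk A B \<sim>\<^sub>G z_1_1"
  using equivG_frame[of v0 v1 v2 v3 v4 v5 "ew 2 3"
      "ew 4 5"]
  by (auto simp: congr_simps z_1_1_def)

lemma nf_2: "fr v0 v1 v2 v3 v4 v5 \<Longrightarrow> A = wedge v4 v5 \<Longrightarrow>
    B = wedge v2 v4 + wedge v3 v5 \<Longrightarrow> mk A B \<sim>\<^sub>G z_2"
  using equivG_frame[of v0 v1 v2 v3 v4 v5 "ew 4 5"
      "ew 2 4 + ew 3 5"]
  by (auto simp: congr_simps z_2_def)

lemma nf_L1_1: "fr v0 v1 v2 v3 v4 v5 \<Longrightarrow> A = wedge v2 v5 \<Longrightarrow>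
    B = wedge v1 v5 + wedge v3 v4 \<Longrightarrow> mk A B \<sim>\<^sub>G z_L1_1"
  using equivG_frame[of v0 v1 v2 v3 v4 v5 "ew 2 5"
      "ew 1 5 + ew 3 4"]
  by (auto simp: congr_simps z_L1_1_def)

lemma nf_21: "fr v0 v1 v2 v3 v4 v5 \<Longrightarrow> A = wedge v4 v5 \<Longrightarrow>
    B = wedge v0 v4 + wedge v1 v5 + wedge v2 v3 \<Longrightarrow> mk A B \<sim>\<^sub>G z_21"
  using equivG_frame[of v0 v1 v2 v3 v4 v5 "ew 4 5"
      "ew 0 4 + ew 1 5 + ew 2 3"]
  by (auto simp: congr_simps z_21_def)

lemma nf_11_1: "fr v0 v1 v2 v3 v4 v5 \<Longrightarrow> A = wedge v4 v5 \<Longrightarrow>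
    B = wedge v0 v1 + wedge v2 v3 \<Longrightarrow> mk A B \<sim>\<^sub>G z_11_1"
  using equivG_frame[of v0 v1 v2 v3 v4 v5 "ew 4 5"
      "ew 0 1 + ew 2 3"]
  by (auto simp: congr_simps z_11_1_def)

lemma nf_L2: "fr v0 v1 v2 v3 v4 v5 \<Longrightarrow> A = wedge v1 v4 + wedge v2 v5 \<Longrightarrow>
    B = wedge v1 v5 + wedge v3 v4 \<Longrightarrow> mk A B \<sim>\<^sub>G z_L2"
  using equivG_frame[of v0 v1 v2 v3 v4 v5 "ew 1 4 + ew 2 5"
      "ew 1 5 + ew 3 4"]
  by (auto simp: congr_simps z_L2_def)

lemma nf_L1_L1: "fr v0 v1 v2 v3 v4 v5 \<Longrightarrow> A = wedge v0 v4 + wedge v1 v5 \<Longrightarrow>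
    B = wedge v2 v4 + wedge v3 v5 \<Longrightarrow> mk A B \<sim>\<^sub>G z_L1_L1"
  using equivG_frame[of v0 v1 v2 v3 v4 v5 "ew 0 4 + ew 1 5"
      "ew 2 4 + ew 3 5"]
  by (auto simp: congr_simps z_L1_L1_def)

lemma nf_2_1: "fr v0 v1 v2 v3 v4 v5 \<Longrightarrow> A = wedge v2 v3 + wedge v4 v5 \<Longrightarrow>
    B = wedge v0 v2 + wedge v1 v3 \<Longrightarrow> mk A B \<sim>\<^sub>G z_2_1"
  using equivG_frame[of v0 v1 v2 v3 v4 v5 "ew 2 3 + ew 4 5"
      "ew 0 2 + ew 1 3"]
  by (auto simp: congr_simps z_2_1_def)

lemma nf_3: "fr v0 v1 v2 v3 v4 v5 \<Longrightarrow> A = wedge v2 v4 + wedge v3 v5 \<Longrightarrow>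
    B = wedge v0 v4 + wedge v1 v5 + wedge v2 v3 \<Longrightarrow> mk A B \<sim>\<^sub>G z_3"
  using equivG_frame[of v0 v1 v2 v3 v4 v5 "ew 2 4 + ew 3 5"
      "ew 0 4 + ew 1 5 + ew 2 3"]
  by (auto simp: congr_simps z_3_def)

lemma nf_N: "fr v0 v1 v2 v3 v4 v5 \<Longrightarrow> A = wedge v2 v3 + wedge v4 v5 \<Longrightarrow>
    B = wedge v2 v4 + smat b (wedge v3 v5) + smat g (wedge v4 v5) \<Longrightarrow> mk A B \<sim>\<^sub>G z_N g b"
  using equivG_frame[of v0 v1 v2 v3 v4 v5 "ew 2 3 + ew 4 5"
      "ew 2 4 + smat b (ew 3 5) + smat g (ew 4 5)"]
  by (auto simp: congr_simps z_N_def)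

lemma nf_S: "fr v0 v1 v2 v3 v4 v5 \<Longrightarrow> A = wedge v2 v3 + wedge v4 v5 \<Longrightarrow>
    B = wedge v0 v1 + wedge v2 v4 + smat b (wedge v3 v5) + smat g (wedge v4 v5) \<Longrightarrow> mk A B \<sim>\<^sub>G z_S g b"
  using equivG_frame[of v0 v1 v2 v3 v4 v5 "ew 2 3 + ew 4 5"
      "ew 0 1 + ew 2 4 + smat b (ew 3 5) + smat g (ew 4 5)"]
  by (auto simp: congr_simps z_S_def)

subsection \<open>Adapting a spanning list to vectors and bivectors\<close>

lemma span_insert_cong: "vec.span S = vec.span T \<Longrightarrow> vec.span (insert a S) = vec.span (insert a T)"
  by (simp add: vec.span_insert)

lemma span_Un_cong: "vec.span S = vec.span S' \<Longrightarrow> vec.span T = vec.span T' \<Longrightarrow> vec.span (S \<union> T) = vec.span (S' \<union> T')"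
  by (simp add: vec.span_Un)

lemma span_insert_swap:
  assumes "a \<in> vec.span (insert b S)" "b \<in> vec.span (insert a S)"
  shows "vec.span (insert a S) = vec.span (insert b S)"
proof -
  have "insert a S \<subseteq> vec.span (insert b S)" "insert b S \<subseteq> vec.span (insert a S)"
    using assms vec.span_superset by fastforce+
  then show ?thesis by (simp only: vec.span_eq)
qed

text \<open>Steinitz exchange: the dropped entry is one whose tail no longer spans \<open>v\<close>.
  Lists keep count of the vectors, where a set could collapse.\<close>

lemma exchange_list:
  fixes v :: "'a::field^'n"
  assumes "v \<in> vec.span (set xs)" "v \<noteq> 0"
  obtains ys where "length xs = Suc (length ys)" "vec.span (insert v (set ys)) = vec.span (set xs)"
  using assms
proof (induction xs arbitrary: thesis)
  case (Cons e xs)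
  show ?case
  proof (cases "v \<in> vec.span (set xs)")
    case True
    then obtain ys where ys: "length xs = Suc (length ys)" "vec.span (insert v (set ys)) = vec.span (set xs)"
      using Cons.IH Cons.prems(3) by blast
    show ?thesis
    proof (rule Cons.prems(1)[of "e # ys"])
      show "vec.span (insert v (set (e # ys))) = vec.span (set (e # xs))"
        using span_insert_cong[OF ys(2), of e] by (simp add: insert_commute)
    qed (use ys in simp)
  next
    case False
    have v: "v \<in> vec.span (insert e (set xs))" using Cons.prems(2) by simp
    have e: "e \<in> vec.span (insert v (set xs))" by (rule vec.in_span_insert[OF v False])
    show ?thesis
    proof (rule Cons.prems(1)[of xs])
      show "vec.span (insert v (set xs)) = vec.span (set (e # xs))"
        using span_insert_swap[OF v e] by simp
    qed simp
  qed
qed simp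

text \<open>One step of the Darboux reduction. The partner \<open>y\<close> of the first vector
  \<open>s\<close> is exchanged into the list, and the terms of the remainder that contain
  \<open>y\<close> are collected as well, so that both vectors leave the remainder.\<close>

lemma bivector_step:
  fixes B :: "'a::field^6^6"
  assumes "B \<in> wspan (vec.span (set xs))" "B \<noteq> 0"
  obtains u v ys B' where "length xs = Suc (Suc (length ys))"
    "vec.span (insert u (insert v (set ys))) = vec.span (set xs)"
    "B' \<in> wspan (vec.span (set ys))" "B = wedge u v + B'"
  using assms
proof (induction xs arbitrary: thesis)
  case Nil
  then show ?case using wspan_empty[of B] by simp
next
  case (Cons s xs)
  have "B \<in> wspan (vec.span (insert s (set xs)))" using Cons.prems(2) by simp
  then obtain y B1 where yB: "y \<in> vec.span (set xs)" "B1 \<in> wspan (vec.span (set xs))" "B = wedge s y + B1"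
    by (rule wspan_insert) (rule that)
  show ?case
  proof (cases "y = 0")
    case True
    then have "B \<in> wspan (vec.span (set xs))" using yB by simp
    then obtain u v ys B' where *: "length xs = Suc (Suc (length ys))"
      "vec.span (insert u (insert v (set ys))) = vec.span (set xs)"
      "B' \<in> wspan (vec.span (set ys))" "B = wedge u v + B'"
      using Cons.IH Cons.prems(3) by blast
    show ?thesis
    proof (rule Cons.prems(1)[of "s # ys" u v B'])
      show "vec.span (insert u (insert v (set (s # ys)))) = vec.span (set (s # xs))"
        using span_insert_cong[OF *(2), of s] by (simp add: insert_commute)
      show "B' \<in> wspan (vec.span (set (s # ys)))"
        by (rule wspan_mono[OF *(3)], rule vec.span_mono) auto
    qed (use * in simp_all)
  next
    case False
    obtain ys where ys: "length xs = Suc (length ys)" "vec.span (insert y (set ys)) = vec.span (set xs)"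
      using exchange_list[OF yB(1) False] by blast
    have "B1 \<in> wspan (vec.span (insert y (set ys)))" using yB(2) ys(2) by simp
    then obtain t B2 where t: "t \<in> vec.span (set ys)" "B2 \<in> wspan (vec.span (set ys))" "B1 = wedge y t + B2"
      by (rule wspan_insert) (rule that)
    show ?thesis
    \<comment> \<open>The sum of \<open>wedge s y\<close> and \<open>wedge y t\<close> is the single
      wedge of \<open>s - t\<close> and \<open>y\<close>.\<close>
    proof (rule Cons.prems(1)[of ys "s - t" y B2])
      have t': "t \<in> vec.span (insert s (insert y (set ys)))" "t \<in> vec.span (insert (s - t) (insert y (set ys)))"
        using t(1) vec.span_mono[of "set ys" "insert s (insert y (set ys))"]
          vec.span_mono[of "set ys" "insert (s - t) (insert y (set ys))"] by blast+
      have "s - t \<in> vec.span (insert s (insert y (set ys)))"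
        by (intro vec.span_diff t' vec.span_base) simp
      moreover have "s \<in> vec.span (insert (s - t) (insert y (set ys)))"
        using vec.span_add[OF vec.span_base[of "s - t"] t'(2)] by simp
      ultimately have "vec.span (insert (s - t) (insert y (set ys))) = vec.span (insert s (insert y (set ys)))"
        by (rule span_insert_swap)
      then show "vec.span (insert (s - t) (insert y (set ys))) = vec.span (set (s # xs))"
        using span_insert_cong[OF ys(2), of s] by simp
      show "B = wedge (s - t) y + B2" unfolding yB t by (simp add: wedge_unfold algebra_simps)
    qed (use ys t in simp_all)
  qed
qed

text \<open>The cases are the ranks of the pair \<open>a\<close>, \<open>b\<close>. In rank one a
  change of \<open>f0\<close>, \<open>f1\<close> of determinant one merges the two wedges and leaves
  the bivector of the plane unchanged.\<close>

lemma pair_cases: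
  fixes a b f0 f1 :: "'a::field^6"
  assumes "a \<in> vec.span (set xs)" "b \<in> vec.span (set xs)"
  obtains (zero) "wedge f0 a + wedge f1 b = 0"
  | (one) g0 g1 c ys where "wedge g0 g1 = wedge f0 f1" "vec.span {g0, g1} = vec.span {f0, f1}"
      "wedge f0 a + wedge f1 b = wedge g0 c" "length xs = Suc (length ys)"
      "vec.span (insert c (set ys)) = vec.span (set xs)"
  | (two) ys where "length xs = Suc (Suc (length ys))" "vec.span (insert a (insert b (set ys))) = vec.span (set xs)"
proof (cases "a = 0")
  case True
  show ?thesis
  proof (cases "b = 0")
    case True then show ?thesis using \<open>a = 0\<close> zero by simp
  next
    case False
    then obtain ys where ys: "length xs = Suc (length ys)" "vec.span (insert b (set ys)) = vec.span (set xs)"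
      using exchange_list[OF assms(2)] by blast
    show ?thesis
    proof (rule one[of f1 "- f0" b ys])
      show "vec.span {f1, - f0} = vec.span {f0, f1}"
      proof -
        have "- f0 \<in> vec.span {f0, f1}" by (intro vec.span_neg vec.span_base) simp
        moreover have "f0 \<in> vec.span {- f0, f1}"
          using vec.span_neg[OF vec.span_base[of "- f0" "{- f0, f1}"]] by simp
        ultimately have "vec.span {- f0, f1} = vec.span {f0, f1}" by (rule span_insert_swap)
        then show ?thesis by (simp add: insert_commute)
      qed
    qed (use ys True in \<open>simp_all add: wedge_unfold\<close>)
  qed
next
  case False
  then obtain ys where ys: "length xs = Suc (length ys)" "vec.span (insert a (set ys)) = vec.span (set xs)"
    using exchange_list[OF assms(1)] by blast
  have "b \<in> vec.span (insert a (set ys))" using assms(2) ys(2) by simp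
  then obtain t where t: "b - t *s a \<in> vec.span (set ys)" by (auto simp: vec.span_insert)
  show ?thesis
  proof (cases "b - t *s a = 0")
    case True
    then have b: "b = t *s a" by simp
    show ?thesis
    proof (rule one[of "f0 + t *s f1" f1 a ys])
      have "f0 + t *s f1 \<in> vec.span {f0, f1}" by (intro vec.span_add vec.span_scale vec.span_base) simp_all
      moreover have "f0 \<in> vec.span {f0 + t *s f1, f1}"
        using vec.span_diff[OF vec.span_base[of "f0 + t *s f1"] vec.span_scale[OF vec.span_base[of f1]], of "{f0 + t *s f1, f1}" t]
        by simp
      ultimately show "vec.span {f0 + t *s f1, f1} = vec.span {f0, f1}"
        by (rule span_insert_swap)
    qed (use ys in \<open>simp_all add: b wedge_unfold algebra_simps\<close>)
  next
    case False
    then obtain zs where zs: "length ys = Suc (length zs)" "vec.span (insert (b - t *s a) (set zs)) = vec.span (set ys)"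
      using exchange_list[OF t] by blast
    show ?thesis
    proof (rule two[of zs])
      let ?S = "insert a (insert b (set zs))" and ?T = "insert a (insert (b - t *s a) (set zs))"
      let ?U = "insert a (set zs)"
      have "b \<in> vec.span (insert (b - t *s a) ?U)"
        using vec.span_add[OF vec.span_base[of "b - t *s a"] vec.span_scale[OF vec.span_base[of a]], of "insert (b - t *s a) ?U" t]
        by simp
      moreover have "b - t *s a \<in> vec.span (insert b ?U)"
        by (intro vec.span_diff vec.span_scale vec.span_base) simp_all
      ultimately have "vec.span (insert b ?U) = vec.span (insert (b - t *s a) ?U)"
        by (rule span_insert_swap)
      then have "vec.span ?S = vec.span ?T" by (simp add: insert_commute)
      also have "\<dots> = vec.span (set xs)" using span_insert_cong[OF zs(2), of a] ys(2) by simp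
      finally show "vec.span ?S = vec.span (set xs)" .
    qed (use ys zs in simp)
  qed
qed

lemma fr_perm: "fr a b c d e f \<Longrightarrow> {a, b, c, d, e, f} = {a', b', c', d', e', f'} \<Longrightarrow> fr a' b' c' d' e' f'"
  by (simp add: fr_def)

subsection \<open>Classification\<close>

definition nforms :: "'a::field rep set" where
  "nforms = {z_1, z_11, z_111, z_L1, z_1_1, z_2, z_L1_1, z_21, z_11_1, z_L2, z_L1_L1, z_2_1, z_3}"

text \<open>The list is not free of repetitions: a member of the first family whose quadratic has a
  root in the field is equivalent to \<open>z_1_1\<close>.\<close>

definition cls :: "'a::field rep \<Rightarrow> bool" where
  "cls x \<longleftrightarrow> x = 0 \<or> (\<exists>z\<in>nforms. x \<sim>\<^sub>G z) \<or> (\<exists>g b. g\<^sup>2 + 4 * b \<noteq> 0 \<and> x \<sim>\<^sub>G z_N g b) \<or>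
    (\<exists>g b. g\<^sup>2 + 4 * b \<noteq> 0 \<and> x \<sim>\<^sub>G z_S g b)"

lemma act_zero: "act g 0 = 0"
  by (simp add: vec_eq_iff act_component)

lemma cls_equivG: assumes "x \<sim>\<^sub>G y" "cls y" shows "cls x"
proof (cases "y = 0")
  case True
  then have "x = 0" using equivG_sym[OF assms(1)] by (auto simp: equivG_def act_zero)
  then show ?thesis by (simp add: cls_def)
next
  case False
  then show ?thesis using assms equivG_trans unfolding cls_def by meson
qed

lemma cls_z:
  "x \<sim>\<^sub>G z_1 \<Longrightarrow> cls x"
  "x \<sim>\<^sub>G z_11 \<Longrightarrow> cls x"
  "x \<sim>\<^sub>G z_111 \<Longrightarrow> cls x"
  "x \<sim>\<^sub>G z_L1 \<Longrightarrow> cls x"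
  "x \<sim>\<^sub>G z_1_1 \<Longrightarrow> cls x"
  "x \<sim>\<^sub>G z_2 \<Longrightarrow> cls x"
  "x \<sim>\<^sub>G z_L1_1 \<Longrightarrow> cls x"
  "x \<sim>\<^sub>G z_21 \<Longrightarrow> cls x"
  "x \<sim>\<^sub>G z_11_1 \<Longrightarrow> cls x"
  "x \<sim>\<^sub>G z_L2 \<Longrightarrow> cls x"
  "x \<sim>\<^sub>G z_L1_L1 \<Longrightarrow> cls x"
  "x \<sim>\<^sub>G z_2_1 \<Longrightarrow> cls x"
  "x \<sim>\<^sub>G z_3 \<Longrightarrow> cls x"
  unfolding cls_def nforms_def by blast+

lemma cls_shift: "cls (mk A (B + smat t A)) \<Longrightarrow> cls (mk A B)"
proof (rule cls_equivG)
  have "mk A B \<sim>\<^sub>G mk (smat 1 A + smat 0 B) (smat t A + smat 1 B)" by (rule equivG_gl2) simp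
  also have "mk (smat 1 A + smat 0 B) (smat t A + smat 1 B) = mk A (B + smat t A)"
    by (simp add: wedge_unfold mk_def)
  finally show "mk A B \<sim>\<^sub>G mk A (B + smat t A)" .
qed

lemma cls_swap: "cls (mk B A) \<Longrightarrow> cls (mk A B)"
proof (rule cls_equivG)
  have "mk A B \<sim>\<^sub>G mk (smat 0 A + smat 1 B) (smat 1 A + smat 0 B)" by (rule equivG_gl2) simp
  also have "mk (smat 0 A + smat 1 B) (smat 1 A + smat 0 B) = mk B A"
    by (simp add: wedge_unfold mk_def)
  finally show "mk A B \<sim>\<^sub>G mk B A" .
qed

lemma fr_neg: "fr a b c d e f \<Longrightarrow> fr (- a) b c d e f"
  by (erule fr_repl[of _ _ _ _ _ _ _ "-1" 0]) (simp_all add: vec.span_zero vec_eq_iff)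

lemma span_pair_iff: "x \<in> vec.span {p, q} \<longleftrightarrow> (\<exists>s t. x = s *s p + t *s q)" for x :: "'a::field^'n"
proof
  assume "x \<in> vec.span {p, q}"
  then obtain s where "x - s *s p \<in> vec.span {q}" unfolding vec.span_insert[of p] by blast
  then obtain t where "x - s *s p = t *s q" unfolding vec.span_singleton by blast
  then have "x = s *s p + t *s q" by (simp add: algebra_simps)
  then show "\<exists>s t. x = s *s p + t *s q" by blast
qed (auto intro!: vec.span_add vec.span_scale intro: vec.span_base)

lemma fr_add2:
  assumes "fr a b c d e f" "k \<noteq> 0"
  shows "fr (k *s a + (s *s b + t *s c)) b c d e f"
  by (rule fr_repl[OF assms(1) refl assms(2)]) (intro vec.span_add vec.span_scale vec.span_base; simp)

lemma fr_add2_1: "fr a b c d e f \<Longrightarrow> fr (a + (s *s b + t *s c)) b c d e f"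
  using fr_add2[of a b c d e f 1] by simp

lemma span_E: "vec.span (set [E 0, E 1, E 2, E 3, E 4, E 5 :: 'a::field^6]) = UNIV"
proof -
  have "x \<in> vec.span (set [E 0, E 1, E 2, E 3, E 4, E 5])" for x :: "'a^6"
  proof -
    have "x = x $ 0 *s E 0 + x $ 1 *s E 1 + x $ 2 *s E 2 + x $ 3 *s E 3 + x $ 4 *s E 4 + x $ 5 *s E 5"
      by (simp add: vec_eq_iff forall_6 E_def axis_def)
    also have "\<dots> \<in> vec.span (set [E 0, E 1, E 2, E 3, E 4, E 5])"
      by (intro vec.span_add vec.span_scale vec.span_base) simp_all
    finally show ?thesis .
  qed
  then show ?thesis by blast
qed

text \<open>Up to three planes are split off \<open>B\<close>. Their number is half its rank and
  decides between zero, \<open>z_1\<close>, \<open>z_11\<close> and \<open>z_111\<close>.\<close>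

lemma cls_A_zero:
  fixes B :: "'a::field^6^6"
  assumes "B \<in> wspan UNIV"
  shows "cls (mk 0 B)"
proof (cases "B = 0")
  case True
  then have "mk 0 B = 0" by (simp add: vec_eq_iff mk_def)
  then show ?thesis by (simp add: cls_def)
next
  case False
  let ?xs = "[E 0, E 1, E 2, E 3, E 4, E 5 :: 'a^6]"
  have "B \<in> wspan (vec.span (set ?xs))" unfolding span_E by (rule assms)
  then obtain u v ys B1 where 1: "length ?xs = Suc (Suc (length ys))" "vec.span (insert u (insert v (set ys))) = vec.span (set ?xs)"
    "B1 \<in> wspan (vec.span (set ys))" "B = wedge u v + B1"
    by (rule bivector_step[OF _ False]) (rule that)
  note sp = 1(2)[unfolded span_E]
  have "length ys = Suc (Suc (Suc (Suc 0)))" using 1(1) by simp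
  then obtain c d e f where ys: "ys = [c, d, e, f]" unfolding length_Suc_conv length_0_conv by blast
  show ?thesis
  proof (cases "B1 = 0")
    case True
    have "fr u v c d e f" using sp by (simp add: ys fr_def)
    then have "fr c d e f u v" by (rule fr_perm) auto
    from nf_1[OF this refl] show ?thesis unfolding 1(4) True by (simp add: cls_z)
  next
    case False
    obtain p q zs B2 where 2: "length ys = Suc (Suc (length zs))" "vec.span (insert p (insert q (set zs))) = vec.span (set ys)"
      "B2 \<in> wspan (vec.span (set zs))" "B1 = wedge p q + B2"
      by (rule bivector_step[OF 1(3) False]) (rule that)
    have "length zs = Suc (Suc 0)" using 2(1) ys by simp
    then obtain m n where zs: "zs = [m, n]" unfolding length_Suc_conv length_0_conv by blast
    have "B2 \<in> wspan (vec.span {m, n})" using 2(3) by (simp only: zs list.set)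
    then obtain k where k: "B2 = smat k (wedge m n)" by (rule wspan_2) (rule that)
    have "fr u v p q m n"
      using sp span_insert_cong[OF span_insert_cong[OF 2(2)], of u v] by (simp add: zs fr_def)
    then have fr: "fr m n u v p q" by (rule fr_perm) auto
    show ?thesis
    proof (cases "k = 0")
      case True
      then have "B = wedge u v + wedge p q" using 1 2 k by (simp add: wedge_unfold)
      from nf_11[OF fr refl this] show ?thesis by (rule cls_z)
    next
      case False
      have fr': "fr (k *s m) n u v p q" by (rule fr_repl[OF fr, of _ k 0]) (simp_all add: False vec.span_zero)
      have "B = wedge (k *s m) n + wedge u v + wedge p q" using 1 2 k by (simp add: wedge_unfold algebra_simps)
      from nf_111[OF fr' refl this] show ?thesis by (rule cls_z)
    qed
  qed
qed

text \<open>The cases are the rank of \<open>B2\<close>, which is the second bivector modulo the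
  plane of \<open>f0\<close> and \<open>f1\<close>, and then the rank of what remains of
  \<open>a\<close> and \<open>b\<close>. Components of \<open>a\<close> and \<open>b\<close> along a
  plane of \<open>B2\<close> are absorbed into that plane.\<close>

lemma cls_decomposable_aux:
  fixes f0 :: "'a::field^6"
  assumes fr: "fr f0 f1 c d e f" and ab: "a \<in> vec.span {c, d, e, f}" "b \<in> vec.span {c, d, e, f}"
    and B2: "B2 \<in> wspan (vec.span {c, d, e, f})"
  shows "cls (mk (wedge f0 f1) (wedge f0 a + wedge f1 b + B2))"
proof (cases "B2 = 0")
  case True
  let ?xs = "[c, d, e, f]"
  have ab': "a \<in> vec.span (set ?xs)" "b \<in> vec.span (set ?xs)" using ab by simp_all
  show ?thesis
  proof (cases rule: pair_cases[OF ab', of f0 f1, case_names zero one two])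
    case zero
    have "fr c d e f f0 f1" using fr by (rule fr_perm) auto
    from nf_1[OF this refl refl] have "cls (mk 0 (wedge f0 f1))" by (rule cls_z)
    moreover have "wedge f0 a + wedge f1 b + B2 = 0" unfolding zero True by simp
    ultimately show ?thesis by - (rule cls_swap, simp only:)
  next
    case (one g0 g1 h ys)
    have "length ys = Suc (Suc (Suc 0))" using one(4) by simp
    then obtain p q r where ys: "ys = [p, q, r]" unfolding length_Suc_conv length_0_conv by blast
    have "fr g0 g1 h p q r"
      using span_Un_cong[OF one(2,5)] fr by (simp add: ys fr_def insert_commute)
    then have "fr (- g0) g1 h p q r" by (rule fr_neg)
    then have "fr p q r g1 h (- g0)" by (rule fr_perm) auto
    from nf_L1[OF this refl refl] have "cls (mk (wedge g1 (- g0)) (wedge h (- g0)))"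
      by (rule cls_z)
    moreover have "wedge g1 (- g0) = wedge f0 f1" unfolding one(1)[symmetric] by (simp add: wedge_unfold)
    moreover have "wedge h (- g0) = wedge f0 a + wedge f1 b + B2" unfolding one(3) True by (simp add: wedge_unfold)
    ultimately show ?thesis by (simp only:)
  next
    case (two ys)
    have "length ys = Suc (Suc 0)" using two(1) by simp
    then obtain p q where ys: "ys = [p, q]" unfolding length_Suc_conv length_0_conv by blast
    have "fr f0 f1 a b p q"
      using span_insert_cong[OF span_insert_cong[OF two(2)], of f0 f1] fr by (simp add: ys fr_def)
    then have "fr (- f0) f1 a b p q" by (rule fr_neg)
    then have "fr f1 a b p q (- f0)" by (rule fr_perm) auto
    then have "fr (- f1) a b p q (- f0)" by (rule fr_neg)
    then have "fr p q a b (- f0) (- f1)" by (rule fr_perm) auto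
    from nf_2[OF this refl refl] have "cls (mk (wedge (- f0) (- f1)) (wedge a (- f0) + wedge b (- f1)))"
      by (rule cls_z)
    moreover have "wedge (- f0) (- f1) = wedge f0 f1" by (simp add: wedge_unfold)
    moreover have "wedge a (- f0) + wedge b (- f1) = wedge f0 a + wedge f1 b + B2"
      unfolding True by (simp add: wedge_unfold)
    ultimately show ?thesis by (simp only:)
  qed
next
  case False
  let ?xs = "[c, d, e, f]"
  have B2': "B2 \<in> wspan (vec.span (set ?xs))" using B2 by simp
  obtain u v ys B3 where 1: "length ?xs = Suc (Suc (length ys))" "vec.span (insert u (insert v (set ys))) = vec.span (set ?xs)"
    "B3 \<in> wspan (vec.span (set ys))" "B2 = wedge u v + B3"
    by (rule bivector_step[OF B2' False]) (rule that)
  have "length ys = Suc (Suc 0)" using 1(1) by simp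
  then obtain p q where ys: "ys = [p, q]" unfolding length_Suc_conv length_0_conv by blast
  have "B3 \<in> wspan (vec.span {p, q})" using 1(3) by (simp only: ys list.set)
  then obtain k where k: "B3 = smat k (wedge p q)" by (rule wspan_2) (rule that)
  have fr1: "fr f0 f1 u v p q"
    using span_insert_cong[OF span_insert_cong[OF 1(2)], of f0 f1] fr by (simp add: ys fr_def)
  have split: "\<exists>x1 x2 y. y \<in> vec.span {p, q} \<and> x = x1 *s u + x2 *s v + y" if "x \<in> vec.span {c, d, e, f}" for x
  proof -
    have "x \<in> vec.span (insert u (insert v {p, q}))" using that 1(2) by (simp add: ys)
    then obtain x1 where "x - x1 *s u \<in> vec.span (insert v {p, q})" unfolding vec.span_insert[of u] by blast
    then obtain x2 where "x - x1 *s u - x2 *s v \<in> vec.span {p, q}" unfolding vec.span_insert[of v] by blast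
    then show ?thesis by (intro exI[of _ x1] exI[of _ x2] exI[of _ "x - x1 *s u - x2 *s v"]) simp
  qed
  obtain a1 a2 a3 where a: "a3 \<in> vec.span {p, q}" "a = a1 *s u + a2 *s v + a3" using split[OF ab(1)] by blast
  obtain b1 b2 b3 where b: "b3 \<in> vec.span {p, q}" "b = b1 *s u + b2 *s v + b3" using split[OF ab(2)] by blast
  \<comment> \<open>The corrections in the direction of \<open>f0\<close>, \<open>f1\<close> swallow
    the components of \<open>a\<close> and \<open>b\<close> along \<open>u\<close>,
    \<open>v\<close>. The price is the multiple \<open>m\<close> of the first bivector, which a
    change of generators removes.\<close>
  define u' where "u' = u + (a2 *s f0 + b2 *s f1)"
  define v' where "v' = v + ((- a1) *s f0 + (- b1) *s f1)"
  have "fr u f0 f1 v p q" using fr1 by (rule fr_perm) auto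
  then have "fr u' f0 f1 v p q"
    unfolding u'_def by (rule fr_add2_1)
  then have "fr v f0 f1 u' p q" by (rule fr_perm) auto
  then have "fr v' f0 f1 u' p q"
    unfolding v'_def by (rule fr_add2_1)
  then have fr2: "fr f0 f1 u' v' p q" by (rule fr_perm) auto
  define m where "m = b2 * a1 - a2 * b1"
  have eq: "wedge f0 a + wedge f1 b + B2 + smat m (wedge f0 f1) =
      wedge u' v' + wedge f0 a3 + wedge f1 b3 + smat k (wedge p q)"
    unfolding 1(4) k a(2) b(2) u'_def v'_def m_def by (simp add: wedge_unfold algebra_simps)
  have main: "cls (mk (wedge f0 f1) (wedge u' v' + wedge f0 a3 + wedge f1 b3 + smat k (wedge p q)))"
  proof (cases "k = 0")
    case True
    have ab3: "a3 \<in> vec.span (set [p, q])" "b3 \<in> vec.span (set [p, q])" using a b by simp_all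
    show ?thesis
    proof (cases rule: pair_cases[OF ab3, of f0 f1, case_names zero one two])
      case zero
      have "fr p q f0 f1 u' v'" using fr2 by (rule fr_perm) auto
      from nf_1_1[OF this refl refl] have "cls (mk (wedge f0 f1) (wedge u' v'))"
        by (rule cls_z)
      moreover have "wedge u' v' + wedge f0 a3 + wedge f1 b3 + smat k (wedge p q) = wedge u' v'"
        unfolding add.assoc[of "wedge u' v'"] zero True by (simp add: wedge_unfold)
      ultimately show ?thesis by (simp only:)
    next
      case (one g0 g1 h ys)
      have "length ys = Suc 0" using one(4) by simp
      then obtain r where ys: "ys = [r]" unfolding length_Suc_conv length_0_conv by blast
      have "vec.span ({g0, g1} \<union> (insert h (set ys) \<union> {u', v'})) = vec.span ({f0, f1} \<union> (set [p, q] \<union> {u', v'}))"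
        by (intro span_Un_cong one refl)
      also have "{f0, f1} \<union> (set [p, q] \<union> {u', v'}) = {f0, f1, u', v', p, q}" by auto
      also have "vec.span \<dots> = UNIV" using fr2 by (simp add: fr_def)
      finally have "fr g0 g1 h r u' v'" by (simp add: ys fr_def insert_commute)
      then have "fr (- g0) g1 h r u' v'" by (rule fr_neg)
      then have "fr r h g1 u' v' (- g0)" by (rule fr_perm) auto
      from nf_L1_1[OF this refl refl] have "cls (mk (wedge g1 (- g0)) (wedge h (- g0) + wedge u' v'))"
        by (rule cls_z)
      moreover have "wedge g1 (- g0) = wedge f0 f1" unfolding one(1)[symmetric] by (simp add: wedge_unfold)
      moreover have "wedge h (- g0) + wedge u' v' = wedge u' v' + wedge f0 a3 + wedge f1 b3 + smat k (wedge p q)"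
        unfolding add.assoc[of "wedge u' v'"] one(3) True by (simp add: wedge_unfold)
      ultimately show ?thesis by (simp only:)
    next
      case (two ys)
      then have ys: "ys = []" by simp
      have "vec.span ({f0, f1, u', v'} \<union> {a3, b3}) = vec.span ({f0, f1, u', v'} \<union> {p, q})"
        using two(2) by (intro span_Un_cong refl) (simp add: ys)
      then have "fr f0 f1 u' v' a3 b3" using fr2 by (simp add: fr_def insert_commute)
      then have "fr (- f0) f1 u' v' a3 b3" by (rule fr_neg)
      then have "fr f1 u' v' a3 b3 (- f0)" by (rule fr_perm) auto
      then have "fr (- f1) u' v' a3 b3 (- f0)" by (rule fr_neg)
      then have "fr a3 b3 u' v' (- f0) (- f1)" by (rule fr_perm) auto
      from nf_21[OF this refl refl] have "cls (mk (wedge (- f0) (- f1)) (wedge a3 (- f0) + wedge b3 (- f1) + wedge u' v'))"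
        by (rule cls_z)
      moreover have "wedge (- f0) (- f1) = wedge f0 f1" by (simp add: wedge_unfold)
      moreover have "wedge a3 (- f0) + wedge b3 (- f1) + wedge u' v' =
          wedge u' v' + wedge f0 a3 + wedge f1 b3 + smat k (wedge p q)"
        by (simp add: wedge_unfold True)
      ultimately show ?thesis by (simp only:)
    qed
  next
    case False
    obtain a4 a5 where a3: "a3 = a4 *s p + a5 *s q" using a(1) unfolding span_pair_iff by blast
    obtain b4 b5 where b3: "b3 = b4 *s p + b5 *s q" using b(1) unfolding span_pair_iff by blast
    \<comment> \<open>The same absorption for the second plane, with the factor \<open>k\<close>
      placed on \<open>p\<close>; the other correction is divided by \<open>k\<close>
      accordingly.\<close>
    define p' where "p' = k *s p + (a5 *s f0 + b5 *s f1)"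
    define q' where "q' = q + ((- a4 / k) *s f0 + (- b4 / k) *s f1)"
    have "fr p f0 f1 u' v' q" using fr2 by (rule fr_perm) auto
    then have "fr p' f0 f1 u' v' q"
      unfolding p'_def using False by (rule fr_add2)
    then have "fr q f0 f1 u' v' p'" by (rule fr_perm) auto
    then have "fr q' f0 f1 u' v' p'"
      unfolding q'_def by (rule fr_add2_1)
    then have "fr u' v' p' q' f0 f1" by (rule fr_perm) auto
    from nf_11_1[OF this refl refl] have "cls (mk (wedge f0 f1) (wedge u' v' + wedge p' q'))"
      by (rule cls_z)
    moreover have "wedge u' v' + wedge p' q' = wedge u' v' + wedge f0 a3 + wedge f1 b3 + smat k (wedge p q)
        + smat ((b5 * a4 - a5 * b4) / k) (wedge f0 f1)"
      using False unfolding a3 b3 p'_def q'_def by (simp add: wedge_unfold field_simps)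
    ultimately show ?thesis by - (rule cls_shift[of _ _ "(b5 * a4 - a5 * b4) / k"], simp)
  qed
  show ?thesis
    by (rule cls_shift[of _ _ m]) (simp only: eq main)
qed

lemma cls_decomposable:
  fixes f0 :: "'a::field^6"
  assumes fr: "fr f0 f1 c d e f" and B: "B \<in> wspan UNIV"
  shows "cls (mk (wedge f0 f1) B)"
proof -
  let ?T = "{c, d, e, f}"
  have "B \<in> wspan (vec.span (insert f0 (insert f1 ?T)))" using fr B by (simp add: fr_def)
  then obtain y B1 where 1: "y \<in> vec.span (insert f1 ?T)" "B1 \<in> wspan (vec.span (insert f1 ?T))" "B = wedge f0 y + B1"
    by (rule wspan_insert) (rule that)
  obtain b B2 where 2: "b \<in> vec.span ?T" "B2 \<in> wspan (vec.span ?T)" "B1 = wedge f1 b + B2"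
    using 1(2) by (rule wspan_insert) (rule that)
  obtain t where t: "y - t *s f1 \<in> vec.span ?T" using 1(1) unfolding vec.span_insert[of f1] by blast
  have "B + smat (- t) (wedge f0 f1) = wedge f0 (y - t *s f1) + wedge f1 b + B2"
    unfolding 1(3) 2(3) by (simp add: wedge_unfold algebra_simps)
  then show ?thesis
    using cls_decomposable_aux[OF fr t 2(1,2)] by - (rule cls_shift[of _ _ "- t"], simp)
qed

section \<open>Symplectic bases and pencils on a four-dimensional space\<close>

lemma span_triple: "x \<in> vec.span {p, q, r} \<Longrightarrow> \<exists>s t u. x = s *s p + t *s q + u *s r" for x :: "'a::field^'n"
proof -
  assume "x \<in> vec.span {p, q, r}"
  then obtain s where "x - s *s p \<in> vec.span {q, r}" unfolding vec.span_insert[of p] by blast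
  then obtain t u where "x - s *s p = t *s q + u *s r" unfolding span_pair_iff by blast
  then have "x = s *s p + t *s q + u *s r" by (simp add: algebra_simps)
  then show ?thesis by blast
qed

lemma span_quadruple: "x \<in> vec.span {p, q, r, m} \<Longrightarrow> \<exists>s t u v. x = s *s p + t *s q + u *s r + v *s m" for x :: "'a::field^'n"
proof -
  assume "x \<in> vec.span {p, q, r, m}"
  then obtain s where "x - s *s p \<in> vec.span {q, r, m}" unfolding vec.span_insert[of p] by blast
  then obtain t u v where "x - s *s p = t *s q + u *s r + v *s m" using span_triple by blast
  then have "x = s *s p + t *s q + u *s r + v *s m" by (simp add: algebra_simps)
  then show ?thesis by blast
qed

lemma span4_eqI:
  fixes f0 :: "'a::field^'n"
  assumes "\<exists>s t u v. g0 = s *s f0 + t *s f1 + u *s f2 + v *s f3" "\<exists>s t u v. g1 = s *s f0 + t *s f1 + u *s f2 + v *s f3"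
    "\<exists>s t u v. g2 = s *s f0 + t *s f1 + u *s f2 + v *s f3" "\<exists>s t u v. g3 = s *s f0 + t *s f1 + u *s f2 + v *s f3"
    "\<exists>s t u v. f0 = s *s g0 + t *s g1 + u *s g2 + v *s g3" "\<exists>s t u v. f1 = s *s g0 + t *s g1 + u *s g2 + v *s g3"
    "\<exists>s t u v. f2 = s *s g0 + t *s g1 + u *s g2 + v *s g3" "\<exists>s t u v. f3 = s *s g0 + t *s g1 + u *s g2 + v *s g3"
  shows "vec.span {g0, g1, g2, g3} = vec.span {f0, f1, f2, f3}"
proof -
  have *: "x \<in> vec.span {p, q, r, m}" if "\<exists>s t u v. x = s *s p + t *s q + u *s r + v *s m" for x p q r m :: "'a^'n"
    using that by (auto intro!: vec.span_add vec.span_scale intro: vec.span_base)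
  show ?thesis
    unfolding vec.span_eq by (intro conjI insert_subsetI empty_subsetI *) (rule assms)+
qed

text \<open>The partner \<open>f1\<close> is rescaled, and \<open>f2\<close>, \<open>f3\<close>
  receive the multiples of \<open>f1\<close> that cancel the components of \<open>a\<close> along
  them.\<close>

lemma symplectic_vector_aux:
  fixes f0 :: "'a::field^6"
  assumes "a = a0 *s f0 + a1 *s f1 + a2 *s f2 + a3 *s f3" "a0 \<noteq> 0"
  shows "\<exists>g1 g2 g3. vec.span {a, g1, g2, g3} = vec.span {f0, f1, f2, f3} \<and>
    wedge f0 f1 + wedge f2 f3 = wedge a g1 + wedge g2 g3"
proof (intro exI conjI)
  let ?g1 = "inverse a0 *s f1" and ?g2 = "f2 + (a3 / a0) *s f1" and ?g3 = "f3 - (a2 / a0) *s f1"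
  show "wedge f0 f1 + wedge f2 f3 = wedge a ?g1 + wedge ?g2 ?g3"
    using assms(2) unfolding assms(1) by (simp add: wedge_unfold field_simps)
  show "vec.span {a, ?g1, ?g2, ?g3} = vec.span {f0, f1, f2, f3}"
  proof (rule span4_eqI)
    show "\<exists>s t u v. a = s *s f0 + t *s f1 + u *s f2 + v *s f3" using assms(1) by blast
    show "\<exists>s t u v. ?g1 = s *s f0 + t *s f1 + u *s f2 + v *s f3"
      by (intro exI[of _ 0] exI[of _ "inverse a0"]) simp
    show "\<exists>s t u v. ?g2 = s *s f0 + t *s f1 + u *s f2 + v *s f3"
      by (rule exI[of _ 0], rule exI[of _ "a3/a0"], rule exI[of _ 1], rule exI[of _ 0]) simp
    show "\<exists>s t u v. ?g3 = s *s f0 + t *s f1 + u *s f2 + v *s f3"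
      by (rule exI[of _ 0], rule exI[of _ "-(a2/a0)"], rule exI[of _ 0], rule exI[of _ 1]) simp
    show "\<exists>s t u v. f0 = s *s a + t *s ?g1 + u *s ?g2 + v *s ?g3"
      by (rule exI[of _ "inverse a0"], rule exI[of _ "-a1"], rule exI[of _ "-(a2/a0)"], rule exI[of _ "-(a3/a0)"])
        (use assms in \<open>simp add: vec_eq_iff field_simps\<close>)
    show "\<exists>s t u v. f1 = s *s a + t *s ?g1 + u *s ?g2 + v *s ?g3"
      by (rule exI[of _ 0], rule exI[of _ a0], rule exI[of _ 0], rule exI[of _ 0]) (simp add: assms(2))
    show "\<exists>s t u v. f2 = s *s a + t *s ?g1 + u *s ?g2 + v *s ?g3"
      by (rule exI[of _ 0], rule exI[of _ "-a3"], rule exI[of _ 1], rule exI[of _ 0])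
        (use assms in \<open>simp add: vec_eq_iff field_simps\<close>)
    show "\<exists>s t u v. f3 = s *s a + t *s ?g1 + u *s ?g2 + v *s ?g3"
      by (rule exI[of _ 0], rule exI[of _ a2], rule exI[of _ 0], rule exI[of _ 1])
        (use assms in \<open>simp add: vec_eq_iff field_simps\<close>)
  qed
qed

lemma span4_neg: "vec.span {f0, f1, f2, - f3} = vec.span {f0, f1, f2, f3 :: 'a::field^'n}"
proof -
  have "- f3 \<in> vec.span (insert f3 {f0, f1, f2})" by (intro vec.span_neg vec.span_base) simp
  moreover have "f3 \<in> vec.span (insert (- f3) {f0, f1, f2})"
    using vec.span_neg[OF vec.span_base[of "- f3" "insert (- f3) {f0, f1, f2}"]] by simp
  ultimately show ?thesis using span_insert_swap[of "- f3" f3 "{f0, f1, f2}"] by (simp add: insert_commute)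
qed

text \<open>These changes of symplectic basis bring any nonzero coordinate of a vector to the first
  place and any mixed coefficient of a bivector to the pair of first and third vector.\<close>

lemma symplectic_rotations:
  fixes f0 :: "'a::field^6"
  shows "vec.span {f1, - f0, f2, f3} = vec.span {f0, f1, f2, f3}" "wedge f1 (- f0) + wedge f2 f3 = wedge f0 f1 + wedge f2 f3"
    "vec.span {f2, f3, f0, f1} = vec.span {f0, f1, f2, f3}" "wedge f2 f3 + wedge f0 f1 = wedge f0 f1 + wedge f2 f3"
    "vec.span {f3, - f2, f0, f1} = vec.span {f0, f1, f2, f3}" "wedge f3 (- f2) + wedge f0 f1 = wedge f0 f1 + wedge f2 f3"
    "vec.span {f0, f1, f3, - f2} = vec.span {f0, f1, f2, f3}" "wedge f0 f1 + wedge f3 (- f2) = wedge f0 f1 + wedge f2 f3"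
    "vec.span {f1, - f0, f3, - f2} = vec.span {f0, f1, f2, f3}" "wedge f1 (- f0) + wedge f3 (- f2) = wedge f0 f1 + wedge f2 f3"
  using span4_neg[of f1 f2 f3 f0] span4_neg[of f3 f0 f1 f2] span4_neg[of f1 f3 "- f2" f0]
  by (simp_all add: insert_commute add.commute wedge_unfold)

lemma symplectic_vector:
  fixes f0 :: "'a::field^6"
  assumes "a \<in> vec.span {f0, f1, f2, f3}" "a \<noteq> 0"
  obtains g1 g2 g3 where "vec.span {a, g1, g2, g3} = vec.span {f0, f1, f2, f3}"
    "wedge f0 f1 + wedge f2 f3 = wedge a g1 + wedge g2 g3"
proof -
  obtain a0 a1 a2 a3 where a: "a = a0 *s f0 + a1 *s f1 + a2 *s f2 + a3 *s f3"
    using span_quadruple[OF assms(1)] by blast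
  consider "a0 \<noteq> 0" | "a1 \<noteq> 0" | "a2 \<noteq> 0" | "a3 \<noteq> 0" using assms(2) a by fastforce
  then show ?thesis
  proof cases
    case 1 then show ?thesis using symplectic_vector_aux[OF a] that by blast
  next
    case 2
    have "a = a1 *s f1 + (- a0) *s (- f0) + a2 *s f2 + a3 *s f3" by (simp add: a)
    from symplectic_vector_aux[OF this 2] show ?thesis
      unfolding symplectic_rotations(1,2)[of f1 f0 f2 f3] using that by blast
  next
    case 3
    have "a = a2 *s f2 + a3 *s f3 + a0 *s f0 + a1 *s f1" by (simp add: a)
    from symplectic_vector_aux[OF this 3] show ?thesis
      unfolding symplectic_rotations(3,4)[of f2 f3 f0 f1] using that by blast
  next
    case 4
    have "a = a3 *s f3 + (- a2) *s (- f2) + a0 *s f0 + a1 *s f1" by (simp add: a)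
    from symplectic_vector_aux[OF this 4] show ?thesis
      unfolding symplectic_rotations(5,6)[of f3 f2 f0 f1] using that by blast
  qed
qed

lemma wspan_3:
  assumes "B \<in> wspan (vec.span {a, b, c :: 'a::field^6})"
  obtains p q r where "B = smat p (wedge a b) + smat q (wedge a c) + smat r (wedge b c)"
proof -
  obtain y B' where 1: "y \<in> vec.span {b, c}" "B' \<in> wspan (vec.span {b, c})" "B = wedge a y + B'"
    using assms by (rule wspan_insert) (rule that)
  obtain p q where y: "y = p *s b + q *s c" using 1(1) unfolding span_pair_iff by blast
  obtain r where r: "B' = smat r (wedge b c)" using 1(2) by (rule wspan_2) (rule that)
  have "B = smat p (wedge a b) + smat q (wedge a c) + smat r (wedge b c)"
    unfolding 1(3) y r by (simp add: wedge_unfold algebra_simps)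
  then show ?thesis by (rule that)
qed

lemma wspan_4:
  assumes "B \<in> wspan (vec.span {a, b, c, d :: 'a::field^6})"
  obtains b01 b02 b03 b12 b13 b23 where "B = smat b01 (wedge a b) + smat b02 (wedge a c) + smat b03 (wedge a d) +
    smat b12 (wedge b c) + smat b13 (wedge b d) + smat b23 (wedge c d)"
proof -
  obtain y B' where 1: "y \<in> vec.span {b, c, d}" "B' \<in> wspan (vec.span {b, c, d})" "B = wedge a y + B'"
    using assms by (rule wspan_insert) (rule that)
  obtain s t u where y: "y = s *s b + t *s c + u *s d" using span_triple[OF 1(1)] by blast
  obtain p q r where r: "B' = smat p (wedge b c) + smat q (wedge b d) + smat r (wedge c d)"
    using 1(2) by (rule wspan_3) (rule that)
  have "B = smat s (wedge a b) + smat t (wedge a c) + smat u (wedge a d) +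
    smat p (wedge b c) + smat q (wedge b d) + smat r (wedge c d)"
    unfolding 1(3) y r by (simp add: wedge_unfold algebra_simps)
  then show ?thesis by (rule that)
qed

text \<open>A common normal form for the bivector of rank four and a second bivector on the same
  four-space; \<open>b\<close> and \<open>g\<close> have the same meaning as in
  \<open>z_N\<close>.\<close>

definition pform :: "'a::field^6 \<Rightarrow> 'a^6 \<Rightarrow> 'a^6 \<Rightarrow> 'a^6 \<Rightarrow> 'a^6^6 \<Rightarrow> bool" where
  "pform f0 f1 f2 f3 B \<longleftrightarrow> (\<exists>g0 g1 g2 g3 b g. vec.span {g0, g1, g2, g3} = vec.span {f0, f1, f2, f3} \<and>
     wedge f0 f1 + wedge f2 f3 = wedge g0 g1 + wedge g2 g3 \<and>
     B = wedge g0 g2 + smat b (wedge g1 g3) + smat g (wedge g2 g3))"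

text \<open>The parameters are forced. With \<open>A\<close> the symplectic bivector, the Pfaffian
  of \<open>s A + B\<close> is \<open>s^2 + (b01 + b23) s + Pf B\<close>, so \<open>g\<close> is
  \<open>b01 + b23\<close> and \<open>b\<close> is minus the Pfaffian of \<open>B\<close>.\<close>

lemma pform_aux:
  fixes f0 :: "'a::field^6"
  assumes B: "B = smat b01 (wedge f0 f1) + smat b02 (wedge f0 f2) + smat b03 (wedge f0 f3) +
    smat b12 (wedge f1 f2) + smat b13 (wedge f1 f3) + smat b23 (wedge f2 f3)" and n: "b02 \<noteq> 0"
  shows "pform f0 f1 f2 f3 B"
  unfolding pform_def
proof (intro exI conjI)
  let ?g3 = "inverse b02 *s f3"
  let ?g0 = "f0 + b01 *s ?g3 + (b12 / b02) *s f1" and ?g2 = "b02 *s f2 + b03 *s f3 + b01 *s f1"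
  show "wedge f0 f1 + wedge f2 f3 = wedge ?g0 f1 + wedge ?g2 ?g3"
    using n by (simp add: wedge_unfold field_simps)
  show "B = wedge ?g0 ?g2 + smat (b13 * b02 - b12 * b03 - b01 * b23) (wedge f1 ?g3) + smat (b23 + b01) (wedge ?g2 ?g3)"
    using n unfolding B by (simp add: wedge_unfold field_simps)
  show "vec.span {?g0, f1, ?g2, ?g3} = vec.span {f0, f1, f2, f3}"
  proof (rule span4_eqI)
    show "\<exists>s t u v. ?g0 = s *s f0 + t *s f1 + u *s f2 + v *s f3"
      by (rule exI[of _ 1], rule exI[of _ "b12/b02"], rule exI[of _ 0], rule exI[of _ "b01 * inverse b02"]) (simp add: algebra_simps)
    show "\<exists>s t u v. f1 = s *s f0 + t *s f1 + u *s f2 + v *s f3"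
      by (rule exI[of _ 0], rule exI[of _ 1], rule exI[of _ 0], rule exI[of _ 0]) simp
    show "\<exists>s t u v. ?g2 = s *s f0 + t *s f1 + u *s f2 + v *s f3"
      by (rule exI[of _ 0], rule exI[of _ b01], rule exI[of _ b02], rule exI[of _ b03]) (simp add: algebra_simps)
    show "\<exists>s t u v. ?g3 = s *s f0 + t *s f1 + u *s f2 + v *s f3"
      by (rule exI[of _ 0], rule exI[of _ 0], rule exI[of _ 0], rule exI[of _ "inverse b02"]) simp
    show "\<exists>s t u v. f0 = s *s ?g0 + t *s f1 + u *s ?g2 + v *s ?g3"
      by (rule exI[of _ 1], rule exI[of _ "- b12/b02"], rule exI[of _ 0], rule exI[of _ "- b01"]) (simp add: vec_eq_iff algebra_simps)
    show "\<exists>s t u v. f1 = s *s ?g0 + t *s f1 + u *s ?g2 + v *s ?g3"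
      by (rule exI[of _ 0], rule exI[of _ 1], rule exI[of _ 0], rule exI[of _ 0]) simp
    show "\<exists>s t u v. f2 = s *s ?g0 + t *s f1 + u *s ?g2 + v *s ?g3"
      by (rule exI[of _ 0], rule exI[of _ "- b01 / b02"], rule exI[of _ "inverse b02"], rule exI[of _ "- b03"])
        (use n in \<open>simp add: vec_eq_iff field_simps\<close>)
    show "\<exists>s t u v. f3 = s *s ?g0 + t *s f1 + u *s ?g2 + v *s ?g3"
      by (rule exI[of _ 0], rule exI[of _ 0], rule exI[of _ 0], rule exI[of _ b02]) (simp add: n)
  qed
qed

lemma pform_cong:
  assumes "pform g0 g1 g2 g3 B" "vec.span {g0, g1, g2, g3} = vec.span {f0, f1, f2, f3}"
    "wedge g0 g1 + wedge g2 g3 = wedge f0 f1 + wedge f2 f3"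
  shows "pform f0 f1 f2 f3 B"
  using assms unfolding pform_def by simp

lemma pform_cases:
  fixes f0 :: "'a::field^6"
  assumes "B \<in> wspan (vec.span {f0, f1, f2, f3})"
  shows "(\<exists>t. B = smat t (wedge f0 f1 + wedge f2 f3)) \<or> pform f0 f1 f2 f3 B"
proof -
  obtain b01 b02 b03 b12 b13 b23 where B: "B = smat b01 (wedge f0 f1) + smat b02 (wedge f0 f2) + smat b03 (wedge f0 f3) +
    smat b12 (wedge f1 f2) + smat b13 (wedge f1 f3) + smat b23 (wedge f2 f3)"
    using assms by (rule wspan_4) (rule that)
  consider "b02 \<noteq> 0" | "b03 \<noteq> 0" | "b12 \<noteq> 0" | "b13 \<noteq> 0" | "b02 = 0" "b03 = 0" "b12 = 0" "b13 = 0" "b01 \<noteq> b23"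
    | "b02 = 0" "b03 = 0" "b12 = 0" "b13 = 0" "b01 = b23" by blast
  then show ?thesis
  proof cases
    case 1 then show ?thesis using pform_aux[OF B] by blast
  next
    case 2
    have "B = smat b01 (wedge f0 f1) + smat b03 (wedge f0 f3) + smat (- b02) (wedge f0 (- f2)) +
      smat b13 (wedge f1 f3) + smat (- b12) (wedge f1 (- f2)) + smat b23 (wedge f3 (- f2))"
      unfolding B by (simp add: wedge_unfold algebra_simps)
    from pform_cong[OF pform_aux[OF this 2] symplectic_rotations(7,8)] show ?thesis by blast
  next
    case 3
    have "B = smat b01 (wedge f1 (- f0)) + smat b12 (wedge f1 f2) + smat b13 (wedge f1 f3) +
      smat (- b02) (wedge (- f0) f2) + smat (- b03) (wedge (- f0) f3) + smat b23 (wedge f2 f3)"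
      unfolding B by (simp add: wedge_unfold algebra_simps)
    from pform_cong[OF pform_aux[OF this 3] symplectic_rotations(1,2)] show ?thesis by blast
  next
    case 4
    have "B = smat b01 (wedge f1 (- f0)) + smat b13 (wedge f1 f3) + smat (- b12) (wedge f1 (- f2)) +
      smat (- b03) (wedge (- f0) f3) + smat b02 (wedge (- f0) (- f2)) + smat b23 (wedge f3 (- f2))"
      unfolding B by (simp add: wedge_unfold algebra_simps)
    from pform_cong[OF pform_aux[OF this 4] symplectic_rotations(9,10)] show ?thesis by blast
  next
    case 5
    \<comment> \<open>The mixed coefficients vanish but the two others differ. This shear preserves
      the symplectic bivector and creates the coefficient \<open>b23 - b01\<close>, which serves as
      the nonzero one.\<close>
    let ?h1 = "f1 + f3" and ?h2 = "f2 - f0"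
    have "B = smat b01 (wedge f0 ?h1) + smat (b23 - b01) (wedge f0 f3) + smat 0 (wedge f0 (- ?h2)) +
      smat 0 (wedge ?h1 f3) + smat 0 (wedge ?h1 (- ?h2)) + smat b23 (wedge f3 (- ?h2))"
      unfolding B 5(1-4) by (simp add: wedge_unfold algebra_simps)
    moreover have "b23 - b01 \<noteq> 0" using 5 by simp
    ultimately have "pform f0 ?h1 f3 (- ?h2) B" by (rule pform_aux)
    from pform_cong[OF this symplectic_rotations(7,8)] have p: "pform f0 ?h1 ?h2 f3 B" .
    have "vec.span {f0, ?h1, ?h2, f3} = vec.span {f0, f1, f2, f3}"
    proof (rule span4_eqI)
      show "\<exists>s t u v. f0 = s *s f0 + t *s f1 + u *s f2 + v *s f3"
        by (rule exI[of _ 1], rule exI[of _ 0], rule exI[of _ 0], rule exI[of _ 0]) simp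
      show "\<exists>s t u v. ?h1 = s *s f0 + t *s f1 + u *s f2 + v *s f3"
        by (rule exI[of _ 0], rule exI[of _ 1], rule exI[of _ 0], rule exI[of _ 1]) simp
      show "\<exists>s t u v. ?h2 = s *s f0 + t *s f1 + u *s f2 + v *s f3"
        by (rule exI[of _ "-1"], rule exI[of _ 0], rule exI[of _ 1], rule exI[of _ 0]) simp
      show "\<exists>s t u v. f3 = s *s f0 + t *s f1 + u *s f2 + v *s f3"
        by (rule exI[of _ 0], rule exI[of _ 0], rule exI[of _ 0], rule exI[of _ 1]) simp
      show "\<exists>s t u v. f0 = s *s f0 + t *s ?h1 + u *s ?h2 + v *s f3"
        by (rule exI[of _ 1], rule exI[of _ 0], rule exI[of _ 0], rule exI[of _ 0]) simp
      show "\<exists>s t u v. f1 = s *s f0 + t *s ?h1 + u *s ?h2 + v *s f3"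
        by (rule exI[of _ 0], rule exI[of _ 1], rule exI[of _ 0], rule exI[of _ "-1"]) simp
      show "\<exists>s t u v. f2 = s *s f0 + t *s ?h1 + u *s ?h2 + v *s f3"
        by (rule exI[of _ 1], rule exI[of _ 0], rule exI[of _ 1], rule exI[of _ 0]) simp
      show "\<exists>s t u v. f3 = s *s f0 + t *s ?h1 + u *s ?h2 + v *s f3"
        by (rule exI[of _ 0], rule exI[of _ 0], rule exI[of _ 0], rule exI[of _ 1]) simp
    qed
    moreover have "wedge f0 ?h1 + wedge ?h2 f3 = wedge f0 f1 + wedge f2 f3"
      by (simp add: wedge_unfold algebra_simps)
    ultimately show ?thesis using pform_cong[OF p] by blast
  next
    case 6
    then have "B = smat b01 (wedge f0 f1 + wedge f2 f3)" unfolding B by (simp add: wedge_unfold algebra_simps)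
    then show ?thesis by blast
  qed
qed

lemma fr_span4:
  assumes "vec.span {g0, g1, g2, g3} = vec.span {f0, f1, f2, f3}" "fr f0 f1 f2 f3 f4 f5"
  shows "fr g0 g1 g2 g3 f4 f5"
proof -
  have "vec.span ({g0, g1, g2, g3} \<union> {f4, f5}) = vec.span ({f0, f1, f2, f3} \<union> {f4, f5})"
    by (intro span_Un_cong assms(1) refl)
  moreover have "{g0, g1, g2, g3} \<union> {f4, f5} = {g0, g1, g2, g3, f4, f5}" "{f0, f1, f2, f3} \<union> {f4, f5} = {f0, f1, f2, f3, f4, f5}"
    by auto
  ultimately show ?thesis using assms(2) by (simp only: fr_def)
qed

lemma fr_scale:
  assumes "fr a b c d e f" "k0 \<noteq> 0" "k1 \<noteq> 0" "k2 \<noteq> 0" "k3 \<noteq> 0" "k4 \<noteq> 0" "k5 \<noteq> 0"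
  shows "fr (k0 *s a) (k1 *s b) (k2 *s c) (k3 *s d) (k4 *s e) (k5 *s f)"
proof -
  have rot: "fr b' c' d' e' f' (k *s a')" if "fr a' b' c' d' e' f'" "k \<noteq> 0" for a' b' c' d' e' f' k
  proof -
    have "fr (k *s a') b' c' d' e' f'"
      by (rule fr_repl[OF that(1) _ that(2), of _ 0]) (simp_all add: vec.span_zero)
    then show ?thesis by (rule fr_perm) auto
  qed
  show ?thesis by (rule rot[OF rot[OF rot[OF rot[OF rot[OF rot]]]]]) (rule assms)+
qed

lemma fr_mod:
  assumes s: "vec.span {g0, g1, g2, g3} = vec.span {f0, f1, f2, f3}" and fr: "fr f0 f1 f2 f3 f4 f5"
    and k: "k4 \<noteq> 0" "k5 \<noteq> 0" and r: "r4 \<in> vec.span {g0, g1, g2, g3}" "r5 \<in> vec.span {g0, g1, g2, g3}"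
  shows "fr g0 g1 g2 g3 (k4 *s f4 + (l *s f5 + r4)) (k5 *s f5 + r5)"
proof -
  let ?f4 = "k4 *s f4 + (l *s f5 + r4)" and ?f5 = "k5 *s f5 + r5"
  have "fr f4 g0 g1 g2 g3 f5" by (rule fr_perm[OF fr_span4[OF s fr]]) auto
  then have "fr ?f4 g0 g1 g2 g3 f5"
  proof (rule fr_repl[OF _ refl k(1)])
    have "r4 \<in> vec.span {g0, g1, g2, g3, f5}" by (rule subsetD[OF vec.span_mono r(1)]) auto
    then show "l *s f5 + r4 \<in> vec.span {g0, g1, g2, g3, f5}"
      by (intro vec.span_add[OF vec.span_scale[OF vec.span_base]]) simp_all
  qed
  then have "fr f5 g0 g1 g2 g3 ?f4" by (rule fr_perm) auto
  then have "fr ?f5 g0 g1 g2 g3 ?f4"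
  proof (rule fr_repl[OF _ refl k(2)])
    show "r5 \<in> vec.span {g0, g1, g2, g3, ?f4}"
      by (rule subsetD[OF vec.span_mono r(2)]) auto
  qed
  then show ?thesis by (rule fr_perm) auto
qed

text \<open>A partner spanning the same area: a multiple of \<open>q\<close> or of \<open>p\<close>,
  according to which coordinate of \<open>d\<close> is nonzero.\<close>

lemma pair_adapt:
  fixes d :: "'a::field^6"
  assumes "d \<in> vec.span {p, q}" "d \<noteq> 0"
  obtains w where "wedge d w = wedge p q" "vec.span {d, w} = vec.span {p, q}"
proof -
  obtain s t where d: "d = s *s p + t *s q" using assms(1) unfolding span_pair_iff by blast
  have eqI: "vec.span {d, w} = vec.span {p, q}" if "w \<in> vec.span {p, q}" "p \<in> vec.span {d, w}" "q \<in> vec.span {d, w}" for w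
    unfolding vec.span_eq using assms(1) that by simp
  show ?thesis
  proof (cases "s = 0")
    case False
    show ?thesis
    proof (rule that[of "inverse s *s q"])
      show "wedge d (inverse s *s q) = wedge p q" using False unfolding d by (simp add: wedge_unfold field_simps)
      show "vec.span {d, inverse s *s q} = vec.span {p, q}"
      proof (rule eqI)
        show "inverse s *s q \<in> vec.span {p, q}" by (intro vec.span_scale vec.span_base) simp
        show "p \<in> vec.span {d, inverse s *s q}" unfolding span_pair_iff
          by (rule exI[of _ "inverse s"], rule exI[of _ "- t"]) (use False in \<open>simp add: d vec_eq_iff field_simps\<close>)
        show "q \<in> vec.span {d, inverse s *s q}" unfolding span_pair_iff
          by (rule exI[of _ 0], rule exI[of _ s]) (use False in \<open>simp add: vec_eq_iff\<close>)
      qed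
    qed
  next
    case True
    then have t: "t \<noteq> 0" using assms(2) d by auto
    show ?thesis
    proof (rule that[of "(- inverse t) *s p"])
      show "wedge d ((- inverse t) *s p) = wedge p q" using True t unfolding d by (simp add: wedge_unfold field_simps)
      show "vec.span {d, (- inverse t) *s p} = vec.span {p, q}"
      proof (rule eqI)
        show "(- inverse t) *s p \<in> vec.span {p, q}" by (intro vec.span_scale vec.span_base) simp
        show "p \<in> vec.span {d, (- inverse t) *s p}" unfolding span_pair_iff
          by (rule exI[of _ 0], rule exI[of _ "- t"]) (use t in \<open>simp add: vec_eq_iff\<close>)
        show "q \<in> vec.span {d, (- inverse t) *s p}" unfolding span_pair_iff
          by (rule exI[of _ "inverse t"], rule exI[of _ 0]) (use t True in \<open>simp add: d vec_eq_iff\<close>)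
      qed
    qed
  qed
qed

section \<open>The two quadratic families and pencils with a member of rank four\<close>

lemma cls_N:
  assumes fr: "fr f0 f1 f2 f3 f4 f5" and "g\<^sup>2 + 4 * b \<noteq> 0"
  shows "cls (mk (wedge f0 f1 + wedge f2 f3) (wedge f0 f2 + smat b (wedge f1 f3) + smat g (wedge f2 f3)))"
proof -
  have "fr f4 f5 f0 f1 f2 f3" using fr by (rule fr_perm) auto
  from nf_N[OF this refl refl] show ?thesis using assms(2) unfolding cls_def by blast
qed

lemma pformE:
  assumes "pform f0 f1 f2 f3 B"
  obtains g0 g1 g2 g3 b g where "vec.span {g0, g1, g2, g3} = vec.span {f0, f1, f2, f3}"
    "wedge f0 f1 + wedge f2 f3 = wedge g0 g1 + wedge g2 g3"
    "B = wedge g0 g2 + smat b (wedge g1 g3) + smat g (wedge g2 g3)"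
  using assms unfolding pform_def by (elim exE conjE) (rule that)

text \<open>For these parameters the Pfaffian of \<open>s A + B\<close> is \<open>(s - r)^2\<close>,
  and the member at the double root is decomposable.\<close>

lemma double_root_decomposition:
  fixes f0 :: "'a::field^6"
  shows "wedge f0 f1 + wedge f2 f3 = wedge (f0 + r *s f3) f1 + wedge (f2 + r *s f1) f3"
    "smat r (wedge f0 f1 + wedge f2 f3) + (wedge f0 f2 + smat (- (r * r)) (wedge f1 f3) + smat (- 2 * r) (wedge f2 f3))
      = wedge (f0 + r *s f3) (f2 + r *s f1)"
  by (simp_all add: wedge_unfold algebra_simps)

text \<open>If the discriminant vanishes, the member at the double root \<open>r\<close> is the sum
  of two planes, one of which is the plane of \<open>f4\<close>, \<open>f5\<close>. Taking this
  member as first generator produces the type \<open>2_1\<close>: a Jordan block of size two, and a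
  block of size one at a different degenerate member.\<close>

lemma cls_S:
  fixes f0 :: "'a::field^6"
  assumes fr: "fr f0 f1 f2 f3 f4 f5" and perf: "g\<^sup>2 + 4 * b = 0 \<Longrightarrow> \<exists>r. g = - 2 * r \<and> b = - (r * r)"
  shows "cls (mk (wedge f0 f1 + wedge f2 f3) (wedge f4 f5 + (wedge f0 f2 + smat b (wedge f1 f3) + smat g (wedge f2 f3))))"
    (is "cls (mk ?A ?B)")
proof (cases "g\<^sup>2 + 4 * b = 0")
  case False
  have "fr f4 f5 f0 f1 f2 f3" using fr by (rule fr_perm) auto
  from nf_S[OF this refl refl, of b g] have "mk ?A ?B \<sim>\<^sub>G z_S g b" by (simp add: add.assoc)
  then show ?thesis using False unfolding cls_def by blast
next
  case True
  then obtain r where r: "g = - 2 * r" "b = - (r * r)" using perf by blast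
  let ?g0 = "f0 + r *s f3" and ?g2 = "f2 + r *s f1"
  have "vec.span {?g0, f1, ?g2, f3} = vec.span {f0, f1, f2, f3}"
  proof (rule span4_eqI)
    show "\<exists>s t u v. ?g0 = s *s f0 + t *s f1 + u *s f2 + v *s f3"
      by (rule exI[of _ 1], rule exI[of _ 0], rule exI[of _ 0], rule exI[of _ r]) simp
    show "\<exists>s t u v. f1 = s *s f0 + t *s f1 + u *s f2 + v *s f3"
      by (rule exI[of _ 0], rule exI[of _ 1], rule exI[of _ 0], rule exI[of _ 0]) simp
    show "\<exists>s t u v. ?g2 = s *s f0 + t *s f1 + u *s f2 + v *s f3"
      by (rule exI[of _ 0], rule exI[of _ r], rule exI[of _ 1], rule exI[of _ 0]) simp
    show "\<exists>s t u v. f3 = s *s f0 + t *s f1 + u *s f2 + v *s f3"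
      by (rule exI[of _ 0], rule exI[of _ 0], rule exI[of _ 0], rule exI[of _ 1]) simp
    show "\<exists>s t u v. f0 = s *s ?g0 + t *s f1 + u *s ?g2 + v *s f3"
      by (rule exI[of _ 1], rule exI[of _ 0], rule exI[of _ 0], rule exI[of _ "- r"]) simp
    show "\<exists>s t u v. f1 = s *s ?g0 + t *s f1 + u *s ?g2 + v *s f3"
      by (rule exI[of _ 0], rule exI[of _ 1], rule exI[of _ 0], rule exI[of _ 0]) simp
    show "\<exists>s t u v. f2 = s *s ?g0 + t *s f1 + u *s ?g2 + v *s f3"
      by (rule exI[of _ 0], rule exI[of _ "- r"], rule exI[of _ 1], rule exI[of _ 0]) simp
    show "\<exists>s t u v. f3 = s *s ?g0 + t *s f1 + u *s ?g2 + v *s f3"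
      by (rule exI[of _ 0], rule exI[of _ 0], rule exI[of _ 0], rule exI[of _ 1]) simp
  qed
  then have "fr ?g0 f1 ?g2 f3 f4 f5" using fr by (rule fr_span4)
  then have "fr (1 *s ?g0) ((- 1) *s f1) (1 *s ?g2) ((- 1) *s f3) (1 *s f4) (1 *s f5)" by (rule fr_scale) simp_all
  then have "fr ?g0 (- f1) ?g2 (- f3) f4 f5" by simp
  then have fr': "fr (- f1) (- f3) ?g0 ?g2 f4 f5" by (rule fr_perm) auto
  have B: "?B + smat r ?A = wedge ?g0 ?g2 + wedge f4 f5"
    using double_root_decomposition(2)[of r f0 f1 f2 f3] unfolding r by (simp add: algebra_simps)
  have A: "?A = wedge (- f1) ?g0 + wedge (- f3) ?g2"
    unfolding double_root_decomposition(1)[of f0 f1 f2 f3 r] by (simp add: wedge_unfold)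
  show ?thesis
  proof (rule cls_shift[of _ _ r], rule cls_swap)
    from nf_2_1[OF fr' refl refl] have "cls (mk (wedge ?g0 ?g2 + wedge f4 f5) (wedge (- f1) ?g0 + wedge (- f3) ?g2))"
      by (rule cls_z)
    then show "cls (mk (?B + smat r ?A) ?A)" unfolding B unfolding A .
  qed
qed

text \<open>The first generator has rank four; pencils containing a decomposable member are treated
  by \<open>cls_decomposable\<close>. The assumption \<open>perf\<close> is elementary so that
  perfect and algebraically closed fields can both supply it.\<close>

locale indecomposable_pencil =
  fixes f0 f1 f2 f3 f4 f5 :: "'a::field^6"
  assumes fr: "fr f0 f1 f2 f3 f4 f5"
    and perf: "\<And>g b :: 'a. g\<^sup>2 + 4 * b = 0 \<Longrightarrow> \<exists>r. g = - 2 * r \<and> b = - (r * r)"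
begin

abbreviation "A \<equiv> wedge f0 f1 + wedge f2 f3"
abbreviation "U \<equiv> vec.span {f0, f1, f2, f3}"

definition indec :: "'a^6^6 \<Rightarrow> bool" where
  "indec B \<longleftrightarrow> (\<forall>t u v. B + smat t A \<noteq> wedge u v)"

text \<open>On the four-space itself the only alternative to the family \<open>z_N\<close> is a
  multiple of \<open>A\<close> or a vanishing discriminant, and each of these yields a decomposable
  member.\<close>

lemma cls_inner:
  assumes B: "B \<in> wspan U" and H: "indec B"
  shows "cls (mk A B)"
  using pform_cases[OF B]
proof
  assume "\<exists>t. B = smat t A"
  then obtain t where "B + smat (- t) A = wedge 0 0" by (auto simp: wedge_unfold)
  then show ?thesis using H unfolding indec_def by blast
next
  assume "pform f0 f1 f2 f3 B"
  then obtain g0 g1 g2 g3 b g where g: "vec.span {g0, g1, g2, g3} = U" "A = wedge g0 g1 + wedge g2 g3"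
     "B = wedge g0 g2 + smat b (wedge g1 g3) + smat g (wedge g2 g3)" by (rule pformE) (rule that)
  have "g\<^sup>2 + 4 * b \<noteq> 0"
  proof
    assume "g\<^sup>2 + 4 * b = 0"
    then obtain r where r: "g = - 2 * r" "b = - (r * r)" using perf by blast
    have "B + smat r A = wedge (g0 + r *s g3) (g2 + r *s g1)"
      using double_root_decomposition(2)[of r g0 g1 g2 g3] unfolding g(2,3) r by (simp add: algebra_simps)
    then show False using H unfolding indec_def by blast
  qed
  then show ?thesis unfolding g(2,3) by (rule cls_N[OF fr_span4[OF g(1) fr]])
qed

text \<open>With \<open>h\<close> first in a symplectic basis, terms containing \<open>h\<close> are
  absorbed into the outside vector. What is left is \<open>wedge g1 d\<close> with \<open>d\<close>
  in the span of \<open>g2\<close>, \<open>g3\<close>. If \<open>d\<close> vanished, a member would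
  be decomposable; otherwise five vectors carry the singular block \<open>L2\<close>.\<close>

lemma cls_one:
  assumes fr': "fr f0 f1 f2 f3 h4 h5" and h: "h \<in> U" "h \<noteq> 0" and B': "B' \<in> wspan U" and H: "indec (wedge h4 h + B')"
  shows "cls (mk A (wedge h4 h + B'))"
proof -
  obtain g1 g2 g3 where g: "vec.span {h, g1, g2, g3} = U" "A = wedge h g1 + wedge g2 g3"
    by (rule symplectic_vector[OF h]) (rule that)
  have "B' \<in> wspan (vec.span {h, g1, g2, g3})" using B' g(1) by simp
  then obtain y B2 where 1: "y \<in> vec.span {g1, g2, g3}" "B2 \<in> wspan (vec.span {g1, g2, g3})" "B' = wedge h y + B2"
    by (rule wspan_insert) (rule that)
  obtain d B3 where 2: "d \<in> vec.span {g2, g3}" "B3 \<in> wspan (vec.span {g2, g3})" "B2 = wedge g1 d + B3"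
    using 1(2) by (rule wspan_insert) (rule that)
  obtain e where e: "B3 = smat e (wedge g2 g3)" using 2(2) by (rule wspan_2) (rule that)
  let ?r = "e *s g1 - y"
  let ?g4 = "1 *s h4 + (0 *s h5 + ?r)"
  have eq: "wedge h4 h + B' + smat (- e) A = wedge ?g4 h + wedge g1 d"
    unfolding g(2) 1(3) 2(3) e by (simp add: wedge_unfold algebra_simps)
  have "d \<noteq> 0"
  proof
    assume "d = 0"
    then have "wedge h4 h + B' + smat (- e) A = wedge ?g4 h" unfolding eq by simp
    then show False using H unfolding indec_def by blast
  qed
  then obtain w where w: "wedge d w = wedge g2 g3" "vec.span {d, w} = vec.span {g2, g3}"
    by (rule pair_adapt[OF 2(1)]) (rule that)
  have sp: "vec.span {h, g1, d, w} = U"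
    using span_insert_cong[OF span_insert_cong[OF w(2)], of h g1] g(1) by simp
  have y: "?r \<in> vec.span {h, g1, d, w}"
  proof -
    have "y \<in> vec.span {h, g1, g2, g3}" using 1(1) vec.span_mono[of "{g1, g2, g3}" "{h, g1, g2, g3}"] by blast
    then have "y \<in> vec.span {h, g1, d, w}" using sp g(1) by simp
    then show ?thesis by (intro vec.span_diff[OF vec.span_scale[OF vec.span_base]]) simp_all
  qed
  have "fr h g1 d w ?g4 (1 *s h5 + 0)"
    by (rule fr_mod[OF sp fr' _ _ y]) (simp_all add: vec.span_zero)
  then have "fr (1 *s h) ((-1) *s g1) ((-1) *s d) (1 *s w) (1 *s ?g4) (1 *s (1 *s h5 + 0))" by (rule fr_scale) simp_all
  then have "fr (1 *s (1 *s h5 + 0)) ((-1) *s g1) (1 *s w) (1 *s ?g4) (1 *s h) ((-1) *s d)" by (rule fr_perm) auto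
  from nf_L2[OF this refl refl] have "cls (mk (wedge ((-1) *s g1) (1 *s h) + wedge (1 *s w) ((-1) *s d))
      (wedge ((-1) *s g1) ((-1) *s d) + wedge (1 *s ?g4) (1 *s h)))" by (rule cls_z)
  moreover have "wedge ((-1) *s g1) (1 *s h) + wedge (1 *s w) ((-1) *s d) = A"
    unfolding g(2) w(1)[symmetric] by (simp add: wedge_unfold)
  moreover have "wedge ((-1) *s g1) ((-1) *s d) + wedge (1 *s ?g4) (1 *s h) = wedge h4 h + B' + smat (- e) A"
    unfolding eq by (simp add: wedge_unfold)
  ultimately show ?thesis by - (rule cls_shift[of _ _ "- e"], simp only:)
qed

text \<open>In a symplectic basis through \<open>a\<close>, the coefficient \<open>b1\<close> is the
  symplectic pairing of \<open>a\<close> and \<open>b\<close>. If it is nonzero, the two span a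
  hyperbolic plane and the type is \<open>2_1\<close>. If it vanishes and \<open>a\<close>,
  \<open>b\<close> are independent, they span an isotropic plane, and the coefficient
  \<open>e\<close> left on its partners separates \<open>L1_L1\<close> from \<open>3\<close>. If
  they are dependent, one outside vector suffices.\<close>

lemma cls_two:
  assumes a: "a \<in> U" "a \<noteq> 0" and b: "b \<in> U" and B': "B' \<in> wspan U"
    and H: "indec (wedge f4 a + wedge f5 b + B')"
  shows "cls (mk A (wedge f4 a + wedge f5 b + B'))"
proof -
  obtain g1 g2 g3 where g: "vec.span {a, g1, g2, g3} = U" "A = wedge a g1 + wedge g2 g3"
    by (rule symplectic_vector[OF a]) (rule that)
  obtain b0 where "b - b0 *s a \<in> vec.span {g1, g2, g3}"
    using b unfolding g(1)[symmetric] vec.span_insert[of a] by blast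
  then obtain b1 where y: "b - b0 *s a - b1 *s g1 \<in> vec.span {g2, g3}"
    unfolding vec.span_insert[of g1] by blast
  define y where "y = b - b0 *s a - b1 *s g1"
  have b_eq: "b = b0 *s a + b1 *s g1 + y" by (simp add: y_def)
  have y: "y \<in> vec.span {g2, g3}" using y by (simp add: y_def)
  obtain y2 y3 where y23: "y = y2 *s g2 + y3 *s g3" using y unfolding span_pair_iff by blast
  show ?thesis
  proof (cases "b1 = 0")
    case False
    \<comment> \<open>The component \<open>y\<close> of \<open>b\<close> is moved into
      \<open>g1\<close>, and \<open>g2\<close>, \<open>g3\<close> are corrected by multiples of
      \<open>a\<close> to keep the symplectic shape. Then \<open>b\<close> lies in the span of
      \<open>a\<close> and the new \<open>g1\<close>.\<close>
    let ?g1 = "g1 + (y2 / b1) *s g2 + (y3 / b1) *s g3" and ?g2 = "g2 - (y3 / b1) *s a" and ?g3 = "g3 + (y2 / b1) *s a"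
    have A: "A = wedge a ?g1 + wedge ?g2 ?g3"
      unfolding g(2) by (simp add: wedge_unfold algebra_simps)
    have "vec.span {a, ?g1, ?g2, ?g3} = vec.span {a, g1, g2, g3}"
    proof (rule span4_eqI)
      show "\<exists>s t u v. a = s *s a + t *s g1 + u *s g2 + v *s g3"
        by (rule exI[of _ 1], rule exI[of _ 0], rule exI[of _ 0], rule exI[of _ 0]) simp
      show "\<exists>s t u v. ?g1 = s *s a + t *s g1 + u *s g2 + v *s g3"
        by (rule exI[of _ 0], rule exI[of _ 1], rule exI[of _ "y2 / b1"], rule exI[of _ "y3 / b1"]) simp
      show "\<exists>s t u v. ?g2 = s *s a + t *s g1 + u *s g2 + v *s g3"
        by (rule exI[of _ "- (y3 / b1)"], rule exI[of _ 0], rule exI[of _ 1], rule exI[of _ 0]) simp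
      show "\<exists>s t u v. ?g3 = s *s a + t *s g1 + u *s g2 + v *s g3"
        by (rule exI[of _ "y2 / b1"], rule exI[of _ 0], rule exI[of _ 0], rule exI[of _ 1]) simp
      show "\<exists>s t u v. a = s *s a + t *s ?g1 + u *s ?g2 + v *s ?g3"
        by (rule exI[of _ 1], rule exI[of _ 0], rule exI[of _ 0], rule exI[of _ 0]) simp
      show "\<exists>s t u v. g1 = s *s a + t *s ?g1 + u *s ?g2 + v *s ?g3"
        by (rule exI[of _ 0], rule exI[of _ 1], rule exI[of _ "- (y2 / b1)"], rule exI[of _ "- (y3 / b1)"])
          (simp add: vec_eq_iff algebra_simps)
      show "\<exists>s t u v. g2 = s *s a + t *s ?g1 + u *s ?g2 + v *s ?g3"
        by (rule exI[of _ "y3 / b1"], rule exI[of _ 0], rule exI[of _ 1], rule exI[of _ 0]) simp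
      show "\<exists>s t u v. g3 = s *s a + t *s ?g1 + u *s ?g2 + v *s ?g3"
        by (rule exI[of _ "- (y2 / b1)"], rule exI[of _ 0], rule exI[of _ 0], rule exI[of _ 1]) simp
    qed
    then have sp: "vec.span {a, ?g1, ?g2, ?g3} = U" using g(1) by simp
    obtain h1 h2 h3 where h: "h1 = ?g1" "h2 = ?g2" "h3 = ?g3" by blast
    note sp = sp[folded h] and A = A[folded h]
    have "B' \<in> wspan (vec.span {a, h1, h2, h3})" using B' sp by simp
    then obtain y0 B2 where 1: "y0 \<in> vec.span {h1, h2, h3}" "B2 \<in> wspan (vec.span {h1, h2, h3})" "B' = wedge a y0 + B2"
      by (rule wspan_insert) (rule that)
    obtain y1 B3 where 2: "y1 \<in> vec.span {h2, h3}" "B3 \<in> wspan (vec.span {h2, h3})" "B2 = wedge h1 y1 + B3"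
      using 1(2) by (rule wspan_insert) (rule that)
    obtain e where e: "B3 = smat e (wedge h2 h3)" using 2(2) by (rule wspan_2) (rule that)
    let ?F4 = "1 *s f4 + (b0 *s f5 + (e *s h1 - y0))" and ?F5 = "b1 *s f5 + (- y1)"
    have y0: "y0 \<in> vec.span {a, h1, h2, h3}" "y1 \<in> vec.span {a, h1, h2, h3}"
      using 1(1) 2(1) vec.span_mono[of "{h1, h2, h3}" "{a, h1, h2, h3}"] vec.span_mono[of "{h2, h3}" "{a, h1, h2, h3}"]
      by blast+
    have "fr a h1 h2 h3 ?F4 ?F5"
    proof (rule fr_mod[OF sp fr _ False])
      show "e *s h1 - y0 \<in> vec.span {a, h1, h2, h3}"
        by (intro vec.span_diff[OF vec.span_scale[OF vec.span_base] y0(1)]) simp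
      show "- y1 \<in> vec.span {a, h1, h2, h3}" by (rule vec.span_neg[OF y0(2)])
    qed simp
    then have "fr ?F4 ?F5 a h1 h2 h3" by (rule fr_perm) auto
    from nf_2_1[OF this refl refl] have "cls (mk (wedge a h1 + wedge h2 h3) (wedge ?F4 a + wedge ?F5 h1))"
      by (rule cls_z)
    moreover have "b1 *s h1 = b1 *s g1 + y" unfolding h y23 using False by (simp add: vec_eq_iff field_simps)
    then have "b = b0 *s a + b1 *s h1" unfolding b_eq by (simp add: add.assoc)
    then have "wedge f4 a + wedge f5 b + B' + smat (- e) A = wedge ?F4 a + wedge ?F5 h1"
      unfolding A 1(3) 2(3) e by (simp add: wedge_unfold algebra_simps)
    ultimately show ?thesis by - (rule cls_shift[of _ _ "- e"], simp only: A)
  next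
    case True
    show ?thesis
    proof (cases "y = 0")
      case y0: True
      have "wedge f4 a + wedge f5 b + B' = wedge (f4 + b0 *s f5) a + B'"
        unfolding b_eq True y0 by (simp add: wedge_unfold algebra_simps)
      moreover have "fr f0 f1 f2 f3 (1 *s f4 + (b0 *s f5 + 0)) (1 *s f5 + 0)"
        by (rule fr_mod[OF refl fr]) (simp_all add: vec.span_zero)
      then have "fr f0 f1 f2 f3 (f4 + b0 *s f5) f5" by simp
      ultimately show ?thesis using cls_one[OF _ a B'] H by simp
    next
      case False
      then obtain w where w: "wedge y w = wedge g2 g3" "vec.span {y, w} = vec.span {g2, g3}"
        by (rule pair_adapt[OF y]) (rule that)
      have sp: "vec.span {a, g1, y, w} = U"
        using span_insert_cong[OF span_insert_cong[OF w(2)], of a g1] g(1) by simp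
      then have "B' \<in> wspan (vec.span {a, y, g1, w})" using B' by (simp add: insert_commute)
      then obtain y0 B2 where 1: "y0 \<in> vec.span {y, g1, w}" "B2 \<in> wspan (vec.span {y, g1, w})" "B' = wedge a y0 + B2"
        by (rule wspan_insert) (rule that)
      obtain y1 B3 where 2: "y1 \<in> vec.span {g1, w}" "B3 \<in> wspan (vec.span {g1, w})" "B2 = wedge y y1 + B3"
        using 1(2) by (rule wspan_insert) (rule that)
      obtain e where e: "B3 = smat e (wedge g1 w)" using 2(2) by (rule wspan_2) (rule that)
      let ?F4 = "1 *s f4 + (b0 *s f5 + (- y0))" and ?F5 = "1 *s f5 + (- y1)"
      have y0: "y0 \<in> vec.span {a, g1, y, w}" "y1 \<in> vec.span {a, g1, y, w}"
        using 1(1) 2(1) vec.span_mono[of "{y, g1, w}" "{a, g1, y, w}"] vec.span_mono[of "{g1, w}" "{a, g1, y, w}"]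
        by blast+
      have F: "fr a g1 y w ?F4 ?F5"
        by (rule fr_mod[OF sp fr _ _ vec.span_neg[OF y0(1)] vec.span_neg[OF y0(2)]]) simp_all
      have A: "A = wedge a g1 + wedge y w" unfolding g(2) w(1) ..
      have B: "wedge f4 a + wedge f5 b + B' = wedge ?F4 a + wedge ?F5 y + smat e (wedge g1 w)"
        unfolding 1(3) 2(3) e b_eq True by (simp add: wedge_unfold algebra_simps)
      show ?thesis
      proof (cases "e = 0")
        case e: True
        from F have "fr (1 *s a) ((-1) *s g1) (1 *s y) ((-1) *s w) (1 *s ?F4) (1 *s ?F5)" by (rule fr_scale) simp_all
        then have "fr ((-1) *s g1) ((-1) *s w) (1 *s ?F4) (1 *s ?F5) (1 *s a) (1 *s y)" by (rule fr_perm) auto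
        from nf_L1_L1[OF this refl refl] have "cls (mk (wedge ((-1) *s g1) (1 *s a) + wedge ((-1) *s w) (1 *s y))
           (wedge (1 *s ?F4) (1 *s a) + wedge (1 *s ?F5) (1 *s y)))" by (rule cls_z)
        moreover have "wedge ((-1) *s g1) (1 *s a) + wedge ((-1) *s w) (1 *s y) = A"
          unfolding A by (simp add: wedge_unfold)
        moreover have "wedge (1 *s ?F4) (1 *s a) + wedge (1 *s ?F5) (1 *s y) = wedge f4 a + wedge f5 b + B'"
          unfolding B e by (simp add: wedge_unfold)
        ultimately show ?thesis by (simp only:)
      next
        case e: False
        from F have "fr (inverse e *s a) ((-e) *s g1) (1 *s y) ((-1) *s w) (e *s ?F4) (1 *s ?F5)"
          by (rule fr_scale) (use e in simp_all)
        then have "fr (e *s ?F4) (1 *s ?F5) ((-e) *s g1) ((-1) *s w) (inverse e *s a) (1 *s y)" by (rule fr_perm) auto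
        from nf_3[OF this refl refl] have "cls (mk (wedge ((-e) *s g1) (inverse e *s a) + wedge ((-1) *s w) (1 *s y))
           (wedge (e *s ?F4) (inverse e *s a) + wedge (1 *s ?F5) (1 *s y) + wedge ((-e) *s g1) ((-1) *s w)))" by (rule cls_z)
        moreover have "wedge ((-e) *s g1) (inverse e *s a) + wedge ((-1) *s w) (1 *s y) = A"
          unfolding A using e by (simp add: wedge_unfold field_simps)
        moreover have "wedge (e *s ?F4) (inverse e *s a) + wedge (1 *s ?F5) (1 *s y) + wedge ((-e) *s g1) ((-1) *s w)
           = wedge f4 a + wedge f5 b + B'"
          unfolding B using e by (simp add: wedge_unfold field_simps)
        ultimately show ?thesis by (simp only:)
      qed
    qed
  qed
qed

text \<open>Let \<open>c\<close> be the coefficient at the two outside vectors. If it is nonzero, a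
  plane complementary to \<open>U\<close> splits off. Otherwise the number of nonzero vectors among
  \<open>a\<close> and \<open>b\<close> decides which of the preceding lemmas applies.\<close>

lemma cls_indec:
  assumes B: "B \<in> wspan UNIV" and H: "indec B"
  shows "cls (mk A B)"
proof -
  have "{f4, f5, f0, f1, f2, f3} = {f0, f1, f2, f3, f4, f5}" by auto
  then have "B \<in> wspan (vec.span (insert f4 (insert f5 {f0, f1, f2, f3})))" using fr B by (simp add: fr_def)
  then obtain y B1 where 1: "y \<in> vec.span (insert f5 {f0, f1, f2, f3})" "B1 \<in> wspan (vec.span (insert f5 {f0, f1, f2, f3}))"
    "B = wedge f4 y + B1" by (rule wspan_insert) (rule that)
  obtain b B' where 2: "b \<in> U" "B' \<in> wspan U" "B1 = wedge f5 b + B'"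
    using 1(2) by (rule wspan_insert) (rule that)
  obtain c where c: "y - c *s f5 \<in> U" using 1(1) unfolding vec.span_insert[of f5] by blast
  define a where "a = y - c *s f5"
  have y: "y = c *s f5 + a" by (simp add: a_def)
  have a: "a \<in> U" using c by (simp add: a_def)
  show ?thesis
  proof (cases "c = 0")
    case False
    \<comment> \<open>Completion of the square: \<open>wedge ?F4 ?F5\<close> accounts for every term
      with an outside vector, and only a multiple of \<open>wedge b a\<close> is left to correct
      inside \<open>U\<close>.\<close>
    let ?F4 = "1 *s f4 + (0 *s f5 + (- inverse c) *s b)" and ?F5 = "c *s f5 + a"
    define B'' where "B'' = wedge (inverse c *s b) a + B'"
    have BU: "B'' \<in> wspan U" unfolding B''_def by (intro wspan.add vec.span_scale 2 a)
    have Beq: "B = wedge ?F4 ?F5 + B''"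
      unfolding 1(3) 2(3) y B''_def using False by (simp add: wedge_unfold field_simps)
    show ?thesis using pform_cases[OF BU]
    proof
      assume "\<exists>t. B'' = smat t A"
      then obtain t where "B'' = smat t A" by blast
      then have "B + smat (- t) A = wedge ?F4 ?F5" unfolding Beq by (simp add: wedge_unfold)
      then show ?thesis using H unfolding indec_def by blast
    next
      assume "pform f0 f1 f2 f3 B''"
      then obtain g0 g1 g2 g3 b' g where g: "vec.span {g0, g1, g2, g3} = U" "A = wedge g0 g1 + wedge g2 g3"
        "B'' = wedge g0 g2 + smat b' (wedge g1 g3) + smat g (wedge g2 g3)" by (rule pformE) (rule that)
      have bb: "b \<in> vec.span {g0, g1, g2, g3}" and aa: "a \<in> vec.span {g0, g1, g2, g3}"
        using 2(1) a g(1) by simp_all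
      have "fr g0 g1 g2 g3 ?F4 ?F5"
        by (rule fr_mod[OF g(1) fr _ False vec.span_scale[OF bb] aa]) simp
      then show ?thesis unfolding Beq g(2,3) using perf by (rule cls_S)
    qed
  next
    case c0: True
    then have ya: "y = a" using y by simp
    have Beq: "B = wedge f4 a + wedge f5 b + B'" unfolding 1(3) 2(3) ya by (simp add: add.assoc)
    show ?thesis
    proof (cases "a = 0")
      case True
      then have Beq': "B = wedge f5 b + B'" using Beq by simp
      show ?thesis
      proof (cases "b = 0")
        case True
        then have "B = B'" using Beq' by simp
        then show ?thesis using cls_inner[OF 2(2)] H by simp
      next
        case False
        have "fr f0 f1 f2 f3 f5 f4" by (rule fr_perm[OF fr]) auto
        from cls_one[OF this 2(1) False 2(2)] show ?thesis using H unfolding Beq' .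
      qed
    next
      case False
      then show ?thesis using cls_two[OF a False 2(1,2)] H unfolding Beq by blast
    qed
  qed
qed

end

section \<open>Pencils with a singular member\<close>

lemma wspan_act: 
  assumes "x \<in> V" shows "smat s (x $ 0) + smat t (x $ 1) \<in> wspan (UNIV :: ('a::field^6) set)"
proof -
  have "smat c (x $ l) \<in> wspan (UNIV :: ('a^6) set)" for c l
    using wspan_smat[of "x $ l" "set [E 0, E 1, E 2, E 3, E 4, E 5]" c] alt_wspan[OF assms] by (simp only: span_E)
  then show ?thesis by (intro wspan_plus)
qed

lemma cls_decomposable':
  assumes B: "B \<in> wspan (UNIV :: ('a::field^6) set)"
  shows "cls (mk (wedge u v) B)"
proof (cases "wedge u v = 0")
  case True then show ?thesis using cls_A_zero[OF B] by simp
next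
  case False
  let ?xs = "[E 0, E 1, E 2, E 3, E 4, E 5 :: 'a^6]"
  have "u \<noteq> 0" using False by auto
  moreover have "u \<in> vec.span (set ?xs)" unfolding span_E by simp
  ultimately obtain ys where ys: "length ?xs = Suc (length ys)" "vec.span (insert u (set ys)) = vec.span (set ?xs)"
    using exchange_list by blast
  then have "v \<in> vec.span (insert u (set ys))" unfolding span_E by simp
  then obtain c where c: "v - c *s u \<in> vec.span (set ys)" unfolding vec.span_insert[of u] by blast
  define w where "w = v - c *s u"
  have uw: "wedge u v = wedge u w" by (simp add: w_def wedge_unfold algebra_simps)
  then have "w \<noteq> 0" using False by auto
  then obtain zs where zs: "length ys = Suc (length zs)" "vec.span (insert w (set zs)) = vec.span (set ys)"
    using exchange_list[OF c[folded w_def]] by blast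
  have "length zs = Suc (Suc (Suc (Suc 0)))" using ys(1) zs(1) by simp
  then obtain p q r s where "zs = [p, q, r, s]" unfolding length_Suc_conv length_0_conv by blast
  then have "fr u w p q r s" using span_insert_cong[OF zs(2), of u] ys(2) unfolding span_E by (simp add: fr_def)
  then show ?thesis unfolding uw using B by (rule cls_decomposable)
qed

lemma symplectic_matrix_invertible:
  assumes "k \<noteq> (0::'a::field)"
  shows "invertible (ew 0 1 + ew 2 3 + smat k (ew 4 5))"
proof -
  have "(ew 0 1 + ew 2 3 + smat k (ew 4 5)) ** (smat (-1) (ew 0 1) + smat (-1) (ew 2 3) + smat (- inverse k) (ew 4 5)) = mat 1"
    using assms by (simp add: vec_eq_iff forall_6 matrix_matrix_mult_def sum_6 mat_def wedge_def smat_def E_def axis_def)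
  then show ?thesis unfolding invertible_right_inverse by blast
qed

lemma rank6_det:
  assumes "fr m n p q u v" "k \<noteq> (0::'a::field)"
  shows "det (wedge p q + wedge u v + smat k (wedge m n)) \<noteq> 0"
proof -
  have "fr p q u v m n" by (rule fr_perm[OF assms(1)]) auto
  then obtain F where F: "invertible F" "F *v E 0 = p" "F *v E 1 = q" "F *v E 2 = u" "F *v E 3 = v" "F *v E 4 = m" "F *v E 5 = n"
    using fr_matrix by blast
  have "wedge p q + wedge u v + smat k (wedge m n) = F ** (ew 0 1 + ew 2 3 + smat k (ew 4 5)) ** transpose F"
    by (simp add: congr_simps F)
  then show ?thesis
    using F(1) symplectic_matrix_invertible[OF assms(2)] by (simp add: det_mul invertible_det_nz)
qed

text \<open>Planes are split off \<open>C\<close>; a third one would make it invertible. With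
  exactly two planes, a decomposable shift of \<open>D\<close> is exchanged with \<open>C\<close>,
  which leads back to the decomposable case.\<close>

lemma cls_degenerate:
  fixes C :: "'a::field^6^6"
  assumes perf: "\<And>g b :: 'a. g\<^sup>2 + 4 * b = 0 \<Longrightarrow> \<exists>r. g = - 2 * r \<and> b = - (r * r)"
    and C: "C \<in> wspan UNIV" and D: "D \<in> wspan UNIV" and det: "det C = 0"
  shows "cls (mk C D)"
proof (cases "C = 0")
  case True then show ?thesis using cls_A_zero[OF D] by simp
next
  case False
  let ?xs = "[E 0, E 1, E 2, E 3, E 4, E 5 :: 'a^6]"
  have "C \<in> wspan (vec.span (set ?xs))" unfolding span_E by (rule C)
  then obtain u v ys C1 where 1: "length ?xs = Suc (Suc (length ys))" "vec.span (insert u (insert v (set ys))) = vec.span (set ?xs)"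
    "C1 \<in> wspan (vec.span (set ys))" "C = wedge u v + C1"
    by (rule bivector_step[OF _ False]) (rule that)
  note sp = 1(2)[unfolded span_E]
  have "length ys = Suc (Suc (Suc (Suc 0)))" using 1(1) by simp
  then obtain c d e f where ys: "ys = [c, d, e, f]" unfolding length_Suc_conv length_0_conv by blast
  show ?thesis
  proof (cases "C1 = 0")
    case True then show ?thesis unfolding 1(4) using cls_decomposable'[OF D] by simp
  next
    case False
    obtain p q zs C2 where 2: "length ys = Suc (Suc (length zs))" "vec.span (insert p (insert q (set zs))) = vec.span (set ys)"
      "C2 \<in> wspan (vec.span (set zs))" "C1 = wedge p q + C2"
      by (rule bivector_step[OF 1(3) False]) (rule that)
    have "length zs = Suc (Suc 0)" using 2(1) ys by simp
    then obtain m n where zs: "zs = [m, n]" unfolding length_Suc_conv length_0_conv by blast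
    have "C2 \<in> wspan (vec.span {m, n})" using 2(3) by (simp only: zs list.set)
    then obtain k where k: "C2 = smat k (wedge m n)" by (rule wspan_2) (rule that)
    have fr: "fr u v p q m n"
      using sp span_insert_cong[OF span_insert_cong[OF 2(2)], of u v] by (simp add: zs fr_def)
    have "k = 0"
    proof (rule ccontr)
      assume "k \<noteq> 0"
      moreover have "fr m n u v p q" by (rule fr_perm[OF fr]) auto
      ultimately have "det C \<noteq> 0" using rank6_det unfolding 1(4) 2(4) k by (simp add: add.assoc[symmetric])
      then show False using det by simp
    qed
    then have C': "C = wedge u v + wedge p q" unfolding 1(4) 2(4) k by (simp add: wedge_unfold)
    interpret indecomposable_pencil u v p q m n by unfold_locales (use fr perf in auto)
    show ?thesis
    proof (cases "indec D")
      case True then show ?thesis unfolding C' using cls_indec[OF D] by blast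
    next
      case False
      then obtain t x y where txy: "D + smat t (wedge u v + wedge p q) = wedge x y" unfolding indec_def by blast
      have "cls (mk (wedge x y) C)" by (rule cls_decomposable'[OF C])
      then show ?thesis unfolding C' txy[symmetric] by (rule cls_shift[OF cls_swap])
    qed
  qed
qed

text \<open>A nonzero pair \<open>(s, t)\<close> is completed to an invertible 2 x 2 matrix, which
  moves the singular member into first position.\<close>

theorem classification:
  fixes x :: "'a::field rep"
  assumes perf: "\<And>g b :: 'a. g\<^sup>2 + 4 * b = 0 \<Longrightarrow> \<exists>r. g = - 2 * r \<and> b = - (r * r)"
    and x: "x \<in> V" and st: "(s, t) \<noteq> (0, 0)" and det: "det (smat s (x $ 0) + smat t (x $ 1)) = 0"
  shows "cls x"
proof -
  obtain q p where pq: "s * q - t * p \<noteq> 0"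
  proof (cases "s = 0")
    case True then show ?thesis using st by (intro that[of 0 1]) auto
  next
    case False then show ?thesis by (intro that[of 1 0]) auto
  qed
  have "mk (x $ 0) (x $ 1) \<sim>\<^sub>G mk (smat s (x $ 0) + smat t (x $ 1)) (smat p (x $ 0) + smat q (x $ 1))"
    by (rule equivG_gl2[OF pq])
  moreover have "cls (mk (smat s (x $ 0) + smat t (x $ 1)) (smat p (x $ 0) + smat q (x $ 1)))"
    by (rule cls_degenerate[OF perf wspan_act[OF x] wspan_act[OF x] det])
  ultimately show ?thesis using cls_equivG unfolding mk_eta by blast
qed

subsection \<open>The determinant of a pencil\<close>

text \<open>The binary sextic of the pencil, dehomogenised so that the first component is the point
  at infinity. A root there appears as a drop of the degree below six.\<close>

definition cpoly :: "'a::comm_ring_1 rep \<Rightarrow> 'a poly" where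
  "cpoly x = det (\<chi> i j. [:x $ 1 $ i $ j, x $ 0 $ i $ j:])"

lemma coeff_prod_linear:
  fixes a b :: "'n \<Rightarrow> 'a::comm_ring_1"
  assumes "finite I"
  shows "Polynomial.degree (\<Prod>i\<in>I. [:b i, a i:]) \<le> card I \<and> Polynomial.coeff (\<Prod>i\<in>I. [:b i, a i:]) (card I) = (\<Prod>i\<in>I. a i)"
  using assms
proof induction
  case (insert x I)
  let ?P = "\<Prod>i\<in>I. [:b i, a i:]"
  have P: "(\<Prod>i\<in>insert x I. [:b i, a i:]) = Polynomial.smult (b x) ?P + pCons 0 (Polynomial.smult (a x) ?P)"
    using insert by simp
  have "Polynomial.degree (\<Prod>i\<in>insert x I. [:b i, a i:]) \<le> Suc (card I)"
    unfolding P
  proof (rule degree_add_le)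
    show "Polynomial.degree (Polynomial.smult (b x) ?P) \<le> Suc (card I)"
      using insert.IH degree_smult_le[of "b x" ?P] by linarith
    show "Polynomial.degree (pCons 0 (Polynomial.smult (a x) ?P)) \<le> Suc (card I)"
      using insert.IH degree_pCons_le[of 0 "Polynomial.smult (a x) ?P"] degree_smult_le[of "a x" ?P] by linarith
  qed
  moreover have "Polynomial.coeff ?P (Suc (card I)) = 0"
    using insert.IH by (intro coeff_eq_0) simp
  then have "Polynomial.coeff (\<Prod>i\<in>insert x I. [:b i, a i:]) (Suc (card I)) = (\<Prod>i\<in>insert x I. a i)"
    unfolding P using insert by simp
  ultimately show ?case using insert by simp
qed simp

lemma poly_cpoly: "poly (cpoly x) s = det (smat s (x $ 0) + smat 1 (x $ 1))"
  by (simp add: cpoly_def det_def poly_sum poly_prod smat_def algebra_simps)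

lemma cpoly_degree: "Polynomial.degree (cpoly x) \<le> 6"
  and cpoly_coeff: "Polynomial.coeff (cpoly x) 6 = det (x $ 0)"
proof -
  have d: "Polynomial.degree (\<Prod>i\<in>UNIV. [:x $ 1 $ i $ p i, x $ 0 $ i $ p i:]) \<le> 6"
    and c: "Polynomial.coeff (\<Prod>i\<in>UNIV. [:x $ 1 $ i $ p i, x $ 0 $ i $ p i:]) 6 = (\<Prod>i\<in>UNIV. x $ 0 $ i $ p i)" for p
    using coeff_prod_linear[of UNIV "\<lambda>i. x $ 1 $ i $ p i" "\<lambda>i. x $ 0 $ i $ p i"] by simp_all
  have s: "of_int (sign p) * P = Polynomial.smult (of_int (sign p)) P" for p :: "6 \<Rightarrow> 6" and P :: "'a poly"
    by (simp add: of_int_poly)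
  show "Polynomial.degree (cpoly x) \<le> 6"
    unfolding cpoly_def det_def
  proof (rule degree_sum_le)
    fix p :: "6 \<Rightarrow> 6"
    show "Polynomial.degree (of_int (sign p) * (\<Prod>i\<in>UNIV. (\<chi> i j. [:x $ 1 $ i $ j, x $ 0 $ i $ j:]) $ i $ p i)) \<le> 6"
      unfolding s using d[of p] degree_smult_le[of "of_int (sign p)" "\<Prod>i\<in>UNIV. [:x $ 1 $ i $ p i, x $ 0 $ i $ p i:]"]
      by simp
  qed simp
  show "Polynomial.coeff (cpoly x) 6 = det (x $ 0)"
    unfolding cpoly_def det_def coeff_sum s by (simp add: c)
qed

text \<open>The polynomial matrix of the transformed pencil is a congruence, by the constant matrix
  \<open>fst g\<close>, of a combination of the old components. The coefficients of this combination
  are linear polynomials formed from the columns of \<open>snd g\<close>.\<close>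

lemma cpoly_act:
  fixes y :: "'a::comm_ring_1 rep"
  shows "cpoly (act g y) = [:det (fst g) * det (fst g):] * 
    det (\<chi> i j. Polynomial.smult (y $ 0 $ i $ j) [:snd g $ 1 $ 0, snd g $ 0 $ 0:] +
                Polynomial.smult (y $ 1 $ i $ j) [:snd g $ 1 $ 1, snd g $ 0 $ 1:])"
proof -
  let ?F = "(\<chi> i j. [:fst g $ i $ j:]) :: 'a poly^6^6"
  let ?Y = "(\<chi> i j. Polynomial.smult (y $ 0 $ i $ j) [:snd g $ 1 $ 0, snd g $ 0 $ 0:] +
                Polynomial.smult (y $ 1 $ i $ j) [:snd g $ 1 $ 1, snd g $ 0 $ 1:])"
  have sm: "(\<Sum>i\<in>A. [:f i, h i:]) = [:\<Sum>i\<in>A. f i, \<Sum>i\<in>A. h i:]" if "finite A" for f h and A :: "6 set"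
    using that by induction auto
  have "(\<chi> i j. [:act g y $ 1 $ i $ j, act g y $ 0 $ i $ j:]) = ?F ** ?Y ** transpose ?F"
    by (simp add: vec_eq_iff matrix_matrix_mult_def transpose_def act_component sum_2' sm sum_distrib_left sum_distrib_right
         sum.distrib[symmetric] algebra_simps)
  moreover have "det ?F = [:det (fst g):]"
  proof -
    have pr: "(\<Prod>i\<in>A. [:f i:]) = [:\<Prod>i\<in>A. f i:]" if "finite A" for f and A :: "6 set"
      using that by induction (auto simp: one_pCons mult.commute)
    have s0: "(\<Sum>p\<in>A. [:f p:]) = [:\<Sum>p\<in>A. f p:]" if "finite A" for f and A :: "(6 \<Rightarrow> 6) set"
      using that by induction auto
    show ?thesis unfolding det_def by (simp add: pr s0 of_int_poly finite_permutations mult.commute)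
  qed
  ultimately show ?thesis unfolding cpoly_def by (simp add: det_mul algebra_simps)
qed

lemma card_Compl_6: "card (- S) = 6 - card S" for S :: "6 set"
  by (simp add: Compl_eq_Diff_UNIV card_Diff_subset)

text \<open>In the expansion over permutations every factor of a nonzero term has weight at least
  the squared norm of \<beta>. In the sum of the six weights the entries of the first block cancel,
  because a permutation runs through each of them twice with total zero. The second block then
  permits at most two factors from the first component, so the linear form \<open>Q\<close> occurs
  at least four times.\<close>

proposition stratum_cpoly:
  fixes x :: "'a::alg_closed_field rep"
  assumes b: "\<beta> \<in> BB" and x: "x \<in> stratum \<beta>"
  shows "(\<exists>\<theta>. [:- \<theta>, 1:] ^ 4 dvd cpoly x) \<or> Polynomial.degree (cpoly x) \<le> 2"
proof -
  obtain g y where gy: "x = act g y" "g \<in> G" "y \<in> Y_ss \<beta>" using x unfolding stratum_def by blast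
  have bt: "\<beta> \<in> t_star" and bp: "\<beta> \<in> t_star_plus" and b0: "\<beta> \<noteq> 0" using b by (auto simp: BB_def t_star_plus_def)
  define P where "P = [:snd g $ 1 $ 0, snd g $ 0 $ 0:]"
  define Q where "Q = [:snd g $ 1 $ 1, snd g $ 0 $ 1:]"
  define f where "f p i = Polynomial.smult (y $ 0 $ i $ p i) P + Polynomial.smult (y $ 1 $ i $ p i) Q" for p i
  have Qdet: "cpoly x = [:det (fst g) * det (fst g):] * (\<Sum>p | p permutes UNIV. of_int (sign p) * (\<Prod>i\<in>UNIV. f p i))"
    unfolding gy(1) cpoly_act P_def[symmetric] Q_def[symmetric] by (subst (3) det_def) (simp only: f_def[abs_def] vec_lambda_beta)
  \<comment> \<open>The rows in which the first component of \<open>y\<close> contributes; in all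
    other rows the factor is a constant times \<open>Q\<close>.\<close>
  define K where "K p = {i. y $ 0 $ i $ p i \<noteq> 0}" for p :: "6 \<Rightarrow> 6"
  have K: "card (K p) \<le> 2" if p: "p permutes UNIV" and n: "(\<Prod>i\<in>UNIV. f p i) \<noteq> 0" for p
  proof -
    have nz: "y $ 0 $ i $ p i \<noteq> 0 \<or> y $ 1 $ i $ p i \<noteq> 0" for i
    proof -
      have "f p i \<noteq> 0" using n by (auto simp: prod_zero_iff)
      then show ?thesis by (auto simp: f_def)
    qed
    define l :: "6 \<Rightarrow> 2" where "l i = (if i \<in> K p then 0 else 1)" for i
    have "y $ l i $ i $ p i \<noteq> 0" for i using nz[of i] by (auto simp: l_def K_def)
    then have w: "\<beta> \<bullet> \<beta> \<le> fst \<beta> $ i + fst \<beta> $ p i + snd \<beta> $ l i" for i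
      using Y_ss_wgt[OF bt gy(3)] by (simp add: wgt_def)
    have "0 < (\<Sum>i\<in>(UNIV::6 set). \<beta> \<bullet> \<beta>)" using b0 by simp
    also have "\<dots> \<le> (\<Sum>i\<in>UNIV. fst \<beta> $ i + fst \<beta> $ p i + snd \<beta> $ l i)" by (rule sum_mono) (rule w)
    also have "\<dots> = (\<Sum>i\<in>UNIV. fst \<beta> $ i) + (\<Sum>i\<in>UNIV. fst \<beta> $ p i) + (\<Sum>i\<in>UNIV. snd \<beta> $ l i)"
      by (simp add: sum.distrib)
    also have "(\<Sum>i\<in>UNIV. fst \<beta> $ p i) = (\<Sum>i\<in>UNIV. fst \<beta> $ i)"
      using sum.permute[OF p, of "\<lambda>i. fst \<beta> $ i"] by (simp add: o_def)
    also have "(\<Sum>i\<in>UNIV. fst \<beta> $ i) = 0" using bt by (simp add: t_star_def)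
    also have "(\<Sum>i\<in>UNIV. snd \<beta> $ l i) = (\<Sum>i\<in>UNIV. if i \<in> K p then snd \<beta> $ 0 else snd \<beta> $ 1)"
      by (intro sum.cong) (auto simp: l_def)
    also have "\<dots> = card (K p) * snd \<beta> $ 0 + card (- K p) * snd \<beta> $ 1"
      by (simp add: sum.If_cases)
    also have "card (- K p) = 6 - card (K p)" by (simp add: card_Compl_6)
    finally have s: "0 < card (K p) * snd \<beta> $ 0 + real (6 - card (K p)) * snd \<beta> $ 1" by simp
    have sn: "snd \<beta> $ 0 = - snd \<beta> $ 1" using bt by (simp add: t_star_def sum_2')
    moreover have "snd \<beta> $ 0 \<le> snd \<beta> $ 1" using bp by (simp add: t_star_plus_def)
    ultimately have c0: "snd \<beta> $ 1 \<ge> 0" by simp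
    have c6: "card (K p) \<le> 6" using card_mono[of UNIV "K p"] by simp
    \<comment> \<open>Rows in \<open>K p\<close> contribute the entry \<open>snd \<beta> $ 1\<close>
      with a minus sign, the others with a plus sign. This entry is nonnegative, so positivity
      leaves at most two rows in \<open>K p\<close>.\<close>
    have "0 < (6 - 2 * real (card (K p))) * snd \<beta> $ 1"
      using s c6 by (simp add: sn of_nat_diff algebra_simps)
    then have "6 - 2 * real (card (K p)) > 0" using c0 by (simp add: zero_less_mult_iff)
    then show ?thesis by simp
  qed
  have split: "(\<Prod>i\<in>UNIV. f p i) = (\<Prod>i\<in>K p. f p i) * ((\<Prod>i\<in>- K p. [:y $ 1 $ i $ p i:]) * Q ^ card (- K p))" for p
  proof -
    have "(\<Prod>i\<in>UNIV. f p i) = (\<Prod>i\<in>K p. f p i) * (\<Prod>i\<in>- K p. f p i)"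
      by (metis Compl_eq_Diff_UNIV finite mult.commute prod.subset_diff subset_UNIV)
    also have "(\<Prod>i\<in>- K p. f p i) = (\<Prod>i\<in>- K p. [:y $ 1 $ i $ p i:] * Q)"
      by (intro prod.cong refl) (simp add: f_def K_def)
    finally show ?thesis by (simp only: prod.distrib prod_constant)
  qed
  show ?thesis
  proof (cases "snd g $ 0 $ 1 = 0")
    case False
    define \<theta> where "\<theta> = - (snd g $ 1 $ 1 / snd g $ 0 $ 1)"
    have "Q = [:- \<theta>, 1:] * [:snd g $ 0 $ 1:]" using False by (simp add: Q_def \<theta>_def)
    then have dq: "[:- \<theta>, 1:] ^ 4 dvd Q ^ 4" by (simp only: dvd_power_same dvd_triv_left)
    have "[:- \<theta>, 1:] ^ 4 dvd (\<Prod>i\<in>UNIV. f p i)" if p: "p permutes UNIV" for p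
    proof (cases "(\<Prod>i\<in>UNIV. f p i) = 0")
      case False
      then have "card (K p) \<le> 2" using K[OF p] by blast
      then have "4 \<le> card (- K p)" by (simp add: card_Compl_6)
      then have "Q ^ 4 dvd Q ^ card (- K p)" by (rule le_imp_power_dvd)
      then show ?thesis unfolding split using dq by (meson dvd_mult dvd_trans)
    next
      case True then show ?thesis by (simp only: dvd_0_right)
    qed
    then have "[:- \<theta>, 1:] ^ 4 dvd cpoly x" unfolding Qdet by (intro dvd_mult dvd_sum) auto
    then show ?thesis by blast
  next
    case True
    \<comment> \<open>Here \<open>Q\<close> is constant: the root of high multiplicity sits at
      infinity, and each of the at most two rows in \<open>K p\<close> raises the degree by at most
      one.\<close>
    have "Polynomial.degree (of_int (sign p) * (\<Prod>i\<in>UNIV. f p i)) \<le> 2" if p: "p permutes UNIV" for p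
    proof (cases "(\<Prod>i\<in>UNIV. f p i) = 0")
      case False
      then have "card (K p) \<le> 2" using K[OF p] by blast
      have "Polynomial.degree (\<Prod>i\<in>UNIV. f p i) \<le> (\<Sum>i\<in>UNIV. Polynomial.degree (f p i))"
        using degree_prod_sum_le[of UNIV "f p"] by simp
      also have "\<dots> \<le> (\<Sum>i\<in>UNIV. if i \<in> K p then 1 else 0)"
      proof (rule sum_mono)
        fix i
        show "Polynomial.degree (f p i) \<le> (if i \<in> K p then 1 else 0)"
          using True degree_pCons_le[of "y $ 0 $ i $ p i * snd g $ 1 $ 0 + y $ 1 $ i $ p i * snd g $ 1 $ 1"
              "[:y $ 0 $ i $ p i * snd g $ 0 $ 0:]"]
          by (auto simp: f_def K_def P_def Q_def)
      qed
      also have "\<dots> = card (K p)" by (simp add: sum.If_cases)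
      finally have "Polynomial.degree (\<Prod>i\<in>UNIV. f p i) \<le> 2" using \<open>card (K p) \<le> 2\<close> by simp
      then show ?thesis using degree_mult_le[of "of_int (sign p)" "\<Prod>i\<in>UNIV. f p i"] by simp
    next
      case True then show ?thesis by (simp only: mult_zero_right degree_0)
    qed
    then have "Polynomial.degree (\<Sum>p | p permutes UNIV. of_int (sign p) * (\<Prod>i\<in>UNIV. f p i)) \<le> 2"
      by (intro degree_sum_le) (auto simp: finite_permutations)
    then have "Polynomial.degree (cpoly x) \<le> 2"
      unfolding Qdet
      using degree_mult_le[of "[:det (fst g) * det (fst g):]" "\<Sum>p | p permutes UNIV. of_int (sign p) * (\<Prod>i\<in>UNIV. f p i)"]
      by simp
    then show ?thesis by blast
  qed
qed

section \<open>Double roots of quadratic polynomials\<close>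

lemma perfect_alg_closed:
  fixes g b :: "'a::alg_closed_field"
  assumes "g\<^sup>2 + 4 * b = 0"
  shows "\<exists>r. g = - 2 * r \<and> b = - (r * r)"
proof -
  have "Polynomial.degree [:- b, g, 1:] > 0" by simp
  then obtain r where r: "poly [:- b, g, 1:] r = 0" using alg_closed_imp_poly_has_root by blast
  then have b: "b = r * r + g * r" by (simp add: algebra_simps)
  have "(2 * r + g) * (2 * r + g) = g\<^sup>2 + 4 * b" unfolding b by (simp add: algebra_simps power2_eq_square)
  then have "g = - 2 * r" using assms by (simp add: eq_neg_iff_add_eq_0 add.commute)
  moreover from this have "b = - (r * r)" unfolding b by simp
  ultimately show ?thesis by blast
qed

lemma irreducible_quadratic:
  fixes g b :: "'a::field"
  assumes "\<And>r. poly [:- b, g, 1:] r \<noteq> 0"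
  shows "Factorial_Ring.irreducible [:- b, g, 1:]"
proof (rule Factorial_Ring.irreducibleI)
  show "[:- b, g, 1:] \<noteq> 0" by simp
  show "\<not> [:- b, g, 1:] dvd 1" by (simp add: is_unit_iff_degree)
  fix p q assume pq: "[:- b, g, 1:] = p * q"
  then have nz: "p \<noteq> 0" "q \<noteq> 0" by auto
  have "Polynomial.degree p + Polynomial.degree q = 2"
    using degree_mult_eq[OF nz] pq[symmetric] by simp
  moreover have "Polynomial.degree h \<noteq> 1" if h: "h dvd [:- b, g, 1:]" for h
  proof
    assume "Polynomial.degree h = 1"
    then obtain c d where cd: "h = [:c, d:]" "d \<noteq> 0" by (rule degree1_coeffs)
    then have "poly h (- c / d) = 0" by simp
    moreover obtain k where "[:- b, g, 1:] = h * k" using h by (elim dvdE)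
    then have "poly [:- b, g, 1:] (- c / d) = poly h (- c / d) * poly k (- c / d)" by (simp only: poly_mult)
    ultimately have "poly [:- b, g, 1:] (- c / d) = 0" by simp
    then show False using assms by blast
  qed
  then have "Polynomial.degree p \<noteq> 1" "Polynomial.degree q \<noteq> 1" using pq by simp_all
  ultimately have "Polynomial.degree p = 0 \<or> Polynomial.degree q = 0" by linarith
  then show "p dvd 1 \<or> q dvd 1" using nz by (simp add: is_unit_iff_degree)
qed

text \<open>At a root \<open>r\<close> the square of \<open>2 r + g\<close> is the discriminant, in
  any characteristic. Without a root the quadratic is irreducible, hence separable. This is
  impossible: in characteristic two its derivative is zero, and otherwise \<open>- g / 2\<close> is
  a root.\<close>

lemma perfect_double_root:
  fixes g b :: "'k::field"
  assumes perf: "perfect_field TYPE('k)" and disc: "g\<^sup>2 + 4 * b = 0"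
  shows "\<exists>r. g = - 2 * r \<and> b = - (r * r)"
proof (cases "\<exists>r. poly [:- b, g, 1:] r = 0")
  case True
  then obtain r where r: "poly [:- b, g, 1:] r = 0" by blast
  then have b: "b = r * r + g * r" by (simp add: algebra_simps)
  have "(2 * r + g) * (2 * r + g) = g\<^sup>2 + 4 * b" unfolding b by (simp add: algebra_simps power2_eq_square)
  then have "g = - 2 * r" using disc by (simp add: eq_neg_iff_add_eq_0 add.commute)
  moreover from this have "b = - (r * r)" unfolding b by simp
  ultimately show ?thesis by blast
next
  case False
  then have irr: "Factorial_Ring.irreducible [:- b, g, 1:]" using irreducible_quadratic by blast
  then have cop: "coprime [:- b, g, 1:] (pderiv [:- b, g, 1:])"
    using perf by (simp add: perfect_field_def separable_poly_def)
  show ?thesis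
  proof (cases "(2 :: 'k) = 0")
    case True
    have "(4 :: 'k) = 2 * 2" by simp
    then have "(4 :: 'k) = 0" by (simp only: True mult_zero_left)
    then have "g = 0" using disc by simp
    then have "pderiv [:- b, g, 1:] = 0" using True by (simp add: pderiv_pCons numeral_2_eq_2)
    then have "is_unit [:- b, g, 1:]" using cop by simp
    then show ?thesis by (simp add: is_unit_iff_degree)
  next
    case 2: False
    define h where "h = g / 2"
    have g: "g = 2 * h" using 2 by (simp add: h_def)
    have "4 * poly [:- b, g, 1:] (- h) = - (g\<^sup>2 + 4 * b)"
      unfolding g by (simp add: algebra_simps power2_eq_square)
    then have "(2 * 2) * poly [:- b, g, 1:] (- h) = 0" using disc by simp
    then have "poly [:- b, g, 1:] (- h) = 0" using 2 by (simp only: mult_eq_0_iff) blast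
    then show ?thesis using False by blast
  qed
qed

subsection \<open>Pencils outside the strata\<close>

text \<open>A symmetric factorisation replaces the expansion of a determinant of size six.
  \<open>L\<close> is a polynomial matrix with inverse \<open>L'\<close>, \<open>J\<close> an
  invertible constant alternating matrix, and \<open>R\<close> is diagonal with the quadratic as its
  only entry other than one. The remaining unit is left unevaluated.\<close>

lemma cpoly_z_S:
  fixes g b :: "'a::field"
  defines "q \<equiv> [:- b, g, 1:]"
  obtains c where "c dvd 1" "cpoly (z_S g b) * c = q ^ 2"
proof -
  let ?X = "[:0, 1:] :: 'a poly" and ?e = "\<lambda>i j. wedge (axis i 1) (axis j 1) :: 'a poly^6^6"
  define L :: "'a poly^6^6" where "L = (\<chi> i j. (if i = j then 1 else 0) - (if i = 5 \<and> j = 2 then [:g, 1:] else 0)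
      + (if i = 3 \<and> j = 4 then ?X else 0))"
  define L' :: "'a poly^6^6" where "L' = (\<chi> i j. (if i = j then 1 else 0) + (if i = 5 \<and> j = 2 then [:g, 1:] else 0)
      - (if i = 3 \<and> j = 4 then ?X else 0))"
  define J where "J = ?e 0 1 + ?e 2 4 - ?e 3 5"
  have "L ** L' = mat 1"
    by (simp add: vec_eq_iff forall_6 matrix_matrix_mult_def sum_6 mat_def L_def L'_def)
  from arg_cong[OF this, of det] have dL: "det L * det L' = 1" by (simp only: det_I det_mul)
  have "J ** (?e 1 0 + ?e 4 2 - ?e 5 3) = mat 1"
    by (simp add: vec_eq_iff forall_6 matrix_matrix_mult_def sum_6 mat_def J_def wedge_def axis_def)
  from arg_cong[OF this, of det] have dJ: "det J * det (?e 1 0 + ?e 4 2 - ?e 5 3) = 1" by (simp only: det_I det_mul)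
  define R :: "'a poly^6^6" where "R = (\<chi> i j. if i = j then if i = 3 then q else 1 else 0)"
  have "(\<chi> i j. [:z_S g b $ 1 $ i $ j, z_S g b $ 0 $ i $ j:]) = L ** (R ** J ** transpose R) ** transpose L"
    by (simp add: vec_eq_iff forall_6 matrix_matrix_mult_def sum_6 transpose_def L_def R_def J_def wedge_def axis_def
        z_S_def smat_def E_def q_def one_pCons)
  then have "cpoly (z_S g b) = det L * (det R * det J * det R) * det L"
    unfolding cpoly_def by (simp add: det_mul)
  moreover have "det R = q"
  proof -
    have "det R = (\<Prod>i\<in>UNIV. R $ i $ i)" by (rule det_diagonal) (simp add: R_def)
    also have "\<dots> = q" by (simp add: R_def)
    finally show ?thesis .
  qed
  ultimately have c: "cpoly (z_S g b) = q ^ 2 * (det J * det L * det L)"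
    by (simp only: power2_eq_square mult_ac)
  have "(det J * det L * det L) * (det (?e 1 0 + ?e 4 2 - ?e 5 3) * det L' * det L') =
     (det J * det (?e 1 0 + ?e 4 2 - ?e 5 3)) * (det L * det L') * (det L * det L')"
    by (simp only: mult_ac)
  then have u: "(det J * det L * det L) * (det (?e 1 0 + ?e 4 2 - ?e 5 3) * det L' * det L') = 1"
    by (simp add: dL dJ)
  show ?thesis
  proof (rule that)
    show "cpoly (z_S g b) * (det (?e 1 0 + ?e 4 2 - ?e 5 3) * det L' * det L') = q ^ 2"
      unfolding c mult.assoc[of "q ^ 2"] u by simp
    show "det (?e 1 0 + ?e 4 2 - ?e 5 3) * det L' * det L' dvd 1"
      using dvd_triv_right[of "det (?e 1 0 + ?e 4 2 - ?e 5 3) * det L' * det L'" "det J * det L * det L"] unfolding u .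
  qed
qed

lemma pderiv_double_root: "poly (pderiv ([:- \<theta>, 1:] ^ 2 * r)) \<theta> = 0" for \<theta> :: "'a::field"
proof -
  have "poly [:- \<theta>, 1:] \<theta> = 0" by simp
  then show ?thesis
    by (simp only: power2_eq_square mult.assoc pderiv_mult poly_add poly_mult mult_zero_left mult_zero_right add_0_left)
qed

text \<open>The polynomial has degree four, which rules out the degree alternative of
  \<open>stratum_cpoly\<close>. A fourfold root of the square is a double root of the quadratic,
  contradicting the discriminant.\<close>

lemma z_S_not_in_stratum:
  fixes g b :: "'a::alg_closed_field"
  assumes "g\<^sup>2 + 4 * b \<noteq> 0" "\<beta> \<in> BB"
  shows "z_S g b \<notin> stratum \<beta>"
proof
  assume z: "z_S g b \<in> stratum \<beta>"
  let ?q = "[:- b, g, 1:]"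
  obtain c where c: "c dvd 1" "cpoly (z_S g b) * c = ?q ^ 2" by (rule cpoly_z_S)
  have q0: "?q \<noteq> 0" by simp
  have "Polynomial.degree (cpoly (z_S g b)) = 4"
  proof -
    have nz: "cpoly (z_S g b) \<noteq> 0" "c \<noteq> 0" using c(2) q0 by auto
    have "Polynomial.degree (cpoly (z_S g b)) + Polynomial.degree c = Polynomial.degree (?q ^ 2)"
      using degree_mult_eq[OF nz] c(2) by simp
    also have "\<dots> = 4" by (simp add: degree_power_eq)
    finally show ?thesis using c(1) nz by (simp add: is_unit_iff_degree)
  qed
  then obtain \<theta> where "[:- \<theta>, 1:] ^ 4 dvd cpoly (z_S g b)" using stratum_cpoly[OF assms(2) z] by auto
  then have "[:- \<theta>, 1:] ^ 4 dvd ?q ^ 2" unfolding c(2)[symmetric] by (rule dvd_mult2)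
  moreover have "Polynomial.order \<theta> (?q ^ 2) = Polynomial.order \<theta> ?q + Polynomial.order \<theta> ?q"
    using order_mult[of ?q ?q \<theta>] by (simp add: power2_eq_square)
  ultimately have "2 \<le> Polynomial.order \<theta> ?q" by (simp add: order_divides)
  then have "[:- \<theta>, 1:] ^ 2 dvd ?q" by (simp only: order_divides simp_thms)
  then obtain r where r: "?q = [:- \<theta>, 1:] ^ 2 * r" by (elim dvdE)
  have "poly ?q \<theta> = 0" unfolding r by simp
  moreover have "poly (pderiv ?q) \<theta> = 0" unfolding r by (rule pderiv_double_root)
  ultimately have e: "\<theta> * \<theta> + g * \<theta> - b = 0" "2 * \<theta> + g = 0" by (simp_all add: pderiv_pCons algebra_simps)
  have "g\<^sup>2 + 4 * b = (2 * \<theta> + g) * (2 * \<theta> + g) - 4 * (\<theta> * \<theta> + g * \<theta> - b)"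
    by (simp add: algebra_simps power2_eq_square)
  then show False using assms(1) e by simp
qed

section \<open>The determinant of a pencil under extension of the ground field\<close>

lemma map_poly_to_ac_mult: "map_poly to_ac (p * q) = map_poly to_ac p * map_poly to_ac q"
  by (rule poly_eqI) (simp add: coeff_map_poly coeff_mult to_ac_sum)

lemma map_poly_to_ac_add: "map_poly to_ac (p + q) = map_poly to_ac p + map_poly to_ac q"
  by (rule poly_eqI) (simp add: coeff_map_poly)

lemma map_poly_to_ac_sum: "map_poly to_ac (\<Sum>i\<in>A. f i) = (\<Sum>i\<in>A. map_poly to_ac (f i))"
  by (rule poly_eqI) (simp add: coeff_map_poly coeff_sum to_ac_sum)

lemma map_poly_to_ac_prod: "map_poly to_ac (\<Prod>i\<in>A. f i) = (\<Prod>i\<in>A. map_poly to_ac (f i))"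
  by (induction A rule: infinite_finite_induct) (simp_all add: map_poly_to_ac_mult)

lemma map_poly_to_ac_pderiv: "map_poly to_ac (pderiv p) = pderiv (map_poly to_ac p)"
  by (rule poly_eqI) (simp add: coeff_map_poly coeff_pderiv)

lemma map_poly_to_ac_eq_0 [simp]: "map_poly to_ac p = 0 \<longleftrightarrow> p = 0"
  by (auto simp: poly_eq_iff coeff_map_poly)

lemma cpoly_base_change: "cpoly (base_change x) = map_poly to_ac (cpoly x)"
proof -
  have i: "map_poly to_ac (of_int n) = of_int n" for n :: int
    by (simp add: of_int_poly map_poly_pCons)
  show ?thesis
    unfolding cpoly_def det_def map_poly_to_ac_sum map_poly_to_ac_mult map_poly_to_ac_prod i
    by (simp add: base_change_def map_poly_pCons)
qed

text \<open>Over a perfect field an irrational root of multiplicity four would come with its conjugates,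
  forcing the degree to be at least eight.\<close>

lemma nondegenerate_not_in_stratum:
  fixes x :: "'k::field rep"
  assumes perf: "perfect_field TYPE('k)" and b: "\<beta> \<in> BB"
    and nd: "\<And>s t. (s, t) \<noteq> (0, 0) \<Longrightarrow> det (smat s (x $ 0) + smat t (x $ 1)) \<noteq> 0"
  shows "base_change x \<notin> stratum \<beta>"
proof
  assume z: "base_change x \<in> stratum \<beta>"
  let ?D = "cpoly x"
  have "smat 1 (x $ 0) + smat 0 (x $ 1) = x $ 0" by (simp add: vec_eq_iff smat_def)
  then have "det (x $ 0) \<noteq> 0" using nd[of 1 0] by simp
  then have d6: "Polynomial.degree ?D = 6"
    using cpoly_degree[of x] cpoly_coeff[of x] le_degree[of ?D 6] by simp
  then have D0: "?D \<noteq> 0" by auto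
  have noroot: "poly ?D r \<noteq> 0" for r using nd[of r 1] by (simp add: poly_cpoly)
  have "Polynomial.degree (cpoly (base_change x)) = 6"
    unfolding cpoly_base_change by (subst degree_map_poly) (simp_all add: d6)
  then obtain \<theta> where \<theta>: "[:- \<theta>, 1:] ^ 4 dvd map_poly to_ac ?D"
    using stratum_cpoly[OF b z] unfolding cpoly_base_change by auto
  define ann where "ann p \<longleftrightarrow> p \<noteq> 0 \<and> poly (map_poly to_ac p) \<theta> = 0" for p :: "'k poly"
  have annD: "ann ?D"
  proof -
    have "[:- \<theta>, 1:] dvd map_poly to_ac ?D" using \<theta> by (rule dvd_trans[rotated]) simp
    then show ?thesis using D0 by (simp add: ann_def poly_eq_0_iff_dvd)
  qed
  \<comment> \<open>The minimal polynomial of \<open>\<theta>\<close> over the base field, taken as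
    a nonzero annihilating polynomial of least degree.\<close>
  define p where "p = (ARG_MIN Polynomial.degree p. ann p)"
  have p: "ann p" "\<And>q. ann q \<Longrightarrow> Polynomial.degree p \<le> Polynomial.degree q"
    using arg_min_nat_lemma[of ann ?D Polynomial.degree] annD unfolding p_def by auto
  have p0: "p \<noteq> 0" using p(1) by (simp add: ann_def)
  have pdvd: "p dvd h" if "poly (map_poly to_ac h) \<theta> = 0" for h
  proof (rule ccontr)
    assume nd: "\<not> p dvd h"
    have "h = h div p * p + h mod p" by simp
    then have "poly (map_poly to_ac h) \<theta> = poly (map_poly to_ac (h div p * p + h mod p)) \<theta>" by simp
    then have "poly (map_poly to_ac (h mod p)) \<theta> = 0"
      using that p(1) by (simp only: map_poly_to_ac_add map_poly_to_ac_mult ann_def) simp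
    moreover have "h mod p \<noteq> 0" using nd by (simp add: mod_eq_0_iff_dvd)
    ultimately have "Polynomial.degree p \<le> Polynomial.degree (h mod p)" by (intro p(2)) (simp add: ann_def)
    moreover have "h mod p = 0 \<or> Polynomial.degree (h mod p) < Polynomial.degree p" by (rule degree_mod_less[OF p0])
    ultimately show False using \<open>h mod p \<noteq> 0\<close> by simp
  qed
  have p_root: "poly p r \<noteq> 0" for r
  proof
    assume "poly p r = 0"
    moreover have "p dvd ?D" using annD by (intro pdvd) (simp add: ann_def)
    ultimately have "poly ?D r = 0" by (auto elim!: dvdE)
    then show False using noroot[of r] by simp
  qed
  have pd0: "Polynomial.degree p \<noteq> 0"
  proof
    assume "Polynomial.degree p = 0"
    then obtain a where "p = [:a:]" by (rule degree_eq_zeroE)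
    then show False using p(1) by (simp add: ann_def map_poly_pCons)
  qed
  have pd1: "Polynomial.degree p \<noteq> 1"
  proof
    assume "Polynomial.degree p = 1"
    then obtain c d where "p = [:c, d:]" "d \<noteq> 0" by (rule degree1_coeffs)
    then have "poly p (- c / d) = 0" by simp
    then show False using p_root[of "- c / d"] by simp
  qed
  have irr: "Factorial_Ring.irreducible p"
  proof (rule Factorial_Ring.irreducibleI)
    show "\<not> p dvd 1" using pd0 p0 by (simp add: is_unit_iff_degree)
    fix f h assume fh: "p = f * h"
    then have nz: "f \<noteq> 0" "h \<noteq> 0" using p0 by auto
    have deg: "Polynomial.degree p = Polynomial.degree f + Polynomial.degree h"
      unfolding fh by (rule degree_mult_eq[OF nz])
    have "poly (map_poly to_ac f) \<theta> * poly (map_poly to_ac h) \<theta> = 0"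
      using p(1) unfolding fh by (simp add: ann_def map_poly_to_ac_mult)
    then have "ann f \<or> ann h" using nz by (auto simp: ann_def)
    then have "Polynomial.degree h = 0 \<or> Polynomial.degree f = 0" using p(2)[of f] p(2)[of h] deg by auto
    then show "f dvd 1 \<or> h dvd 1" using nz by (auto simp: is_unit_iff_degree)
  qed (rule p0)
  have sep: "poly (map_poly to_ac (pderiv p)) \<theta> \<noteq> 0"
  proof
    assume "poly (map_poly to_ac (pderiv p)) \<theta> = 0"
    then have "p dvd pderiv p" by (rule pdvd)
    moreover have "coprime p (pderiv p)" using perf irr by (simp add: perfect_field_def separable_poly_def)
    ultimately have "p dvd 1" by (meson coprime_def dvd_refl)
    then show False using pd0 p0 by (simp add: is_unit_iff_degree)
  qed
  let ?p = "map_poly to_ac p"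
  \<comment> \<open>Separability makes \<open>\<theta>\<close> a simple root of its minimal
    polynomial, so each factor \<open>p\<close> accounts for exactly one unit of the
    multiplicity.\<close>
  have op: "Polynomial.order \<theta> ?p = 1"
  proof -
    have "Polynomial.order \<theta> ?p \<noteq> 0" using p(1) p0 order_root[of ?p \<theta>] by (simp add: ann_def)
    moreover have "\<not> 2 \<le> Polynomial.order \<theta> ?p"
    proof
      assume "2 \<le> Polynomial.order \<theta> ?p"
      then have "[:- \<theta>, 1:] ^ 2 dvd ?p" by (simp only: order_divides simp_thms)
      then obtain r where r: "?p = [:- \<theta>, 1:] ^ 2 * r" by (elim dvdE)
      have "poly (pderiv ?p) \<theta> = 0" unfolding r by (rule pderiv_double_root)
      then show False using sep by (simp add: map_poly_to_ac_pderiv)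
    qed
    ultimately show ?thesis by simp
  qed
  \<comment> \<open>After fewer than four copies of \<open>p\<close> have been removed, the quotient
    still vanishes at \<open>\<theta>\<close> and is divisible by \<open>p\<close> once
    more.\<close>
  have "p ^ j dvd ?D" if "j \<le> 4" for j
    using that
  proof (induction j)
    case (Suc j)
    then obtain r where r: "?D = p ^ j * r" by (auto elim: dvdE)
    have r0: "r \<noteq> 0" using r D0 by auto
    have pw: "map_poly to_ac (p ^ j) = ?p ^ j" by (induction j) (simp_all add: map_poly_to_ac_mult)
    have oj: "Polynomial.order \<theta> (?p ^ i) = i" for i
    proof (induction i)
      case (Suc i)
      have "?p * ?p ^ i \<noteq> 0" using p0 by simp
      then show ?case using Suc op by (simp add: order_mult)
    qed simp
    have e: "map_poly to_ac ?D = ?p ^ j * map_poly to_ac r" unfolding r map_poly_to_ac_mult pw ..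
    have nz: "?p ^ j * map_poly to_ac r \<noteq> 0" using p0 r0 by simp
    have "4 \<le> Polynomial.order \<theta> (?p ^ j * map_poly to_ac r)"
      using \<theta> nz unfolding e order_divides by blast
    then have "Polynomial.order \<theta> (map_poly to_ac r) \<noteq> 0" using order_mult[OF nz, of \<theta>] oj[of j] Suc.prems by simp
    then have "poly (map_poly to_ac r) \<theta> = 0" by (simp add: order_root)
    then have "p dvd r" by (rule pdvd)
    then show ?case unfolding r by (auto elim!: dvdE)
  qed simp
  then have "p ^ 4 dvd ?D" by simp
  then have "Polynomial.degree (p ^ 4) \<le> 6" using dvd_imp_degree_le[OF _ D0] d6 by fastforce
  then have "4 * Polynomial.degree p \<le> 6" using p0 by (simp add: degree_power_eq)
  then show False using pd0 pd1 by linarith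
qed

subsection \<open>Block determinants\<close>

text \<open>A permutation moving an index outside \<open>B\<close> meets a zero entry of the padded
  matrix.\<close>

lemma block_det_sum:
  fixes A :: "'a::comm_ring_1^'n^'n"
  shows "block_det A B = (\<Sum>p | p permutes B. of_int (sign p) * (\<Prod>i\<in>B. A $ i $ p i))"
proof -
  let ?A = "\<lambda>i j. if i \<in> B \<and> j \<in> B then A $ i $ j else if i = j then 1 else 0 :: 'a"
  have "block_det A B = (\<Sum>p | p permutes UNIV. of_int (sign p) * (\<Prod>i\<in>UNIV. ?A i (p i)))"
    by (simp add: block_det_def det_def)
  also have "\<dots> = (\<Sum>p | p permutes B. of_int (sign p) * (\<Prod>i\<in>UNIV. ?A i (p i)))"
  proof (rule sum.mono_neutral_right)
    show "{p. p permutes B} \<subseteq> {p. p permutes UNIV}" by (auto intro: permutes_subset)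
    show "\<forall>p\<in>{p. p permutes UNIV} - {p. p permutes B}. of_int (sign p) * (\<Prod>i\<in>UNIV. ?A i (p i)) = 0"
    proof
      fix p assume p: "p \<in> {p. p permutes UNIV} - {p. p permutes B}"
      then obtain i where "i \<notin> B" "p i \<noteq> i"
        by (auto simp: permutes_def)
      then have "?A i (p i) = 0" by simp
      then have "(\<Prod>i\<in>UNIV. ?A i (p i)) = 0" by (intro prod_zero finite bexI[of _ i]) simp_all
      then show "of_int (sign p) * (\<Prod>i\<in>UNIV. ?A i (p i)) = 0" by simp
    qed
  qed (simp add: finite_permutations)
  also have "\<dots> = (\<Sum>p | p permutes B. of_int (sign p) * (\<Prod>i\<in>B. A $ i $ p i))"
  proof (rule sum.cong[OF refl])
    fix p assume "p \<in> {p. p permutes B}"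
    then have p: "p permutes B" by simp
    have "(\<Prod>i\<in>UNIV. ?A i (p i)) = (\<Prod>i\<in>B. ?A i (p i))"
      by (rule prod.mono_neutral_right) (use p in \<open>auto simp: permutes_not_in\<close>)
    also have "\<dots> = (\<Prod>i\<in>B. A $ i $ p i)"
      by (intro prod.cong refl) (use p in \<open>auto simp: permutes_in_image\<close>)
    finally show "of_int (sign p) * (\<Prod>i\<in>UNIV. ?A i (p i)) = of_int (sign p) * (\<Prod>i\<in>B. A $ i $ p i)" by simp
  qed
  finally show ?thesis .
qed

lemma block_det_1: "block_det A {a} = A $ a $ a"
  by (simp add: block_det_sum)

lemma block_det_2: "a \<noteq> b \<Longrightarrow> block_det A {a, b} = A $ a $ a * A $ b $ b - A $ a $ b * A $ b $ a"
  unfolding block_det_sum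
  by (subst sum_over_permutations_insert)
     (simp_all add: sign_swap_id transpose_def sign_id)

lemma block_det_3:
  assumes "a \<noteq> b" "a \<noteq> c" "b \<noteq> c"
  shows "block_det A {a, b, c} = A $ a $ a * (A $ b $ b * A $ c $ c - A $ b $ c * A $ c $ b)
    - A $ a $ b * (A $ b $ a * A $ c $ c - A $ b $ c * A $ c $ a)
    + A $ a $ c * (A $ b $ a * A $ c $ b - A $ b $ b * A $ c $ a)"
  unfolding block_det_sum using assms
  apply (subst sum_over_permutations_insert, simp, simp)
  apply (subst sum_over_permutations_insert, simp, simp)
  by (simp add: sign_swap_id sign_compose permutation_swap_id transpose_def sign_id algebra_simps)

lemma block_det_4:
  assumes "a \<noteq> b" "a \<noteq> c" "b \<noteq> c" "a \<noteq> d" "b \<noteq> d" "c \<noteq> d"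
  shows "block_det A {a, b, c, d} =
      A $ a $ a * (A $ b $ b * (A $ c $ c * A $ d $ d - A $ c $ d * A $ d $ c) - A $ b $ c * (A $ c $ b * A $ d $ d - A $ c $ d * A $ d $ b)
         + A $ b $ d * (A $ c $ b * A $ d $ c - A $ c $ c * A $ d $ b))
    - A $ a $ b * (A $ b $ a * (A $ c $ c * A $ d $ d - A $ c $ d * A $ d $ c) - A $ b $ c * (A $ c $ a * A $ d $ d - A $ c $ d * A $ d $ a)
         + A $ b $ d * (A $ c $ a * A $ d $ c - A $ c $ c * A $ d $ a))
    + A $ a $ c * (A $ b $ a * (A $ c $ b * A $ d $ d - A $ c $ d * A $ d $ b) - A $ b $ b * (A $ c $ a * A $ d $ d - A $ c $ d * A $ d $ a)
         + A $ b $ d * (A $ c $ a * A $ d $ b - A $ c $ b * A $ d $ a))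
    - A $ a $ d * (A $ b $ a * (A $ c $ b * A $ d $ c - A $ c $ c * A $ d $ b) - A $ b $ b * (A $ c $ a * A $ d $ c - A $ c $ c * A $ d $ a)
         + A $ b $ c * (A $ c $ a * A $ d $ b - A $ c $ b * A $ d $ a))"
  unfolding block_det_sum using assms
  apply (subst sum_over_permutations_insert, simp, simp)
  apply (subst sum_over_permutations_insert, simp, simp)
  apply (subst sum_over_permutations_insert, simp, simp)
  by (simp add: sign_swap_id sign_compose permutation_swap_id permutation_compose transpose_def sign_id algebra_simps)

lemma block_det_mult:
  fixes A Y :: "'a::comm_ring_1^'n^'n"
  assumes "\<And>i j. i \<in> B \<Longrightarrow> j \<notin> B \<Longrightarrow> A $ i $ j = 0"
  shows "block_det (A ** Y) B = block_det A B * block_det Y B"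
proof -
  let ?P = "\<lambda>A. (\<chi> i j. if i \<in> B \<and> j \<in> B then A $ i $ j else if i = j then 1 else 0) :: 'a^'n^'n"
  have "?P (A ** Y) $ i $ j = (?P A ** ?P Y) $ i $ j" for i j
  proof (cases "i \<in> B")
    case True
    have "(?P A ** ?P Y) $ i $ j = (\<Sum>k\<in>UNIV. if k \<in> B then A $ i $ k * (if j \<in> B then Y $ k $ j else 0) else 0)"
      unfolding matrix_matrix_mult_def vec_lambda_beta by (intro sum.cong refl) (use True in auto)
    also have "\<dots> = (\<Sum>k\<in>UNIV. A $ i $ k * (if j \<in> B then Y $ k $ j else 0))"
      by (intro sum.cong refl) (use True assms in auto)
    finally show ?thesis using True by (cases "j \<in> B") (auto simp: matrix_matrix_mult_def)
  next
    case False
    have "(?P A ** ?P Y) $ i $ j = (\<Sum>k\<in>UNIV. if k = i then (if i = j then 1 else 0) else 0)"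
      unfolding matrix_matrix_mult_def vec_lambda_beta by (intro sum.cong refl) (use False in auto)
    then show ?thesis using False by simp
  qed
  then have "?P (A ** Y) = ?P A ** ?P Y" by (simp add: vec_eq_iff)
  then show ?thesis by (simp add: block_det_def det_mul)
qed

lemma block_det_UNIV: "block_det A UNIV = det A"
  by (simp add: block_det_def)

lemma det_blocks:
  fixes A :: "'a::comm_ring_1^'n^'n" and f :: "'n \<Rightarrow> 'b"
  assumes "\<And>i j. f i \<noteq> f j \<Longrightarrow> A $ i $ j = 0"
  shows "det A = (\<Prod>b\<in>range f. block_det A {i. f i = b})"
proof -
  have "block_det A {i. f i \<in> S} = (\<Prod>b\<in>S. block_det A {i. f i = b})" if "finite S" for S
    using that
  proof induction
    case empty
    have "block_det A {i. f i \<in> {}} = det (mat 1 :: 'a^'n^'n)"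
      unfolding block_det_def mat_def by simp
    then show ?case by simp
  next
    case (insert b S)
    let ?P = "\<lambda>B. (\<chi> i j. if i \<in> B \<and> j \<in> B then A $ i $ j else if i = j then 1 else 0) :: 'a^'n^'n"
    let ?B = "{i. f i = b}" and ?C = "{i. f i \<in> S}"
    have "?P {i. f i \<in> insert b S} $ i $ j = (?P ?B ** ?P ?C) $ i $ j" for i j
    proof (cases "f i = b")
      case True
      have "(?P ?B ** ?P ?C) $ i $ j = (\<Sum>k\<in>UNIV. if k = j then (if f j = b then A $ i $ j else 0) else 0)"
        unfolding matrix_matrix_mult_def vec_lambda_beta
        by (intro sum.cong refl) (use True insert.hyps(2) in auto)
      then show ?thesis using True assms[of i j] by auto
    next
      case False
      have "(?P ?B ** ?P ?C) $ i $ j = (\<Sum>k\<in>UNIV. if k = i then ?P ?C $ i $ j else 0)"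
        unfolding matrix_matrix_mult_def vec_lambda_beta
        by (intro sum.cong refl) (use False in auto)
      then show ?thesis using False assms[of i j] by auto
    qed
    then have "?P {i. f i \<in> insert b S} = ?P ?B ** ?P ?C" by (simp add: vec_eq_iff)
    then have "block_det A {i. f i \<in> insert b S} = block_det A ?B * block_det A ?C"
      by (simp add: block_det_def det_mul)
    then show ?case using insert by simp
  qed
  from this[of "range f"] show ?thesis by (simp add: block_det_UNIV[symmetric])
qed

subsection \<open>A criterion for semistability\<close>

text \<open>Integral vectors over a common denominator; when they are jointly primitive they are the
  exponents of the block determinants in \<open>chi\<close>.\<close>

definition dir :: "real \<Rightarrow> (6 \<Rightarrow> int) \<Rightarrow> (2 \<Rightarrow> int) \<Rightarrow> wt" where
  "dir c n m = (\<chi> i. of_int (n i) / c, \<chi> l. of_int (m l) / c)"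

lemma prim_dir_dir:
  assumes "c > 0" "Gcd (range n \<union> range m) = 1"
  shows "prim_dir (dir c n m) c (case_sum n m)"
proof -
  have "range (case_sum n m) = range n \<union> range m" 
    by (auto simp: image_iff split: sum.splits) (metis sum.case)+
  then show ?thesis
    unfolding prim_dir_def using assms by (auto simp: entry_def dir_def split: sum.split)
qed

lemma chi_dir:
  assumes "c > 0" "Gcd (range n \<union> range m) = 1"
  shows "chi (dir c n m) g = (\<Prod>b\<in>range n. block_det (fst g) {i. n i = b} powi b) *
    (\<Prod>b\<in>range m. block_det (snd g) {i. m i = b} powi b)"
proof -
  have s: "chi_scale (dir c n m) = c" by (rule prim_dir_chi_scale[OF prim_dir_dir[OF assms]])
  have *: "(\<Prod>b\<in>range (\<lambda>i. real_of_int (f i) / c). block_det A {i. real_of_int (f i) / c = b} powi \<lfloor>c * b\<rfloor>) =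
     (\<Prod>b\<in>range f. block_det A {i. f i = b} powi b)" for A :: "'a^'n^'n" and f :: "'n::finite \<Rightarrow> int"
  proof -
    have "range (\<lambda>i. real_of_int (f i) / c) = (\<lambda>b. real_of_int b / c) ` range f" by (simp add: image_image)
    moreover have "inj_on (\<lambda>b. real_of_int b / c) (range f)" using assms(1) by (auto simp: inj_on_def)
    ultimately show ?thesis using assms(1) by (simp add: prod.reindex)
  qed
  show ?thesis unfolding chi_def s unfolding dir_def fst_conv snd_conv vec_lambda_beta * ..
qed

text \<open>Exponents affine in the entries of the index: the linear part gives the
  \<open>N\<close>-th power of \<open>chi\<close>, and the constants \<open>a1\<close>,
  \<open>a2\<close> give powers of the two full determinants. All of these are one on the group
  considered.\<close>

lemma character_trivial:
  fixes g :: "'a::field grp"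
  assumes c: "c > 0" "Gcd (range n \<union> range m) = 1" and g: "g \<in> M (dir c n m)" "g \<in> G_st" "chi (dir c n m) g = 1"
    and ex: "\<And>b. b \<in> range n \<Longrightarrow> int (e1 b) = N * b + a1" "\<And>b. b \<in> range m \<Longrightarrow> int (e2 b) = N * b + a2"
  shows "(\<Prod>b\<in>range n. block_det (fst g) {i. n i = b} ^ e1 b) * (\<Prod>b\<in>range m. block_det (snd g) {i. m i = b} ^ e2 b) = 1"
proof -
  have M: "n i \<noteq> n j \<Longrightarrow> fst g $ i $ j = 0" "m k \<noteq> m l \<Longrightarrow> snd g $ k $ l = 0" for i j k l
    using g(1) c(1) by (auto simp: M_def dir_def)
  have d1: "(\<Prod>b\<in>range n. block_det (fst g) {i. n i = b}) = 1" using det_blocks[of n "fst g"] M g(2) by (simp add: G_st_def)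
  have d2: "(\<Prod>b\<in>range m. block_det (snd g) {i. m i = b}) = 1" using det_blocks[of m "snd g"] M g(2) by (simp add: G_st_def)
  have n1: "block_det (fst g) {i. n i = b} \<noteq> 0" if "b \<in> range n" for b
    using d1 that by (metis finite_imageI finite prod_zero_iff zero_neq_one)
  have n2: "block_det (snd g) {i. m i = b} \<noteq> 0" if "b \<in> range m" for b
    using d2 that by (metis finite_imageI finite prod_zero_iff zero_neq_one)
  have *: "(\<Prod>b\<in>S. D b ^ e b) = (\<Prod>b\<in>S. D b powi b) powi N * (\<Prod>b\<in>S. D b) powi a"
    if "\<And>b. b \<in> S \<Longrightarrow> int (e b) = N * b + a" "\<And>b. b \<in> S \<Longrightarrow> D b \<noteq> (0::'a)" for S D e and a :: int
  proof -
    have "(\<Prod>b\<in>S. D b ^ e b) = (\<Prod>b\<in>S. (D b powi b) powi N * D b powi a)"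
    proof (rule prod.cong[OF refl])
      fix b assume b: "b \<in> S"
      have "D b ^ e b = D b powi int (e b)" by simp
      also have "\<dots> = (D b powi b) powi N * D b powi a"
        using that(2)[OF b] unfolding that(1)[OF b] mult.commute[of N b]
        by (simp only: power_int_add power_int_mult simp_thms)
      finally show "D b ^ e b = (D b powi b) powi N * D b powi a" .
    qed
    then show ?thesis by (simp add: prod.distrib power_int_prod)
  qed
  have "(\<Prod>b\<in>range n. block_det (fst g) {i. n i = b} powi b) powi N * (\<Prod>b\<in>range m. block_det (snd g) {i. m i = b} powi b) powi N
     = chi (dir c n m) g powi N"
    unfolding chi_dir[OF c] by (simp add: power_int_mult_distrib)
  then have "(\<Prod>b\<in>range n. block_det (fst g) {i. n i = b} powi b) powi N * (\<Prod>b\<in>range m. block_det (snd g) {i. m i = b} powi b) powi N = 1"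
    using g(3) by simp
  moreover have "(\<Prod>b\<in>range n. block_det (fst g) {i. n i = b} ^ e1 b)
     = (\<Prod>b\<in>range n. block_det (fst g) {i. n i = b} powi b) powi N"
    using *[OF ex(1) n1, of "range n"] d1 by simp
  moreover have "(\<Prod>b\<in>range m. block_det (snd g) {i. m i = b} ^ e2 b)
     = (\<Prod>b\<in>range m. block_det (snd g) {i. m i = b} powi b) powi N"
    using *[OF ex(2) n2, of "range m"] d2 by simp
  ultimately show ?thesis by simp
qed

lemma Z_dir_zero:
  assumes c: "c > 0" and t: "dir c n m \<in> t_star" and s: "of_int s = c * (dir c n m \<bullet> dir c n m)" and y: "y \<in> Z (dir c n m)"
    and "n i + n j + m l \<noteq> s"
  shows "y $ l $ i $ j = 0"
proof (rule ccontr)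
  assume "y $ l $ i $ j \<noteq> 0"
  then have "wgt (dir c n m) (i, j, l) = dir c n m \<bullet> dir c n m" using y by (simp add: Z_iff[OF t])
  then have "of_int (n i + n j + m l) / c = of_int s / c" using c unfolding s by (simp add: wgt_def dir_def add_divide_distrib)
  then have "n i + n j + m l = s" using c by (simp only: divide_cancel_right of_int_eq_iff) simp
  then show False using assms(5) by simp
qed

text \<open>The transformation law becomes a polynomial identity for block diagonal matrices and
  points of \<open>Z\<close>, and \<open>character_trivial\<close> turns its factor into one. The
  integer \<open>s\<close> is the value of \<open>n i + n j + m l\<close> common to all coordinates
  of \<open>Z\<close>.\<close>

proposition Z_ss_criterion:
  fixes z :: "'a::alg_closed_field rep"
  assumes c: "c > 0" "Gcd (range n \<union> range m) = 1" and t: "dir c n m \<in> t_star"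
    and s: "of_int s = c * (dir c n m \<bullet> dir c n m)"
    and z: "z \<in> V" "\<And>l i j. n i + n j + m l \<noteq> s \<Longrightarrow> z $ l $ i $ j = 0"
    and f: "hompoly (Z_idx (dir c n m)) d f" "d > 0" "f (coordV z) \<noteq> 0"
    and ex: "\<And>b. b \<in> range n \<Longrightarrow> int (e1 b) = N * b + a1" "\<And>b. b \<in> range m \<Longrightarrow> int (e2 b) = N * b + a2"
    and tr: "\<And>g y. \<forall>i j. n i \<noteq> n j \<longrightarrow> fst g $ i $ j = 0 \<Longrightarrow> \<forall>k l. m k \<noteq> m l \<longrightarrow> snd g $ k $ l = 0 \<Longrightarrow>
      \<forall>l i j. n i + n j + m l \<noteq> s \<longrightarrow> y $ l $ i $ j = 0 \<Longrightarrow> \<forall>l i j. j < i \<longrightarrow> y $ l $ i $ j = - y $ l $ j $ i \<Longrightarrow>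
      \<forall>l i. y $ l $ i $ i = 0 \<Longrightarrow>
      f (coordV (act g y)) = (\<Prod>b\<in>range n. block_det (fst g) {i. n i = b} ^ e1 b) *
        (\<Prod>b\<in>range m. block_det (snd g) {i. m i = b} ^ e2 b) * f (coordV y)"
  shows "z \<in> Z_ss (dir c n m)"
proof (rule Z_ssI[OF _ f(1,2,3)])
  show "z \<in> Z (dir c n m)"
    unfolding Z_iff[OF t]
  proof (intro conjI z(1) allI impI)
    fix l i j assume "z $ l $ i $ j \<noteq> 0"
    then have "n i + n j + m l = s" using z(2) by blast
    then have "of_int (n i + n j + m l) = c * (dir c n m \<bullet> dir c n m)" using s by simp
    then show "wgt (dir c n m) (i, j, l) = dir c n m \<bullet> dir c n m"
      using c(1) by (simp add: wgt_def dir_def field_simps)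
  qed
  fix g :: "'a grp" and y :: "'a rep" assume g: "g \<in> M (dir c n m)" "g \<in> G_st" "chi (dir c n m) g = 1" and y: "y \<in> Z (dir c n m)"
  have yV: "y \<in> V" using y by (simp add: Z_iff[OF t])
  have "f (coordV (act g y)) = (\<Prod>b\<in>range n. block_det (fst g) {i. n i = b} ^ e1 b) *
        (\<Prod>b\<in>range m. block_det (snd g) {i. m i = b} ^ e2 b) * f (coordV y)"
  proof (rule tr)
    show "\<forall>i j. n i \<noteq> n j \<longrightarrow> fst g $ i $ j = 0" "\<forall>k l. m k \<noteq> m l \<longrightarrow> snd g $ k $ l = 0"
      using g(1) c(1) by (auto simp: M_def dir_def)
    show "\<forall>l i j. n i + n j + m l \<noteq> s \<longrightarrow> y $ l $ i $ j = 0" using Z_dir_zero[OF c(1) t s y] by blast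
    show "\<forall>l i j. j < i \<longrightarrow> y $ l $ i $ j = - y $ l $ j $ i" using V_skew[OF yV] by blast
    show "\<forall>l i. y $ l $ i $ i = 0" using V_diag[OF yV] by blast
  qed
  moreover have "(\<Prod>b\<in>range n. block_det (fst g) {i. n i = b} ^ e1 b) *
        (\<Prod>b\<in>range m. block_det (snd g) {i. m i = b} ^ e2 b) = 1"
    by (rule character_trivial[OF c g ex])
  ultimately show "f (coordV (act g y)) = f (coordV y)" by simp
qed

text \<open>The lists certify \<beta> as a convex combination of weights that all lie on its
  supporting hyperplane, so it is the closest point of their hull.\<close>

lemma BB_dir:
  assumes c: "c > 0" and t: "dir c n m \<in> t_star_plus" and nz: "dir c n m \<noteq> 0"
    and s: "of_int s = c * (dir c n m \<bullet> dir c n m)"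
    and I: "set ts \<subseteq> idx" "\<forall>(i, j, l)\<in>set ts. n i + n j + m l = s"
    and u: "\<forall>u\<in>set us. 0 \<le> u" "length us = length ts" "(\<Sum>k<length ts. us ! k) = 1"
      "(\<Sum>k<length ts. us ! k *\<^sub>R gam (ts ! k)) = dir c n m"
  shows "dir c n m \<in> BB"
proof -
  have ts: "dir c n m \<in> t_star" using t by (rule t_star_plus_t_star)
  have ne: "set ts \<noteq> {}" using u(3) by auto
  then have ne': "gam ` set ts \<noteq> {}" by simp
  have "dir c n m = closest_point (convex hull (gam ` set ts)) 0"
  proof (rule closest_point_hull_iff[OF _ ne', THEN iffD2], simp, intro conjI ballI)
    show "dir c n m \<in> convex hull (gam ` set ts)"
      unfolding u(4)[symmetric] by (rule convex_sum[OF _ convex_convex_hull u(3)]) (use u(1,2) in \<open>auto intro: hull_inc\<close>)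
    fix x assume "x \<in> gam ` set ts"
    then obtain i j l where x: "x = gam (i, j, l)" "(i, j, l) \<in> set ts" by auto
    have "n i + n j + m l = s" using I(2) x(2) by auto
    then have "of_int (n i + n j + m l) = c * (dir c n m \<bullet> dir c n m)" using s by simp
    then have "x \<bullet> dir c n m = dir c n m \<bullet> dir c n m"
      unfolding x(1) inner_gam[OF ts] using c by (simp add: wgt_def dir_def field_simps)
    then show "dir c n m \<bullet> dir c n m \<le> x \<bullet> dir c n m" by simp
  qed
  then show ?thesis using t nz I(1) ne unfolding BB_def by blast
qed

subsection \<open>Explicit directions\<close>

definition ix6 :: "'a \<Rightarrow> 'a \<Rightarrow> 'a \<Rightarrow> 'a \<Rightarrow> 'a \<Rightarrow> 'a \<Rightarrow> 6 \<Rightarrow> 'a" where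
  "ix6 a b c d e f i = (if i = 0 then a else if i = 1 then b else if i = 2 then c
     else if i = 3 then d else if i = 4 then e else f)"

definition ix2 :: "'a \<Rightarrow> 'a \<Rightarrow> 2 \<Rightarrow> 'a" where
  "ix2 a b i = (if i = 0 then a else b)"

lemma ix6_simps [simp]: "ix6 a b c d e f 0 = a" "ix6 a b c d e f 1 = b" "ix6 a b c d e f 2 = c"
  "ix6 a b c d e f 3 = d" "ix6 a b c d e f 4 = e" "ix6 a b c d e f 5 = f"
  by (simp_all add: ix6_def)

lemma ix2_simps [simp]: "ix2 a b 0 = a" "ix2 a b 1 = b"
  by (simp_all add: ix2_def)

lemma range_ix6 [simp]: "range (ix6 a b c d e f) = {a, b, c, d, e, f}"
  by (simp add: UNIV_6)

lemma range_ix2 [simp]: "range (ix2 a b) = {a, b}"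
  by (simp add: UNIV_2')

lemma vimage_ix6 [simp]: "{i. ix6 a b c d e f i = x} =
  (if a = x then {0} else {}) \<union> ((if b = x then {1} else {}) \<union> ((if c = x then {2} else {}) \<union>
  ((if d = x then {3} else {}) \<union> ((if e = x then {4} else {}) \<union> (if f = x then {5} else {})))))"
  by (simp add: set_eq_iff forall_6)

lemma vimage_ix2 [simp]: "{i. ix2 a b i = x} = (if a = x then {0} else {}) \<union> (if b = x then {1} else {})"
  by (simp add: set_eq_iff forall_2')

lemma t_star_plus_dir:
  assumes "a \<le> b" "b \<le> c" "c \<le> d" "d \<le> e" "e \<le> f" "a + b + c + d + e + f = 0" "g \<le> h" "g + h = 0" "0 < k"
  shows "dir k (ix6 a b c d e f) (ix2 g h) \<in> t_star_plus"
proof -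
  have 0: "of_int a / k + of_int b / k + of_int c / k + of_int d / k + of_int e / k + of_int f / k = 0"
    using arg_cong[OF assms(6), of "\<lambda>x. of_int x / k"] by (simp add: add_divide_distrib)
  have 1: "of_int g / k + of_int h / k = 0"
    using arg_cong[OF assms(8), of "\<lambda>x. of_int x / k"] by (simp add: add_divide_distrib)
  have le: "of_int x / k \<le> of_int y / k" if "x \<le> y" for x y :: int
    using that assms(9) by (simp add: divide_right_mono)
  have "\<forall>i j. i \<le> j \<longrightarrow> real_of_int (ix6 a b c d e f i) / k \<le> of_int (ix6 a b c d e f j) / k"
    unfolding forall_6 using assms(1-5) by (intro conjI impI le) (auto dest: leD simp: not_le)
  moreover have "\<forall>i j. i \<le> j \<longrightarrow> real_of_int (ix2 g h i) / k \<le> of_int (ix2 g h j) / k"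
    unfolding forall_2' using assms(7) by (intro conjI impI le) (auto dest: leD simp: not_le)
  ultimately show ?thesis using 0 1
    by (simp add: t_star_plus_def t_star_def dir_def sum_6 sum_2')
qed

lemma norm_dir: "k > 0 \<Longrightarrow> k * (dir k (ix6 a b c d e f) (ix2 g h) \<bullet> dir k (ix6 a b c d e f) (ix2 g h)) =
  of_int (a^2 + b^2 + c^2 + d^2 + e^2 + f^2 + g^2 + h^2) / k"
  by (simp add: dir_def inner_vec_def sum_6 sum_2' field_simps power2_eq_square)

definition bt :: "int \<Rightarrow> int \<Rightarrow> int \<Rightarrow> int \<Rightarrow> int \<Rightarrow> int \<Rightarrow> int \<Rightarrow> int \<Rightarrow> int \<Rightarrow> wt" where
  "bt k a b c d e f g h = dir (of_int k) (ix6 a b c d e f) (ix2 g h)"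

text \<open>All hypotheses can be checked on explicit integers and polynomials. In the applications
  \<open>F\<close> reduces at \<open>z\<close> to a single monomial whose exponents are
  \<open>D\<close> times the convex coefficients \<open>us\<close>. Its weight before projection is
  therefore \<open>D\<close> times the sum of \<beta> and the block means 1/3 and 1/2. This is the
  origin of the constants: \<open>D = N * k\<close>, \<open>a1 = D / 3\<close> and
  \<open>a2 = D / 2\<close>. The semistable point lies in the stratum with zero component in
  \<open>W\<close>.\<close>

lemma stratum_criterion:
  fixes z :: "'a::alg_closed_field rep" and a b c d e f g h :: int
  assumes t: "a \<le> b \<and> b \<le> c \<and> c \<le> d \<and> d \<le> e \<and> e \<le> f \<and> a + b + c + d + e + f = 0 \<and> g \<le> h \<and> g + h = 0
     \<and> 0 < k \<and> 0 < s \<and> s * k = a^2 + b^2 + c^2 + d^2 + e^2 + f^2 + g^2 + h^2"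
    and k: "Gcd {a, b, c, d, e, f, g, h} = 1"
    and z: "z \<in> V" "\<forall>l i j. ix6 a b c d e f i + ix6 a b c d e f j + ix2 g h l \<noteq> s \<longrightarrow> z $ l $ i $ j = 0"
    and F: "hompoly {(i, j, l). i < j \<and> ix6 a b c d e f i + ix6 a b c d e f j + ix2 g h l = s} D F"
      "D > 0" "F (coordV z) \<noteq> 0"
    and ex: "(\<forall>b\<in>{a, b, c, d, e, f}. 0 \<le> N * b + a1) \<and> (\<forall>b\<in>{g, h}. 0 \<le> N * b + a2)"
    and tr: "\<And>g1 y. \<forall>i j. ix6 a b c d e f i \<noteq> ix6 a b c d e f j \<longrightarrow> fst g1 $ i $ j = 0 \<Longrightarrow>
      \<forall>k l. ix2 g h k \<noteq> ix2 g h l \<longrightarrow> snd g1 $ k $ l = 0 \<Longrightarrow>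
      \<forall>l i j. ix6 a b c d e f i + ix6 a b c d e f j + ix2 g h l \<noteq> s \<longrightarrow> y $ l $ i $ j = 0 \<Longrightarrow>
      \<forall>l i j. j < i \<longrightarrow> y $ l $ i $ j = - y $ l $ j $ i \<Longrightarrow> \<forall>l i. y $ l $ i $ i = 0 \<Longrightarrow>
      F (coordV (act g1 y)) = (\<Prod>x\<in>{a, b, c, d, e, f}. block_det (fst g1) {i. ix6 a b c d e f i = x} ^ nat (N * x + a1)) *
        (\<Prod>x\<in>{g, h}. block_det (snd g1) {i. ix2 g h i = x} ^ nat (N * x + a2)) * F (coordV y)"
    and I: "\<forall>(i, j, l)\<in>set ts. i < j \<and> ix6 a b c d e f i + ix6 a b c d e f j + ix2 g h l = s"
    and u: "(\<forall>u\<in>set us. 0 \<le> u) \<and> length us = length ts \<and> (\<Sum>k<length ts. us ! k) = 1"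
      "(\<Sum>k<length ts. us ! k *\<^sub>R gam (ts ! k)) = dir (of_int k) (ix6 a b c d e f) (ix2 g h)"
  shows "bt k a b c d e f g h \<in> BB \<and> z \<in> stratum (bt k a b c d e f g h)"
proof -
  define n m \<beta> where "n = ix6 a b c d e f" and "m = ix2 g h" and "\<beta> = dir (of_int k) n m"
  note def = n_def[symmetric] m_def[symmetric]
  have k': "real_of_int k > 0" using t by simp
  have G: "Gcd (range n \<union> range m) = 1"
    using k by (simp add: n_def m_def insert_commute Un_insert_left)
  have tp: "\<beta> \<in> t_star_plus" using t k' unfolding \<beta>_def n_def m_def by (intro t_star_plus_dir) auto
  then have ts: "\<beta> \<in> t_star" by (rule t_star_plus_t_star)
  have s: "of_int s = of_int k * (\<beta> \<bullet> \<beta>)"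
  proof -
    have "of_int k * (\<beta> \<bullet> \<beta>) = of_int (s * k) / of_int k"
      using t unfolding \<beta>_def n_def m_def norm_dir[OF k'] by metis
    then show ?thesis using k' by simp
  qed
  then have nz: "\<beta> \<noteq> 0" using t by auto
  have B: "\<beta> \<in> BB" unfolding \<beta>_def
  proof (rule BB_dir[OF k'])
    show "dir (of_int k) n m \<in> t_star_plus" "dir (of_int k) n m \<noteq> 0"
      "of_int s = of_int k * (dir (of_int k) n m \<bullet> dir (of_int k) n m)"
      using tp nz s by (simp_all add: \<beta>_def)
    show "set ts \<subseteq> idx" using I by (auto simp: idx_def)
    show "\<forall>(i, j, l)\<in>set ts. n i + n j + m l = s" using I by (auto simp: def)
    show "\<forall>u\<in>set us. 0 \<le> u" "length us = length ts" "(\<Sum>k<length ts. us ! k) = 1" using u(1) by auto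
    show "(\<Sum>k<length ts. us ! k *\<^sub>R gam (ts ! k)) = dir (of_int k) n m" using u(2) by (simp add: def)
  qed
  have zi: "Z_idx \<beta> = {(i, j, l). i < j \<and> n i + n j + m l = s}"
  proof -
    have "wgt \<beta> (i, j, l) = \<beta> \<bullet> \<beta> \<longleftrightarrow> n i + n j + m l = s" for i j l
    proof -
      have "wgt \<beta> (i, j, l) = of_int (n i + n j + m l) / of_int k"
        by (simp add: wgt_def \<beta>_def dir_def add_divide_distrib)
      moreover have "\<beta> \<bullet> \<beta> = of_int s / of_int k" using s k' by simp
      ultimately show ?thesis using k' by (simp only: divide_cancel_right of_int_eq_iff) simp
    qed
    then show ?thesis unfolding set_eq_iff Z_idx_iff[OF ts] by (simp add: idx_def split_paired_all)
  qed
  have "z \<in> Z_ss \<beta>"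
    unfolding \<beta>_def
  proof (rule Z_ss_criterion[where f = F and d = D and N = N and ?a1.0 = a1 and ?a2.0 = a2 and s = s
      and ?e1.0 = "\<lambda>x. nat (N * x + a1)" and ?e2.0 = "\<lambda>x. nat (N * x + a2)"])
    show "0 < real_of_int k" "Gcd (range n \<union> range m) = 1" "z \<in> V" "D > 0" "F (coordV z) \<noteq> 0" by fact+
    show "dir (of_int k) n m \<in> t_star" "of_int s = of_int k * (dir (of_int k) n m \<bullet> dir (of_int k) n m)"
      using ts s by (simp_all add: \<beta>_def)
    show "z $ l $ i $ j = 0" if "n i + n j + m l \<noteq> s" for l i j using z(2) that by (simp add: def)
    show "hompoly (Z_idx (dir (of_int k) n m)) D F" using F(1) zi by (simp add: \<beta>_def def)
    show "int (nat (N * x + a1)) = N * x + a1" if "x \<in> range n" for x using ex that by (auto simp: n_def)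
    show "int (nat (N * x + a2)) = N * x + a2" if "x \<in> range m" for x using ex that by (auto simp: m_def)
    fix g1 :: "'a grp" and y :: "'a rep"
    assume "\<forall>i j. n i \<noteq> n j \<longrightarrow> fst g1 $ i $ j = 0" "\<forall>k l. m k \<noteq> m l \<longrightarrow> snd g1 $ k $ l = 0"
      "\<forall>l i j. n i + n j + m l \<noteq> s \<longrightarrow> y $ l $ i $ j = 0"
      "\<forall>l i j. j < i \<longrightarrow> y $ l $ i $ j = - y $ l $ j $ i" "\<forall>l i. y $ l $ i $ i = 0"
    then show "F (coordV (act g1 y)) = (\<Prod>x\<in>range n. block_det (fst g1) {i. n i = x} ^ nat (N * x + a1)) *
        (\<Prod>x\<in>range m. block_det (snd g1) {i. m i = x} ^ nat (N * x + a2)) * F (coordV y)"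
      unfolding n_def m_def range_ix6 range_ix2 by (rule tr)
  qed
  moreover have "0 \<in> W \<beta>" unfolding W_iff[OF ts] by (simp add: V_iff alt_def)
  ultimately have "z + 0 \<in> Y_ss \<beta>" unfolding Y_ss_def by blast
  then have "act (mat 1, mat 1) z \<in> stratum \<beta>" unfolding stratum_def using one_G by fastforce
  then have "z \<in> stratum \<beta>" by (simp add: act_one)
  then show ?thesis using B by (simp add: \<beta>_def bt_def def)
qed

section \<open>Semistability of the thirteen normal forms\<close>

lemmas z_simps = mk_def wedge_def E_def axis_def forall_6 forall_2'
lemmas hull_simps = lessThan_Suc gam_eq dir_def vec_eq_iff forall_6 forall_2' axis_def numeral_eq_Suc

text \<open>\<open>Z\<close> is the line of the highest coordinate, which is itself a relative
  invariant.\<close>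

lemma stratum_1: "bt 6 (-2) (-2) (-2) (-2) 4 4 (-3) 3 \<in> BB \<and> z_1 \<in> stratum (bt 6 (-2) (-2) (-2) (-2) 4 4 (-3) 3)"
  apply (rule stratum_criterion[where s = 11 and D = "6 * 1" and F = "\<lambda>\<phi>. \<phi> (4, 5, 1) ^ 6" and N = 1
      and ?a1.0 = 2 and ?a2.0 = 3 and ts = "[(4, 5, 1)]" and us = "[1]"])
            apply simp
           apply simp
          subgoal by (simp add: V_iff alt_def z_1_def z_simps)
         subgoal by (simp add: z_1_def z_simps)
        subgoal by (rule hompoly_mult hompoly_power hompoly_add hompoly_diff hompoly_cmult hompoly_var | simp)+
       apply simp
      subgoal by (simp add: coordV_def z_1_def z_simps)
     apply simp
    subgoal premises H for g y
    proof -
      note H' = H(1)[unfolded forall_6, simplified] H(2)[unfolded forall_2', simplified]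
        H(3)[unfolded forall_6 forall_2', simplified] H(4,5)
      have a0: "act g y $ 1 $ 4 $ 5 = block_det (snd g) {1} * block_det (fst g) {5, 4} * y $ 1 $ 4 $ 5"
        by (simp add: act_component sum_6 sum_2' H' block_det_1 block_det_2 block_det_3 power2_eq_square algebra_simps)
      show ?thesis unfolding coordV_def prod.case a0
        by (simp add: power_mult_distrib power_mult[symmetric]  mult_ac)
    qed
   apply simp
  apply simp
  by (simp add: hull_simps)

text \<open>\<open>Z\<close> consists of the coordinate at \<open>(4, 5, 0)\<close> and of 2 x 2
  matrices with rows 2, 3 and columns 4, 5, whose determinant is the second factor.\<close>

lemma stratum_2: "bt 6 (-2) (-2) 0 0 2 2 (-1) 1 \<in> BB \<and> z_2 \<in> stratum (bt 6 (-2) (-2) 0 0 2 2 (-1) 1)"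
  apply (rule stratum_criterion[where s = 3 and D = "2 * 1 + 2 * (1 + 1)" and F = "\<lambda>\<phi>. \<phi> (4, 5, 0) ^ 2 * (\<phi> (2, 4, 1) * \<phi> (3, 5, 1) - \<phi> (2, 5, 1) * \<phi> (3, 4, 1)) ^ 2" and N = 1
      and ?a1.0 = 2 and ?a2.0 = 3 and ts = "[(4, 5, 0), (2, 4, 1), (3, 5, 1)]" and us = "[1/3, 1/3, 1/3]"])
            apply simp
           apply simp
          subgoal by (simp add: V_iff alt_def z_2_def z_simps)
         subgoal by (simp add: z_2_def z_simps)
        subgoal by (rule hompoly_mult hompoly_power hompoly_add hompoly_diff hompoly_cmult hompoly_var | simp)+
       apply simp
      subgoal by (simp add: coordV_def z_2_def z_simps)
     apply simp
    subgoal premises H for g y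
    proof -
      note H' = H(1)[unfolded forall_6, simplified] H(2)[unfolded forall_2', simplified]
        H(3)[unfolded forall_6 forall_2', simplified] H(4,5)
      have a0: "act g y $ 0 $ 4 $ 5 = block_det (snd g) {0} * block_det (fst g) {5, 4} * y $ 0 $ 4 $ 5"
        by (simp add: act_component sum_6 sum_2' H' block_det_1 block_det_2 block_det_3 power2_eq_square algebra_simps)
      have a2: "(act g y $ 1 $ 2 $ 4 * act g y $ 1 $ 3 $ 5 - act g y $ 1 $ 2 $ 5 * act g y $ 1 $ 3 $ 4) = block_det (snd g) {1}^2 * block_det (fst g) {3, 2} * block_det (fst g) {5, 4} * (y $ 1 $ 2 $ 4 * y $ 1 $ 3 $ 5 - y $ 1 $ 2 $ 5 * y $ 1 $ 3 $ 4)"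
        by (simp add: act_component sum_6 sum_2' H' block_det_1 block_det_2 block_det_3 power2_eq_square algebra_simps)
      show ?thesis unfolding coordV_def prod.case a0 a2
        by (simp add: power_mult_distrib power_mult[symmetric] power_add[of "block_det (fst g) {5, 4}" 2 2, simplified] mult_ac)
    qed
   apply simp
  apply simp
  by (simp add: hull_simps)

text \<open>\<open>Z\<close> consists of two single coordinates and of 2 x 2 matrices with rows 0, 1
  and columns 4, 5; the invariant combines the coordinates with the determinant.\<close>

lemma stratum_21: "bt 6 (-1) (-1) 0 0 1 1 (-1) 1 \<in> BB \<and> z_21 \<in> stratum (bt 6 (-1) (-1) 0 0 1 1 (-1) 1)"
  apply (rule stratum_criterion[where s = 1 and D = "2 * 1 + (1 + 1) + 2 * 1" and F = "\<lambda>\<phi>. \<phi> (4, 5, 0) ^ 2 * (\<phi> (0, 4, 1) * \<phi> (1, 5, 1) - \<phi> (0, 5, 1) * \<phi> (1, 4, 1)) * \<phi> (2, 3, 1) ^ 2" and N = 1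
      and ?a1.0 = 2 and ?a2.0 = 3 and ts = "[(4, 5, 0), (0, 4, 1), (1, 5, 1), (2, 3, 1)]" and us = "[1/3, 1/6, 1/6, 1/3]"])
            apply simp
           apply simp
          subgoal by (simp add: V_iff alt_def z_21_def z_simps)
         subgoal by (simp add: z_21_def z_simps)
        subgoal by (rule hompoly_mult hompoly_power hompoly_add hompoly_diff hompoly_cmult hompoly_var | simp)+
       apply simp
      subgoal by (simp add: coordV_def z_21_def z_simps)
     apply simp
    subgoal premises H for g y
    proof -
      note H' = H(1)[unfolded forall_6, simplified] H(2)[unfolded forall_2', simplified]
        H(3)[unfolded forall_6 forall_2', simplified] H(4,5)
      have a0: "act g y $ 0 $ 4 $ 5 = block_det (snd g) {0} * block_det (fst g) {5, 4} * y $ 0 $ 4 $ 5"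
        by (simp add: act_component sum_6 sum_2' H' block_det_1 block_det_2 block_det_3 power2_eq_square algebra_simps)
      have a1: "act g y $ 1 $ 2 $ 3 = block_det (snd g) {1} * block_det (fst g) {3, 2} * y $ 1 $ 2 $ 3"
        by (simp add: act_component sum_6 sum_2' H' block_det_1 block_det_2 block_det_3 power2_eq_square algebra_simps)
      have a2: "(act g y $ 1 $ 0 $ 4 * act g y $ 1 $ 1 $ 5 - act g y $ 1 $ 0 $ 5 * act g y $ 1 $ 1 $ 4) = block_det (snd g) {1}^2 * block_det (fst g) {1, 0} * block_det (fst g) {5, 4} * (y $ 1 $ 0 $ 4 * y $ 1 $ 1 $ 5 - y $ 1 $ 0 $ 5 * y $ 1 $ 1 $ 4)"
        by (simp add: act_component sum_6 sum_2' H' block_det_1 block_det_2 block_det_3 power2_eq_square algebra_simps)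
      show ?thesis unfolding coordV_def prod.case a0 a1 a2
        by (simp add: power_mult_distrib power_mult[symmetric] power_add[of "block_det (fst g) {5, 4}" 2 1, simplified] power_add[of "block_det (snd g) {1}" 2 2, simplified] mult_ac)
    qed
   apply simp
  apply simp
  by (simp add: hull_simps)

text \<open>Two spaces of 2 x 2 matrices and one coordinate. The powers 4, 4 and 2 are the convex
  coefficients 2/9, 2/9 and 1/9 times the total degree 18.\<close>

lemma stratum_3: "bt 18 (-2) (-2) 0 0 2 2 (-1) 1 \<in> BB \<and> z_3 \<in> stratum (bt 18 (-2) (-2) 0 0 2 2 (-1) 1)"
  apply (rule stratum_criterion[where s = 1 and D = "4 * (1 + 1) + 4 * (1 + 1) + 2 * 1" and F = "\<lambda>\<phi>. (\<phi> (2, 4, 0) * \<phi> (3, 5, 0) - \<phi> (2, 5, 0) * \<phi> (3, 4, 0)) ^ 4 * (\<phi> (0, 4, 1) * \<phi> (1, 5, 1) - \<phi> (0, 5, 1) * \<phi> (1, 4, 1)) ^ 4 * \<phi> (2, 3, 1) ^ 2" and N = 1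
      and ?a1.0 = 6 and ?a2.0 = 9 and ts = "[(2, 4, 0), (3, 5, 0), (0, 4, 1), (1, 5, 1), (2, 3, 1)]" and us = "[2/9, 2/9, 2/9, 2/9, 1/9]"])
            apply simp
           apply simp
          subgoal by (simp add: V_iff alt_def z_3_def z_simps)
         subgoal by (simp add: z_3_def z_simps)
        subgoal by (rule hompoly_mult hompoly_power hompoly_add hompoly_diff hompoly_cmult hompoly_var | simp)+
       apply simp
      subgoal by (simp add: coordV_def z_3_def z_simps)
     apply simp
    subgoal premises H for g y
    proof -
      note H' = H(1)[unfolded forall_6, simplified] H(2)[unfolded forall_2', simplified]
        H(3)[unfolded forall_6 forall_2', simplified] H(4,5)
      have a1: "act g y $ 1 $ 2 $ 3 = block_det (snd g) {1} * block_det (fst g) {3, 2} * y $ 1 $ 2 $ 3"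
        by (simp add: act_component sum_6 sum_2' H' block_det_1 block_det_2 block_det_3 power2_eq_square algebra_simps)
      have a0: "(act g y $ 0 $ 2 $ 4 * act g y $ 0 $ 3 $ 5 - act g y $ 0 $ 2 $ 5 * act g y $ 0 $ 3 $ 4) = block_det (snd g) {0}^2 * block_det (fst g) {3, 2} * block_det (fst g) {5, 4} * (y $ 0 $ 2 $ 4 * y $ 0 $ 3 $ 5 - y $ 0 $ 2 $ 5 * y $ 0 $ 3 $ 4)"
        by (simp add: act_component sum_6 sum_2' H' block_det_1 block_det_2 block_det_3 power2_eq_square algebra_simps)
      have a2: "(act g y $ 1 $ 0 $ 4 * act g y $ 1 $ 1 $ 5 - act g y $ 1 $ 0 $ 5 * act g y $ 1 $ 1 $ 4) = block_det (snd g) {1}^2 * block_det (fst g) {1, 0} * block_det (fst g) {5, 4} * (y $ 1 $ 0 $ 4 * y $ 1 $ 1 $ 5 - y $ 1 $ 0 $ 5 * y $ 1 $ 1 $ 4)"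
        by (simp add: act_component sum_6 sum_2' H' block_det_1 block_det_2 block_det_3 power2_eq_square algebra_simps)
      show ?thesis unfolding coordV_def prod.case a0 a1 a2
        by (simp add: power_mult_distrib power_mult[symmetric] power_add[of "block_det (fst g) {5, 4}" 4 4, simplified] power_add[of "block_det (fst g) {3, 2}" 4 2, simplified] power_add[of "block_det (snd g) {1}" 8 2, simplified] mult_ac)
    qed
   apply simp
  apply simp
  by (simp add: hull_simps)

text \<open>The coordinates at \<open>(3, 5, l)\<close> and \<open>(4, 5, l)\<close> form a 2 x 2
  matrix; the second factor of the group and the block of the indices 3, 4 act on its two
  sides.\<close>

lemma stratum_L1: "bt 6 (-2) (-2) (-2) 1 1 4 0 0 \<in> BB \<and> z_L1 \<in> stratum (bt 6 (-2) (-2) (-2) 1 1 4 0 0)"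
  apply (rule stratum_criterion[where s = 5 and D = "3 * (1 + 1)" and F = "\<lambda>\<phi>. (\<phi> (3, 5, 0) * \<phi> (4, 5, 1) - \<phi> (4, 5, 0) * \<phi> (3, 5, 1)) ^ 3" and N = 1
      and ?a1.0 = 2 and ?a2.0 = 3 and ts = "[(3, 5, 0), (4, 5, 1)]" and us = "[1/2, 1/2]"])
            apply simp
           apply simp
          subgoal by (simp add: V_iff alt_def z_L1_def z_simps)
         subgoal by (simp add: z_L1_def z_simps)
        subgoal by (rule hompoly_mult hompoly_power hompoly_add hompoly_diff hompoly_cmult hompoly_var | simp)+
       apply simp
      subgoal by (simp add: coordV_def z_L1_def z_simps)
     apply simp
    subgoal premises H for g y
    proof -
      note H' = H(1)[unfolded forall_6, simplified] H(2)[unfolded forall_2', simplified]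
        H(3)[unfolded forall_6 forall_2', simplified] H(4,5)
      have a0: "(act g y $ 0 $ 3 $ 5 * act g y $ 1 $ 4 $ 5 - act g y $ 0 $ 4 $ 5 * act g y $ 1 $ 3 $ 5) = block_det (snd g) {1, 0} * block_det (fst g) {4, 3} * block_det (fst g) {5}^2 * (y $ 0 $ 3 $ 5 * y $ 1 $ 4 $ 5 - y $ 0 $ 4 $ 5 * y $ 1 $ 3 $ 5)"
        by (simp add: act_component sum_6 sum_2' H' block_det_1 block_det_2 block_det_3 power2_eq_square algebra_simps)
      show ?thesis unfolding coordV_def prod.case a0
        by (simp add: power_mult_distrib power_mult[symmetric]  mult_ac)
    qed
   apply simp
  apply simp
  by (simp add: hull_simps)

text \<open>The coordinates \<open>(i, 5, 0)\<close> for \<open>i\<close> among 2, 3, 4 form a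
  vector, and those of the other component at pairs of these indices form a bivector in the same
  three-space. Their exterior product is a volume; the coordinate at \<open>(1, 5, 1)\<close>
  supplies the missing weight.\<close>

lemma stratum_L1_1: "bt 30 (-10) (-4) 2 2 2 8 (-3) 3 \<in> BB \<and> z_L1_1 \<in> stratum (bt 30 (-10) (-4) 2 2 2 8 (-3) 3)"
  apply (rule stratum_criterion[where s = 7 and D = "12 * (1 + 1) + 6 * 1" and F = "\<lambda>\<phi>. (\<phi> (2, 5, 0) * \<phi> (3, 4, 1) - \<phi> (3, 5, 0) * \<phi> (2, 4, 1) + \<phi> (4, 5, 0) * \<phi> (2, 3, 1)) ^ 12 * \<phi> (1, 5, 1) ^ 6" and N = 1
      and ?a1.0 = 10 and ?a2.0 = 15 and ts = "[(2, 5, 0), (1, 5, 1), (3, 4, 1)]" and us = "[2/5, 1/5, 2/5]"])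
            apply simp
           apply simp
          subgoal by (simp add: V_iff alt_def z_L1_1_def z_simps)
         subgoal by (simp add: z_L1_1_def z_simps)
        subgoal by (rule hompoly_mult hompoly_power hompoly_add hompoly_diff hompoly_cmult hompoly_var | simp)+
       apply simp
      subgoal by (simp add: coordV_def z_L1_1_def z_simps)
     apply simp
    subgoal premises H for g y
    proof -
      note H' = H(1)[unfolded forall_6, simplified] H(2)[unfolded forall_2', simplified]
        H(3)[unfolded forall_6 forall_2', simplified] H(4,5)
      have a1: "act g y $ 1 $ 1 $ 5 = block_det (snd g) {1} * block_det (fst g) {1} * block_det (fst g) {5} * y $ 1 $ 1 $ 5"
        by (simp add: act_component sum_6 sum_2' H' block_det_1 block_det_2 block_det_3 power2_eq_square algebra_simps)
      have a0: "(act g y $ 0 $ 2 $ 5 * act g y $ 1 $ 3 $ 4 - act g y $ 0 $ 3 $ 5 * act g y $ 1 $ 2 $ 4 + act g y $ 0 $ 4 $ 5 * act g y $ 1 $ 2 $ 3) = block_det (snd g) {0} * block_det (snd g) {1} * block_det (fst g) {5} * block_det (fst g) {4, 3, 2} * (y $ 0 $ 2 $ 5 * y $ 1 $ 3 $ 4 - y $ 0 $ 3 $ 5 * y $ 1 $ 2 $ 4 + y $ 0 $ 4 $ 5 * y $ 1 $ 2 $ 3)"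
        by (simp add: act_component sum_6 sum_2' H' block_det_1 block_det_2 block_det_3 power2_eq_square algebra_simps)
      show ?thesis unfolding coordV_def prod.case a0 a1
        by (simp add: power_mult_distrib power_mult[symmetric] power_add[of "block_det (fst g) {5}" 12 6, simplified] power_add[of "block_det (snd g) {1}" 12 6, simplified] mult_ac)
    qed
   apply simp
  apply simp
  by (simp add: hull_simps)

section \<open>Pfaffians and discriminants as relative invariants\<close>

definition minor :: "'a::comm_ring_1^'n^'n \<Rightarrow> 'n \<Rightarrow> 'n \<Rightarrow> 'n \<Rightarrow> 'n \<Rightarrow> 'a" where
  "minor A i j p q = A $ i $ p * A $ j $ q - A $ i $ q * A $ j $ p"

text \<open>The assumption expresses a congruence \<open>A X A^T\<close> through the second compound
  of \<open>A\<close>; the conclusion is the rule \<open>Pf (A X A^T) = det A * Pf X\<close> on four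
  indices.\<close>

lemma pfaffian_congr:
  fixes A :: "'a::comm_ring_1^'n^'n"
  assumes "a \<noteq> b" "a \<noteq> c" "b \<noteq> c" "a \<noteq> d" "b \<noteq> d" "c \<noteq> d"
    and U: "\<And>i j. (i, j) \<in> {(a, b), (a, c), (a, d), (b, c), (b, d), (c, d)} \<Longrightarrow>
      u i j = minor A i j a b * x1 + minor A i j a c * x2 + minor A i j a d * x3
        + minor A i j b c * x4 + minor A i j b d * x5 + minor A i j c d * x6"
  shows "u a b * u c d - u a c * u b d + u a d * u b c = block_det A {d, c, b, a} * (x1 * x6 - x2 * x5 + x3 * x4)"
proof -
  have "{d, c, b, a} = {a, b, c, d}" by auto
  then show ?thesis using assms(1-6) by (simp add: U block_det_4 minor_def algebra_simps)
qed

text \<open>Polarisation of \<open>pfaffian_congr\<close>: its instances for \<open>u\<close> and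
  \<open>v\<close> are subtracted from the one for their sum. No division by two occurs.\<close>

lemma pfaffian_polar_congr:
  fixes A :: "'a::comm_ring_1^'n^'n"
  assumes d: "a \<noteq> b" "a \<noteq> c" "b \<noteq> c" "a \<noteq> d" "b \<noteq> d" "c \<noteq> d"
    and U: "\<And>i j. (i, j) \<in> {(a, b), (a, c), (a, d), (b, c), (b, d), (c, d)} \<Longrightarrow>
      u i j = minor A i j a b * x1 + minor A i j a c * x2 + minor A i j a d * x3
        + minor A i j b c * x4 + minor A i j b d * x5 + minor A i j c d * x6"
    and W: "\<And>i j. (i, j) \<in> {(a, b), (a, c), (a, d), (b, c), (b, d), (c, d)} \<Longrightarrow>
      v i j = minor A i j a b * y1 + minor A i j a c * y2 + minor A i j a d * y3
        + minor A i j b c * y4 + minor A i j b d * y5 + minor A i j c d * y6"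
  shows "u a b * v c d + u c d * v a b - (u a c * v b d + u b d * v a c) + (u a d * v b c + u b c * v a d)
    = block_det A {d, c, b, a} * (x1 * y6 + x6 * y1 - (x2 * y5 + x5 * y2) + (x3 * y4 + x4 * y3))"
proof -
  let ?Z = "\<lambda>i j. u i j + v i j" and ?D = "block_det A {d, c, b, a}"
  have "?Z a b * ?Z c d - ?Z a c * ?Z b d + ?Z a d * ?Z b c = ?D *
    ((x1 + y1) * (x6 + y6) - (x2 + y2) * (x5 + y5) + (x3 + y3) * (x4 + y4))"
    by (rule pfaffian_congr[OF d]) (simp add: U W algebra_simps)
  note eqs = this pfaffian_congr[OF d, of u, OF U] pfaffian_congr[OF d, of v, OF W]
  have "u a b * v c d + u c d * v a b - (u a c * v b d + u b d * v a c) + (u a d * v b c + u b c * v a d)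
    = (?Z a b * ?Z c d - ?Z a c * ?Z b d + ?Z a d * ?Z b c) - (u a b * u c d - u a c * u b d + u a d * u b c)
      - (v a b * v c d - v a c * v b d + v a d * v b c)"
    by (simp add: algebra_simps)
  also have "\<dots> = ?D * ((x1 + y1) * (x6 + y6) - (x2 + y2) * (x5 + y5) + (x3 + y3) * (x4 + y4))
      - ?D * (x1 * x6 - x2 * x5 + x3 * x4) - ?D * (y1 * y6 - y2 * y5 + y3 * y4)"
    by (simp only: eqs)
  also have "\<dots> = ?D * (x1 * y6 + x6 * y1 - (x2 * y5 + x5 * y2) + (x3 * y4 + x4 * y3))"
    by (simp add: algebra_simps)
  finally show ?thesis .
qed

text \<open>Here \<open>p\<close>, \<open>q\<close>, \<open>r\<close> are the coefficients of the
  binary quadratic form given by the Pfaffian of a pencil, \<open>D\<close> is a block determinant,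
  and the other letters are the entries of the substitution.\<close>

lemma discriminant_transform:
  fixes a b c d p q r D :: "'a::comm_ring_1"
  shows "D * (2 * a * c * p + (a * d + b * c) * q + 2 * b * d * r) * (D * (2 * a * c * p + (a * d + b * c) * q + 2 * b * d * r))
    - 4 * (D * (a^2 * p + a * b * q + b^2 * r) * (D * (c^2 * p + c * d * q + d^2 * r)))
    = D^2 * (a * d - b * c)^2 * (q * q - 4 * (p * r))"
  by (simp add: power2_eq_square algebra_simps)

text \<open>\<open>Z\<close> is the space of bivectors on the last four indices in one component;
  the Pfaffian is its relative invariant.\<close>

lemma stratum_11: "bt 6 (-2) (-2) 1 1 1 1 (-3) 3 \<in> BB \<and> z_11 \<in> stratum (bt 6 (-2) (-2) 1 1 1 1 (-3) 3)"
  apply (rule stratum_criterion[where s = 5 and D = "6 * (1 + 1)" and F = "\<lambda>\<phi>. (\<phi> (2, 3, 1) * \<phi> (4, 5, 1) - \<phi> (2, 4, 1) * \<phi> (3, 5, 1) + \<phi> (2, 5, 1) * \<phi> (3, 4, 1)) ^ 6" and N = 2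
      and ?a1.0 = 4 and ?a2.0 = 6 and ts = "[(2, 3, 1), (4, 5, 1)]" and us = "[1/2, 1/2]"])
            apply simp
           apply simp
          subgoal by (simp add: V_iff alt_def z_11_def z_simps)
         subgoal by (simp add: z_11_def z_simps)
        subgoal by (rule hompoly_mult hompoly_power hompoly_add hompoly_diff hompoly_cmult hompoly_var | simp)+
       apply simp
      subgoal by (simp add: coordV_def z_11_def z_simps)
     apply simp
    subgoal premises H for g y
    proof -
      note H' = H(1)[unfolded forall_6, simplified] H(2)[unfolded forall_2', simplified]
        H(3)[unfolded forall_6 forall_2', simplified] H(4,5)
      have a0: "(act g y $ 1 $ 2 $ 3 * act g y $ 1 $ 4 $ 5 - act g y $ 1 $ 2 $ 4 * act g y $ 1 $ 3 $ 5 + act g y $ 1 $ 2 $ 5 * act g y $ 1 $ 3 $ 4) = block_det (fst g) {5, 4, 3, 2} * (block_det (snd g) {1}^2 * (y $ 1 $ 2 $ 3 * y $ 1 $ 4 $ 5 - y $ 1 $ 2 $ 4 * y $ 1 $ 3 $ 5 + y $ 1 $ 2 $ 5 * y $ 1 $ 3 $ 4))"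
      proof -
        have "(act g y $ 1 $ 2 $ 3 * act g y $ 1 $ 4 $ 5 - act g y $ 1 $ 2 $ 4 * act g y $ 1 $ 3 $ 5 + act g y $ 1 $ 2 $ 5 * act g y $ 1 $ 3 $ 4) = block_det (fst g) {5, 4, 3, 2} * ((snd g $ 1 $ 1 * y $ 1 $ 2 $ 3) * ((snd g $ 1 $ 1 * y $ 1 $ 4 $ 5)) - (snd g $ 1 $ 1 * y $ 1 $ 2 $ 4) * ((snd g $ 1 $ 1 * y $ 1 $ 3 $ 5)) + (snd g $ 1 $ 1 * y $ 1 $ 2 $ 5) * ((snd g $ 1 $ 1 * y $ 1 $ 3 $ 4)))"
          by (rule pfaffian_congr[where u = "\<lambda>i j. act g y $ 1 $ i $ j"], simp_all, elim disjE conjE)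
             (simp_all add: act_component sum_6 sum_2' H' minor_def algebra_simps)
        then show ?thesis by (simp add: block_det_1 power2_eq_square algebra_simps)
      qed
      show ?thesis unfolding coordV_def prod.case a0
        by (simp add: power_mult_distrib power_mult[symmetric]  mult_ac)
    qed
   apply simp
  apply simp
  by (simp add: hull_simps)

text \<open>A plane on the indices 4, 5 in one component and bivectors on the first four indices in
  the other: a coordinate and a Pfaffian.\<close>

lemma stratum_11_1: "bt 30 (-1) (-1) (-1) (-1) 2 2 (-3) 3 \<in> BB \<and> z_11_1 \<in> stratum (bt 30 (-1) (-1) (-1) (-1) 2 2 (-3) 3)"
  apply (rule stratum_criterion[where s = 1 and D = "24 * 1 + 18 * (1 + 1)" and F = "\<lambda>\<phi>. \<phi> (4, 5, 0) ^ 24 * (\<phi> (0, 1, 1) * \<phi> (2, 3, 1) - \<phi> (0, 2, 1) * \<phi> (1, 3, 1) + \<phi> (0, 3, 1) * \<phi> (1, 2, 1)) ^ 18" and N = 2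
      and ?a1.0 = 20 and ?a2.0 = 30 and ts = "[(4, 5, 0), (0, 1, 1), (2, 3, 1)]" and us = "[2/5, 3/10, 3/10]"])
            apply simp
           apply simp
          subgoal by (simp add: V_iff alt_def z_11_1_def z_simps)
         subgoal by (simp add: z_11_1_def z_simps)
        subgoal by (rule hompoly_mult hompoly_power hompoly_add hompoly_diff hompoly_cmult hompoly_var | simp)+
       apply simp
      subgoal by (simp add: coordV_def z_11_1_def z_simps)
     apply simp
    subgoal premises H for g y
    proof -
      note H' = H(1)[unfolded forall_6, simplified] H(2)[unfolded forall_2', simplified]
        H(3)[unfolded forall_6 forall_2', simplified] H(4,5)
      have a0: "act g y $ 0 $ 4 $ 5 = block_det (snd g) {0} * block_det (fst g) {5, 4} * y $ 0 $ 4 $ 5"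
        by (simp add: act_component sum_6 sum_2' H' block_det_1 block_det_2 block_det_3 power2_eq_square algebra_simps)
      have a1: "(act g y $ 1 $ 0 $ 1 * act g y $ 1 $ 2 $ 3 - act g y $ 1 $ 0 $ 2 * act g y $ 1 $ 1 $ 3 + act g y $ 1 $ 0 $ 3 * act g y $ 1 $ 1 $ 2) = block_det (fst g) {3, 2, 1, 0} * (block_det (snd g) {1}^2 * (y $ 1 $ 0 $ 1 * y $ 1 $ 2 $ 3 - y $ 1 $ 0 $ 2 * y $ 1 $ 1 $ 3 + y $ 1 $ 0 $ 3 * y $ 1 $ 1 $ 2))"
      proof -
        have "(act g y $ 1 $ 0 $ 1 * act g y $ 1 $ 2 $ 3 - act g y $ 1 $ 0 $ 2 * act g y $ 1 $ 1 $ 3 + act g y $ 1 $ 0 $ 3 * act g y $ 1 $ 1 $ 2) = block_det (fst g) {3, 2, 1, 0} * ((snd g $ 1 $ 1 * y $ 1 $ 0 $ 1) * ((snd g $ 1 $ 1 * y $ 1 $ 2 $ 3)) - (snd g $ 1 $ 1 * y $ 1 $ 0 $ 2) * ((snd g $ 1 $ 1 * y $ 1 $ 1 $ 3)) + (snd g $ 1 $ 1 * y $ 1 $ 0 $ 3) * ((snd g $ 1 $ 1 * y $ 1 $ 1 $ 2)))"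
          by (rule pfaffian_congr[where u = "\<lambda>i j. act g y $ 1 $ i $ j"], simp_all, elim disjE conjE)
             (simp_all add: act_component sum_6 sum_2' H' minor_def algebra_simps)
        then show ?thesis by (simp add: block_det_1 power2_eq_square algebra_simps)
      qed
      show ?thesis unfolding coordV_def prod.case a0 a1
        by (simp add: power_mult_distrib power_mult[symmetric]  mult_ac)
    qed
   apply simp
  apply simp
  by (simp add: hull_simps)

lemma hompoly_det:
  assumes "\<And>i j. hompoly S 1 (\<lambda>\<phi>. f \<phi> $ i $ j)"
  shows "hompoly S (card (UNIV :: 'n::finite set)) (\<lambda>\<phi>. det (f \<phi> :: 'a::comm_ring_1^'n^'n))"
  unfolding det_def by (intro hompoly_sum hompoly_cmult hompoly_prod finite assms)

lemma hompoly_block_det: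
  assumes "\<And>i j. i \<in> B \<Longrightarrow> j \<in> B \<Longrightarrow> hompoly S 1 (\<lambda>\<phi>. f \<phi> $ i $ j)"
  shows "hompoly S (card B) (\<lambda>\<phi>. block_det (f \<phi> :: 'a::comm_ring_1^'n::finite^'n) B)"
  unfolding block_det_sum
  by (intro hompoly_sum hompoly_cmult hompoly_prod finite assms) (auto simp: permutes_in_image)

lemma block_det_cong:
  assumes "\<And>i j. i \<in> B \<Longrightarrow> j \<in> B \<Longrightarrow> A $ i $ j = C $ i $ j"
  shows "block_det A B = block_det C B"
  unfolding block_det_def by (intro arg_cong[where f = det]) (simp add: vec_eq_iff assms)

text \<open>The determinant takes the place of the Pfaffian, whose square it is, because its
  behaviour under congruence is immediate. \<open>?M\<close> rebuilds the alternating matrix from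
  the coordinates above the diagonal.\<close>

lemma stratum_111: "bt 2 0 0 0 0 0 0 (-1) 1 \<in> BB \<and> z_111 \<in> stratum (bt 2 0 0 0 0 0 0 (-1) 1)"
proof -
  let ?M = "\<lambda>\<phi> :: 6 \<times> 6 \<times> 2 \<Rightarrow> 'a. (\<chi> i j. if i < j then \<phi> (i, j, 1) else if j < i then - \<phi> (j, i, 1) else 0) :: 'a^6^6"
  have M: "?M (coordV x) = x $ 1" if "\<forall>l i j. j < i \<longrightarrow> x $ l $ i $ j = - x $ l $ j $ i" "\<forall>l i. x $ l $ i $ i = 0" for x
    using that by (auto simp: vec_eq_iff coordV_def not_less)
  show ?thesis
  apply (rule stratum_criterion[where s = 1 and D = 6 and F = "\<lambda>\<phi>. det (?M \<phi>)" and N = 3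
      and ?a1.0 = 2 and ?a2.0 = 3 and ts = "[(0, 1, 1), (2, 3, 1), (4, 5, 1)]" and us = "[1/3, 1/3, 1/3]"])
            apply simp
           apply simp
          subgoal by (simp add: V_iff alt_def z_111_def z_simps)
         subgoal by (simp add: z_111_def z_simps)
        subgoal
        proof -
          have 0: "ix6 0 0 0 0 0 0 i = (0 :: int)" for i by (simp add: ix6_def)
          have "hompoly {(i, j, l). i < j \<and> ix6 0 0 0 0 0 0 i + ix6 0 0 0 0 0 0 j + ix2 (-1) (1::int) l = 1} 1
             (\<lambda>\<phi> :: 6 \<times> 6 \<times> 2 \<Rightarrow> 'a. ?M \<phi> $ i $ j)" for i j
          proof (cases i j rule: linorder_cases)
            case less
            then show ?thesis by (simp add: 0 hompoly_var[unfolded One_nat_def])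
          next
            case equal
            then show ?thesis by (simp add: hompoly_zero)
          next
            case greater
            moreover from this have "\<not> i < j" by (rule less_not_sym)
            ultimately show ?thesis by (simp add: 0 hompoly_uminus hompoly_var[unfolded One_nat_def])
          qed
          from hompoly_det[OF this] show ?thesis by simp
        qed
       apply simp
      subgoal
      proof -
        have "?M (coordV z_111) = z_111 $ 1"
          by (simp add: vec_eq_iff coordV_def z_111_def z_simps)
        moreover have "det (z_111 $ 1 :: 'a^6^6) \<noteq> 0"
        proof -
          have "z_111 $ 1 ** (- (z_111 $ 1)) = (mat 1 :: 'a^6^6)"
          by (simp add: vec_eq_iff matrix_matrix_mult_def mat_def sum_6 z_111_def z_simps)
          then have "det (z_111 $ 1 :: 'a^6^6) * det (- (z_111 $ 1 :: 'a^6^6)) = 1" by (metis det_I det_mul)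
          then show ?thesis by auto
        qed
        ultimately show ?thesis by simp
      qed
     apply simp
    subgoal premises H for g y
    proof -
      note H' = H(2)[unfolded forall_2', simplified]
      have yV: "alt (y $ l)" for l
      proof -
        have "y $ l $ i $ j = - y $ l $ j $ i" for i j
        proof (cases i j rule: linorder_cases)
          case less
          then have "y $ l $ j $ i = - y $ l $ i $ j" using H(4) by blast
          then show ?thesis by simp
        next
          case equal
          then show ?thesis using H(5) by simp
        next
          case greater
          then show ?thesis using H(4) by blast
        qed
        then show ?thesis unfolding alt_def using H(5) by blast
      qed
      then have "alt (act g y $ l)" for l by (rule alt_act)
      then have sk: "act g y $ l $ i $ j = - act g y $ l $ j $ i" "act g y $ l $ i $ i = 0" for l i j
        unfolding alt_def by blast+
      have 1: "?M (coordV (act g y)) = act g y $ 1"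
        by (intro M allI impI sk)
      have 2: "act g y $ 1 = (\<chi> i. snd g $ 1 $ 1 *s (fst g ** y $ 1 ** transpose (fst g)) $ i)"
        by (simp add: act_def vec_eq_iff sum_2' H')
      have 3: "det (act g y $ 1) = (snd g $ 1 $ 1) ^ 6 * det (fst g ** y $ 1 ** transpose (fst g))"
        unfolding 2 by (simp add: det_rows_mul)
      have 4: "?M (coordV y) = y $ 1" using H(4,5) by (rule M)
      have 5: "{5, 4, 3, 2, 1, 0} = (UNIV :: 6 set)" by (auto simp: UNIV_6)
      show ?thesis unfolding 1 3 4
        by (simp add: det_mul det_transpose block_det_1 5 block_det_UNIV power2_eq_square mult_ac)
    qed
   apply simp
  apply simp
  by (simp add: hull_simps)
qed

section \<open>The relative invariant of tensors of format 3 x 2 x 2\<close>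

definition d3 :: "(6 \<Rightarrow> 'a::comm_ring_1) \<Rightarrow> (6 \<Rightarrow> 'a) \<Rightarrow> (6 \<Rightarrow> 'a) \<Rightarrow> 'a" where
  "d3 u v w = u 1 * (v 2 * w 3 - v 3 * w 2) - u 2 * (v 1 * w 3 - v 3 * w 1) + u 3 * (v 1 * w 2 - v 2 * w 1)"

text \<open>Relative invariant of pencils of \<open>3 \<times> 2\<close> matrices: the determinant of the \<open>2 \<times> 2\<close> matrix
  formed by the maximal minors of the four columns \<open>u\<^sub>1, u\<^sub>2\<close> and \<open>v\<^sub>1, v\<^sub>2\<close>.\<close>

definition qf :: "(6 \<Rightarrow> 'a::comm_ring_1) \<Rightarrow> (6 \<Rightarrow> 'a) \<Rightarrow> (6 \<Rightarrow> 'a) \<Rightarrow> (6 \<Rightarrow> 'a) \<Rightarrow> 'a" where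
  "qf u1 u2 v1 v2 = d3 u2 v1 v2 * d3 u1 u2 v1 - d3 u1 v1 v2 * d3 u1 u2 v2"

lemma d3_lin:
  "d3 (\<lambda>i. a * u i + b * v i) w x = a * d3 u w x + b * d3 v w x"
  "d3 w (\<lambda>i. a * u i + b * v i) x = a * d3 w u x + b * d3 w v x"
  "d3 w x (\<lambda>i. a * u i + b * v i) = a * d3 w x u + b * d3 w x v"
  by (simp_all add: d3_def algebra_simps)

lemma d3_alt: "d3 u u v = 0" "d3 v u u = 0" "d3 u v u = 0" "d3 v u w = - d3 u v w" "d3 u w v = - d3 u v w"
  by (simp_all add: d3_def algebra_simps)

text \<open>The component index and the choice between the indices 4 and 5 enter symmetrically, so
  that \<open>qf_cols\<close> serves both two-dimensional factors.\<close>

lemma qf_swap: "qf u1 v1 u2 v2 = qf u1 u2 v1 v2"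
  using d3_alt(4)[of u2 v1 v2] d3_alt(5)[of u1 u2 v1] by (simp add: qf_def)

lemma qf_cols: "qf (\<lambda>i. a * u1 i + b * u2 i) (\<lambda>i. c * u1 i + d * u2 i) (\<lambda>i. a * v1 i + b * v2 i) (\<lambda>i. c * v1 i + d * v2 i)
   = (a * d - b * c) ^ 3 * qf u1 u2 v1 v2"
proof -
  have 1: "d3 w (\<lambda>i. a * v1 i + b * v2 i) (\<lambda>i. c * v1 i + d * v2 i) = (a * d - b * c) * d3 w v1 v2" for w
    using d3_alt(5)[of w v1 v2] by (simp add: d3_lin d3_alt(2) algebra_simps)
  have 2: "d3 (\<lambda>i. a * u1 i + b * u2 i) (\<lambda>i. c * u1 i + d * u2 i) w = (a * d - b * c) * d3 u1 u2 w" for w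
    using d3_alt(4)[of u1 u2 w] by (simp add: d3_lin d3_alt(1) algebra_simps)
  show ?thesis unfolding qf_def 1 2 unfolding d3_lin by (simp add: power3_eq_cube algebra_simps)
qed

lemma d3_rows:
  assumes "\<And>i. i \<in> {1, 2, 3} \<Longrightarrow> u' i = g $ i $ 1 * u 1 + g $ i $ 2 * u 2 + g $ i $ 3 * u 3"
    "\<And>i. i \<in> {1, 2, 3} \<Longrightarrow> v' i = g $ i $ 1 * v 1 + g $ i $ 2 * v 2 + g $ i $ 3 * v 3"
    "\<And>i. i \<in> {1, 2, 3} \<Longrightarrow> w' i = g $ i $ 1 * w 1 + g $ i $ 2 * w 2 + g $ i $ 3 * w 3"
  shows "d3 u' v' w' = block_det g {3, 2, 1} * d3 u v w"
  by (simp add: d3_def assms block_det_3 algebra_simps)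

text \<open>The block on the indices 1, 2, 3 multiplies each maximal minor by its determinant, hence
  the invariant by the square; each two-dimensional factor contributes the cube of its
  determinant.\<close>

lemma stratum_L2: "bt 6 (-2) 0 0 0 1 1 0 0 \<in> BB \<and> z_L2 \<in> stratum (bt 6 (-2) 0 0 0 1 1 0 0)"
  apply (rule stratum_criterion[where s = 1 and D = "(1 + (1 + 1)) + (1 + (1 + 1))" and N = 1
      and F = "\<lambda>\<phi>. qf (\<lambda>i. \<phi> (i, 4, 0)) (\<lambda>i. \<phi> (i, 5, 0)) (\<lambda>i. \<phi> (i, 4, 1)) (\<lambda>i. \<phi> (i, 5, 1))"
      and ?a1.0 = 2 and ?a2.0 = 3 and ts = "[(1, 4, 0), (2, 5, 0), (1, 5, 1), (3, 4, 1)]" and us = "[1/6, 1/3, 1/6, 1/3]"])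
            apply simp
           apply simp
          subgoal by (simp add: V_iff alt_def z_L2_def z_simps)
         subgoal by (simp add: z_L2_def z_simps)
        subgoal unfolding qf_def d3_def by (rule hompoly_diff hompoly_mult hompoly_add hompoly_var | simp)+
       apply simp
      subgoal by (simp add: coordV_def z_L2_def z_simps qf_def d3_def)
     apply simp
    subgoal premises H for g y
    proof -
      note H' = H(1)[unfolded forall_6, simplified] H(3)[unfolded forall_6 forall_2', simplified] H(4,5)
      let ?c = "\<lambda>l j p. snd g $ l $ 0 * (fst g $ j $ 4 * y $ 0 $ p $ 4 + fst g $ j $ 5 * y $ 0 $ p $ 5)
        + snd g $ l $ 1 * (fst g $ j $ 4 * y $ 1 $ p $ 4 + fst g $ j $ 5 * y $ 1 $ p $ 5)"
      have e: "act g y $ l $ i $ j = fst g $ i $ 1 * ?c l j 1 + fst g $ i $ 2 * ?c l j 2 + fst g $ i $ 3 * ?c l j 3"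
        if "j = 4 \<or> j = 5" "i \<in> {1, 2, 3}" for l i j
        using that(2,1) by (elim insertE emptyE disjE) (simp_all add: act_component sum_6 sum_2' H' algebra_simps)
      have r: "d3 (\<lambda>i. act g y $ l $ i $ j) (\<lambda>i. act g y $ l' $ i $ j') (\<lambda>i. act g y $ l'' $ i $ j'')
          = block_det (fst g) {3, 2, 1} * d3 (?c l j) (?c l' j') (?c l'' j'')"
        if "j = 4 \<or> j = 5" "j' = 4 \<or> j' = 5" "j'' = 4 \<or> j'' = 5" for l l' l'' j j' j''
        by (rule d3_rows) (rule e; use that in simp)+
      let ?b = "\<lambda>l j p. fst g $ j $ 4 * y $ l $ p $ 4 + fst g $ j $ 5 * y $ l $ p $ 5"
      have "qf (?c 0 4) (?c 0 5) (?c 1 4) (?c 1 5) = qf (?c 0 4) (?c 1 4) (?c 0 5) (?c 1 5)" by (rule qf_swap)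
      also have "\<dots> = (snd g $ 0 $ 0 * snd g $ 1 $ 1 - snd g $ 0 $ 1 * snd g $ 1 $ 0) ^ 3 * qf (?b 0 4) (?b 1 4) (?b 0 5) (?b 1 5)"
        by (rule qf_cols)
      also have "qf (?b 0 4) (?b 1 4) (?b 0 5) (?b 1 5) = qf (?b 0 4) (?b 0 5) (?b 1 4) (?b 1 5)" by (rule qf_swap)
      also have "\<dots> = (fst g $ 4 $ 4 * fst g $ 5 $ 5 - fst g $ 4 $ 5 * fst g $ 5 $ 4) ^ 3
         * qf (\<lambda>i. y $ 0 $ i $ 4) (\<lambda>i. y $ 0 $ i $ 5) (\<lambda>i. y $ 1 $ i $ 4) (\<lambda>i. y $ 1 $ i $ 5)"
        by (rule qf_cols)
      also have "fst g $ 4 $ 4 * fst g $ 5 $ 5 - fst g $ 4 $ 5 * fst g $ 5 $ 4 = block_det (fst g) {5, 4}"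
        by (simp add: block_det_2 algebra_simps)
      also have "snd g $ 0 $ 0 * snd g $ 1 $ 1 - snd g $ 0 $ 1 * snd g $ 1 $ 0 = block_det (snd g) {1, 0}"
        by (simp add: block_det_2 algebra_simps)
      finally have "qf (?c 0 4) (?c 0 5) (?c 1 4) (?c 1 5) = block_det (snd g) {1, 0} ^ 3 * (block_det (fst g) {5, 4} ^ 3 *
        qf (\<lambda>i. y $ 0 $ i $ 4) (\<lambda>i. y $ 0 $ i $ 5) (\<lambda>i. y $ 1 $ i $ 4) (\<lambda>i. y $ 1 $ i $ 5))" .
      moreover have "qf (\<lambda>i. act g y $ 0 $ i $ 4) (\<lambda>i. act g y $ 0 $ i $ 5) (\<lambda>i. act g y $ 1 $ i $ 4) (\<lambda>i. act g y $ 1 $ i $ 5)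
        = block_det (fst g) {3, 2, 1} ^ 2 * qf (?c 0 4) (?c 0 5) (?c 1 4) (?c 1 5)"
        unfolding qf_def by (subst r, simp_all)+ (simp add: power2_eq_square algebra_simps)
      ultimately show ?thesis by (simp add: coordV_def mult_ac)
    qed
   apply simp
  apply simp
  by (simp add: hull_simps)

text \<open>\<open>Z\<close> is identified with 4 x 4 matrices: the rows are the first four indices,
  the columns are pairs of a component and one of the indices 4, 5. On the columns the two factors
  of the group act through their Kronecker product.\<close>

lemma stratum_L1_L1: "bt 12 (-1) (-1) (-1) (-1) 2 2 0 0 \<in> BB \<and> z_L1_L1 \<in> stratum (bt 12 (-1) (-1) (-1) (-1) 2 2 0 0)"
proof -
  let ?M = "\<lambda>\<phi> :: 6 \<times> 6 \<times> 2 \<Rightarrow> 'a. (\<chi> i. vec_lambda (ix6 (\<phi> (i, 4, 0)) (\<phi> (i, 5, 0)) (\<phi> (i, 4, 1)) (\<phi> (i, 5, 1)) 0 0)) :: 'a^6^6"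
  let ?B = "{3, 2, 1, 0} :: 6 set"
  show ?thesis
  apply (rule stratum_criterion[where s = 1 and D = "3 * 4" and F = "\<lambda>\<phi>. block_det (?M \<phi>) ?B ^ 3" and N = 1
      and ?a1.0 = 4 and ?a2.0 = 6 and ts = "[(0, 4, 0), (1, 5, 0), (2, 4, 1), (3, 5, 1)]" and us = "[1/4, 1/4, 1/4, 1/4]"])
            apply simp
           apply simp
          subgoal by (simp add: V_iff alt_def z_L1_L1_def z_simps)
         subgoal by (simp add: z_L1_L1_def z_simps)
        subgoal
        proof -
          have "hompoly {(i, j, l). i < j \<and> ix6 (- 1) (- 1) (- 1) (- 1) 2 2 i + ix6 (- 1) (- 1) (- 1) (- 1) 2 2 j + ix2 0 (0::int) l = 1} 1
             (\<lambda>\<phi> :: 6 \<times> 6 \<times> 2 \<Rightarrow> 'a. ?M \<phi> $ i $ j)" if "i \<in> ?B" "j \<in> ?B" for i j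
            using that by (elim insertE emptyE) (simp_all add: hompoly_var[unfolded One_nat_def])
          from hompoly_power[OF hompoly_block_det[where B = ?B, OF this], where n = 3] show ?thesis by simp
        qed
       apply simp
      subgoal by (simp add: coordV_def z_L1_L1_def z_simps block_det_4)
     apply simp
    subgoal premises H for g y
    proof -
      note H' = H(1)[unfolded forall_6, simplified] H(3)[unfolded forall_6 forall_2', simplified] H(4,5)
      \<comment> \<open>\<open>la\<close> and \<open>ja\<close> decode a column number into its
        component and index; their values at 4 and 5 are fillers outside the block
        \<open>?B\<close>. With them \<open>K\<close> is the Kronecker product.\<close>
      define la :: "6 \<Rightarrow> 2" where "la = ix6 0 0 1 1 0 0"
      define ja :: "6 \<Rightarrow> 6" where "ja = ix6 4 5 4 5 4 4"
      define K :: "'a^6^6" where "K = (\<chi> r q. snd g $ la q $ la r * fst g $ ja q $ ja r)"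
      have 1: "block_det (?M (coordV (act g y))) ?B = block_det ((fst g ** ?M (coordV y)) ** K) ?B"
      proof (rule block_det_cong)
        fix i j assume "i \<in> ?B" "j \<in> ?B"
        then show "?M (coordV (act g y)) $ i $ j = ((fst g ** ?M (coordV y)) ** K) $ i $ j"
          by (elim insertE emptyE)
             (simp_all add: act_component sum_6 sum_2' H' K_def la_def ja_def coordV_def matrix_matrix_mult_def algebra_simps)
      qed
      have 2: "block_det ((fst g ** ?M (coordV y)) ** K) ?B = block_det (fst g ** ?M (coordV y)) ?B * block_det K ?B"
      proof (rule block_det_mult)
        fix i j assume "j \<notin> ?B"
        then have "j = 4 \<or> j = 5" using exhaust_6[of j] by auto
        then show "(fst g ** ?M (coordV y)) $ i $ j = 0" by (auto simp: matrix_matrix_mult_def)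
      qed
      have 3: "block_det (fst g ** ?M (coordV y)) ?B = block_det (fst g) ?B * block_det (?M (coordV y)) ?B"
      proof (rule block_det_mult)
        fix i j assume i: "i \<in> ?B" and "j \<notin> ?B"
        then have "j = 4 \<or> j = 5" using exhaust_6[of j] by auto
        then show "fst g $ i $ j = 0" using i by (elim disjE insertE emptyE) (simp_all add: H')
      qed
      have 4: "block_det K ?B = block_det (snd g) {1, 0} ^ 2 * block_det (fst g) {5, 4} ^ 2"
        by (simp add: block_det_4 block_det_2 K_def la_def ja_def power2_eq_square algebra_simps)
      have "block_det (?M (coordV (act g y))) ?B = block_det (fst g) ?B * block_det (?M (coordV y)) ?B
        * (block_det (snd g) {1, 0} ^ 2 * block_det (fst g) {5, 4} ^ 2)"
        unfolding 1 2 3 4 ..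
      then show ?thesis by (simp add: power_mult_distrib power_mult[symmetric] mult_ac)
    qed
   apply simp
  apply simp
  by (simp add: hull_simps)
qed

text \<open>The Pfaffian of a pencil of bivectors on four-space is a binary quadratic form, and its
  discriminant is the relative invariant. At \<open>z_1_1\<close> the form is the product of the two
  parameters, so the discriminant is one.\<close>

lemma stratum_1_1: "bt 6 (-2) (-2) 1 1 1 1 0 0 \<in> BB \<and> z_1_1 \<in> stratum (bt 6 (-2) (-2) 1 1 1 1 0 0)"
  apply (rule stratum_criterion[where s = 2 and D = "3 * (1 + 1 + (1 + 1))" and F = "\<lambda>\<phi>. ((\<phi> (2, 3, 0) * \<phi> (4, 5, 1) + \<phi> (4, 5, 0) * \<phi> (2, 3, 1) - (\<phi> (2, 4, 0) * \<phi> (3, 5, 1) + \<phi> (3, 5, 0) * \<phi> (2, 4, 1)) + (\<phi> (2, 5, 0) * \<phi> (3, 4, 1) + \<phi> (3, 4, 0) * \<phi> (2, 5, 1))) * (\<phi> (2, 3, 0) * \<phi> (4, 5, 1) + \<phi> (4, 5, 0) * \<phi> (2, 3, 1) - (\<phi> (2, 4, 0) * \<phi> (3, 5, 1) + \<phi> (3, 5, 0) * \<phi> (2, 4, 1)) + (\<phi> (2, 5, 0) * \<phi> (3, 4, 1) + \<phi> (3, 4, 0) * \<phi> (2, 5, 1))) - 4 * ((\<phi> (2, 3, 0) * \<phi> (4, 5, 0) - \<phi> (2, 4, 0) * \<phi> (3, 5, 0) + \<phi> (2, 5, 0) * \<phi> (3, 4, 0)) * (\<phi> (2, 3, 1) *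 \<phi> (4, 5, 1) - \<phi> (2, 4, 1) * \<phi> (3, 5, 1) + \<phi> (2, 5, 1) * \<phi> (3, 4, 1)))) ^ 3" and N = 2
      and ?a1.0 = 4 and ?a2.0 = 6 and ts = "[(2, 3, 0), (4, 5, 1)]" and us = "[1/2, 1/2]"])
            apply simp
           apply simp
          subgoal by (simp add: V_iff alt_def z_1_1_def z_simps)
         subgoal by (simp add: z_1_1_def z_simps)
        subgoal by (rule hompoly_mult hompoly_power hompoly_add hompoly_diff hompoly_cmult hompoly_var | simp)+
       apply simp
      subgoal by (simp add: coordV_def z_1_1_def z_simps)
     apply simp
    subgoal premises H for g y
    proof -
      note H' = H(1)[unfolded forall_6, simplified] H(2)[unfolded forall_2', simplified]
        H(3)[unfolded forall_6 forall_2', simplified] H(4,5)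
      have a0: "(act g y $ 0 $ 2 $ 3 * act g y $ 0 $ 4 $ 5 - act g y $ 0 $ 2 $ 4 * act g y $ 0 $ 3 $ 5 + act g y $ 0 $ 2 $ 5 * act g y $ 0 $ 3 $ 4) = block_det (fst g) {5, 4, 3, 2} * (snd g $ 0 $ 0^2 * (y $ 0 $ 2 $ 3 * y $ 0 $ 4 $ 5 - y $ 0 $ 2 $ 4 * y $ 0 $ 3 $ 5 + y $ 0 $ 2 $ 5 * y $ 0 $ 3 $ 4) + snd g $ 0 $ 0 * snd g $ 0 $ 1 * (y $ 0 $ 2 $ 3 * y $ 1 $ 4 $ 5 + y $ 0 $ 4 $ 5 * y $ 1 $ 2 $ 3 - (y $ 0 $ 2 $ 4 * y $ 1 $ 3 $ 5 + y $ 0 $ 3 $ 5 * y $ 1 $ 2 $ 4) + (y $ 0 $ 2 $ 5 * y $ 1 $ 3 $ 4 + y $ 0 $ 3 $ 4 * y $ 1 $ 2 $ 5)) + snd g $ 0 $ 1^2 * (y $ 1 $ 2 $ 3 * y $ 1 $ 4 $ 5 - y $ 1 $ 2 $ 4 * y $ 1 $ 3 $ 5 + y $ 1 $ 2 $ 5 * y $ 1 $ 3 $ 4))"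
      proof -
        have "(act g y $ 0 $ 2 $ 3 * act g y $ 0 $ 4 $ 5 - act g y $ 0 $ 2 $ 4 * act g y $ 0 $ 3 $ 5 + act g y $ 0 $ 2 $ 5 * act g y $ 0 $ 3 $ 4) = block_det (fst g) {5, 4, 3, 2} * ((snd g $ 0 $ 0 * y $ 0 $ 2 $ 3 + snd g $ 0 $ 1 * y $ 1 $ 2 $ 3) * ((snd g $ 0 $ 0 * y $ 0 $ 4 $ 5 + snd g $ 0 $ 1 * y $ 1 $ 4 $ 5)) - (snd g $ 0 $ 0 * y $ 0 $ 2 $ 4 + snd g $ 0 $ 1 * y $ 1 $ 2 $ 4) * ((snd g $ 0 $ 0 * y $ 0 $ 3 $ 5 + snd g $ 0 $ 1 * y $ 1 $ 3 $ 5)) + (snd g $ 0 $ 0 * y $ 0 $ 2 $ 5 + snd g $ 0 $ 1 * y $ 1 $ 2 $ 5) * ((snd g $ 0 $ 0 * y $ 0 $ 3 $ 4 + snd g $ 0 $ 1 * y $ 1 $ 3 $ 4)))"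
          by (rule pfaffian_congr[where u = "\<lambda>i j. act g y $ 0 $ i $ j"], simp_all, elim disjE conjE)
             (simp_all add: act_component sum_6 sum_2' H' minor_def algebra_simps)
        then show ?thesis by (simp add: block_det_1 power2_eq_square algebra_simps)
      qed
      have a1: "(act g y $ 1 $ 2 $ 3 * act g y $ 1 $ 4 $ 5 - act g y $ 1 $ 2 $ 4 * act g y $ 1 $ 3 $ 5 + act g y $ 1 $ 2 $ 5 * act g y $ 1 $ 3 $ 4) = block_det (fst g) {5, 4, 3, 2} * (snd g $ 1 $ 0^2 * (y $ 0 $ 2 $ 3 * y $ 0 $ 4 $ 5 - y $ 0 $ 2 $ 4 * y $ 0 $ 3 $ 5 + y $ 0 $ 2 $ 5 * y $ 0 $ 3 $ 4) + snd g $ 1 $ 0 * snd g $ 1 $ 1 * (y $ 0 $ 2 $ 3 * y $ 1 $ 4 $ 5 + y $ 0 $ 4 $ 5 * y $ 1 $ 2 $ 3 - (y $ 0 $ 2 $ 4 * y $ 1 $ 3 $ 5 + y $ 0 $ 3 $ 5 * y $ 1 $ 2 $ 4) + (y $ 0 $ 2 $ 5 * y $ 1 $ 3 $ 4 + y $ 0 $ 3 $ 4 * y $ 1 $ 2 $ 5)) + snd g $ 1 $ 1^2 * (y $ 1 $ 2 $ 3 * y $ 1 $ 4 $ 5 - y $ 1 $ 2 $ 4 * y $ 1 $ 3 $ 5 + y $ 1 $ 2 $ 5 * y $ 1 $ 3 $ 4))"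
      proof -
        have "(act g y $ 1 $ 2 $ 3 * act g y $ 1 $ 4 $ 5 - act g y $ 1 $ 2 $ 4 * act g y $ 1 $ 3 $ 5 + act g y $ 1 $ 2 $ 5 * act g y $ 1 $ 3 $ 4) = block_det (fst g) {5, 4, 3, 2} * ((snd g $ 1 $ 0 * y $ 0 $ 2 $ 3 + snd g $ 1 $ 1 * y $ 1 $ 2 $ 3) * ((snd g $ 1 $ 0 * y $ 0 $ 4 $ 5 + snd g $ 1 $ 1 * y $ 1 $ 4 $ 5)) - (snd g $ 1 $ 0 * y $ 0 $ 2 $ 4 + snd g $ 1 $ 1 * y $ 1 $ 2 $ 4) * ((snd g $ 1 $ 0 * y $ 0 $ 3 $ 5 + snd g $ 1 $ 1 * y $ 1 $ 3 $ 5)) + (snd g $ 1 $ 0 * y $ 0 $ 2 $ 5 + snd g $ 1 $ 1 * y $ 1 $ 2 $ 5) * ((snd g $ 1 $ 0 * y $ 0 $ 3 $ 4 + snd g $ 1 $ 1 * y $ 1 $ 3 $ 4)))"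
          by (rule pfaffian_congr[where u = "\<lambda>i j. act g y $ 1 $ i $ j"], simp_all, elim disjE conjE)
             (simp_all add: act_component sum_6 sum_2' H' minor_def algebra_simps)
        then show ?thesis by (simp add: block_det_1 power2_eq_square algebra_simps)
      qed
      have a2: "(act g y $ 0 $ 2 $ 3 * act g y $ 1 $ 4 $ 5 + act g y $ 0 $ 4 $ 5 * act g y $ 1 $ 2 $ 3 - (act g y $ 0 $ 2 $ 4 * act g y $ 1 $ 3 $ 5 + act g y $ 0 $ 3 $ 5 * act g y $ 1 $ 2 $ 4) + (act g y $ 0 $ 2 $ 5 * act g y $ 1 $ 3 $ 4 + act g y $ 0 $ 3 $ 4 * act g y $ 1 $ 2 $ 5)) = block_det (fst g) {5, 4, 3, 2} * (2 * snd g $ 0 $ 0 * snd g $ 1 $ 0 * (y $ 0 $ 2 $ 3 * y $ 0 $ 4 $ 5 - y $ 0 $ 2 $ 4 * y $ 0 $ 3 $ 5 + y $ 0 $ 2 $ 5 * y $ 0 $ 3 $ 4) + (snd g $ 0 $ 0 * snd g $ 1 $ 1 + snd g $ 0 $ 1 * snd g $ 1 $ 0) * (y $ 0 $ 2 $ 3 * y $ 1 $ 4 $ 5 + y $ 0 $ 4 $ 5 * y $ 1 $ 2 $ 3 - (y $ 0 $ 2 $ 4 * y $ 1 $ 3 $ 5 + y $ 0 $ 3 $ 5 * y $ 1 $ 2 $ 4) + (y $ 0 $ 2 $ 5 * y $ 1 $ 3 $ 4 + y $ 0 $ 3 $ 4 * y $ 1 $ 2 $ 5)) + 2 * snd g $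 0 $ 1 * snd g $ 1 $ 1 * (y $ 1 $ 2 $ 3 * y $ 1 $ 4 $ 5 - y $ 1 $ 2 $ 4 * y $ 1 $ 3 $ 5 + y $ 1 $ 2 $ 5 * y $ 1 $ 3 $ 4))"
      proof -
        have "(act g y $ 0 $ 2 $ 3 * act g y $ 1 $ 4 $ 5 + act g y $ 0 $ 4 $ 5 * act g y $ 1 $ 2 $ 3 - (act g y $ 0 $ 2 $ 4 * act g y $ 1 $ 3 $ 5 + act g y $ 0 $ 3 $ 5 * act g y $ 1 $ 2 $ 4) + (act g y $ 0 $ 2 $ 5 * act g y $ 1 $ 3 $ 4 + act g y $ 0 $ 3 $ 4 * act g y $ 1 $ 2 $ 5)) = block_det (fst g) {5, 4, 3, 2} * ((snd g $ 0 $ 0 * y $ 0 $ 2 $ 3 + snd g $ 0 $ 1 * y $ 1 $ 2 $ 3) * (snd g $ 1 $ 0 * y $ 0 $ 4 $ 5 + snd g $ 1 $ 1 * y $ 1 $ 4 $ 5) + (snd g $ 0 $ 0 * y $ 0 $ 4 $ 5 + snd g $ 0 $ 1 * y $ 1 $ 4 $ 5) * (snd g $ 1 $ 0 * y $ 0 $ 2 $ 3 + snd g $ 1 $ 1 * y $ 1 $ 2 $ 3) - ((snd g $ 0 $ 0 * y $ 0 $ 2 $ 4 + snd g $ 0 $ 1 * y $ 1 $ 2 $ 4) * (snd g $ 1 $ 0 * y $ 0 $ 3 $ 5 + snd g $ 1 $ 1 * y $ 1 $ 3 $ 5) + (snd g $ 0 $ 0 * y $ 0 $ 3 $ 5 +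 snd g $ 0 $ 1 * y $ 1 $ 3 $ 5) * (snd g $ 1 $ 0 * y $ 0 $ 2 $ 4 + snd g $ 1 $ 1 * y $ 1 $ 2 $ 4)) + ((snd g $ 0 $ 0 * y $ 0 $ 2 $ 5 + snd g $ 0 $ 1 * y $ 1 $ 2 $ 5) * (snd g $ 1 $ 0 * y $ 0 $ 3 $ 4 + snd g $ 1 $ 1 * y $ 1 $ 3 $ 4) + (snd g $ 0 $ 0 * y $ 0 $ 3 $ 4 + snd g $ 0 $ 1 * y $ 1 $ 3 $ 4) * (snd g $ 1 $ 0 * y $ 0 $ 2 $ 5 + snd g $ 1 $ 1 * y $ 1 $ 2 $ 5)))"
          apply (rule pfaffian_polar_congr[where u = "\<lambda>i j. act g y $ 0 $ i $ j" and v = "\<lambda>i j. act g y $ 1 $ i $ j"], simp_all)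
           apply (elim disjE conjE; simp add: act_component sum_6 sum_2' H' minor_def algebra_simps)
          by (elim disjE conjE; simp add: act_component sum_6 sum_2' H' minor_def block_det_1 block_det_2 power2_eq_square algebra_simps)
        then show ?thesis by (simp add: block_det_1 block_det_2 power2_eq_square algebra_simps)
      qed
      have b: "block_det (snd g) {1, 0} = snd g $ 0 $ 0 * snd g $ 1 $ 1 - snd g $ 0 $ 1 * snd g $ 1 $ 0" by (simp add: block_det_2 algebra_simps)
      show ?thesis
        unfolding coordV_def prod.case a0 a1 a2 discriminant_transform
        by (simp add: power_mult_distrib power_mult[symmetric] b mult_ac)
    qed
   apply simp
  apply simp
  by (simp add: hull_simps)

text \<open>One factor is the Pfaffian of the bivector in the first component. The other is its
  polar pairing with the wedge of the rows 0 and 1 of the second component. The exponents 6 and 18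
  balance them to the required weight.\<close>

lemma stratum_2_1: "bt 66 (-4) (-4) 2 2 2 2 (-3) 3 \<in> BB \<and> z_2_1 \<in> stratum (bt 66 (-4) (-4) 2 2 2 2 (-3) 3)"
  apply (rule stratum_criterion[where s = 1 and D = "6 * (1 + 1) + 18 * (1 + (1 + 1))" and F = "\<lambda>\<phi>. (\<phi> (2, 3, 0) * \<phi> (4, 5, 0) - \<phi> (2, 4, 0) * \<phi> (3, 5, 0) + \<phi> (2, 5, 0) * \<phi> (3, 4, 0)) ^ 6 * ((\<phi> (2, 3, 0) * (\<phi> (0, 4, 1) * \<phi> (1, 5, 1) - \<phi> (0, 5, 1) * \<phi> (1, 4, 1)) + \<phi> (4, 5, 0) * (\<phi> (0, 2, 1) * \<phi> (1, 3, 1) - \<phi> (0, 3, 1) * \<phi> (1, 2, 1)) - (\<phi> (2, 4, 0) * (\<phi> (0, 3, 1) * \<phi> (1, 5, 1) - \<phi> (0, 5, 1) * \<phi> (1, 3, 1)) + \<phi> (3, 5, 0) * (\<phi> (0, 2, 1) * \<phi> (1, 4, 1) - \<phi> (0, 4, 1) * \<phi> (1, 2, 1))) + (\<phi> (2, 5, 0) * (\<phi> (0, 3, 1) * \<phi> (1, 4, 1) - \<phi> (0, 4, 1) * \<phi> (1, 3, 1)) + \<phi> (3, 4, 0) * (\<phi> (0, 2, 1) * \<phi> (1, 5, 1) - \<phi> (0, 5, 1) * \<phi> (1, 2, 1))))) ^ 18" and N = 1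
      and ?a1.0 = 22 and ?a2.0 = 33 and ts = "[(2, 3, 0), (4, 5, 0), (0, 2, 1), (1, 3, 1)]" and us = "[1/11, 4/11, 3/11, 3/11]"])
            apply simp
           apply simp
          subgoal by (simp add: V_iff alt_def z_2_1_def z_simps)
         subgoal by (simp add: z_2_1_def z_simps)
        subgoal by (rule hompoly_mult hompoly_power hompoly_add hompoly_diff hompoly_var hompoly_add[where d = "1 + (1 + 1)"] | simp)+
       apply simp
      subgoal by (simp add: coordV_def z_2_1_def z_simps)
     apply simp
    subgoal premises H for g y
    proof -
      note H' = H(1)[unfolded forall_6, simplified] H(2)[unfolded forall_2', simplified]
        H(3)[unfolded forall_6 forall_2', simplified] H(4,5)
      have a0: "(act g y $ 0 $ 2 $ 3 * act g y $ 0 $ 4 $ 5 - act g y $ 0 $ 2 $ 4 * act g y $ 0 $ 3 $ 5 + act g y $ 0 $ 2 $ 5 * act g y $ 0 $ 3 $ 4) = block_det (fst g) {5, 4, 3, 2} * (block_det (snd g) {0}^2 * (y $ 0 $ 2 $ 3 * y $ 0 $ 4 $ 5 - y $ 0 $ 2 $ 4 * y $ 0 $ 3 $ 5 + y $ 0 $ 2 $ 5 * y $ 0 $ 3 $ 4))"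
      proof -
        have "(act g y $ 0 $ 2 $ 3 * act g y $ 0 $ 4 $ 5 - act g y $ 0 $ 2 $ 4 * act g y $ 0 $ 3 $ 5 + act g y $ 0 $ 2 $ 5 * act g y $ 0 $ 3 $ 4) = block_det (fst g) {5, 4, 3, 2} * ((snd g $ 0 $ 0 * y $ 0 $ 2 $ 3) * ((snd g $ 0 $ 0 * y $ 0 $ 4 $ 5)) - (snd g $ 0 $ 0 * y $ 0 $ 2 $ 4) * ((snd g $ 0 $ 0 * y $ 0 $ 3 $ 5)) + (snd g $ 0 $ 0 * y $ 0 $ 2 $ 5) * ((snd g $ 0 $ 0 * y $ 0 $ 3 $ 4)))"
          by (rule pfaffian_congr[where u = "\<lambda>i j. act g y $ 0 $ i $ j"], simp_all, elim disjE conjE)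
             (simp_all add: act_component sum_6 sum_2' H' minor_def algebra_simps)
        then show ?thesis by (simp add: block_det_1 power2_eq_square algebra_simps)
      qed
      have a1: "(act g y $ 0 $ 2 $ 3 * (act g y $ 1 $ 0 $ 4 * act g y $ 1 $ 1 $ 5 - act g y $ 1 $ 0 $ 5 * act g y $ 1 $ 1 $ 4) + act g y $ 0 $ 4 $ 5 * (act g y $ 1 $ 0 $ 2 * act g y $ 1 $ 1 $ 3 - act g y $ 1 $ 0 $ 3 * act g y $ 1 $ 1 $ 2) - (act g y $ 0 $ 2 $ 4 * (act g y $ 1 $ 0 $ 3 * act g y $ 1 $ 1 $ 5 - act g y $ 1 $ 0 $ 5 * act g y $ 1 $ 1 $ 3) + act g y $ 0 $ 3 $ 5 * (act g y $ 1 $ 0 $ 2 * act g y $ 1 $ 1 $ 4 - act g y $ 1 $ 0 $ 4 * act g y $ 1 $ 1 $ 2)) + (act g y $ 0 $ 2 $ 5 * (act g y $ 1 $ 0 $ 3 * act g y $ 1 $ 1 $ 4 - act g y $ 1 $ 0 $ 4 * act g y $ 1 $ 1 $ 3) + act g y $ 0 $ 3 $ 4 * (act g y $ 1 $ 0 $ 2 * act g y $ 1 $ 1 $ 5 - act g y $ 1 $ 0 $ 5 * act g y $ 1 $ 1 $ 2))) = block_det (fst g) {5, 4, 3, 2} * (block_det (snd g) {0} * block_det (snd g) {1}^2 * block_det (fst g) {1, 0} * (y $ 0 $ 2 $ 3 * (y $ 1 $ 0 $ 4 * y $ 1 $ 1 $ 5 - y $ 1 $ 0 $ 5 * y $ 1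 $ 1 $ 4) + y $ 0 $ 4 $ 5 * (y $ 1 $ 0 $ 2 * y $ 1 $ 1 $ 3 - y $ 1 $ 0 $ 3 * y $ 1 $ 1 $ 2) - (y $ 0 $ 2 $ 4 * (y $ 1 $ 0 $ 3 * y $ 1 $ 1 $ 5 - y $ 1 $ 0 $ 5 * y $ 1 $ 1 $ 3) + y $ 0 $ 3 $ 5 * (y $ 1 $ 0 $ 2 * y $ 1 $ 1 $ 4 - y $ 1 $ 0 $ 4 * y $ 1 $ 1 $ 2)) + (y $ 0 $ 2 $ 5 * (y $ 1 $ 0 $ 3 * y $ 1 $ 1 $ 4 - y $ 1 $ 0 $ 4 * y $ 1 $ 1 $ 3) + y $ 0 $ 3 $ 4 * (y $ 1 $ 0 $ 2 * y $ 1 $ 1 $ 5 - y $ 1 $ 0 $ 5 * y $ 1 $ 1 $ 2))))"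
      proof -
        have "(act g y $ 0 $ 2 $ 3 * (act g y $ 1 $ 0 $ 4 * act g y $ 1 $ 1 $ 5 - act g y $ 1 $ 0 $ 5 * act g y $ 1 $ 1 $ 4) + act g y $ 0 $ 4 $ 5 * (act g y $ 1 $ 0 $ 2 * act g y $ 1 $ 1 $ 3 - act g y $ 1 $ 0 $ 3 * act g y $ 1 $ 1 $ 2) - (act g y $ 0 $ 2 $ 4 * (act g y $ 1 $ 0 $ 3 * act g y $ 1 $ 1 $ 5 - act g y $ 1 $ 0 $ 5 * act g y $ 1 $ 1 $ 3) + act g y $ 0 $ 3 $ 5 * (act g y $ 1 $ 0 $ 2 * act g y $ 1 $ 1 $ 4 - act g y $ 1 $ 0 $ 4 * act g y $ 1 $ 1 $ 2)) + (act g y $ 0 $ 2 $ 5 * (act g y $ 1 $ 0 $ 3 * act g y $ 1 $ 1 $ 4 - act g y $ 1 $ 0 $ 4 * act g y $ 1 $ 1 $ 3) + act g y $ 0 $ 3 $ 4 * (act g y $ 1 $ 0 $ 2 * act g y $ 1 $ 1 $ 5 - act g y $ 1 $ 0 $ 5 * act g y $ 1 $ 1 $ 2))) = block_det (fst g) {5, 4, 3, 2} * ((snd g $ 0 $ 0 * y $ 0 $ 2 $ 3) * (block_det (snd g) {1}^2 * block_det (fst g) {1, 0} * (y $ 1 $ 0 $ 4 * y $ 1 $ 1 $ 5 - y $ 1 $ 0 $ 5 * y $ 1 $ 1 $ 4)) + (snd g $ 0 $ 0 * y $ 0 $ 4 $ 5) * (block_det (snd g) {1}^2 * block_det (fst g)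 {1, 0} * (y $ 1 $ 0 $ 2 * y $ 1 $ 1 $ 3 - y $ 1 $ 0 $ 3 * y $ 1 $ 1 $ 2)) - ((snd g $ 0 $ 0 * y $ 0 $ 2 $ 4) * (block_det (snd g) {1}^2 * block_det (fst g) {1, 0} * (y $ 1 $ 0 $ 3 * y $ 1 $ 1 $ 5 - y $ 1 $ 0 $ 5 * y $ 1 $ 1 $ 3)) + (snd g $ 0 $ 0 * y $ 0 $ 3 $ 5) * (block_det (snd g) {1}^2 * block_det (fst g) {1, 0} * (y $ 1 $ 0 $ 2 * y $ 1 $ 1 $ 4 - y $ 1 $ 0 $ 4 * y $ 1 $ 1 $ 2))) + ((snd g $ 0 $ 0 * y $ 0 $ 2 $ 5) * (block_det (snd g) {1}^2 * block_det (fst g) {1, 0} * (y $ 1 $ 0 $ 3 * y $ 1 $ 1 $ 4 - y $ 1 $ 0 $ 4 * y $ 1 $ 1 $ 3)) + (snd g $ 0 $ 0 * y $ 0 $ 3 $ 4) * (block_det (snd g) {1}^2 * block_det (fst g) {1, 0} * (y $ 1 $ 0 $ 2 * y $ 1 $ 1 $ 5 - y $ 1 $ 0 $ 5 * y $ 1 $ 1 $ 2))))"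
          apply (rule pfaffian_polar_congr[where u = "\<lambda>i j. act g y $ 0 $ i $ j" and v = "\<lambda>i j. (act g y $ 1 $ 0 $ i * act g y $ 1 $ 1 $ j - act g y $ 1 $ 0 $ j * act g y $ 1 $ 1 $ i)"], simp_all)
           apply (elim disjE conjE; simp add: act_component sum_6 sum_2' H' minor_def algebra_simps)
          by (elim disjE conjE; simp add: act_component sum_6 sum_2' H' minor_def block_det_1 block_det_2 power2_eq_square algebra_simps)
        then show ?thesis by (simp add: block_det_1 block_det_2 power2_eq_square algebra_simps)
      qed
      show ?thesis unfolding coordV_def prod.case a0 a1
        by (simp add: power_mult_distrib power_mult[symmetric] power_add[of "block_det (fst g) {5, 4, 3, 2}" 6 18, simplified] power_add[of "block_det (snd g) {0}" 12 18, simplified] mult_ac)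
    qed
   apply simp
  apply simp
  by (simp add: hull_simps)

subsection \<open>Nondegenerate binary quadratic pencils\<close>

lemma smat_simps:
  "smat c (A + B) = smat c A + smat c B" "smat c (smat d A) = smat (c * d) A" "smat 1 A = A" "smat 0 A = 0"
  by (simp_all add: smat_def vec_eq_iff algebra_simps)

lemma fr_E:
  assumes "\<And>k. E k \<in> vec.span {v0, v1, v2, v3, v4, v5 :: 'a::field^6}"
  shows "fr v0 v1 v2 v3 v4 v5"
proof -
  have "vec.span {E 0, E 1, E 2, E 3, E 4, E 5 :: 'a^6} \<subseteq> vec.span {v0, v1, v2, v3, v4, v5}"
    by (rule vec.span_minimal[OF _ vec.subspace_span]) (use assms in auto)
  then show ?thesis using span_E by (auto simp: fr_def)
qed

text \<open>The quadratic has the roots \<open>r1\<close> and \<open>r2\<close>, and the members at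
  these roots are decomposable. As the roots differ, these members can serve as generators, and
  their planes are complementary in the span of the last four vectors.\<close>

lemma z_N_split:
  fixes r1 r2 :: "'a::field"
  assumes "r1 \<noteq> r2"
  shows "z_N (- (r1 + r2)) (- (r1 * r2)) \<sim>\<^sub>G z_1_1"
proof -
  let ?A = "ew 2 3 + ew 4 5 :: 'a^6^6"
  let ?B = "ew 2 4 + smat (- (r1 * r2)) (ew 3 5) + smat (- (r1 + r2)) (ew 4 5) :: 'a^6^6"
  let ?v2 = "E 2 + r2 *s E 5 :: 'a^6" and ?v3 = "r1 *s E 3 + E 4 :: 'a^6"
    and ?v4 = "E 2 + r1 *s E 5 :: 'a^6" and ?v5 = "r2 *s E 3 + E 4 :: 'a^6"
  have "mk ?A ?B \<sim>\<^sub>G mk (smat r1 ?A + smat 1 ?B) (smat r2 ?A + smat 1 ?B)"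
    by (rule equivG_gl2) (use assms in simp)
  also have "\<dots> \<sim>\<^sub>G z_1_1"
  proof (rule nf_1_1)
    let ?S = "vec.span {E 0, E 1, ?v2, ?v3, ?v4, ?v5}"
    have b: "E 0 \<in> ?S" "E 1 \<in> ?S" "?v2 \<in> ?S" "?v3 \<in> ?S" "?v4 \<in> ?S" "?v5 \<in> ?S" by (auto intro: vec.span_base)
    have k: "inverse (r1 - r2) * r1 - inverse (r1 - r2) * r2 = 1"
      using assms by (simp add: right_diff_distrib[symmetric])
    have "inverse (r1 - r2) *s (?v4 - ?v2) \<in> ?S" using b by (intro vec.span_scale vec.span_diff)
    also have "inverse (r1 - r2) *s (?v4 - ?v2) = E 5"
      using k by (simp add: vec_eq_iff left_diff_distrib[symmetric])
    finally have e5: "E 5 \<in> ?S" .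
    have "inverse (r1 - r2) *s (?v3 - ?v5) \<in> ?S" using b by (intro vec.span_scale vec.span_diff)
    also have "inverse (r1 - r2) *s (?v3 - ?v5) = E 3"
      using k by (simp add: vec_eq_iff left_diff_distrib[symmetric])
    finally have e3: "E 3 \<in> ?S" .
    have "?v2 - r2 *s E 5 \<in> ?S" using b e5 by (intro vec.span_scale vec.span_diff)
    then have e2: "E 2 \<in> ?S" by simp
    have "?v3 - r1 *s E 3 \<in> ?S" using b e3 by (intro vec.span_scale vec.span_diff)
    then have e4: "E 4 \<in> ?S" by simp
    show "fr (E 0) (E 1) ?v2 ?v3 ?v4 ?v5"
    proof (rule fr_E)
      show "E k \<in> ?S" for k using exhaust_6[of k] b(1,2) e2 e3 e4 e5 by auto
    qed
    show "smat r1 ?A + smat 1 ?B = wedge ?v2 ?v3"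
      by (simp add: wedge_unfold algebra_simps)
    show "smat r2 ?A + smat 1 ?B = wedge ?v4 ?v5"
      by (simp add: wedge_unfold algebra_simps)
  qed
  finally show ?thesis by (simp add: z_N_def)
qed

text \<open>If \<theta> is a root for the parameters \<open>g\<close>, \<open>b\<close>, then
  \<open>a + c \<theta>\<close> is a root for the new ones.\<close>

lemma z_N_affine:
  fixes a c g b :: "'a::field"
  assumes c: "c \<noteq> 0"
  shows "z_N g b \<sim>\<^sub>G z_N (c * g - 2 * a) (c\<^sup>2 * b + a * c * g - a\<^sup>2)"
proof -
  let ?A = "ew 2 3 + ew 4 5 :: 'a^6^6"
  let ?B = "ew 2 4 + smat b (ew 3 5) + smat g (ew 4 5) :: 'a^6^6"
  let ?v2 = "E 2 - (a / c) *s E 5 :: 'a^6" and ?v4 = "c *s E 4 - a *s E 3 :: 'a^6" and ?v5 = "(1 / c) *s E 5 :: 'a^6"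
  have "mk ?A ?B \<sim>\<^sub>G mk (smat 1 ?A + smat 0 ?B) (smat (- a) ?A + smat c ?B)"
    by (rule equivG_gl2) (use assms in simp)
  also have "\<dots> \<sim>\<^sub>G z_N (c * g - 2 * a) (c\<^sup>2 * b + a * c * g - a\<^sup>2)"
  proof (rule nf_N)
    let ?S = "vec.span {E 0, E 1, ?v2, E 3, ?v4, ?v5}"
    have b: "E 0 \<in> ?S" "E 1 \<in> ?S" "?v2 \<in> ?S" "E 3 \<in> ?S" "?v4 \<in> ?S" "?v5 \<in> ?S" by (auto intro: vec.span_base)
    have "c *s ?v5 \<in> ?S" by (rule vec.span_scale[OF b(6)])
    then have e5: "E 5 \<in> ?S" using c by simp
    have "?v2 + (a / c) *s E 5 \<in> ?S" by (rule vec.span_add[OF b(3) vec.span_scale[OF e5]])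
    then have e2: "E 2 \<in> ?S" by simp
    have "(1 / c) *s (?v4 + a *s E 3) \<in> ?S" by (rule vec.span_scale[OF vec.span_add[OF b(5) vec.span_scale[OF b(4)]]])
    then have e4: "E 4 \<in> ?S" using c by simp
    show "fr (E 0) (E 1) ?v2 (E 3) ?v4 ?v5"
    proof (rule fr_E)
      show "E k \<in> ?S" for k using exhaust_6[of k] b(1,2,4) e2 e4 e5 by auto
    qed
    show "smat 1 ?A + smat 0 ?B = wedge ?v2 (E 3) + wedge ?v4 ?v5"
      using c by (simp add: wedge_unfold field_simps)
    show "smat (- a) ?A + smat c ?B = wedge ?v2 ?v4 + smat (c\<^sup>2 * b + a * c * g - a\<^sup>2) (wedge (E 3) ?v5)
      + smat (c * g - 2 * a) (wedge ?v4 ?v5)"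
      using c by (simp add: wedge_unfold field_simps power2_eq_square)
  qed
  finally show ?thesis by (simp add: z_N_def)
qed

definition decomposable :: "'a::field^6^6 \<Rightarrow> bool" where
  "decomposable A \<longleftrightarrow> (\<exists>u v. A = wedge u v)"

lemma decomposable_congr:
  fixes F :: "'a::field^6^6"
  assumes "invertible F"
  shows "decomposable (F ** A ** transpose F) \<longleftrightarrow> decomposable A"
proof
  assume "decomposable (F ** A ** transpose F)"
  then obtain u v where uv: "F ** A ** transpose F = wedge u v" by (auto simp: decomposable_def)
  obtain F' where F': "F' ** F = mat 1" using assms by (auto simp: invertible_def)
  have "A = (F' ** F) ** A ** transpose (F' ** F)" by (simp add: F' transpose_mat)
  also have "\<dots> = F' ** (F ** A ** transpose F) ** transpose F'"
    by (simp add: matrix_transpose_mul matrix_mul_assoc)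
  finally show "decomposable A" unfolding uv congr_wedge decomposable_def by blast
next
  assume "decomposable A"
  then obtain u v where "A = wedge u v" by (auto simp: decomposable_def)
  then have "F ** A ** transpose F = wedge (F *v u) (F *v v)" by (simp add: congr_wedge)
  then show "decomposable (F ** A ** transpose F)" unfolding decomposable_def by blast
qed

text \<open>A decomposable bivector satisfies the Pluecker relation on the indices 2 to 5, which
  here is the quadratic equation. Conversely a root yields an explicit factorisation.\<close>

lemma decomposable_z_N:
  fixes g b s t :: "'a::field"
  assumes st: "(s, t) \<noteq> (0, 0)"
  shows "decomposable (smat s (z_N g b $ 0) + smat t (z_N g b $ 1)) \<longleftrightarrow> t \<noteq> 0 \<and> (s / t)\<^sup>2 + g * (s / t) = b"
proof
  assume "decomposable (smat s (z_N g b $ 0) + smat t (z_N g b $ 1))"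
  then obtain u v where uv: "smat s (z_N g b $ 0) + smat t (z_N g b $ 1) = wedge u v" by (auto simp: decomposable_def)
  let ?w = "wedge u v"
  have "?w $ 2 $ 3 * ?w $ 4 $ 5 - ?w $ 2 $ 4 * ?w $ 3 $ 5 + ?w $ 2 $ 5 * ?w $ 3 $ 4 = 0"
    by (simp add: wedge_def algebra_simps)
  then have eq: "s * (s + t * g) - t * (t * b) = 0"
    unfolding uv[symmetric] by (simp add: z_N_def smat_def wedge_def E_def axis_def)
  have t: "t \<noteq> 0"
  proof
    assume "t = 0"
    then have "s = 0" using eq by simp
    then show False using st \<open>t = 0\<close> by simp
  qed
  have "(s / t)\<^sup>2 + g * (s / t) - b = (s * (s + t * g) - t * (t * b)) / t\<^sup>2"
    using t by (simp add: field_simps power2_eq_square)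
  then show "t \<noteq> 0 \<and> (s / t)\<^sup>2 + g * (s / t) = b" using t eq by simp
next
  assume a: "t \<noteq> 0 \<and> (s / t)\<^sup>2 + g * (s / t) = b"
  define r where "r = s / t"
  have s: "s = t * r" using a by (simp add: r_def)
  have b: "b = r * r + g * r" using a by (simp add: r_def power2_eq_square)
  have "smat s (z_N g b $ 0) + smat t (z_N g b $ 1) = wedge (E 2 - (r + g) *s E 5) (s *s E 3 + t *s E 4)"
    unfolding z_N_def b s by (simp add: wedge_unfold algebra_simps)
  then show "decomposable (smat s (z_N g b $ 0) + smat t (z_N g b $ 1))" unfolding decomposable_def by blast
qed

subsection \<open>Base change\<close>

definition base_change_G :: "'k::field grp \<Rightarrow> 'k alg_closure grp" where
  "base_change_G g = ((\<chi> i j. to_ac (fst g $ i $ j)), (\<chi> i j. to_ac (snd g $ i $ j)))"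

lemma base_change_act: "base_change (act g x) = act (base_change_G g) (base_change x)"
  by (simp add: vec_eq_iff base_change_def act_component base_change_G_def to_ac_sum)

lemma base_change_G_in_G:
  assumes "g \<in> G" shows "base_change_G g \<in> G"
proof -
  have d: "det (\<chi> i j. to_ac (A $ i $ j)) = to_ac (det A)" for A :: "'a^'n::finite^'n"
    by (simp add: det_def to_ac_sum to_ac_prod)
  show ?thesis using assms by (simp add: G_def base_change_G_def invertible_det_nz d)
qed

lemma base_change_equivG: "x \<sim>\<^sub>G y \<Longrightarrow> base_change x \<sim>\<^sub>G base_change y"
  unfolding equivG_def using base_change_act base_change_G_in_G by metis

lemma base_change_mk: "base_change (mk A B) = mk (\<chi> i j. to_ac (A $ i $ j)) (\<chi> i j. to_ac (B $ i $ j))"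
  by (simp add: base_change_def mk_def vec_eq_iff)

lemma to_ac_ew: "to_ac (wedge (E i) (E j) $ p $ q) = wedge (E i) (E j) $ p $ q"
  by (simp add: wedge_def E_def axis_def)

lemma base_change_z_N: "base_change (z_N g b) = z_N (to_ac g) (to_ac b)"
  unfolding z_N_def base_change_mk by (simp add: to_ac_ew smat_def mk_def vec_eq_iff)

lemma base_change_nforms:
  "base_change z_1 = z_1" "base_change z_11 = z_11" "base_change z_111 = z_111" "base_change z_L1 = z_L1"
  "base_change z_1_1 = z_1_1" "base_change z_2 = z_2" "base_change z_L1_1 = z_L1_1" "base_change z_21 = z_21"
  "base_change z_11_1 = z_11_1" "base_change z_L2 = z_L2" "base_change z_L1_L1 = z_L1_L1"
  "base_change z_2_1 = z_2_1" "base_change z_3 = z_3"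
  unfolding z_1_def z_11_def z_111_def z_L1_def z_1_1_def z_2_def z_L1_1_def z_21_def z_11_1_def z_L2_def
    z_L1_L1_def z_2_1_def z_3_def base_change_mk
  by (simp_all add: to_ac_ew mk_def vec_eq_iff)

lemma base_change_z_S: "base_change (z_S g b) = z_S (to_ac g) (to_ac b)"
  unfolding z_S_def base_change_mk by (simp add: to_ac_ew smat_def mk_def vec_eq_iff)

subsection \<open>Quadratic extensions\<close>

text \<open>Defined as a linear span over the base field; it is the generated field as soon as
  \<theta> satisfies a quadratic equation.\<close>

definition adjoin :: "'k::field alg_closure \<Rightarrow> 'k alg_closure set" where
  "adjoin \<theta> = {to_ac u + to_ac v * \<theta> | u v. True}"

lemma adjoinI: "to_ac u + to_ac v * \<theta> \<in> adjoin \<theta>"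
  by (auto simp: adjoin_def)

lemma adjoinE:
  assumes "x \<in> adjoin \<theta>" obtains u v where "x = to_ac u + to_ac v * \<theta>"
  using assms by (auto simp: adjoin_def)

lemma to_ac_adjoin: "to_ac u \<in> adjoin \<theta>"
  using adjoinI[of u 0 \<theta>] by simp

lemma adjoin_self: "\<theta> \<in> adjoin \<theta>"
  using adjoinI[of 0 1 \<theta>] by simp

lemma intermediate_adjoin:
  fixes g b :: "'k::field"
  assumes \<theta>: "\<theta>\<^sup>2 + to_ac g * \<theta> = to_ac b"
  shows "intermediate_field (adjoin \<theta>)"
  unfolding intermediate_field_def
proof (intro conjI ballI)
  have sq: "\<theta> * \<theta> = to_ac b - to_ac g * \<theta>" using \<theta> by (simp add: power2_eq_square algebra_simps)
  show "range to_ac \<subseteq> adjoin \<theta>" using to_ac_adjoin by blast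
  have diff: "x - y \<in> adjoin \<theta>" if h: "x \<in> adjoin \<theta>" "y \<in> adjoin \<theta>" for x y
  proof -
    obtain u v where x: "x = to_ac u + to_ac v * \<theta>" using h(1) by (rule adjoinE)
    obtain u' v' where "y = to_ac u' + to_ac v' * \<theta>" using h(2) by (rule adjoinE)
    with x have "x - y = to_ac (u - u') + to_ac (v - v') * \<theta>" by (simp add: algebra_simps)
    then show ?thesis by (metis adjoinI)
  qed
  have mult: "x * y \<in> adjoin \<theta>" if h: "x \<in> adjoin \<theta>" "y \<in> adjoin \<theta>" for x y
  proof -
    obtain u v where x: "x = to_ac u + to_ac v * \<theta>" using h(1) by (rule adjoinE)
    obtain u' v' where "y = to_ac u' + to_ac v' * \<theta>" using h(2) by (rule adjoinE)
    with x have "x * y = to_ac u * to_ac u' + (to_ac u * to_ac v' + to_ac v * to_ac u') * \<theta> + to_ac v * to_ac v' * (\<theta> * \<theta>)"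
      by (simp add: algebra_simps)
    also have "\<dots> = to_ac (u * u' + v * v' * b) + to_ac (u * v' + v * u' - v * v' * g) * \<theta>"
      unfolding sq by (simp add: algebra_simps)
    finally show ?thesis by (metis adjoinI)
  qed
  show "x - y \<in> adjoin \<theta>" "x * y \<in> adjoin \<theta>" if "x \<in> adjoin \<theta>" "y \<in> adjoin \<theta>" for x y
    using that diff mult by blast+
  fix x assume "x \<in> adjoin \<theta>"
  then obtain u v where x: "x = to_ac u + to_ac v * \<theta>" by (rule adjoinE)
  \<comment> \<open>The conjugate of \<open>x\<close>, with \<theta> replaced by the other root
    \<open>- g - \<theta>\<close>, and the norm of \<open>x\<close>. A vanishing norm forces
    \<open>x\<close> or its conjugate to be zero, and then \<open>x\<close> lies in the base
    field.\<close>
  let ?y = "to_ac (u - v * g) + to_ac (- v) * \<theta>" and ?n = "u\<^sup>2 - g * u * v - b * v\<^sup>2"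
  have "x * ?y = to_ac u * to_ac u - to_ac g * to_ac u * to_ac v - to_ac v * to_ac g * to_ac v * \<theta> - to_ac v * to_ac v * (\<theta> * \<theta>)"
    unfolding x by (simp add: algebra_simps)
  also have "\<dots> = to_ac ?n" unfolding sq by (simp add: power2_eq_square algebra_simps)
  finally have N: "x * ?y = to_ac ?n" .
  show "inverse x \<in> adjoin \<theta>"
  proof (cases "?n = 0")
    case False
    have "x * (to_ac (inverse ?n) * ?y) = to_ac (inverse ?n) * to_ac ?n"
      unfolding N[symmetric] by (rule mult.left_commute)
    also have "\<dots> = 1" unfolding to_ac_mult[symmetric] using False by simp
    finally have "inverse x = to_ac (inverse ?n) * ?y" by (rule inverse_unique)
    moreover have "to_ac (inverse ?n) * ?y \<in> adjoin \<theta>" by (intro mult to_ac_adjoin adjoinI)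
    ultimately show ?thesis by simp
  next
    case True
    then consider "x = 0" | "?y = 0" using N by auto
    then show ?thesis
    proof cases
      case 1 then show ?thesis using to_ac_adjoin[of 0 \<theta>] by simp
    next
      case 2
      have "\<exists>w. x = to_ac w"
      proof (cases "v = 0")
        case True then show ?thesis using x by auto
      next
        case False
        have "to_ac v * \<theta> = to_ac (u - v * g)" using 2 by (simp add: algebra_simps)
        then have "x = to_ac (u + (u - v * g))" unfolding x by simp
        then show ?thesis by blast
      qed
      then obtain w where "x = to_ac w" ..
      then show ?thesis using to_ac_adjoin[of "inverse w" \<theta>] by simp
    qed
  qed
qed

lemma adjoin_range:
  assumes "\<theta> \<in> range to_ac" shows "adjoin \<theta> = range to_ac"
proof -
  obtain r where r: "\<theta> = to_ac r" using assms by blast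
  have "to_ac u + to_ac v * \<theta> \<in> range to_ac" for u v
    unfolding r to_ac_mult[symmetric] to_ac_add[symmetric] by blast
  then have "adjoin \<theta> \<subseteq> range to_ac" by (auto elim!: adjoinE simp del: to_ac_mult to_ac_add)
  moreover have "range to_ac \<subseteq> adjoin \<theta>" using to_ac_adjoin by blast
  ultimately show ?thesis by blast
qed

lemma adjoin_subset:
  assumes "intermediate_field L" "\<theta> \<in> L" shows "adjoin \<theta> \<subseteq> L"
proof
  fix x assume "x \<in> adjoin \<theta>"
  then obtain u v where x: "x = to_ac u + to_ac v * \<theta>" by (rule adjoinE)
  have k: "to_ac w \<in> L" for w using assms(1) by (auto simp: intermediate_field_def)
  have m: "to_ac v * \<theta> \<in> L" using assms k by (auto simp: intermediate_field_def)
  have "to_ac 0 - to_ac v * \<theta> \<in> L" using assms(1) k[of 0] m unfolding intermediate_field_def by blast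
  then have "to_ac u - (to_ac 0 - to_ac v * \<theta>) \<in> L" using assms(1) k[of u] unfolding intermediate_field_def by blast
  then show "x \<in> L" by (simp add: x)
qed

lemma adjoin_affine:
  assumes "c \<noteq> 0" shows "adjoin (to_ac a + to_ac c * \<theta>) = adjoin \<theta>"
proof
  show "adjoin (to_ac a + to_ac c * \<theta>) \<subseteq> adjoin \<theta>"
  proof
    fix x assume "x \<in> adjoin (to_ac a + to_ac c * \<theta>)"
    then obtain u v where "x = to_ac u + to_ac v * (to_ac a + to_ac c * \<theta>)" by (rule adjoinE)
    then have "x = to_ac (u + v * a) + to_ac (v * c) * \<theta>" by (simp add: algebra_simps)
    then show "x \<in> adjoin \<theta>" using adjoinI by metis
  qed
  show "adjoin \<theta> \<subseteq> adjoin (to_ac a + to_ac c * \<theta>)"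
  proof
    fix x assume "x \<in> adjoin \<theta>"
    then obtain u v where "x = to_ac u + to_ac v * \<theta>" by (rule adjoinE)
    then have "x = to_ac (u - v / c * a) + to_ac (v / c) * (to_ac a + to_ac c * \<theta>)"
      using assms by (simp add: field_simps)
    then show "x \<in> adjoin (to_ac a + to_ac c * \<theta>)" using adjoinI by metis
  qed
qed

lemma quadratic_roots:
  fixes \<theta> t :: "'a::idom"
  assumes "\<theta>\<^sup>2 + g * \<theta> = b" "t\<^sup>2 + g * t = b"
  shows "t = \<theta> \<or> t = - g - \<theta>"
proof -
  have "(t - \<theta>) * (t - (- g - \<theta>)) = (t\<^sup>2 + g * t) - (\<theta>\<^sup>2 + g * \<theta>)"
    by (simp add: algebra_simps power2_eq_square)
  then have "(t - \<theta>) * (t - (- g - \<theta>)) = 0" using assms by simp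
  then show ?thesis by simp
qed

lemma adjoin_root:
  assumes "\<theta>\<^sup>2 + to_ac g * \<theta> = to_ac b" "t\<^sup>2 + to_ac g * t = to_ac b"
  shows "adjoin t = adjoin \<theta>"
  using quadratic_roots[OF assms] adjoin_affine[of "-1" "- g" \<theta>] by auto

subsection \<open>Nondegenerate pencils and quadratic extensions\<close>

lemma act_nth: "act g x $ l = fst g ** (smat (snd g $ l $ 0) (x $ 0) + smat (snd g $ l $ 1) (x $ 1)) ** transpose (fst g)"
  unfolding congr_add congr_smat by (simp add: act_def smat_def sum_2' vec_eq_iff)

text \<open>The root \<theta>' marks a decomposable member of the second pencil. Pulled back along a
  rational group element, it becomes a decomposable member of the first pencil with coefficients
  \<open>s\<close>, \<open>t\<close> in \<open>adjoin \<theta>'\<close>. Hence \<open>s / t\<close>,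
  a root of the first quadratic, lies in that field.\<close>

lemma equivG_z_N_subset:
  fixes \<theta> \<theta>' :: "'k::field alg_closure"
  assumes \<theta>: "\<theta>\<^sup>2 + to_ac g * \<theta> = to_ac b" and \<theta>': "\<theta>'\<^sup>2 + to_ac g' * \<theta>' = to_ac b'"
    and eq: "z_N g b \<sim>\<^sub>G z_N g' b'"
  shows "adjoin \<theta> \<subseteq> adjoin \<theta>'"
proof -
  obtain h where h: "h \<in> G" "z_N g' b' = act h (z_N g b)" using eq by (auto simp: equivG_def)
  let ?z = "z_N (to_ac g) (to_ac b)" and ?z' = "z_N (to_ac g') (to_ac b')" and ?H = "snd (base_change_G h)"
  have z': "?z' = act (base_change_G h) ?z" using h(2) by (metis base_change_act base_change_z_N)
  have G: "base_change_G h \<in> G" by (rule base_change_G_in_G[OF h(1)])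
  define s t where "s = \<theta>' * ?H $ 0 $ 0 + ?H $ 1 $ 0" and "t = \<theta>' * ?H $ 0 $ 1 + ?H $ 1 $ 1"
  have I: "intermediate_field (adjoin \<theta>')" by (rule intermediate_adjoin[OF \<theta>'])
  have "decomposable (smat \<theta>' (?z' $ 0) + smat 1 (?z' $ 1))"
    using \<theta>' by (subst decomposable_z_N) (simp_all add: power2_eq_square)
  also have "smat \<theta>' (?z' $ 0) + smat 1 (?z' $ 1) =
    fst (base_change_G h) ** (smat s (?z $ 0) + smat t (?z $ 1)) ** transpose (fst (base_change_G h))"
    unfolding z' act_nth congr_add congr_smat s_def t_def by (simp add: smat_def vec_eq_iff algebra_simps)
  finally have d: "decomposable (smat s (?z $ 0) + smat t (?z $ 1))"
    using G by (subst (asm) decomposable_congr) (simp_all add: G_def)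
  have st: "(s, t) \<noteq> (0, 0)"
  proof
    assume "(s, t) = (0, 0)"
    then have "?H $ 1 $ 0 = - (\<theta>' * ?H $ 0 $ 0)" "?H $ 1 $ 1 = - (\<theta>' * ?H $ 0 $ 1)"
      by (simp_all add: s_def t_def eq_neg_iff_add_eq_0 add.commute)
    then have "?H $ 0 $ 0 * ?H $ 1 $ 1 - ?H $ 0 $ 1 * ?H $ 1 $ 0 = 0" by (simp only:) (simp add: algebra_simps)
    moreover have "det ?H = ?H $ 0 $ 0 * ?H $ 1 $ 1 - ?H $ 0 $ 1 * ?H $ 1 $ 0"
    proof -
      have "UNIV = {0, 1 :: 2}" by (rule UNIV_2')
      then have "det ?H = block_det ?H {0, 1}" by (metis block_det_UNIV)
      then show ?thesis by (simp add: block_det_2)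
    qed
    moreover have "det ?H \<noteq> 0" using G by (simp add: G_def invertible_det_nz)
    ultimately show False by simp
  qed
  have r: "t \<noteq> 0" "(s / t)\<^sup>2 + to_ac g * (s / t) = to_ac b" using d decomposable_z_N[OF st] by blast+
  have "s = to_ac (snd h $ 1 $ 0) + to_ac (snd h $ 0 $ 0) * \<theta>'" "t = to_ac (snd h $ 1 $ 1) + to_ac (snd h $ 0 $ 1) * \<theta>'"
    by (simp_all add: s_def t_def base_change_G_def mult.commute add.commute)
  then have "s \<in> adjoin \<theta>'" "t \<in> adjoin \<theta>'" by (simp_all only: adjoinI)
  then have "s * inverse t \<in> adjoin \<theta>'" using I unfolding intermediate_field_def by blast
  then have "adjoin (s / t) \<subseteq> adjoin \<theta>'" using adjoin_subset[OF I] by (simp add: divide_inverse)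
  then show ?thesis using adjoin_root[OF \<theta> r(2)] by simp
qed

text \<open>The second root is \<open>- g - r\<close>; the square of the difference of the roots is
  the discriminant, so the pencil splits.\<close>

lemma z_N_rational_root:
  fixes g b r :: "'k::field"
  assumes "g\<^sup>2 + 4 * b \<noteq> 0" "r\<^sup>2 + g * r = b"
  shows "z_N g b \<sim>\<^sub>G z_1_1"
proof -
  have "g\<^sup>2 + 4 * b = (2 * r + g) * (2 * r + g)"
    unfolding assms(2)[symmetric] by (simp add: power2_eq_square algebra_simps)
  note eq = this
  have "2 * r + g \<noteq> 0"
  proof
    assume z: "2 * r + g = 0"
    show False using assms(1) unfolding eq z by simp
  qed
  moreover have "2 * r + g = r - (- g - r)" by simp
  ultimately have "r - (- g - r) \<noteq> 0" by metis
  then have "r \<noteq> - g - r" unfolding right_minus_eq .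
  from z_N_split[OF this] show ?thesis
    unfolding assms(2)[symmetric] by (simp add: power2_eq_square algebra_simps)
qed

text \<open>If the common field is the base field, both pencils are equivalent to
  \<open>z_1_1\<close>. Otherwise \<theta>' is an affine expression in \<theta>, and comparing
  coefficients of its equation gives exactly the parameter change of
  \<open>z_N_affine\<close>.\<close>

lemma z_N_equivG_iff:
  fixes \<theta> \<theta>' :: "'k::field alg_closure"
  assumes d: "g\<^sup>2 + 4 * b \<noteq> 0" "g'\<^sup>2 + 4 * b' \<noteq> 0"
    and \<theta>: "\<theta>\<^sup>2 + to_ac g * \<theta> = to_ac b" and \<theta>': "\<theta>'\<^sup>2 + to_ac g' * \<theta>' = to_ac b'"
  shows "z_N g b \<sim>\<^sub>G z_N g' b' \<longleftrightarrow> adjoin \<theta> = adjoin \<theta>'"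
proof
  assume "z_N g b \<sim>\<^sub>G z_N g' b'"
  then show "adjoin \<theta> = adjoin \<theta>'"
    using equivG_z_N_subset[OF \<theta> \<theta>'] equivG_z_N_subset[OF \<theta>' \<theta>] equivG_sym by blast
next
  assume eq: "adjoin \<theta> = adjoin \<theta>'"
  have rat: "z_N g b \<sim>\<^sub>G z_1_1" if h: "t \<in> range to_ac" "t\<^sup>2 + to_ac g * t = to_ac b" "g\<^sup>2 + 4 * b \<noteq> 0"
    for t :: "'k alg_closure" and g b
  proof -
    obtain r where r: "t = to_ac r" using h(1) by (rule rangeE)
    have "to_ac (r\<^sup>2 + g * r) = to_ac b" using h(2) unfolding r by simp
    then have "r\<^sup>2 + g * r = b" by (simp only: to_ac_eq_iff)
    then show ?thesis by (rule z_N_rational_root[OF h(3)])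
  qed
  show "z_N g b \<sim>\<^sub>G z_N g' b'"
  proof (cases "\<theta> \<in> range to_ac")
    case True
    then have t: "\<theta>' \<in> range to_ac" using eq adjoin_self[of \<theta>'] adjoin_range[OF True] by simp
    show ?thesis by (rule equivG_trans[OF rat[OF True \<theta> d(1)] equivG_sym[OF rat[OF t \<theta>' d(2)]]])
  next
    case False
    have "\<theta>' \<in> adjoin \<theta>" using eq adjoin_self[of \<theta>'] by simp
    then obtain a c where ac: "\<theta>' = to_ac a + to_ac c * \<theta>" by (rule adjoinE)
    have c: "c \<noteq> 0"
    proof
      assume "c = 0"
      then have "\<theta>' \<in> range to_ac" using ac by simp
      then show False using eq adjoin_self[of \<theta>] adjoin_range[of \<theta>'] False by simp
    qed
    \<comment> \<open>Constant term and coefficient of \<theta> after \<open>a + c \<theta>\<close>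
      is inserted into the second quadratic and reduced by the first. Both vanish because \<theta>
      lies outside the base field.\<close>
    define P Q where "P = a\<^sup>2 + c\<^sup>2 * b + g' * a - b'" and "Q = c * (2 * a - c * g + g')"
    have sq: "\<theta> * \<theta> = to_ac b - to_ac g * \<theta>" using \<theta> by (simp add: power2_eq_square algebra_simps)
    have "\<theta>'\<^sup>2 + to_ac g' * \<theta>' - to_ac b' = to_ac a * to_ac a + to_ac c * to_ac c * (\<theta> * \<theta>)
        + 2 * to_ac a * to_ac c * \<theta> + to_ac g' * (to_ac a + to_ac c * \<theta>) - to_ac b'"
      unfolding ac by (simp add: power2_eq_square algebra_simps)
    also have "\<dots> = to_ac P + to_ac Q * \<theta>"
      unfolding sq P_def Q_def by (simp add: power2_eq_square algebra_simps)
    finally have PQ: "to_ac P + to_ac Q * \<theta> = 0" using \<theta>' by simp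
    have Q: "Q = 0"
    proof (rule ccontr)
      assume nz: "Q \<noteq> 0"
      then have nz': "to_ac Q \<noteq> (0 :: 'k alg_closure)" by simp
      have "to_ac Q * \<theta> = - to_ac P" using PQ by (simp only: eq_neg_iff_add_eq_0 add.commute)
      then have "\<theta> = - to_ac P / to_ac Q" using nz' by (simp only: eq_divide_eq mult.commute) simp
      also have "\<dots> = to_ac (- P / Q)" by simp
      finally show False using False by blast
    qed
    then have "to_ac P = (0 :: 'k alg_closure)" using PQ by simp
    then have P: "P = 0" by simp
    have "2 * a - c * g + g' = 0" using Q c unfolding Q_def mult_eq_0_iff by blast
    then have g': "g' = c * g - 2 * a" by (simp add: eq_diff_eq add_eq_0_iff algebra_simps)
    have "b' = a\<^sup>2 + c\<^sup>2 * b + g' * a" using P unfolding P_def by (simp only: right_minus_eq)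
    then have b': "b' = c\<^sup>2 * b + a * c * g - a\<^sup>2"
      unfolding g' by (simp add: algebra_simps power2_eq_square)
    show ?thesis unfolding g' b' by (rule z_N_affine[OF c])
  qed
qed

text \<open>Orbits and fields are both images of the set of parameter pairs; equality of the fibres
  gives the correspondence.\<close>

lemma kernel_bij:
  assumes "\<And>x y. x \<in> Q \<Longrightarrow> y \<in> Q \<Longrightarrow> p x = p y \<longleftrightarrow> l x = l y"
  shows "\<exists>f. bij_betw f (p ` Q) (l ` Q)"
proof -
  have inv: "inv_into Q p x \<in> Q" "p (inv_into Q p x) = x" if "x \<in> p ` Q" for x
    using that by (auto intro: inv_into_into f_inv_into_f)
  have "bij_betw (\<lambda>x. l (inv_into Q p x)) (p ` Q) (l ` Q)"
    unfolding bij_betw_def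
  proof
    show "inj_on (\<lambda>x. l (inv_into Q p x)) (p ` Q)"
      by (rule inj_onI) (metis assms inv)
    have "l (inv_into Q p (p q)) = l q" if "q \<in> Q" for q
      using assms inv that by (metis imageI)
    then show "(\<lambda>x. l (inv_into Q p x)) ` p ` Q = l ` Q"
      by (simp add: image_image)
  qed
  then show ?thesis by blast
qed

lemma orbit_eq: "(\<lambda>g. act g x) ` G = {y. x \<sim>\<^sub>G y}"
  by (auto simp: equivG_def)

lemma orbit_eq_iff: "(\<lambda>g. act g x) ` G = (\<lambda>g. act g y) ` G \<longleftrightarrow> x \<sim>\<^sub>G y"
  unfolding orbit_eq using equivG_refl equivG_sym equivG_trans by blast

section \<open>Intermediate fields of degree at most two\<close>

lemma irreducible_root:
  fixes x :: "'k::field alg_closure"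
  shows "\<exists>q :: 'k poly. Factorial_Ring.irreducible q \<and> poly (map_poly to_ac q) x = 0"
proof -
  have "\<exists>q :: 'k poly. Factorial_Ring.irreducible q \<and> poly (map_poly to_ac q) x = 0"
    if "p \<noteq> 0" "poly (map_poly to_ac p) x = 0" for p :: "'k poly"
    using that
  proof (induction "Polynomial.degree p" arbitrary: p rule: less_induct)
    case less
    show ?case
    proof (cases "Factorial_Ring.irreducible p")
      case True
      then show ?thesis using less.prems(2) by blast
    next
      case False
      have "\<not> is_unit p"
      proof
        assume "is_unit p"
        then have "Polynomial.degree p = 0" using less.prems(1) by (simp add: is_unit_iff_degree)
        then obtain c where c: "p = [:c:]" by (rule degree_eq_zeroE)
        then have "poly (map_poly to_ac p) x = to_ac c" by (simp add: map_poly_pCons)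
        then show False using less.prems c by simp
      qed
      with False less.prems(1) have "\<exists>a b. p = a * b \<and> \<not> is_unit a \<and> \<not> is_unit b"
        unfolding Factorial_Ring.irreducible_def by metis
      then obtain a b where ab: "p = a * b" "\<not> is_unit a" "\<not> is_unit b" by metis
      have nz: "a \<noteq> 0" "b \<noteq> 0" using less.prems(1) ab(1) by auto
      then have "Polynomial.degree a \<noteq> 0" "Polynomial.degree b \<noteq> 0"
        using ab(2,3) by (auto simp: is_unit_iff_degree)
      moreover have "Polynomial.degree p = Polynomial.degree a + Polynomial.degree b"
        unfolding ab(1) using nz by (rule degree_mult_eq)
      ultimately have "Polynomial.degree a < Polynomial.degree p" "Polynomial.degree b < Polynomial.degree p" by auto
      moreover have "poly (map_poly to_ac a) x = 0 \<or> poly (map_poly to_ac b) x = 0"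
        using less.prems(2) unfolding ab(1) map_poly_to_ac_mult by simp
      ultimately show ?thesis using less.hyps nz by blast
    qed
  qed
  moreover obtain p :: "'k poly" where "p \<noteq> 0" "poly (map_poly to_ac p) x = 0" by (rule alg_closure_algebraic)
  ultimately show ?thesis by blast
qed

lemma separable_ext_perfect:
  assumes "perfect_field TYPE('k::field)"
  shows "separable_ext (L :: 'k alg_closure set)"
  using assms irreducible_root unfolding separable_ext_def perfect_field_def by blast

lemma k_scale_vector_space: "vector_space (k_scale :: 'k::field \<Rightarrow> 'k alg_closure \<Rightarrow> 'k alg_closure)"
  by unfold_locales (simp_all add: algebra_simps)

lemma span_adjoin: "Modules.module.span k_scale {1, \<theta>} = adjoin \<theta>"
proof -
  interpret ks: vector_space "k_scale :: 'a \<Rightarrow> 'a alg_closure \<Rightarrow> 'a alg_closure" by (rule k_scale_vector_space)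
  have "x \<in> ks.span {1, \<theta>} \<longleftrightarrow> x \<in> adjoin \<theta>" for x
  proof -
    have "x \<in> ks.span {1, \<theta>} \<longleftrightarrow> (\<exists>u v. x - to_ac u * 1 = to_ac v * \<theta>)"
      unfolding ks.span_breakdown_eq[of x 1 "{\<theta>}"] ks.span_singleton image_iff by blast
    also have "\<dots> \<longleftrightarrow> (\<exists>u v. x = to_ac u + to_ac v * \<theta>)"
      by (simp add: diff_eq_eq add.commute)
    finally show ?thesis by (simp add: adjoin_def)
  qed
  then show ?thesis by blast
qed

lemma span_1: "Modules.module.span k_scale {1} = range (to_ac :: 'k::field \<Rightarrow> 'k alg_closure)"
proof -
  interpret ks: vector_space "k_scale :: 'k \<Rightarrow> 'k alg_closure \<Rightarrow> 'k alg_closure" by (rule k_scale_vector_space)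
  show ?thesis unfolding ks.span_singleton by simp
qed

lemma independent_1: "\<not> Modules.module.dependent k_scale {1 :: 'k::field alg_closure}"
proof -
  interpret ks: vector_space "k_scale :: 'k \<Rightarrow> 'k alg_closure \<Rightarrow> 'k alg_closure" by (rule k_scale_vector_space)
  show ?thesis by (simp add: ks.dependent_single)
qed

lemma independent_1_theta:
  fixes \<theta> :: "'k::field alg_closure"
  assumes "\<theta> \<notin> range to_ac"
  shows "\<not> Modules.module.dependent k_scale {\<theta>, 1}"
proof -
  interpret ks: vector_space "k_scale :: 'k \<Rightarrow> 'k alg_closure \<Rightarrow> 'k alg_closure" by (rule k_scale_vector_space)
  have "\<theta> \<noteq> 1" using assms to_ac_1 by (metis rangeI)
  then show ?thesis
    unfolding ks.independent_insert[of \<theta> "{1}"] using assms span_1 independent_1 by auto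
qed

lemma degree_adjoin: "degree_at_most_2 (adjoin \<theta>)"
proof (cases "\<theta> \<in> range to_ac")
  case True
  have "finite {1 :: 'a alg_closure} \<and> card {1 :: 'a alg_closure} \<le> 2 \<and> \<not> Modules.module.dependent k_scale {1 :: 'a alg_closure} \<and>
    Modules.module.span k_scale {1} = adjoin \<theta>"
    unfolding span_1 adjoin_range[OF True] using independent_1 by simp
  then show ?thesis unfolding degree_at_most_2_def by blast
next
  case False
  have "card {\<theta>, 1} \<le> 2" by (simp add: card_insert_if)
  moreover have "Modules.module.span k_scale {\<theta>, 1} = adjoin \<theta>" using span_adjoin[of \<theta>] by (simp only: insert_commute)
  ultimately have "finite {\<theta>, 1} \<and> card {\<theta>, 1} \<le> 2 \<and> \<not> Modules.module.dependent k_scale {\<theta>, 1} \<and>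
    Modules.module.span k_scale {\<theta>, 1} = adjoin \<theta>"
    using independent_1_theta[OF False] by blast
  then show ?thesis unfolding degree_at_most_2_def by blast
qed

lemma adjoin_Ex2_fields:
  assumes "perfect_field TYPE('k::field)" "(\<theta> :: 'k alg_closure)\<^sup>2 + to_ac g * \<theta> = to_ac b"
  shows "adjoin \<theta> \<in> Ex2_fields"
  unfolding Ex2_fields_def using intermediate_adjoin[OF assms(2)] separable_ext_perfect[OF assms(1)] degree_adjoin by blast

text \<open>If \<open>L\<close> is larger than the base field, any element \<theta> outside the base
  field generates it, since three independent elements would exceed the dimension. Expressing the
  square of \<theta> in 1 and \<theta> gives the quadratic; a zero discriminant would put \<theta>
  into the base field by perfectness.\<close>

lemma Ex2_fields_adjoin:
  fixes L :: "'k::field alg_closure set"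
  assumes perf: "perfect_field TYPE('k)" and L: "L \<in> Ex2_fields"
  shows "\<exists>g b \<theta>. g\<^sup>2 + 4 * b \<noteq> 0 \<and> \<theta>\<^sup>2 + to_ac g * \<theta> = to_ac b \<and> L = adjoin \<theta>"
proof (cases "L = range to_ac")
  case True
  have "L = adjoin 0" unfolding True using adjoin_range[of 0] to_ac_0 by (metis rangeI)
  \<comment> \<open>The base field itself comes from \<open>x^2 + x\<close>, with discriminant one
    and root 0.\<close>
  then show ?thesis by (intro exI[of _ 1] exI[of _ 0]) simp
next
  case False
  have IL: "intermediate_field L" using L by (simp add: Ex2_fields_def)
  then have "range to_ac \<subseteq> L" by (simp add: intermediate_field_def)
  with False obtain \<theta> where \<theta>: "\<theta> \<in> L" "\<theta> \<notin> range to_ac" by blast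
  obtain B where B: "finite B" "card B \<le> 2" "Modules.module.span k_scale B = L"
    using L by (auto simp: Ex2_fields_def degree_at_most_2_def)
  interpret ks: vector_space "k_scale :: 'k \<Rightarrow> 'k alg_closure \<Rightarrow> 'k alg_closure" by (rule k_scale_vector_space)
  have sp: "ks.span {\<theta>, 1} = adjoin \<theta>" using span_adjoin[of \<theta>] by (simp only: insert_commute)
  have L1: "1 \<in> L" using \<open>range to_ac \<subseteq> L\<close> by (metis rangeI subsetD to_ac_1)
  have "L \<subseteq> adjoin \<theta>"
  proof
    fix w assume w: "w \<in> L"
    show "w \<in> adjoin \<theta>"
    proof (rule ccontr)
      assume nw: "w \<notin> adjoin \<theta>"
      then have ns: "w \<notin> ks.span {\<theta>, 1}" by (simp only: sp) simp
      then have nin: "w \<notin> {\<theta>, 1}" using ks.span_base by blast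
      have "ks.independent {w, \<theta>, 1}"
        unfolding ks.independent_insert[of w "{\<theta>, 1}"] using ns nin independent_1_theta[OF \<theta>(2)] by simp
      then have "card {w, \<theta>, 1} \<le> card B"
        using ks.independent_span_bound[OF B(1)] w \<theta>(1) L1 B(3) by blast
      moreover have "\<theta> \<noteq> 1" using \<theta>(2) to_ac_1 by (metis rangeI)
      ultimately show False using nin B(2) by simp
    qed
  qed
  then have LA: "L = adjoin \<theta>" using adjoin_subset[OF IL \<theta>(1)] by blast
  have "\<theta> * \<theta> \<in> L" using IL \<theta>(1) by (simp add: intermediate_field_def)
  then obtain u v where uv: "\<theta> * \<theta> = to_ac u + to_ac v * \<theta>" unfolding LA by (rule adjoinE)
  have eq: "\<theta>\<^sup>2 + to_ac (- v) * \<theta> = to_ac u" by (simp add: power2_eq_square uv)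
  have "(- v)\<^sup>2 + 4 * u \<noteq> 0"
  proof
    assume "(- v)\<^sup>2 + 4 * u = 0"
    then obtain r where r: "- v = - 2 * r" "u = - (r * r)" using perfect_double_root[OF perf] by blast
    have "(\<theta> - to_ac r) * (\<theta> - to_ac r) = \<theta> * \<theta> + to_ac (- 2 * r) * \<theta> + to_ac (r * r)"
      by (simp add: algebra_simps)
    also have "\<dots> = 0" unfolding uv r(1)[symmetric] unfolding r(2) by simp
    finally have "\<theta> = to_ac r" by simp
    then show False using \<theta>(2) by blast
  qed
  then show ?thesis using eq LA by blast
qed

text \<open>An isomorphism over the base field sends \<theta> to a root of the same quadratic, and
  both roots generate the same subfield. Isomorphism classes of intermediate fields of degree at
  most two are therefore singletons.\<close>

lemma k_isomorphic_adjoin: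
  fixes \<theta> :: "'k::field alg_closure"
  assumes \<theta>: "\<theta>\<^sup>2 + to_ac g * \<theta> = to_ac b" and iso: "k_isomorphic (adjoin \<theta>) L"
  shows "L = adjoin \<theta>"
proof -
  obtain \<sigma> where \<sigma>: "bij_betw \<sigma> (adjoin \<theta>) L"
    "\<And>x y. x \<in> adjoin \<theta> \<Longrightarrow> y \<in> adjoin \<theta> \<Longrightarrow> \<sigma> (x + y) = \<sigma> x + \<sigma> y"
    "\<And>x y. x \<in> adjoin \<theta> \<Longrightarrow> y \<in> adjoin \<theta> \<Longrightarrow> \<sigma> (x * y) = \<sigma> x * \<sigma> y"
    "\<And>c. \<sigma> (to_ac c) = to_ac c"
    using iso unfolding k_isomorphic_def by blast
  have IF: "x * y \<in> adjoin \<theta>" if "x \<in> adjoin \<theta>" "y \<in> adjoin \<theta>" for x y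
    using intermediate_adjoin[OF \<theta>] that by (simp add: intermediate_field_def)
  have lin: "\<sigma> (to_ac u + to_ac v * \<theta>) = to_ac u + to_ac v * \<sigma> \<theta>" for u v
    using \<sigma>(2)[OF to_ac_adjoin IF[OF to_ac_adjoin adjoin_self]] \<sigma>(3)[OF to_ac_adjoin adjoin_self] \<sigma>(4) by metis
  have "\<sigma> (\<theta> * \<theta> + to_ac g * \<theta>) = \<sigma> \<theta> * \<sigma> \<theta> + to_ac g * \<sigma> \<theta>"
    using \<sigma>(2)[OF IF[OF adjoin_self adjoin_self] IF[OF to_ac_adjoin adjoin_self]]
      \<sigma>(3)[OF adjoin_self adjoin_self] \<sigma>(3)[OF to_ac_adjoin adjoin_self] \<sigma>(4) by metis
  then have t: "(\<sigma> \<theta>)\<^sup>2 + to_ac g * \<sigma> \<theta> = to_ac b"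
    using \<theta> \<sigma>(4) unfolding power2_eq_square by metis
  have "L = \<sigma> ` adjoin \<theta>" using \<sigma>(1) by (simp add: bij_betw_def)
  also have "\<dots> = adjoin (\<sigma> \<theta>)"
  proof (intro equalityI subsetI)
    fix y assume "y \<in> \<sigma> ` adjoin \<theta>"
    then obtain x where x: "x \<in> adjoin \<theta>" "y = \<sigma> x" by blast
    from x(1) obtain u v where "x = to_ac u + to_ac v * \<theta>" by (rule adjoinE)
    then have "y = to_ac u + to_ac v * \<sigma> \<theta>" using x(2) lin by metis
    then show "y \<in> adjoin (\<sigma> \<theta>)" using adjoinI by metis
  next
    fix y assume "y \<in> adjoin (\<sigma> \<theta>)"
    then obtain u v where "y = to_ac u + to_ac v * \<sigma> \<theta>" by (rule adjoinE)
    then have "y = \<sigma> (to_ac u + to_ac v * \<theta>)" using lin by metis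
    then show "y \<in> \<sigma> ` adjoin \<theta>" using adjoinI by (metis imageI)
  qed
  also have "\<dots> = adjoin \<theta>" by (rule adjoin_root[OF \<theta> t])
  finally show ?thesis .
qed

lemma Ex2_eq:
  assumes perf: "perfect_field TYPE('k::field)"
  shows "(Ex2 :: 'k alg_closure set set set) = (\<lambda>L. {L}) ` Ex2_fields"
proof -
  have "k_isomorphic L L' \<longleftrightarrow> L' = L" if "L \<in> Ex2_fields" "L' \<in> Ex2_fields" for L L' :: "'k alg_closure set"
  proof
    assume "k_isomorphic L L'"
    then show "L' = L" using Ex2_fields_adjoin[OF perf that(1)] k_isomorphic_adjoin by metis
  next
    assume "L' = L"
    then show "k_isomorphic L L'" unfolding k_isomorphic_def by (intro exI[of _ id]) (simp add: bij_betw_id)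
  qed
  then have "{(L, L'). L \<in> Ex2_fields \<and> L' \<in> Ex2_fields \<and> k_isomorphic L L'} `` {L} = {L}"
    if "L \<in> Ex2_fields" for L :: "'k alg_closure set" using that by auto
  then show ?thesis unfolding Ex2_def quotient_def by auto
qed

text \<open>The pairs \<open>(g, b)\<close> of nonzero discriminant parametrise both sides, and
  \<open>z_N_equivG_iff\<close> says that the two parametrisations have the same fibres.\<close>

lemma bij_orbits_Ex2:
  assumes perf: "perfect_field TYPE('k::field)"
    and S: "\<And>x. x \<in> S \<longleftrightarrow> (\<exists>g b. g\<^sup>2 + 4 * b \<noteq> 0 \<and> x \<sim>\<^sub>G z_N g b)"
  shows "\<exists>f. bij_betw f (orbits (S :: 'k rep set)) (Ex2 :: 'k alg_closure set set set)"
proof -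
  let ?Q = "{q :: 'k \<times> 'k. (fst q)\<^sup>2 + 4 * snd q \<noteq> 0}"
  define p where "p q = (\<lambda>h. act h (z_N (fst q) (snd q))) ` G" for q :: "'k \<times> 'k"
  have "\<exists>\<theta> :: 'k alg_closure. \<theta>\<^sup>2 + to_ac (fst q) * \<theta> = to_ac (snd q)" for q
  proof -
    have "Polynomial.degree [:- to_ac (snd q), to_ac (fst q), 1 :: 'k alg_closure:] > 0" by simp
    then obtain r where "poly [:- to_ac (snd q), to_ac (fst q), 1 :: 'k alg_closure:] r = 0"
      using alg_closed_imp_poly_has_root by blast
    then show ?thesis by (intro exI[of _ r]) (simp add: algebra_simps power2_eq_square)
  qed
  then obtain \<theta> :: "'k \<times> 'k \<Rightarrow> 'k alg_closure" where \<theta>: "\<And>q. (\<theta> q)\<^sup>2 + to_ac (fst q) * \<theta> q = to_ac (snd q)"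
    by metis
  define l where "l q = {adjoin (\<theta> q)}" for q
  have "p q = p q' \<longleftrightarrow> l q = l q'" if "q \<in> ?Q" "q' \<in> ?Q" for q q'
    unfolding p_def l_def orbit_eq_iff using z_N_equivG_iff[OF _ _ \<theta> \<theta>, of q q'] that by simp
  then have "\<exists>f. bij_betw f (p ` ?Q) (l ` ?Q)" by (rule kernel_bij)
  moreover have "p ` ?Q = orbits S"
  proof (intro equalityI subsetI)
    fix U assume "U \<in> p ` ?Q"
    then obtain q where q: "q \<in> ?Q" "U = p q" by blast
    then have "z_N (fst q) (snd q) \<in> S" unfolding S using equivG_refl by blast
    then show "U \<in> orbits S" using q(2) unfolding orbits_def p_def by blast
  next
    fix U assume "U \<in> orbits S"
    then obtain x where x: "x \<in> S" "U = (\<lambda>g. act g x) ` G" by (auto simp: orbits_def)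
    obtain g b where gb: "g\<^sup>2 + 4 * b \<noteq> 0" "x \<sim>\<^sub>G z_N g b" using x(1) unfolding S by blast
    then have "U = p (g, b)" unfolding x(2) p_def orbit_eq_iff by simp
    then show "U \<in> p ` ?Q" using gb(1) by auto
  qed
  moreover have "l ` ?Q = Ex2"
  proof -
    have "(\<lambda>q. adjoin (\<theta> q)) ` ?Q = Ex2_fields"
    proof (intro equalityI subsetI)
      fix L assume "L \<in> (\<lambda>q. adjoin (\<theta> q)) ` ?Q"
      then show "L \<in> Ex2_fields" using adjoin_Ex2_fields[OF perf \<theta>] by blast
    next
      fix L :: "'k alg_closure set" assume "L \<in> Ex2_fields"
      then obtain g b t where gb: "g\<^sup>2 + 4 * b \<noteq> 0" "t\<^sup>2 + to_ac g * t = to_ac b" "L = adjoin t"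
        using Ex2_fields_adjoin[OF perf] by blast
      have "adjoin (\<theta> (g, b)) = L" unfolding gb(3) using adjoin_root[OF gb(2), of "\<theta> (g, b)"] \<theta>[of "(g, b)"] by simp
      then show "L \<in> (\<lambda>q. adjoin (\<theta> q)) ` ?Q" using gb(1) by force
    qed
    note e = this
    have "l = (\<lambda>q. {adjoin (\<theta> q)})" by (simp add: l_def fun_eq_iff)
    then show ?thesis unfolding Ex2_eq[OF perf] e[symmetric] image_image by simp
  qed
  ultimately show ?thesis by simp
qed

subsection \<open>The list of strata\<close>

text \<open>A point of \<open>Y_ss\<close> has \<beta> in the hull of its weights, which is
  impossible for an empty support.\<close>

lemma zero_not_in_stratum:
  assumes "\<beta> \<in> BB" shows "(0 :: 'a::alg_closed_field rep) \<notin> stratum \<beta>"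
proof
  assume "(0 :: 'a rep) \<in> stratum \<beta>"
  then obtain g and y :: "'a rep" where gy: "g \<in> G" "y \<in> Y_ss \<beta>" "0 = act g y" unfolding stratum_def by blast
  have "y \<sim>\<^sub>G 0" unfolding equivG_def using gy(1,3) by blast
  then have "0 \<sim>\<^sub>G y" by (rule equivG_sym)
  then have "y = 0" unfolding equivG_def act_zero by blast
  then have "supp y = {}" by (auto simp: supp_def coordV_def)
  then show False using Y_ss_closest_point(1)[OF assms gy(2)] by simp
qed

text \<open>Either \<open>cpoly\<close> has a root, or its degree is zero; then the coefficient at
  6, the determinant of the first component, vanishes.\<close>

lemma degenerate_member:
  fixes x :: "'a::alg_closed_field rep"
  shows "\<exists>s t. (s, t) \<noteq> (0, 0) \<and> det (smat s (x $ 0) + smat t (x $ 1)) = 0"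
proof (cases "Polynomial.degree (cpoly x) > 0")
  case True
  then obtain s where "poly (cpoly x) s = 0" using alg_closed_imp_poly_has_root by blast
  then show ?thesis unfolding poly_cpoly by (intro exI[of _ s] exI[of _ 1]) simp
next
  case False
  then have "Polynomial.coeff (cpoly x) 6 = 0" by (intro coeff_eq_0) simp
  then have "det (smat 1 (x $ 0) + smat 0 (x $ 1)) = 0" unfolding cpoly_coeff by (simp add: smat_simps)
  then show ?thesis by (intro exI[of _ 1] exI[of _ 0]) simp
qed

text \<open>The indices do not depend on the field, and the forms have coefficients in the prime
  field, so the list is stable under base change.\<close>

definition nf_list :: "(wt \<times> 'a::field rep) list" where
  "nf_list = [(bt 6 (-2) (-2) (-2) (-2) 4 4 (-3) 3, z_1),
    (bt 6 (-2) (-2) 1 1 1 1 (-3) 3, z_11),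
    (bt 2 0 0 0 0 0 0 (-1) 1, z_111),
    (bt 6 (-2) (-2) (-2) 1 1 4 0 0, z_L1),
    (bt 6 (-2) (-2) 1 1 1 1 0 0, z_1_1),
    (bt 6 (-2) (-2) 0 0 2 2 (-1) 1, z_2),
    (bt 30 (-10) (-4) 2 2 2 8 (-3) 3, z_L1_1),
    (bt 6 (-1) (-1) 0 0 1 1 (-1) 1, z_21),
    (bt 30 (-1) (-1) (-1) (-1) 2 2 (-3) 3, z_11_1),
    (bt 6 (-2) 0 0 0 1 1 0 0, z_L2),
    (bt 12 (-1) (-1) (-1) (-1) 2 2 0 0, z_L1_L1),
    (bt 66 (-4) (-4) 2 2 2 2 (-3) 3, z_2_1),
    (bt 18 (-2) (-2) 0 0 2 2 (-1) 1, z_3)]"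

lemma nf_list_snd: "nforms = snd ` set nf_list"
  by (simp add: nforms_def nf_list_def)

lemma nf_list_obtain:
  assumes "z \<in> nforms" obtains \<beta> where "(\<beta>, z) \<in> set nf_list"
proof -
  obtain p where "p \<in> set nf_list" "z = snd p" using assms unfolding nf_list_snd by (elim imageE)
  then show ?thesis using that[of "fst p"] by simp
qed

lemma nf_list_stratum:
  assumes "(\<beta>, z) \<in> set nf_list"
  shows "\<beta> \<in> BB \<and> (z :: 'a::alg_closed_field rep) \<in> stratum \<beta>"
proof -
  have "\<forall>p\<in>set nf_list. fst p \<in> BB \<and> (snd p :: 'a rep) \<in> stratum (fst p)"
    by (simp add: nf_list_def stratum_1 stratum_11 stratum_111 stratum_L1 stratum_1_1 stratum_2 stratum_L1_1 stratum_21 stratum_11_1 stratum_L2 stratum_L1_L1 stratum_2_1 stratum_3)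
  from bspec[OF this assms] show ?thesis by simp
qed

lemma bt_eq_iff: "bt k a b c d e f g h = bt k' a' b' c' d' e' f' g' h' \<longleftrightarrow>
  real_of_int a / of_int k = of_int a' / of_int k' \<and> real_of_int b / of_int k = of_int b' / of_int k' \<and>
  real_of_int c / of_int k = of_int c' / of_int k' \<and> real_of_int d / of_int k = of_int d' / of_int k' \<and>
  real_of_int e / of_int k = of_int e' / of_int k' \<and> real_of_int f / of_int k = of_int f' / of_int k' \<and>
  real_of_int g / of_int k = of_int g' / of_int k' \<and> real_of_int h / of_int k = of_int h' / of_int k'"
  by (simp add: bt_def dir_def vec_eq_iff forall_6 forall_2')

lemma nf_list_distinct: "distinct (map fst nf_list)"
  by (simp add: nf_list_def bt_eq_iff)

lemma nf_list_unique: "(\<beta>, z) \<in> set nf_list \<Longrightarrow> (\<beta>, z') \<in> set nf_list \<Longrightarrow> z = z'"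
  using eq_key_imp_eq_value[OF nf_list_distinct] by blast

lemma nf_list_base_change:
  assumes "(\<beta>, z) \<in> set nf_list" shows "(\<beta>, base_change z) \<in> set nf_list"
proof -
  have "map (map_prod id base_change) nf_list = nf_list"
    by (simp add: nf_list_def base_change_nforms)
  then have "map_prod id base_change ` set nf_list = set nf_list" by (metis set_map)
  then show ?thesis using assms by force
qed

lemma card_nf_list: "card (fst ` set (nf_list :: (wt \<times> 'a::field rep) list)) = 13"
proof -
  have "card (set (map fst (nf_list :: (wt \<times> 'a rep) list))) = length (map fst (nf_list :: (wt \<times> 'a rep) list))"
    by (rule distinct_card[OF nf_list_distinct])
  moreover have "length (nf_list :: (wt \<times> 'a rep) list) = 13" by (simp add: nf_list_def)
  ultimately show ?thesis by (simp only: set_map length_map)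
qed

lemma nf_list_fst_obtain:
  assumes "\<beta> \<in> fst ` set (nf_list :: (wt \<times> 'a::field rep) list)"
  obtains z :: "'a::field rep" where "(\<beta>, z) \<in> set nf_list"
proof -
  obtain p :: "wt \<times> 'a rep" where "p \<in> set nf_list" "\<beta> = fst p" using assms by blast
  then show ?thesis using that[of "snd p"] by simp
qed

abbreviation "\<beta>_split \<equiv> bt 6 (-2) (-2) 1 1 1 1 0 0"

lemma split_in_nf_list: "(\<beta>_split, z_1_1) \<in> set nf_list"
  by (simp add: nf_list_def)

lemma z_N_alg_closed:
  fixes g b :: "'a::alg_closed_field"
  assumes "g\<^sup>2 + 4 * b \<noteq> 0"
  shows "z_N g b \<sim>\<^sub>G z_1_1"
proof -
  have "Polynomial.degree [:- b, g, 1:] > 0" by simp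
  then obtain r where "poly [:- b, g, 1:] r = 0" using alg_closed_imp_poly_has_root by blast
  then have "r\<^sup>2 + g * r = b" by (simp add: algebra_simps power2_eq_square)
  then show ?thesis by (rule z_N_rational_root[OF assms])
qed

text \<open>The classification leads to some normal form whose stratum is known; by disjointness its
  index is the given one. Over an algebraically closed field the whole family \<open>z_N\<close>
  collapses to \<open>z_1_1\<close>.\<close>

lemma stratum_nf:
  fixes x :: "'a::alg_closed_field rep"
  assumes b: "\<beta> \<in> BB" and x: "x \<in> stratum \<beta>"
  shows "\<exists>z. (\<beta>, z) \<in> set nf_list \<and> x \<sim>\<^sub>G z"
proof -
  have nf: "(\<beta>, z) \<in> set nf_list" if h: "z \<in> nforms" "x \<sim>\<^sub>G z" for z
  proof -
    obtain \<beta>' where b': "(\<beta>', z) \<in> set nf_list" by (rule nf_list_obtain[OF h(1)])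
    have "z \<in> stratum \<beta>" using x unfolding stratum_equivG[OF h(2)] .
    then have "\<beta> = \<beta>'" by (rule strata_disjoint'[OF b conjunct1[OF nf_list_stratum[OF b']] _ conjunct2[OF nf_list_stratum[OF b']]])
    then show ?thesis using b' by simp
  qed
  have xV: "x \<in> V" by (rule subsetD[OF stratum_V[OF BB_t_star[OF b]] x])
  obtain s t where st: "(s, t) \<noteq> (0, 0)" "det (smat s (x $ 0) + smat t (x $ 1)) = 0"
    using degenerate_member[of x] by (elim exE conjE)
  have "cls x" by (rule classification[OF perfect_alg_closed xV st])
  then consider "x = 0" | z where "z \<in> nforms" "x \<sim>\<^sub>G z" | g b where "g\<^sup>2 + 4 * b \<noteq> 0" "x \<sim>\<^sub>G z_N g b"
    | g b where "g\<^sup>2 + 4 * b \<noteq> 0" "x \<sim>\<^sub>G z_S g b"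
    unfolding cls_def by blast
  then show ?thesis
  proof cases
    case 1
    have "(0 :: 'a rep) \<in> stratum \<beta>" using x unfolding 1 .
    then show ?thesis by (rule notE[OF zero_not_in_stratum[OF b]])
  next
    case (2 z)
    then show ?thesis using nf[OF 2] by blast
  next
    case (3 g c)
    have e: "x \<sim>\<^sub>G z_1_1" by (rule equivG_trans[OF 3(2) z_N_alg_closed[OF 3(1)]])
    have "z_1_1 \<in> nforms" by (simp add: nforms_def)
    from nf[OF this e] e show ?thesis by blast
  next
    case (4 g c)
    have "z_S g c \<in> stratum \<beta>" using x unfolding stratum_equivG[OF 4(2)] .
    then show ?thesis using z_S_not_in_stratum[OF 4(1) b] by simp
  qed
qed

lemma nonempty_strata:
  "{\<beta> \<in> BB. stratum \<beta> \<noteq> ({} :: 'a::alg_closed_field rep set)} = fst ` set (nf_list :: (wt \<times> 'a rep) list)"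
proof (intro equalityI subsetI)
  fix \<beta> assume "\<beta> \<in> {\<beta> \<in> BB. stratum \<beta> \<noteq> ({} :: 'a rep set)}"
  then obtain x :: "'a rep" where "\<beta> \<in> BB" "x \<in> stratum \<beta>" by blast
  then obtain z where "(\<beta>, z) \<in> set (nf_list :: (wt \<times> 'a rep) list)" using stratum_nf by blast
  then show "\<beta> \<in> fst ` set (nf_list :: (wt \<times> 'a rep) list)" by (rule rev_image_eqI) simp
next
  fix \<beta> assume "\<beta> \<in> fst ` set (nf_list :: (wt \<times> 'a rep) list)"
  then obtain z :: "'a rep" where z: "(\<beta>, z) \<in> set nf_list" by (rule nf_list_fst_obtain)
  show "\<beta> \<in> {\<beta> \<in> BB. stratum \<beta> \<noteq> ({} :: 'a rep set)}" using nf_list_stratum[OF z] by blast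
qed

subsection \<open>Rational orbits\<close>

lemma stratum_rat_iff:
  fixes x :: "'k::field rep"
  assumes "\<beta> \<in> BB"
  shows "x \<in> stratum_rat \<beta> \<longleftrightarrow> base_change x \<in> stratum \<beta>"
proof -
  have "x \<in> V" if "base_change x \<in> stratum \<beta>"
  proof -
    have "base_change x \<in> V" using stratum_V[OF BB_t_star[OF assms]] that by blast
    then have a: "alt (base_change x $ l)" for l by (simp add: V_iff)
    have "x $ l $ i $ i = 0" for l i
    proof -
      have "to_ac (x $ l $ i $ i) = 0" using a[of l] unfolding alt_def base_change_def by simp
      then show ?thesis by simp
    qed
    moreover have "x $ l $ i $ j = - x $ l $ j $ i" for l i j
    proof -
      have "base_change x $ l $ i $ j = - base_change x $ l $ j $ i" using a[of l] unfolding alt_def by blast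
      then have "to_ac (x $ l $ i $ j) = to_ac (- x $ l $ j $ i)" by (simp add: base_change_def)
      then show ?thesis by (simp only: to_ac_eq_iff)
    qed
    ultimately show ?thesis unfolding V_iff alt_def by blast
  qed
  then show ?thesis by (auto simp: stratum_rat_def)
qed

lemma stratum_rat_equivG:
  fixes x :: "'k::field rep"
  assumes "(\<beta>, z) \<in> set nf_list" "x \<sim>\<^sub>G z"
  shows "x \<in> stratum_rat \<beta>"
proof -
  have s: "\<beta> \<in> BB \<and> base_change z \<in> stratum \<beta>" by (rule nf_list_stratum[OF nf_list_base_change[OF assms(1)]])
  show ?thesis
    unfolding stratum_rat_iff[OF conjunct1[OF s]] stratum_equivG[OF base_change_equivG[OF assms(2)]]
    by (rule conjunct2[OF s])
qed

lemma to_ac_disc: "g\<^sup>2 + 4 * b \<noteq> 0 \<Longrightarrow> (to_ac g)\<^sup>2 + 4 * to_ac b \<noteq> 0"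
  using to_ac_eq_0_iff[of "g\<^sup>2 + 4 * b"] by simp

lemma base_change_z_N_split:
  fixes x :: "'k::field rep"
  assumes "g\<^sup>2 + 4 * b \<noteq> 0" "x \<sim>\<^sub>G z_N g b"
  shows "base_change x \<sim>\<^sub>G z_1_1"
proof -
  have "base_change x \<sim>\<^sub>G z_N (to_ac g) (to_ac b)"
    using base_change_equivG[OF assms(2)] unfolding base_change_z_N .
  then show ?thesis by (rule equivG_trans[OF _ z_N_alg_closed[OF to_ac_disc[OF assms(1)]]])
qed

lemma stratum_rat_z_N:
  fixes x :: "'k::field rep"
  assumes "g\<^sup>2 + 4 * b \<noteq> 0" "x \<sim>\<^sub>G z_N g b"
  shows "x \<in> stratum_rat \<beta>_split"
proof -
  have s: "\<beta>_split \<in> BB \<and> (z_1_1 :: 'k alg_closure rep) \<in> stratum \<beta>_split" by (rule stratum_1_1)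
  show ?thesis
    unfolding stratum_rat_iff[OF conjunct1[OF s]] stratum_equivG[OF base_change_z_N_split[OF assms]]
    by (rule conjunct2[OF s])
qed

text \<open>Over the base field the family \<open>z_N\<close> need not reduce to a single form. It
  does so after base change, which fixes its index as \<open>\<beta>_split\<close>.\<close>

lemma stratum_rat_nf:
  fixes x :: "'k::field rep"
  assumes perf: "perfect_field TYPE('k)" and b: "\<beta> \<in> BB" and x: "x \<in> stratum_rat \<beta>"
  shows "(\<exists>z. (\<beta>, z) \<in> set nf_list \<and> x \<sim>\<^sub>G z) \<or> \<beta> = \<beta>_split \<and> (\<exists>g c. g\<^sup>2 + 4 * c \<noteq> 0 \<and> x \<sim>\<^sub>G z_N g c)"
proof -
  have xb: "base_change x \<in> stratum \<beta>" using x by (simp add: stratum_rat_def)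
  have xV: "x \<in> V" using x by (simp add: stratum_rat_def)
  have "\<exists>s t. (s, t) \<noteq> (0, 0) \<and> det (smat s (x $ 0) + smat t (x $ 1)) = 0"
  proof (rule ccontr)
    assume "\<not> ?thesis"
    then have "det (smat s (x $ 0) + smat t (x $ 1)) \<noteq> 0" if "(s, t) \<noteq> (0, 0)" for s t using that by blast
    from nondegenerate_not_in_stratum[OF perf b this] xb show False by simp
  qed
  then obtain s t where st: "(s, t) \<noteq> (0, 0)" "det (smat s (x $ 0) + smat t (x $ 1)) = 0" by (elim exE conjE)
  have "cls x" by (rule classification[OF perfect_double_root[OF perf] xV st])
  then consider "x = 0" | z where "z \<in> nforms" "x \<sim>\<^sub>G z" | g b where "g\<^sup>2 + 4 * b \<noteq> 0" "x \<sim>\<^sub>G z_N g b"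
    | g b where "g\<^sup>2 + 4 * b \<noteq> 0" "x \<sim>\<^sub>G z_S g b"
    unfolding cls_def by blast
  then show ?thesis
  proof cases
    case 1
    then have "base_change x = 0" by (simp add: base_change_def vec_eq_iff)
    from xb[unfolded this] show ?thesis by (rule notE[OF zero_not_in_stratum[OF b]])
  next
    case (2 z)
    obtain \<beta>' where b': "(\<beta>', z) \<in> set nf_list" by (rule nf_list_obtain[OF 2(1)])
    have s: "base_change x \<in> stratum \<beta>'" using stratum_rat_equivG[OF b' 2(2)] by (simp add: stratum_rat_def)
    have "\<beta>' \<in> BB" by (rule conjunct1[OF nf_list_stratum[OF nf_list_base_change[OF b']]])
    from strata_disjoint'[OF b this xb s] have "\<beta> = \<beta>'" .
    then show ?thesis using b' 2(2) by blast
  next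
    case (3 g c)
    have s: "base_change x \<in> stratum \<beta>_split" using stratum_rat_z_N[OF 3] by (simp add: stratum_rat_def)
    from strata_disjoint'[OF b conjunct1[OF stratum_1_1] xb s] have "\<beta> = \<beta>_split" .
    then show ?thesis using 3 by blast
  next
    case (4 g c)
    have "base_change x \<sim>\<^sub>G z_S (to_ac g) (to_ac c)"
      using base_change_equivG[OF 4(2)] unfolding base_change_z_S .
    from stratum_equivG[OF this] have "z_S (to_ac g) (to_ac c) \<in> stratum \<beta>" using xb by simp
    then show ?thesis using z_S_not_in_stratum[OF to_ac_disc[OF 4(1)] b] by simp
  qed
qed

lemma is_singleton_orbits:
  fixes z :: "'k::field rep"
  assumes perf: "perfect_field TYPE('k)" and z: "(\<beta>, z) \<in> set nf_list" and ne: "\<beta> \<noteq> \<beta>_split"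
  shows "is_singleton (orbits (stratum_rat \<beta> :: 'k rep set))"
proof -
  have b: "\<beta> \<in> BB" by (rule conjunct1[OF nf_list_stratum[OF nf_list_base_change[OF z]]])
  have *: "(\<lambda>g. act g x) ` G = (\<lambda>g. act g z) ` G" if h: "x \<in> stratum_rat \<beta>" for x :: "'k rep"
  proof -
    obtain z' where z': "(\<beta>, z') \<in> set nf_list" "x \<sim>\<^sub>G z'" using stratum_rat_nf[OF perf b h] ne by blast
    then have "x \<sim>\<^sub>G z" using nf_list_unique[OF z z'(1)] by simp
    then show ?thesis by (simp only: orbit_eq_iff)
  qed
  have "z \<in> stratum_rat \<beta>" by (rule stratum_rat_equivG[OF z equivG_refl])
  then have ne: "(stratum_rat \<beta> :: 'k rep set) \<noteq> {}" by blast
  have "orbits (stratum_rat \<beta> :: 'k rep set) = (\<lambda>x. (\<lambda>g. act g z) ` G) ` (stratum_rat \<beta> :: 'k rep set)"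
    unfolding orbits_def by (rule image_cong[OF refl *])
  also have "\<dots> = {(\<lambda>g. act g z) ` G}" unfolding image_constant_conv using ne by simp
  finally have "orbits (stratum_rat \<beta> :: 'k rep set) = {(\<lambda>g. act g z) ` G}" .
  then show ?thesis by (simp add: is_singleton_def)
qed

lemma stratum_rat_split:
  fixes x :: "'k::field rep"
  assumes perf: "perfect_field TYPE('k)"
  shows "x \<in> stratum_rat \<beta>_split \<longleftrightarrow> (\<exists>g b. g\<^sup>2 + 4 * b \<noteq> 0 \<and> x \<sim>\<^sub>G z_N g b)"
proof
  assume x: "x \<in> stratum_rat \<beta>_split"
  \<comment> \<open>The quadratic \<open>x^2 + x\<close> has the distinct roots 0 and -1 in every
    characteristic, so the split form occurs in the family as \<open>z_N 1 0\<close>.\<close>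
  have d: "(1 :: 'k)\<^sup>2 + 4 * 0 \<noteq> 0" by simp
  have e: "z_N 1 0 \<sim>\<^sub>G (z_1_1 :: 'k rep)" by (rule z_N_rational_root[where r = 0]) simp_all
  have "\<exists>g b. g\<^sup>2 + 4 * b \<noteq> 0 \<and> x \<sim>\<^sub>G z_N g b" if h: "(\<beta>_split, z) \<in> set nf_list" "x \<sim>\<^sub>G z" for z
  proof -
    have "x \<sim>\<^sub>G z_1_1" using h(2) unfolding nf_list_unique[OF h(1) split_in_nf_list] .
    from equivG_trans[OF this equivG_sym[OF e]] d show ?thesis by blast
  qed
  then show "\<exists>g b. g\<^sup>2 + 4 * b \<noteq> 0 \<and> x \<sim>\<^sub>G z_N g b"
    using stratum_rat_nf[OF perf conjunct1[OF stratum_1_1] x] by blast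
next
  assume "\<exists>g b. g\<^sup>2 + 4 * b \<noteq> 0 \<and> x \<sim>\<^sub>G z_N g b"
  then show "x \<in> stratum_rat \<beta>_split" by (elim exE conjE) (rule stratum_rat_z_N)
qed

theorem theorem1p2:
  assumes "perfect_field TYPE('k::field)"
  shows "card {\<beta> \<in> BB. stratum \<beta> \<noteq> ({} :: 'k alg_closure rep set)} = 13 \<and>
    (\<exists>\<beta>\<^sub>0\<in>BB. stratum \<beta>\<^sub>0 \<noteq> ({} :: 'k alg_closure rep set) \<and>
      (\<forall>\<beta>\<in>BB. \<beta> \<noteq> \<beta>\<^sub>0 \<and> stratum \<beta> \<noteq> ({} :: 'k alg_closure rep set) \<longrightarrow>
         is_singleton (orbits (stratum_rat \<beta> :: 'k rep set))) \<and>
      (\<exists>f. bij_betw f (orbits (stratum_rat \<beta>\<^sub>0 :: 'k rep set)) (Ex2 :: 'k alg_closure set set set)))"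
proof (intro conjI bexI[of _ \<beta>_split] ballI impI)
  show "card {\<beta> \<in> BB. stratum \<beta> \<noteq> ({} :: 'k alg_closure rep set)} = 13"
    unfolding nonempty_strata by (rule card_nf_list)
  have s: "\<beta>_split \<in> BB \<and> (z_1_1 :: 'k alg_closure rep) \<in> stratum \<beta>_split" by (rule stratum_1_1)
  then show "\<beta>_split \<in> BB" "stratum \<beta>_split \<noteq> ({} :: 'k alg_closure rep set)" by blast+
  show "\<exists>f. bij_betw f (orbits (stratum_rat \<beta>_split :: 'k rep set)) (Ex2 :: 'k alg_closure set set set)"
    by (rule bij_orbits_Ex2[OF assms stratum_rat_split[OF assms]])
  fix \<beta> assume b: "\<beta> \<in> BB" and ne: "\<beta> \<noteq> \<beta>_split \<and> stratum \<beta> \<noteq> ({} :: 'k alg_closure rep set)"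
  have "fst ` set (nf_list :: (wt \<times> 'k rep) list) = fst ` set (nf_list :: (wt \<times> 'k alg_closure rep) list)"
    by (simp add: nf_list_def)
  then have "\<beta> \<in> fst ` set (nf_list :: (wt \<times> 'k rep) list)"
    using b ne nonempty_strata[where 'a = "'k alg_closure"] by blast
  then obtain z :: "'k rep" where z: "(\<beta>, z) \<in> set nf_list" by (rule nf_list_fst_obtain)
  show "is_singleton (orbits (stratum_rat \<beta> :: 'k rep set))"
    by (rule is_singleton_orbits[OF assms z conjunct1[OF ne]])
qed

end
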